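(* Let $X=\mathbb{R}^d$, equipped with some norm, let $r\in\mathbb{N}_0\cup\{\infty\}$, and let $\mathcal{W}$ be a set of smooth functions $f:\mathbb{R}^d\to\mathbb{R}$ containing the constant function $1$ such that: (a) $f(x)\ge0$ for all $f\in\mathcal{W}$ and $x\in\mathbb{R}^d$; (b) for each $x\in\mathbb{R}^d$ there exists $f\in\mathcal{W}$ with $f(x)>0$; (c) for all $N\in\mathbb{N}$, $f_1,\dots,f_N\in\mathcal{W}$ and $k_1,\dots,k_N\in\mathbb{N}_0$ with $k_1,\dots,k_N\le r$, there exist $C>0$ and $f\in\mathcal{W}$ such that $\|\delta^{k_1}_xf_1\|\cdots\|\delta^{k_N}_xf_N\|\le C\,f(x)$ for all $x\in\mathbb{R}^d$. Let $H$ be a Lie group modelled on a locally convex space. Then the Lie group $C^r_{\mathcal{W}}(\mathbb{R}^d,H)^\bullet$ satisfies $$\pi_k\big(C^r_{\mathcal{W}}(\mathbb{R}^d,H)^\bullet\big)\cong\pi_{k+d}(H)\quad\text{for all }k\in\mathbb{N}_0.$$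
   Context: $\mathbb{N}=\{1,2,\dots\}$, $\mathbb{N}_0=\mathbb{N}\cup\{0\}$. All topological spaces are Hausdorff; vector spaces are real. Lie groups may be infinite-dimensional: they are smooth Lie groups modelled on locally convex spaces, where a map between open subsets of locally convex spaces is $C^r$ if it is continuous, has iterated directional derivatives up to order $r$, and these define continuous maps (Michal–Bastiani, Keller's $C^r_c$). $L(H):=T_1(H)$. For a topological group $G$ with neutral element $1$, $\pi_k(G):=\pi_k(G,1)$, and $\pi_0(G)=G/G_{(1)}$ is a group ($G_{(1)}$ the path component of $1$). For a $C^k$-map $\gamma$ on an open subset of $\mathbb{R}^d$, $\delta^k_x\gamma$ denotes the $k$-th Gateaux differential at $x$, $\delta^k_x\gamma(y):=\frac{d^k}{dt^k}\big|_{t=0}\gamma(x+ty)$, a continuous homogeneous polynomial. For a continuous homogeneous polynomial $p:X\to Y$ to a locally convex space $Y$ and a continuous seminorm $q$ on $Y$, $\|p\|_q:=\sup\{q(p(x)):\|x\|\le1\}$; if $Y$ is normed with norm $q$, write $\|p\|:=\|p\|_q$. Weighted function spaces. Let $Y$ be a locally convex space and $\Omega\subseteq\mathbb{R}^d$ open; weights are restricted to $\Omega$. $C^r_{\mathcal{W}}(\Omega,Y)$ is the space of all $C^r$-maps $\gamma:\Omega\to Y$ with $\|\gamma\|_{f,k,q}:=\sup_{x\in\Omega}f(x)\|\delta^k_x\gamma\|_q<\infty$ for all $f\in\mathcal{W}$, $k\in\mathbb{N}_0$ with $k\le r$, and continuous seminorms $q$ on $Y$. $C^r_{\mathcal{W}}(\Omega,Y)^\bullet$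 is the subspace of all $\gamma$ such that moreover $f(x)\|\delta^k_x\gamma\|_q\to0$ as $x\to\infty$ in the Alexandroff compactification $\Omega\cup\{\infty\}$, for all such $f,k,q$. Both carry the locally convex topology given by the seminorms $\|\cdot\|_{f,k,q}$. For $Q\subseteq Y$ open, $C^r_{\mathcal{W}}(\Omega,Q)^\bullet:=\{\gamma\in C^r_{\mathcal{W}}(\Omega,Y)^\bullet:\gamma(\Omega)\subseteq Q\}$, an open subset of $C^r_{\mathcal{W}}(\Omega,Y)^\bullet$. The Lie group. $C^r_{\mathcal{W}}(\mathbb{R}^d,H)^\bullet$ is the set of all $C^r$-maps $\gamma:\mathbb{R}^d\to H$ for which there exist a chart $\kappa:P\to Q\subseteq L(H)$ of $H$ around $1$ with $\kappa(1)=0$, a compact set $K\subseteq\mathbb{R}^d$ with $\gamma(\mathbb{R}^d\setminus K)\subseteq P$, and a compactly supported smooth function $h:\mathbb{R}^d\to[0,1]$ equal to $1$ on a neighbourhood of $K$, such that $(1-h)\cdot(\kappa\circ\gamma|_{\mathbb{R}^d\setminus K})\in C^r_{\mathcal{W}}(\mathbb{R}^d\setminus K,L(H))^\bullet$. With pointwise multiplication this is a group, and it is known to carry a natural Lie group structure modelled on $C^r_{\mathcal{W}}(\mathbb{R}^d,L(H))^\bullet$ such that, for some chart $\kappa:P\to Q$ of $H$ as just described, the map $\{\gamma\in C^r_{\mathcal{W}}(\mathbb{R}^d,H)^\bullet:\gamma(\mathbb{R}^d)\subseteq P\}\to C^r_{\mathcal{W}}(\mathbb{R}^d,Q)^\bullet$,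 $\gamma\mapsto\kappa\circ\gamma$ is a chart around $1$. This Lie group structure is used in the claim. *)

theory Defs
  imports
    "HOL-Analysis.Analysis"
    "HOL-Algebra.Coset"
    "HOL-Library.Function_Algebras"
begin

text \<open>Pointwise vector space structure on functions, so that function spaces and tangent
  spaces are linear subspaces of a type of class \<^class>\<open>real_vector\<close>.\<close>

instantiation "fun" :: (type, real_vector) real_vector
begin

definition "c *\<^sub>R f = (\<lambda>x. c *\<^sub>R f x)"

instance
  by standard (auto simp: scaleR_fun_def plus_fun_def scaleR_add_left scaleR_add_right)

end


section \<open>Locally convex spaces and $C^r$-maps between them\<close>

text \<open>A (Hausdorff) locally convex space is given by the topology on a linear subspace
  (the \<^const>\<open>topspace\<close>) of some real vector space.\<close>

definition locally_convex_space :: "'e::real_vector topology \<Rightarrow> bool" where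
  "locally_convex_space E \<longleftrightarrow>
     subspace (topspace E) \<and> Hausdorff_space E \<and>
     continuous_map (prod_topology E E) E (\<lambda>(x, y). x + y) \<and>
     continuous_map (prod_topology euclideanreal E) E (\<lambda>(c, x). c *\<^sub>R x) \<and>
     neighbourhood_base_at 0 convex E"

definition seminorm_on :: "'e::real_vector set \<Rightarrow> ('e \<Rightarrow> real) \<Rightarrow> bool" where
  "seminorm_on V q \<longleftrightarrow>
     (\<forall>x\<in>V. \<forall>y\<in>V. q (x + y) \<le> q x + q y) \<and> (\<forall>c. \<forall>x\<in>V. q (c *\<^sub>R x) = \<bar>c\<bar> * q x)"

definition is_norm :: "('e::real_vector \<Rightarrow> real) \<Rightarrow> bool" where
  "is_norm n \<longleftrightarrow> seminorm_on UNIV n \<and> (\<forall>x. n x = 0 \<longrightarrow> x = 0)"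

definition continuous_seminorm :: "'e::real_vector topology \<Rightarrow> ('e \<Rightarrow> real) \<Rightarrow> bool" where
  "continuous_seminorm E q \<longleftrightarrow> seminorm_on (topspace E) q \<and> continuous_map E euclideanreal q"

text \<open>\<^term>\<open>seminorm_topology V S\<close> is the topology on \<^term>\<open>V\<close> defined by the
  set \<^term>\<open>S\<close> of seminorms.\<close>

definition seminorm_topology :: "'e::real_vector set \<Rightarrow> ('e \<Rightarrow> real) set \<Rightarrow> 'e topology" where
  "seminorm_topology V S = topology_generated_by
     (insert V {{v\<in>V. p (v - u) < \<epsilon>} |u p \<epsilon>. u \<in> V \<and> p \<in> S \<and> \<epsilon> > 0})"

definition has_dir_deriv ::
  "'f::real_vector topology \<Rightarrow> 'e::real_vector \<Rightarrow> ('e \<Rightarrow> 'f) \<Rightarrow> 'e \<Rightarrow> 'f \<Rightarrow> bool" where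
  "has_dir_deriv F y f x v \<longleftrightarrow>
     limitin F (\<lambda>t::real. (1 / t) *\<^sub>R (f (x + t *\<^sub>R y) - f x)) v (at 0)"

definition dir_deriv ::
  "'f::real_vector topology \<Rightarrow> 'e::real_vector \<Rightarrow> ('e \<Rightarrow> 'f) \<Rightarrow> 'e \<Rightarrow> 'f" where
  "dir_deriv F y f x = (THE v. has_dir_deriv F y f x v)"

text \<open>Michal--Bastiani $C^r$-maps on an open subset \<^term>\<open>U\<close> of \<^term>\<open>E\<close>; here
  \<^term>\<open>fold (dir_deriv F) [y\<^sub>1, y\<^sub>2] f = dir_deriv F y\<^sub>2 (dir_deriv F y\<^sub>1 f)\<close>, and $E^k$ is
  the product of copies of \<^term>\<open>E\<close> indexed by \<^term>\<open>{..<k}\<close>. The values of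
  \<^term>\<open>f\<close> outside \<^term>\<open>U\<close> are irrelevant.\<close>

definition Cr_on :: "enat \<Rightarrow> 'e::real_vector topology \<Rightarrow> 'f::real_vector topology
    \<Rightarrow> 'e set \<Rightarrow> ('e \<Rightarrow> 'f) \<Rightarrow> bool" where
  "Cr_on r E F U f \<longleftrightarrow>
     (\<forall>ys y. enat (length ys) < r \<and> set ys \<subseteq> topspace E \<and> y \<in> topspace E \<longrightarrow>
        (\<forall>x\<in>U. \<exists>v. has_dir_deriv F y (fold (dir_deriv F) ys f) x v)) \<and>
     (\<forall>k. enat k \<le> r \<longrightarrow>
        continuous_map
          (prod_topology (subtopology E U) (product_topology (\<lambda>_. E) {..<k})) F
          (\<lambda>(x, y). fold (dir_deriv F) (map y [0..<k]) f x))"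

text \<open>The Gateaux differential $\delta^k_x f(y) = \frac{d^k}{dt^k}|_{t=0} f(x+ty)$.\<close>

definition gateaux :: "'f::real_vector topology \<Rightarrow> nat \<Rightarrow> ('e::real_vector \<Rightarrow> 'f) \<Rightarrow> 'e \<Rightarrow> 'e \<Rightarrow> 'f"
  where "gateaux F k f x y = (dir_deriv F (1::real) ^^ k) (\<lambda>t. f (x + t *\<^sub>R y)) 0"

text \<open>The supremum of $q(p(x))$ over the unit ball of the norm \<^term>\<open>n\<close>, as an extended number.\<close>

definition poly_norm :: "('e \<Rightarrow> real) \<Rightarrow> ('f \<Rightarrow> real) \<Rightarrow> ('e \<Rightarrow> 'f) \<Rightarrow> ennreal" where
  "poly_norm n q p = (SUP x\<in>{x. n x \<le> 1}. ennreal (q (p x)))"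


section \<open>Weighted function spaces\<close>

definition weighted_seminorm :: "('a::euclidean_space \<Rightarrow> real) \<Rightarrow> 'a set \<Rightarrow> 'f::real_vector topology
    \<Rightarrow> ('a \<Rightarrow> real) \<Rightarrow> nat \<Rightarrow> ('f \<Rightarrow> real) \<Rightarrow> ('a \<Rightarrow> 'f) \<Rightarrow> ennreal" where
  "weighted_seminorm n \<Omega> Y f k q \<gamma> =
     (SUP x\<in>\<Omega>. ennreal (f x) * poly_norm n q (gateaux Y k \<gamma> x))"

text \<open>Functions on \<^term>\<open>\<Omega>\<close> are represented by their extension by \<^term>\<open>0\<close>.\<close>

definition weighted_maps :: "('a::euclidean_space \<Rightarrow> real) \<Rightarrow> enat \<Rightarrow> ('a \<Rightarrow> real) set \<Rightarrow> 'a set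
    \<Rightarrow> 'f::real_vector topology \<Rightarrow> ('a \<Rightarrow> 'f) set" where
  "weighted_maps n r W \<Omega> Y =
     {\<gamma>. Cr_on r euclidean Y \<Omega> \<gamma> \<and> (\<forall>x. x \<notin> \<Omega> \<longrightarrow> \<gamma> x = 0) \<and>
        (\<forall>f\<in>W. \<forall>k q. enat k \<le> r \<and> continuous_seminorm Y q \<longrightarrow>
           weighted_seminorm n \<Omega> Y f k q \<gamma> < \<infinity>)}"

definition weighted_maps_vanishing :: "('a::euclidean_space \<Rightarrow> real) \<Rightarrow> enat \<Rightarrow> ('a \<Rightarrow> real) set
    \<Rightarrow> 'a set \<Rightarrow> 'f::real_vector topology \<Rightarrow> ('a \<Rightarrow> 'f) set" where
  "weighted_maps_vanishing n r W \<Omega> Y =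
     {\<gamma> \<in> weighted_maps n r W \<Omega> Y.
        \<forall>f\<in>W. \<forall>k q. enat k \<le> r \<and> continuous_seminorm Y q \<longrightarrow>
          ((\<lambda>z. ennreal (f (the z)) * poly_norm n q (gateaux Y k \<gamma> (the z))) \<longlongrightarrow> 0)
            (atin (Alexandroff_compactification (top_of_set \<Omega>)) None)}"

definition weighted_space :: "('a::euclidean_space \<Rightarrow> real) \<Rightarrow> enat \<Rightarrow> ('a \<Rightarrow> real) set
    \<Rightarrow> 'a set \<Rightarrow> 'f::real_vector topology \<Rightarrow> ('a \<Rightarrow> 'f) topology" where
  "weighted_space n r W \<Omega> Y =
     seminorm_topology (weighted_maps_vanishing n r W \<Omega> Y)
       {\<lambda>\<gamma>. enn2real (weighted_seminorm n \<Omega> Y f k q \<gamma>) |f k q.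
          f \<in> W \<and> enat k \<le> r \<and> continuous_seminorm Y q}"


section \<open>Manifolds and Lie groups modelled on locally convex spaces\<close>

type_synonym ('m, 'e) chart = "'m set \<times> ('m \<Rightarrow> 'e)"

definition chart_homeomorphism :: "'m topology \<Rightarrow> 'e topology \<Rightarrow> 'm set \<Rightarrow> ('m \<Rightarrow> 'e) \<Rightarrow> bool" where
  "chart_homeomorphism M E U \<phi> \<longleftrightarrow>
     openin M U \<and> openin E (\<phi> ` U) \<and>
     homeomorphic_map (subtopology M U) (subtopology E (\<phi> ` U)) \<phi>"

definition smooth_manifold ::
  "'m topology \<Rightarrow> 'e::real_vector topology \<Rightarrow> ('m, 'e) chart set \<Rightarrow> bool" where
  "smooth_manifold M E A \<longleftrightarrow>
     locally_convex_space E \<and> Hausdorff_space M \<and>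
     (\<forall>(U, \<phi>)\<in>A. chart_homeomorphism M E U \<phi>) \<and>
     (\<Union>(U, \<phi>)\<in>A. U) = topspace M \<and>
     (\<forall>(U, \<phi>)\<in>A. \<forall>(V, \<psi>)\<in>A. Cr_on \<infinity> E E (\<phi> ` (U \<inter> V)) (\<psi> \<circ> inv_into U \<phi>))"

text \<open>A chart of the manifold, i.e. a homeomorphism of an open set onto an open subset of
  a locally convex space \<^term>\<open>F\<close> (not necessarily \<^term>\<open>E\<close> itself) which is a smooth
  diffeomorphism with respect to the atlas \<^term>\<open>A\<close>.\<close>

definition manifold_chart :: "'m topology \<Rightarrow> 'e::real_vector topology \<Rightarrow> ('m, 'e) chart set
    \<Rightarrow> 'f::real_vector topology \<Rightarrow> 'm set \<Rightarrow> ('m \<Rightarrow> 'f) \<Rightarrow> bool" where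
  "manifold_chart M E A F P \<kappa> \<longleftrightarrow>
     chart_homeomorphism M F P \<kappa> \<and>
     (\<forall>(U, \<phi>)\<in>A. Cr_on \<infinity> E F (\<phi> ` (U \<inter> P)) (\<kappa> \<circ> inv_into U \<phi>) \<and>
                Cr_on \<infinity> F E (\<kappa> ` (P \<inter> U)) (\<phi> \<circ> inv_into P \<kappa>))"

definition manifold_Cr_map :: "enat
    \<Rightarrow> 'm topology \<Rightarrow> 'e::real_vector topology \<Rightarrow> ('m, 'e) chart set
    \<Rightarrow> 'n topology \<Rightarrow> 'f::real_vector topology \<Rightarrow> ('n, 'f) chart set
    \<Rightarrow> ('m \<Rightarrow> 'n) \<Rightarrow> bool" where
  "manifold_Cr_map r M E A N F B g \<longleftrightarrow>
     continuous_map M N g \<and>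
     (\<forall>(U, \<phi>)\<in>A. \<forall>(V, \<psi>)\<in>B.
        Cr_on r E F (\<phi> ` (U \<inter> g -` V)) (\<psi> \<circ> g \<circ> inv_into U \<phi>))"

definition prod_atlas ::
  "('m, 'e) chart set \<Rightarrow> ('n, 'f) chart set \<Rightarrow> ('m \<times> 'n, 'e \<times> 'f) chart set" where
  "prod_atlas A B = {(U \<times> V, map_prod \<phi> \<psi>) |U \<phi> V \<psi>. (U, \<phi>) \<in> A \<and> (V, \<psi>) \<in> B}"

definition lie_group :: "('g, 'z) monoid_scheme \<Rightarrow> 'g topology \<Rightarrow> 'e::real_vector topology
    \<Rightarrow> ('g, 'e) chart set \<Rightarrow> bool" where
  "lie_group G M E A \<longleftrightarrow>
     group G \<and> topspace M = carrier G \<and> smooth_manifold M E A \<and>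
     manifold_Cr_map \<infinity> (prod_topology M M) (prod_topology E E) (prod_atlas A A) M E A
       (\<lambda>(x, y). x \<otimes>\<^bsub>G\<^esub> y) \<and>
     manifold_Cr_map \<infinity> M E A M E A (\<lambda>x. inv\<^bsub>G\<^esub> x)"

text \<open>A tangent vector at \<^term>\<open>p\<close> is the family of its representatives with respect to all
  charts in the atlas around \<^term>\<open>p\<close> (padded by \<^term>\<open>0\<close>), and the topology makes
  passage to the representative in each chart around \<^term>\<open>p\<close> continuous.\<close>

type_synonym ('m, 'e) tangent = "('m, 'e) chart \<Rightarrow> 'e"

definition tangent_vectors :: "'e::real_vector topology \<Rightarrow> ('m, 'e) chart set \<Rightarrow> 'm
    \<Rightarrow> ('m, 'e) tangent set" where
  "tangent_vectors E A p =
     {v. (\<forall>U \<phi>. \<not> ((U, \<phi>) \<in> A \<and> p \<in> U) \<longrightarrow> v (U, \<phi>) = 0) \<and>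
         (\<forall>(U, \<phi>)\<in>A. p \<in> U \<longrightarrow> v (U, \<phi>) \<in> topspace E) \<and>
         (\<forall>(U, \<phi>)\<in>A. \<forall>(V, \<psi>)\<in>A. p \<in> U \<inter> V \<longrightarrow>
            v (V, \<psi>) = dir_deriv E (v (U, \<phi>)) (\<psi> \<circ> inv_into U \<phi>) (\<phi> p))}"

definition tangent_space :: "'e::real_vector topology \<Rightarrow> ('m, 'e) chart set \<Rightarrow> 'm
    \<Rightarrow> ('m, 'e) tangent topology" where
  "tangent_space E A p = topology_generated_by
     {{v \<in> tangent_vectors E A p. v (U, \<phi>) \<in> O'} |U \<phi> O'. (U, \<phi>) \<in> A \<and> p \<in> U \<and> openin E O'}"

text \<open>$L(H) = T_1(H)$\<close>

abbreviation lie_algebra_space :: "('h, 'z) monoid_scheme \<Rightarrow> 'e::real_vector topology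
    \<Rightarrow> ('h, 'e) chart set \<Rightarrow> ('h, 'e) tangent topology" where
  "lie_algebra_space H E A \<equiv> tangent_space E A \<one>\<^bsub>H\<^esub>"

definition centred_chart :: "('h, 'z) monoid_scheme \<Rightarrow> 'h topology \<Rightarrow> 'e::real_vector topology
    \<Rightarrow> ('h, 'e) chart set \<Rightarrow> 'h set \<Rightarrow> ('h \<Rightarrow> ('h, 'e) tangent) \<Rightarrow> bool" where
  "centred_chart H M E A P \<kappa> \<longleftrightarrow>
     manifold_chart M E A (lie_algebra_space H E A) P \<kappa> \<and> \<one>\<^bsub>H\<^esub> \<in> P \<and> \<kappa> \<one>\<^bsub>H\<^esub> = 0"


section \<open>Weighted mapping groups\<close>

definition weighted_group_maps :: "('a::euclidean_space \<Rightarrow> real) \<Rightarrow> enat \<Rightarrow> ('a \<Rightarrow> real) set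
    \<Rightarrow> ('h, 'z) monoid_scheme \<Rightarrow> 'h topology \<Rightarrow> 'e::real_vector topology \<Rightarrow> ('h, 'e) chart set
    \<Rightarrow> ('a \<Rightarrow> 'h) set" where
  "weighted_group_maps n r W H M E A =
     {\<gamma>. manifold_Cr_map r euclidean euclidean {(UNIV, id)} M E A \<gamma> \<and>
        (\<exists>P \<kappa> K h. centred_chart H M E A P \<kappa> \<and>
           compact K \<and> \<gamma> ` (- K) \<subseteq> P \<and>
           Cr_on \<infinity> euclidean euclideanreal UNIV h \<and> range h \<subseteq> {0..1} \<and>
           compact (closure {x. h x \<noteq> 0}) \<and>
           (\<exists>V. open V \<and> K \<subseteq> V \<and> (\<forall>x\<in>V. h x = 1)) \<and>
           (\<lambda>x. if x \<in> - K then (1 - h x) *\<^sub>R \<kappa> (\<gamma> x) else 0)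
             \<in> weighted_maps_vanishing n r W (- K) (lie_algebra_space H E A))}"

definition weighted_group :: "('a::euclidean_space \<Rightarrow> real) \<Rightarrow> enat \<Rightarrow> ('a \<Rightarrow> real) set
    \<Rightarrow> ('h, 'z) monoid_scheme \<Rightarrow> 'h topology \<Rightarrow> 'e::real_vector topology \<Rightarrow> ('h, 'e) chart set
    \<Rightarrow> ('a \<Rightarrow> 'h) monoid" where
  "weighted_group n r W H M E A =
     \<lparr>carrier = weighted_group_maps n r W H M E A,
      monoid.mult = (\<lambda>\<gamma> \<eta> x. \<gamma> x \<otimes>\<^bsub>H\<^esub> \<eta> x),
      one = (\<lambda>x. \<one>\<^bsub>H\<^esub>)\<rparr>"

text \<open>\<^term>\<open>(T, B)\<close> is a Lie group structure on the weighted mapping group,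
  modelled on the space of weighted maps into $L(H)$, and for some centred chart
  \<open>\<kappa> : P \<rightarrow> Q\<close> of \<^term>\<open>H\<close>, composition with \<open>\<kappa>\<close> is a chart from the set of
  \<open>P\<close>-valued maps onto the set of \<open>Q\<close>-valued ones.\<close>

definition weighted_lie_group_structure :: "('a::euclidean_space \<Rightarrow> real) \<Rightarrow> enat
    \<Rightarrow> ('a \<Rightarrow> real) set
    \<Rightarrow> ('h, 'z) monoid_scheme \<Rightarrow> 'h topology \<Rightarrow> 'e::real_vector topology \<Rightarrow> ('h, 'e) chart set
    \<Rightarrow> ('a \<Rightarrow> 'h) topology \<Rightarrow> ('a \<Rightarrow> 'h, 'a \<Rightarrow> ('h, 'e) tangent) chart set \<Rightarrow> bool" where
  "weighted_lie_group_structure n r W H M E A T B \<longleftrightarrow>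
     (let G = weighted_group n r W H M E A;
          F = weighted_space n r W UNIV (lie_algebra_space H E A)
      in lie_group G T F B \<and>
         (\<exists>P \<kappa>. centred_chart H M E A P \<kappa> \<and>
            manifold_chart T F B F {\<gamma> \<in> carrier G. range \<gamma> \<subseteq> P} (\<lambda>\<gamma>. \<kappa> \<circ> \<gamma>) \<and>
            (\<lambda>\<gamma>. \<kappa> \<circ> \<gamma>) ` {\<gamma> \<in> carrier G. range \<gamma> \<subseteq> P} =
              {\<eta> \<in> topspace F. range \<eta> \<subseteq> \<kappa> ` P}))"


section \<open>Homotopy groups\<close>

definition cube :: "nat \<Rightarrow> (nat \<Rightarrow> real) topology" where
  "cube k = product_topology (\<lambda>_. top_of_set {0..1}) {..<k}"

definition sends_boundary_to :: "nat \<Rightarrow> 'x \<Rightarrow> ((nat \<Rightarrow> real) \<Rightarrow> 'x) \<Rightarrow> bool" where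
  "sends_boundary_to k p f \<longleftrightarrow>
     (\<forall>t\<in>topspace (cube k). (\<exists>i<k. t i = 0 \<or> t i = 1) \<longrightarrow> f t = p)"

definition homotopy_class ::
  "nat \<Rightarrow> 'x topology \<Rightarrow> 'x \<Rightarrow> ((nat \<Rightarrow> real) \<Rightarrow> 'x) \<Rightarrow> ((nat \<Rightarrow> real) \<Rightarrow> 'x) set" where
  "homotopy_class k X p f = {g. homotopic_with (sends_boundary_to k p) (cube k) X f g}"

definition cube_concat ::
  "((nat \<Rightarrow> real) \<Rightarrow> 'x) \<Rightarrow> ((nat \<Rightarrow> real) \<Rightarrow> 'x) \<Rightarrow> (nat \<Rightarrow> real) \<Rightarrow> 'x" where
  "cube_concat f g t =
     (if t 0 \<le> 1/2 then f (t(0 := 2 * t 0)) else g (t(0 := 2 * t 0 - 1)))"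

text \<open>The homotopy group $\pi_k(X,p)$ for $k\ge 1$.\<close>

definition homotopy_group ::
  "nat \<Rightarrow> 'x topology \<Rightarrow> 'x \<Rightarrow> ((nat \<Rightarrow> real) \<Rightarrow> 'x) set monoid" where
  "homotopy_group k X p =
     \<lparr>carrier = homotopy_class k X p ` {f. continuous_map (cube k) X f \<and> sends_boundary_to k p f},
      monoid.mult = (\<lambda>a b. \<Union>f\<in>a. \<Union>g\<in>b. homotopy_class k X p (cube_concat f g)),
      one = homotopy_class k X p (\<lambda>_. p)\<rparr>"

text \<open>$\pi_0$ of a topological group: the quotient by the path component of the neutral element.\<close>

definition pi0_group :: "('g, 'z) monoid_scheme \<Rightarrow> 'g topology \<Rightarrow> 'g set monoid" where
  "pi0_group G T = G Mod (path_component_of_set T \<one>\<^bsub>G\<^esub>)"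

end

theory Submission
  imports Defs
begin

text \<open>Identify \<open>\<real>\<^sup>d\<close> with the open unit cube. An element of the mapping group tends to \<open>1\<close> at infinity,
  so it extends by \<open>1\<close> to the boundary of the closed cube, and a map from a \<open>k\<close>-cube to the mapping group
  becomes a map from a \<open>(k+d)\<close>-cube to \<open>H\<close>. That this is bijective on homotopy classes rests on an
  approximation argument. A homotopy \<open>g\<close> in \<open>H\<close> starting at \<open>1\<close>, parametrized by a compact space, is the
  product of the increments \<open>g(s\<^sub>i, z)\<^sup>-\<^sup>1 g(s\<^sub>i\<^sub>+\<^sub>1, z)\<close>, each of which takes values in a small
  chart domain. There a partition of unity approximates it by finite sums of \<open>\<phi>(x) y\<close> with test functions
  \<open>\<phi>\<close>, and these belong to the modelling space. The result differs from \<open>g\<close> by a factor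
  near \<open>1\<close>, which is contracted in the chart, or, if \<open>g\<close> already comes from the mapping group, is removed
  by multiplication with an element that lies in the chart domain of the mapping group.
  Of the weights, only \<open>1\<close> matters: it makes the topology finer than uniform convergence.\<close>

text \<open>The hard direction is surjectivity: the increments need a homotopy starting at the
  constant map, and the only one at hand breaks a boundary condition. For \<open>k > 0\<close> the
  parameter cube is shrunk to its vertex 0, a boundary point. The condition on the faces of the unit
  box survives, but over the boundary of the parameter cube the family is trivial only at time 1;
  the lift is merely close to \<one> there and has to be flattened with a Urysohn function. For
  \<open>k = 0\<close> there is no parameter to shrink. The unit box itself is shrunk to its vertex
  0, which destroys the condition on its faces, so the approximation is made only on a compact set
  inside the open box; in an outer shell of it the lift is already near \<one>, and it is scaled
  down to \<one> there. The chain rule between locally convex spaces serves to show that this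
  scaling stays in the mapping group. For \<open>k = 0\<close> the group structures differ in kind,
  pointwise multiplication against concatenation, which calls for the Eckmann--Hilton
  argument.\<close>

section \<open>Locally convex spaces\<close>

locale lcs =
  fixes E :: "'e::real_vector topology"
  assumes lcs: "locally_convex_space E"
begin

lemma subspace_topspace: "subspace (topspace E)"
  using lcs by (simp add: locally_convex_space_def)

lemma Hausdorff: "Hausdorff_space E"
  using lcs by (simp add: locally_convex_space_def)

lemma zero_in [simp]: "0 \<in> topspace E"
  using subspace_topspace by (rule subspace_0)

lemma add_in: "x \<in> topspace E \<Longrightarrow> y \<in> topspace E \<Longrightarrow> x + y \<in> topspace E"
  using subspace_topspace by (rule subspace_add)

lemma diff_in: "x \<in> topspace E \<Longrightarrow> y \<in> topspace E \<Longrightarrow> x - y \<in> topspace E"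
  using subspace_topspace by (rule subspace_diff)

lemma scale_in: "x \<in> topspace E \<Longrightarrow> c *\<^sub>R x \<in> topspace E"
  using subspace_topspace by (rule subspace_scale)

lemma sum_in: "(\<And>i. i \<in> I \<Longrightarrow> f i \<in> topspace E) \<Longrightarrow> sum f I \<in> topspace E"
  using subspace_topspace by (rule subspace_sum)

lemma continuous_map_add:
  assumes "continuous_map X E f" "continuous_map X E g"
  shows "continuous_map X E (\<lambda>x. f x + g x)"
proof -
  have "continuous_map (prod_topology E E) E (\<lambda>(x, y). x + y)"
    using lcs by (simp add: locally_convex_space_def)
  from continuous_map_compose[OF continuous_map_pairedI[OF assms] this]
  show ?thesis by (simp add: o_def)
qed

lemma continuous_map_scale:
  assumes "continuous_map X euclideanreal c" "continuous_map X E g"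
  shows "continuous_map X E (\<lambda>x. c x *\<^sub>R g x)"
proof -
  have "continuous_map (prod_topology euclideanreal E) E (\<lambda>(c, x). c *\<^sub>R x)"
    using lcs by (simp add: locally_convex_space_def)
  from continuous_map_compose[OF continuous_map_pairedI[OF assms] this]
  show ?thesis by (simp add: o_def)
qed

lemma continuous_map_diff:
  assumes "continuous_map X E f" "continuous_map X E g"
  shows "continuous_map X E (\<lambda>x. f x - g x)"
proof -
  have "continuous_map X E (\<lambda>x. f x + (-1) *\<^sub>R g x)"
    by (intro continuous_map_add continuous_map_scale assms) auto
  then show ?thesis by simp
qed

lemma continuous_map_sum:
  assumes "finite I" "\<And>i. i \<in> I \<Longrightarrow> continuous_map X E (f i)"
  shows "continuous_map X E (\<lambda>x. \<Sum>i\<in>I. f i x)"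
  using assms by (induction I rule: finite_induct) (auto intro: continuous_map_add)

lemma limitin_add:
  assumes "limitin E f l F" "limitin E g m F"
  shows "limitin E (\<lambda>x. f x + g x) (l + m) F"
proof -
  have "limitin (prod_topology E E) (\<lambda>x. (f x, g x)) (l, m) F"
    using assms by (simp add: limitin_pairwise o_def)
  moreover have "continuous_map (prod_topology E E) E (\<lambda>(x, y). x + y)"
    using lcs by (simp add: locally_convex_space_def)
  ultimately show ?thesis
    using continuous_map_limit by (fastforce simp: o_def)
qed

lemma limitin_scale:
  assumes "(c \<longlongrightarrow> a) F" "limitin E g m F"
  shows "limitin E (\<lambda>x. c x *\<^sub>R g x) (a *\<^sub>R m) F"
proof -
  have "limitin (prod_topology euclideanreal E) (\<lambda>x. (c x, g x)) (a, m) F"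
    using assms by (simp add: limitin_pairwise o_def)
  moreover have "continuous_map (prod_topology euclideanreal E) E (\<lambda>(x, y). x *\<^sub>R y)"
    using lcs by (simp add: locally_convex_space_def)
  ultimately show ?thesis
    using continuous_map_limit by (fastforce simp: o_def)
qed

lemma limitin_unique:
  assumes "limitin E f l F" "limitin E f m F" "F \<noteq> bot"
  shows "l = m"
  using limitin_Hausdorff_unique[OF assms Hausdorff] by (simp add: trivial_limit_def assms)

lemma openin_translate:
  assumes "openin E U" "a \<in> topspace E"
  shows "openin E {x \<in> topspace E. x - a \<in> U}"
  by (intro openin_continuous_map_preimage[OF _ assms(1)] continuous_map_diff)
     (use assms in auto)

lemma openin_dilate:
  assumes "openin E U"
  shows "openin E {x \<in> topspace E. c *\<^sub>R x \<in> U}"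
  by (intro openin_continuous_map_preimage[OF _ assms(1)] continuous_map_scale) auto

lemma absorbing:
  assumes "openin E U" "0 \<in> U" "x \<in> topspace E"
  obtains \<delta> where "\<delta> > 0" "\<And>c. \<bar>c\<bar> < \<delta> \<Longrightarrow> c *\<^sub>R x \<in> U"
proof -
  have "openin euclideanreal {c \<in> topspace euclideanreal. c *\<^sub>R x \<in> U}"
    by (intro openin_continuous_map_preimage[OF _ assms(1)] continuous_map_scale)
       (use assms in auto)
  then have "open {c. c *\<^sub>R x \<in> U}" by simp
  moreover have "0 \<in> {c. c *\<^sub>R x \<in> U}" using assms by simp
  ultimately obtain e where "e > 0" "ball 0 e \<subseteq> {c. c *\<^sub>R x \<in> U}"
    using open_contains_ball by blast
  then show thesis by (intro that[of e]) (auto simp: subset_iff)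
qed

end

section \<open>Continuous seminorms and Minkowski functionals\<close>

locale csn = lcs +
  fixes q
  assumes csn: "continuous_seminorm E q"
begin

lemma triangle: "x \<in> topspace E \<Longrightarrow> y \<in> topspace E \<Longrightarrow> q (x + y) \<le> q x + q y"
  using csn by (simp add: continuous_seminorm_def seminorm_on_def)

lemma scale: "x \<in> topspace E \<Longrightarrow> q (c *\<^sub>R x) = \<bar>c\<bar> * q x"
  using csn by (simp add: continuous_seminorm_def seminorm_on_def)

lemma cont: "continuous_map E euclideanreal q"
  using csn by (simp add: continuous_seminorm_def)

lemma zero [simp]: "q 0 = 0"
  using scale[of 0 0] by simp

lemma minus: "x \<in> topspace E \<Longrightarrow> q (- x) = q x"
  using scale[of x "-1"] by simp

lemma nonneg: "x \<in> topspace E \<Longrightarrow> 0 \<le> q x"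
  using triangle[of x "-x"] minus[of x] scale_in[of x "-1"] by simp

lemma triangle_diff: "x \<in> topspace E \<Longrightarrow> y \<in> topspace E \<Longrightarrow> q (x - y) \<le> q x + q y"
  using triangle[of x "-y"] minus[of y] scale_in[of y "-1"] by simp

lemma sum_le:
  assumes "finite I" "\<And>i. i \<in> I \<Longrightarrow> f i \<in> topspace E"
  shows "q (sum f I) \<le> (\<Sum>i\<in>I. q (f i))"
  using assms
proof (induction I rule: finite_induct)
  case (insert i I)
  then have "q (f i + sum f I) \<le> q (f i) + q (sum f I)"
    by (intro triangle sum_in) auto
  with insert show ?case by auto
qed simp

lemma openin_ball: "a \<in> topspace E \<Longrightarrow> openin E {x \<in> topspace E. q (x - a) < e}"
proof -
  assume "a \<in> topspace E"
  then have "continuous_map E euclideanreal (q \<circ> (\<lambda>x. x - a))"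
    by (intro continuous_map_compose[OF _ cont] continuous_map_diff) auto
  from openin_continuous_map_preimage[OF this, of "{..<e}"] show ?thesis by simp
qed

end

context lcs
begin

lemma csnI: "continuous_seminorm E q \<Longrightarrow> csn E q"
  by unfold_locales

lemma csn_max:
  assumes p: "continuous_seminorm E p" and q: "continuous_seminorm E q"
  shows "continuous_seminorm E (\<lambda>x. max (p x) (q x))"
proof -
  interpret p: csn E p by (rule csnI[OF p])
  interpret q: csn E q by (rule csnI[OF q])
  have "p (x + y) \<le> max (p x) (q x) + max (p y) (q y)"
       "q (x + y) \<le> max (p x) (q x) + max (p y) (q y)"
    if "x \<in> topspace E" "y \<in> topspace E" for x y
    using p.triangle[OF that] q.triangle[OF that] by linarith+
  then show ?thesis
    by (auto simp: continuous_seminorm_def seminorm_on_def p.scale q.scale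
        max_mult_distrib_left intro!: continuous_map_real_max p.cont q.cont)
qed

lemma csn_scaled:
  assumes "continuous_seminorm E p" "a \<ge> 0"
  shows "continuous_seminorm E (\<lambda>x. a * p x)"
proof -
  interpret p: csn E p by (rule csnI[OF assms(1)])
  have "a * p (x + y) \<le> a * p x + a * p y"
    if "x \<in> topspace E" "y \<in> topspace E" for x y
    using mult_left_mono[OF p.triangle[OF that] assms(2)] by (simp add: algebra_simps)
  then show ?thesis
    by (auto simp: continuous_seminorm_def seminorm_on_def p.scale
        intro!: continuous_map_real_mult_left p.cont)
qed

text \<open>The Minkowski functional of a convex symmetric neighbourhood contained in \<^term>\<open>U\<close>.\<close>

lemma seminorm_below:
  assumes U: "openin E U" "0 \<in> U"
  obtains q where "continuous_seminorm E q" "{x \<in> topspace E. q x < 1} \<subseteq> U"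
proof -
  have "neighbourhood_base_at 0 convex E"
    using lcs by (simp add: locally_convex_space_def)
  then obtain O1 C where O1: "openin E O1" "convex C" "0 \<in> O1" "O1 \<subseteq> C" "C \<subseteq> U"
    using U unfolding neighbourhood_base_at_def neighbourhood_base_of_def by meson
  define S where "S = {x \<in> C. - x \<in> C}"
  have S_conv: "convex S"
  proof (rule convexI)
    fix x y and u v :: real
    assume *: "x \<in> S" "y \<in> S" "0 \<le> u" "0 \<le> v" "u + v = 1"
    have "u *\<^sub>R x + v *\<^sub>R y \<in> C" "u *\<^sub>R (- x) + v *\<^sub>R (- y) \<in> C"
      using * O1(2) unfolding S_def by (blast intro: convexD)+
    then show "u *\<^sub>R x + v *\<^sub>R y \<in> S" unfolding S_def by simp
  qed
  have S_sym: "- x \<in> S" if "x \<in> S" for x using that unfolding S_def by simp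
  have S0: "0 \<in> S" using O1 unfolding S_def by auto
  \<comment> \<open>\<open>S\<close> need not be open. The open neighbourhood \<open>N\<close>
    inside it makes \<open>S\<close> absorbing and later yields the continuity of
    \<open>q\<close>.\<close>
  define N where "N = O1 \<inter> {x \<in> topspace E. (-1) *\<^sub>R x \<in> O1}"
  have N: "openin E N" "0 \<in> N" "N \<subseteq> S"
    using openin_dilate[OF O1(1), of "-1"] O1 unfolding N_def S_def by auto
  have S_shrink: "c *\<^sub>R x \<in> S" if "x \<in> S" "\<bar>c\<bar> \<le> 1" for x c
  proof -
    have "c *\<^sub>R x \<in> S" if "x \<in> S" "0 \<le> c" "c \<le> 1" for x c
      using convexD[OF S_conv that(1) S0, of c "1 - c"] that by simp
    from this[OF that(1), of c] this[OF S_sym[OF that(1)], of "-c"] that(2) show ?thesis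
      by (cases "c \<ge> 0") auto
  qed
  define A where "A x = {t. t > 0 \<and> (1 / t) *\<^sub>R x \<in> S}" for x
  define q where "q x = Inf (A x)" for x
  have A_ne: "A x \<noteq> {}" if "x \<in> topspace E" for x
  proof -
    obtain \<delta> where "\<delta> > 0" "\<And>c. \<bar>c\<bar> < \<delta> \<Longrightarrow> c *\<^sub>R x \<in> N"
      using absorbing[OF N(1,2) \<open>x \<in> topspace E\<close>] by blast
    then have "(\<delta>/2) *\<^sub>R x \<in> S" using N(3) by auto
    then have "2/\<delta> \<in> A x" using \<open>\<delta> > 0\<close> unfolding A_def by simp
    then show ?thesis by blast
  qed
  have A_bdd: "bdd_below (A x)" for x
    by (rule bdd_belowI[of _ 0]) (auto simp: A_def)
  have q_le: "q x \<le> t" if "t \<in> A x" for x t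
    unfolding q_def using A_bdd that by (rule cInf_lower[rotated])
  have q_nonneg: "0 \<le> q x" if "x \<in> topspace E" for x
    unfolding q_def by (rule cInf_greatest[OF A_ne[OF that]]) (auto simp: A_def)
  have A_up: "t \<in> A x" if "x \<in> topspace E" "q x < t" for x t
  proof -
    obtain s where s: "s \<in> A x" "s < t"
      using cInf_lessD[OF A_ne, of x t] \<open>x \<in> topspace E\<close> \<open>q x < t\<close> unfolding q_def by blast
    then have "s > 0" "(1/s) *\<^sub>R x \<in> S" unfolding A_def by auto
    then have "(s/t) *\<^sub>R (1/s) *\<^sub>R x \<in> S" using s(2) by (intro S_shrink[of "(1/s) *\<^sub>R x"]) auto
    then show ?thesis using \<open>s > 0\<close> s(2) unfolding A_def by simp
  qed
  have q_S: "x \<in> S" if "x \<in> topspace E" "q x < 1" for x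
    using A_up[OF that] unfolding A_def by simp
  have tri: "q (x + y) \<le> q x + q y" if xy: "x \<in> topspace E" "y \<in> topspace E" for x y
  proof (rule field_le_epsilon)
    fix e :: real assume "e > 0"
    \<comment> \<open>As x/s and y/t lie in \<open>S\<close>, so does their convex combination with
      weights s/(s+t) and t/(s+t), which is (x+y)/(s+t).\<close>
    define s t where "s = q x + e/2" and "t = q y + e/2"
    have "s \<in> A x" "t \<in> A y" using A_up xy \<open>e > 0\<close> unfolding s_def t_def by auto
    then have st: "s > 0" "t > 0" "(1/s) *\<^sub>R x \<in> S" "(1/t) *\<^sub>R y \<in> S" unfolding A_def by auto
    have "(s/(s+t)) *\<^sub>R (1/s) *\<^sub>R x + (t/(s+t)) *\<^sub>R (1/t) *\<^sub>R y \<in> S"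
      using st by (intro convexD[OF S_conv]) (auto simp flip: add_divide_distrib)
    then have "(1/(s+t)) *\<^sub>R (x + y) \<in> S" using st by (simp add: scaleR_add_right)
    then have "s + t \<in> A (x + y)" using st unfolding A_def by simp
    from q_le[OF this] show "q (x + y) \<le> q x + q y + e" unfolding s_def t_def by simp
  qed
  have sc_le: "q (c *\<^sub>R x) \<le> \<bar>c\<bar> * q x" if "x \<in> topspace E" for c x
  proof (cases "c = 0")
    case True
    have "q 0 \<le> e" if "e > 0" for e
      by (rule q_le) (use S0 that in \<open>auto simp: A_def\<close>)
    then show ?thesis using True field_le_epsilon[of "q 0" 0] by simp
  next
    case False
    show ?thesis
    proof (rule field_le_epsilon)
      fix e :: real assume "e > 0"
      define t where "t = q x + e / \<bar>c\<bar>"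
      have "t \<in> A x" using A_up that \<open>e > 0\<close> False unfolding t_def by simp
      then have t: "t > 0" "(1/t) *\<^sub>R x \<in> S" unfolding A_def by auto
      have "(c / \<bar>c\<bar>) *\<^sub>R (1/t) *\<^sub>R x \<in> S" using False by (intro S_shrink t) auto
      then have "\<bar>c\<bar> * t \<in> A (c *\<^sub>R x)" using t False unfolding A_def by simp
      from q_le[OF this] show "q (c *\<^sub>R x) \<le> \<bar>c\<bar> * q x + e"
        unfolding t_def using False by (simp add: algebra_simps)
    qed
  qed
  have sc: "q (c *\<^sub>R x) = \<bar>c\<bar> * q x" if "x \<in> topspace E" for c x
  proof (cases "c = 0")
    case True
    then show ?thesis using sc_le[OF that, of 0] q_nonneg[of 0] by simp
  next
    case False
    have "q x \<le> \<bar>1/c\<bar> * q (c *\<^sub>R x)"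
      using sc_le[OF scale_in[OF that, of c], of "1/c"] False by simp
    then have "\<bar>c\<bar> * q x \<le> q (c *\<^sub>R x)" using False by (simp add: field_simps)
    then show ?thesis using sc_le[OF that, of c] by simp
  qed
  have qN: "q x \<le> e" if "x \<in> topspace E" "(1/e) *\<^sub>R x \<in> N" "e > 0" for x e
    by (rule q_le) (use N that in \<open>auto simp: A_def\<close>)
  have cont: "continuous_map E euclideanreal q"
    unfolding continuous_map_eq_topcontinuous_at topcontinuous_at_def
  proof (safe)
    fix x V assume x: "x \<in> topspace E" and "openin euclideanreal V" "q x \<in> V"
    then obtain e where e: "e > 0" "ball (q x) e \<subseteq> V" by (auto simp: open_contains_ball)
    \<comment> \<open>\<open>qN\<close> yields a weak inequality only, so the neighbourhood is taken
      for e/2 in order to end strictly below e.\<close>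
    define O' where "O' = {y \<in> topspace E. y - x \<in> {y \<in> topspace E. (2/e) *\<^sub>R y \<in> N}}"
    have "openin E O'" unfolding O'_def by (intro openin_translate openin_dilate N x)
    moreover have "x \<in> O'" unfolding O'_def using x N by auto
    moreover have "q y \<in> V" if "y \<in> O'" for y
    proof -
      have y: "y \<in> topspace E" "y - x \<in> topspace E" "(1/(e/2)) *\<^sub>R (y - x) \<in> N"
        using that unfolding O'_def by auto
      have "q (y - x) \<le> e/2" using qN[OF y(2,3)] e by simp
      moreover have "q (x - y) = q (y - x)" using sc[OF y(2), of "-1"] by simp
      moreover have "q y \<le> q (y - x) + q x" using tri[OF y(2) x] by simp
      moreover have "q x \<le> q (x - y) + q y" using tri[OF diff_in[OF x y(1)] y(1)] by simp
      ultimately have "\<bar>q x - q y\<bar> < e" using e by linarith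
      then show ?thesis using e(2) by (auto simp: dist_real_def)
    qed
    ultimately show "\<exists>O'. openin E O' \<and> x \<in> O' \<and> (\<forall>y\<in>O'. q y \<in> V)" by blast
  qed auto
  have "continuous_seminorm E q"
    unfolding continuous_seminorm_def seminorm_on_def using tri sc cont by blast
  moreover have "{x \<in> topspace E. q x < 1} \<subseteq> U"
    using q_S O1(5) unfolding S_def by blast
  ultimately show thesis by (rule that)
qed

lemma seminorm_ball_below:
  assumes U: "openin E U" "a \<in> U"
  obtains q where "continuous_seminorm E q" "{x \<in> topspace E. q (x - a) < 1} \<subseteq> U"
proof -
  have a: "a \<in> topspace E" using U openin_subset by blast
  have "openin E {x \<in> topspace E. x - (-a) \<in> U}"
    by (intro openin_translate U) (use scale_in[OF a, of "-1"] in simp)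
  then obtain q where q: "continuous_seminorm E q"
      "{x \<in> topspace E. q x < 1} \<subseteq> {x \<in> topspace E. x - (-a) \<in> U}"
    using seminorm_below[of "{x \<in> topspace E. x - (-a) \<in> U}"] U by auto
  have "x \<in> U" if "x \<in> topspace E" "q (x - a) < 1" for x
    using q(2) that diff_in[OF that(1) a] by (auto simp: subset_iff)
  then show thesis using q(1) that by blast
qed

lemma limitin_seminormsI:
  assumes "l \<in> topspace E" "\<forall>\<^sub>F x in F. f x \<in> topspace E"
    and "\<And>q e. continuous_seminorm E q \<Longrightarrow> e > 0 \<Longrightarrow> \<forall>\<^sub>F x in F. q (f x - l) < e"
  shows "limitin E f l F"
  unfolding limitin_def
proof (intro conjI allI impI assms(1))
  fix U assume "openin E U \<and> l \<in> U"
  then obtain q where q: "continuous_seminorm E q" "{x \<in> topspace E. q (x - l) < 1} \<subseteq> U"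
    using seminorm_ball_below by blast
  show "\<forall>\<^sub>F x in F. f x \<in> U"
    using assms(2) assms(3)[OF q(1) zero_less_one] by eventually_elim (use q(2) in auto)
qed

end

section \<open>Directional derivatives and the mean value theorem\<close>

lemma limitin_compose_filterlim:
  "limitin X f l G \<Longrightarrow> filterlim h G F \<Longrightarrow> limitin X (\<lambda>s. f (h s)) l F"
  by (auto simp: limitin_def filterlim_iff)

context lcs
begin

text \<open>Off 0, \<open>z s\<close> is \<open>z 0\<close> plus \<open>s\<close> times its
  difference quotient, so differentiability at 0 forces continuity there.\<close>

lemma limitin_of_derivative:
  assumes z': "limitin E (\<lambda>s::real. (1 / s) *\<^sub>R (z s - z 0)) z' (at 0)" and z0: "z 0 \<in> topspace E"
  shows "limitin E z (z 0) (at 0)"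
proof -
  have "limitin E (\<lambda>s. z 0 + s *\<^sub>R ((1 / s) *\<^sub>R (z s - z 0))) (z 0 + 0 *\<^sub>R z') (at 0)"
    by (intro limitin_add limitin_scale z' tendsto_ident_at) (use z0 in simp)
  moreover have "\<forall>\<^sub>F s in at 0. z 0 + s *\<^sub>R ((1 / s) *\<^sub>R (z s - z 0)) = z s"
    unfolding eventually_at_filter by simp
  ultimately show ?thesis
    using limitin_transform_eventually by fastforce
qed

lemma has_dir_deriv_unique:
  "has_dir_deriv E y f x v \<Longrightarrow> has_dir_deriv E y f x w \<Longrightarrow> v = w"
  unfolding has_dir_deriv_def by (rule limitin_unique) auto

lemma dir_deriv_eq: "has_dir_deriv E y f x v \<Longrightarrow> dir_deriv E y f x = v"
  unfolding dir_deriv_def using has_dir_deriv_unique by (blast intro: the_equality)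

lemma has_dir_deriv_add:
  assumes "has_dir_deriv E y f x v" "has_dir_deriv E y g x w"
  shows "has_dir_deriv E y (\<lambda>x. f x + g x) x (v + w)"
  using limitin_add[OF assms[unfolded has_dir_deriv_def]]
  unfolding has_dir_deriv_def by (simp add: algebra_simps)

lemma has_dir_deriv_scale:
  assumes "has_dir_deriv E y f x v"
  shows "has_dir_deriv E y (\<lambda>x. c *\<^sub>R f x) x (c *\<^sub>R v)"
  using limitin_scale[OF tendsto_const[of c] assms[unfolded has_dir_deriv_def]]
  unfolding has_dir_deriv_def by (simp add: scaleR_right_diff_distrib mult.commute)

lemma has_dir_deriv_const: "has_dir_deriv E y (\<lambda>x. c) x 0"
  unfolding has_dir_deriv_def by simp

end

lemma has_dir_deriv_cong:
  assumes "\<forall>\<^sub>F t in at 0. f (x + t *\<^sub>R y) = g (x + t *\<^sub>R y)" "f x = g x"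
  shows "has_dir_deriv E y f x v = has_dir_deriv E y g x v"
proof -
  have *: "\<forall>\<^sub>F t in at 0. (1 / t) *\<^sub>R (f (x + t *\<^sub>R y) - f x) = (1 / t) *\<^sub>R (g (x + t *\<^sub>R y) - g x)"
    using assms(1) by eventually_elim (simp add: assms(2))
  have **: "\<forall>\<^sub>F t in at 0. (1 / t) *\<^sub>R (g (x + t *\<^sub>R y) - g x) = (1 / t) *\<^sub>R (f (x + t *\<^sub>R y) - f x)"
    by (rule eventually_mono[OF *]) (rule sym)
  show ?thesis
    unfolding has_dir_deriv_def
    by (rule iffI; rule limitin_transform_eventually[OF *] limitin_transform_eventually[OF **])
qed

lemma dir_deriv_cong:
  assumes "\<forall>\<^sub>F t in at 0. f (x + t *\<^sub>R y) = g (x + t *\<^sub>R y)" "f x = g x"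
  shows "dir_deriv E y f x = dir_deriv E y g x"
proof -
  have "has_dir_deriv E y f x = has_dir_deriv E y g x"
    by (rule ext, rule has_dir_deriv_cong[OF assms])
  then show ?thesis by (simp add: dir_deriv_def)
qed

lemma (in lcs) eventually_in_open:
  assumes "openin E V" "x \<in> V" "y \<in> topspace E"
  shows "\<forall>\<^sub>F t::real in at 0. x + t *\<^sub>R y \<in> V"
proof -
  have "x \<in> topspace E" using assms openin_subset by blast
  then have "limitin E (\<lambda>t. x + t *\<^sub>R y) (x + 0 *\<^sub>R y) (at 0)"
    by (intro limitin_add limitin_scale tendsto_ident_at) (use assms in auto)
  then show ?thesis using limitinD[OF _ assms(1)] assms(2) by auto
qed

text \<open>Bolzano's bisection principle replaces the Hahn--Banach theorem here.\<close>

lemma (in csn) mean_value: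
  assumes c: "\<And>s. s \<in> {0..1} \<Longrightarrow> c s \<in> topspace E"
    and c': "\<And>s. s \<in> {0..1} \<Longrightarrow> limitin E (\<lambda>t::real. (1 / t) *\<^sub>R (c (s + t) - c s)) (c' s) (at 0)"
    and v: "v \<in> topspace E"
    and le: "\<And>s. s \<in> {0..1} \<Longrightarrow> q (c' s - v) \<le> e"
  shows "q (c 1 - c 0 - v) \<le> e"
proof (rule field_le_epsilon)
  fix r :: real assume "r > 0"
  \<comment> \<open>The estimate is additive over adjacent intervals, as bisection requires. The
    extra r turns the bound e on the derivatives into a strict one, which then holds for all
    difference quotients near a point.\<close>
  define P where "P a b \<longleftrightarrow> (a \<le> b \<longrightarrow> c a \<in> topspace E \<and> c b \<in> topspace E
    \<and> q (c b - c a - (b - a) *\<^sub>R v) \<le> (e + r) * (b - a))" for a b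
  have "P 0 1"
  proof (rule Bolzano)
    fix x y z assume "P x y" "P y z" "x \<le> y" "y \<le> z"
    then have top: "c x \<in> topspace E" "c y \<in> topspace E" "c z \<in> topspace E"
      and le: "q (c y - c x - (y - x) *\<^sub>R v) \<le> (e + r) * (y - x)"
        "q (c z - c y - (z - y) *\<^sub>R v) \<le> (e + r) * (z - y)"
      unfolding P_def by auto
    have "q ((c y - c x - (y - x) *\<^sub>R v) + (c z - c y - (z - y) *\<^sub>R v))
        \<le> q (c y - c x - (y - x) *\<^sub>R v) + q (c z - c y - (z - y) *\<^sub>R v)"
      by (intro triangle diff_in scale_in top v)
    also have "\<dots> \<le> (e + r) * (z - x)" using le by (simp add: algebra_simps)
    also have "(c y - c x - (y - x) *\<^sub>R v) + (c z - c y - (z - y) *\<^sub>R v)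
        = c z - c x - (z - x) *\<^sub>R v" by (simp add: algebra_simps)
    finally show "P x z" using top unfolding P_def by simp
  next
    fix x :: real assume "0 \<le> x" "x \<le> 1"
    then have x: "x \<in> {0..1}" by simp
    have "c' x \<in> {w \<in> topspace E. q (w - v) < e + r}"
      using le[OF x] \<open>r > 0\<close> limitin_topspace[OF c'[OF x]] by auto
    from limitinD[OF c'[OF x] openin_ball[OF v] this] obtain d where d: "d > 0"
      "\<And>t. t \<noteq> 0 \<Longrightarrow> \<bar>t\<bar> < d \<Longrightarrow> (1 / t) *\<^sub>R (c (x + t) - c x) \<in> topspace E \<and>
         q ((1 / t) *\<^sub>R (c (x + t) - c x) - v) < e + r"
      unfolding eventually_at by (auto simp: dist_real_def)
    \<comment> \<open>The intervals around x in Bolzano's principle may leave \<open>{0..1}\<close>,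
      where nothing is assumed about \<open>c\<close>. The difference quotients near x lie in the
      carrier, hence so do the values.\<close>
    have top: "c (x + t) \<in> topspace E" if "\<bar>t\<bar> < d" for t
    proof (cases "t = 0")
      case False
      have "c x + t *\<^sub>R ((1 / t) *\<^sub>R (c (x + t) - c x)) \<in> topspace E"
        using d(2)[OF False that] by (intro add_in scale_in[of "(1 / t) *\<^sub>R (c (x + t) - c x)"] c x) blast
      then show ?thesis using False by simp
    qed (use c x in simp)
    have est: "q (c (x + t) - c x - t *\<^sub>R v) \<le> (e + r) * \<bar>t\<bar>" if "\<bar>t\<bar> < d" for t
    proof (cases "t = 0")
      case False
      have "q (c (x + t) - c x - t *\<^sub>R v) = q (t *\<^sub>R ((1 / t) *\<^sub>R (c (x + t) - c x) - v))"
        using False by (simp add: scaleR_right_diff_distrib)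
      also have "\<dots> = \<bar>t\<bar> * q ((1 / t) *\<^sub>R (c (x + t) - c x) - v)"
        using d(2)[OF False that] v by (intro scale diff_in) auto
      also have "\<dots> \<le> \<bar>t\<bar> * (e + r)"
        using d(2)[OF False that] by (intro mult_left_mono) auto
      finally show ?thesis by (simp add: mult.commute)
    qed simp
    have "P a b" if "a \<le> x" "x \<le> b" "b - a < d" for a b
    proof -
      have *: "\<bar>a - x\<bar> < d" "\<bar>b - x\<bar> < d" using that by auto
      have top': "c a \<in> topspace E" "c b \<in> topspace E" "c x \<in> topspace E"
        using top[OF *(1)] top[OF *(2)] c[OF x] by auto
      have "q ((c b - c x - (b - x) *\<^sub>R v) - (c a - c x - (a - x) *\<^sub>R v))
          \<le> q (c b - c x - (b - x) *\<^sub>R v) + q (c a - c x - (a - x) *\<^sub>R v)"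
        by (intro triangle_diff diff_in scale_in top' v)
      also have "\<dots> \<le> (e + r) * \<bar>b - x\<bar> + (e + r) * \<bar>a - x\<bar>"
        using est[OF *(1)] est[OF *(2)] by simp
      also have "\<dots> = (e + r) * (b - a)" using that by (simp add: algebra_simps)
      also have "(c b - c x - (b - x) *\<^sub>R v) - (c a - c x - (a - x) *\<^sub>R v)
          = c b - c a - (b - a) *\<^sub>R v" by (simp add: algebra_simps)
      finally show ?thesis using top' unfolding P_def by simp
    qed
    then show "\<exists>d>0. \<forall>a b. a \<le> x \<and> x \<le> b \<and> b - a < d \<longrightarrow> P a b" using d(1) by blast
  qed simp
  then show "q (c 1 - c 0 - v) \<le> e + r" unfolding P_def by simp
qed

section \<open>Iterated derivatives of smooth maps\<close>

locale smooth_map = dom: lcs E + cod: lcs F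
  for E :: "'e::real_vector topology" and F :: "'f::real_vector topology" +
  fixes V g
  assumes openV: "openin E V" and smooth: "Cr_on \<infinity> E F V g"
begin

definition D :: "'e list \<Rightarrow> 'e \<Rightarrow> 'f" where
  "D ys = fold (dir_deriv F) ys g"

lemma V_subset: "V \<subseteq> topspace E"
  using openV by (rule openin_subset)

lemma D_Nil: "D [] = g"
  by (simp add: D_def)

lemma D_snoc: "D (ys @ [y]) = dir_deriv F y (D ys)"
  by (simp add: D_def)

lemma D_deriv:
  assumes "set ys \<subseteq> topspace E" "y \<in> topspace E" "x \<in> V"
  shows "has_dir_deriv F y (D ys) x (D (ys @ [y]) x)"
proof -
  obtain v where "has_dir_deriv F y (D ys) x v"
    using smooth assms unfolding Cr_on_def D_def by (simp; blast)
  then show ?thesis using cod.dir_deriv_eq unfolding D_snoc by blast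
qed

text \<open>Continuity on the product of V and a power of E is awkward when the directions form a
  growing list. As a limit statement along an arbitrary filter it lets base point and all directions
  move at once.\<close>

lemma D_limitin:
  assumes z: "limitin E z z0 G" "z0 \<in> V"
    and us: "list_all2 (\<lambda>u u0. limitin E u u0 G) us u0s"
  shows "limitin F (\<lambda>s. D (map (\<lambda>u. u s) us) (z s)) (D u0s z0) G"
proof -
  define m where "m = length us"
  have m: "length u0s = m" using us list_all2_lengthD unfolding m_def by fastforce
  have ui: "limitin E (us ! i) (u0s ! i) G" if "i < m" for i
    using us that unfolding m_def by (rule list_all2_nthD)
  have cont: "continuous_map (prod_topology (subtopology E V) (product_topology (\<lambda>_. E) {..<m})) F
        (\<lambda>(x, y). D (map y [0..<m]) x)"
    using smooth unfolding Cr_on_def D_def by simp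
  have "limitin (subtopology E V) z z0 G"
    using z limitinD[OF z(1) openV z(2)] by (simp add: limitin_subtopology)
  moreover have "limitin (product_topology (\<lambda>_. E) {..<m}) (\<lambda>s. \<lambda>i\<in>{..<m}. (us ! i) s)
      (\<lambda>i\<in>{..<m}. u0s ! i) G"
  proof -
    have "\<forall>\<^sub>F s in G. \<forall>i\<in>{..<m}. (us ! i) s \<in> topspace E"
      using limitinD[OF ui openin_topspace limitin_topspace[OF ui]]
      by (intro eventually_ball_finite) auto
    then show ?thesis
      unfolding limitin_componentwise
      by (auto simp: ui elim: eventually_mono)
  qed
  ultimately have "limitin (prod_topology (subtopology E V) (product_topology (\<lambda>_. E) {..<m}))
      (\<lambda>s. (z s, \<lambda>i\<in>{..<m}. (us ! i) s)) (z0, \<lambda>i\<in>{..<m}. u0s ! i) G"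
    by (simp add: limitin_pairwise o_def)
  from continuous_map_limit[OF cont this]
  have "limitin F (\<lambda>s. D (map (\<lambda>i\<in>{..<m}. (us ! i) s) [0..<m]) (z s))
      (D (map (\<lambda>i\<in>{..<m}. u0s ! i) [0..<m]) z0) G"
    by (simp add: o_def)
  moreover have "map (\<lambda>i\<in>{..<m}. (us ! i) s) [0..<m] = map (\<lambda>u. u s) us" for s
    by (rule nth_equalityI) (auto simp: m_def)
  moreover have "map (\<lambda>i\<in>{..<m}. u0s ! i) [0..<m] = u0s"
    by (rule nth_equalityI) (auto simp: m)
  ultimately show ?thesis by simp
qed

lemma list_all2_const:
  "set ys \<subseteq> topspace E \<Longrightarrow> list_all2 (\<lambda>u u0. limitin E u u0 G) (map (\<lambda>y _. y) ys) ys"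
  by (induction ys) auto

lemma D_in: "set ys \<subseteq> topspace E \<Longrightarrow> x \<in> V \<Longrightarrow> D ys x \<in> topspace F"
  using D_deriv[of ys 0 x] limitinD[OF D_limitin[of "\<lambda>_. x" x "at (0::real)" "map (\<lambda>y _. y) ys" ys]]
    limitin_topspace[OF D_limitin[of "\<lambda>_. x" x "at (0::real)" "map (\<lambda>y _. y) ys" ys]] V_subset
  by (auto simp: list_all2_conv_all_nth subset_iff)

text \<open>Taking the product filter with the compact parameter interval makes the mean value
  estimate uniform along the segments.\<close>

lemma D_increment:
  assumes z: "limitin E z z0 (at (0::real))" "z0 \<in> V"
    and w: "limitin E w w0 (at 0)"
    and us: "list_all2 (\<lambda>u u0. limitin E u u0 (at 0)) us u0s"
  shows "limitin F (\<lambda>s. (1 / s) *\<^sub>R (D (map (\<lambda>u. u s) us) (z s + s *\<^sub>R w s)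
      - D (map (\<lambda>u. u s) us) (z s))) (D (u0s @ [w0]) z0) (at 0)"
proof (rule cod.limitin_seminormsI)
  let ?us = "\<lambda>s. map (\<lambda>u. u s) us"
  define L where "L = D (u0s @ [w0]) z0"
  define G where "G = (at (0::real)) \<times>\<^sub>F principal {0..1::real}"
  have f1: "filterlim fst (at 0) G" unfolding G_def by (rule filterlim_fst)
  have zt: "limitin E (\<lambda>(s, t). z s + (t * s) *\<^sub>R w s) (z0 + 0 *\<^sub>R w0) G"
  proof -
    have "((\<lambda>p. snd p * fst p) \<longlongrightarrow> 0) G"
    proof (rule tendsto_0_le[where K = 1])
      show "(fst \<longlongrightarrow> 0) G" using f1 by (simp add: filterlim_at)
      have "\<forall>\<^sub>F p in G. snd p \<in> {0..1}"
        unfolding G_def eventually_prod_filter eventually_principal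
        by (intro exI[of _ "\<lambda>_. True"] exI[of _ "\<lambda>t. t \<in> {0..1}"]) auto
      then show "\<forall>\<^sub>F p in G. norm (snd p * fst p) \<le> norm (fst p) * 1"
        by eventually_elim (auto simp: abs_mult mult_left_le_one_le)
    qed
    then show ?thesis
      unfolding case_prod_unfold
      by (intro dom.limitin_add dom.limitin_scale limitin_compose_filterlim[OF z(1) f1]
          limitin_compose_filterlim[OF w f1])
  qed
  have us_in: "\<forall>\<^sub>F s in at 0. set (?us s) \<subseteq> topspace E"
  proof -
    have "\<forall>\<^sub>F s in at 0. u s \<in> topspace E" if "u \<in> set us" for u
    proof -
      obtain i where i: "i < length us" "u = us ! i"
        using \<open>u \<in> set us\<close> by (metis in_set_conv_nth)
      from list_all2_nthD[OF us i(1)] have "limitin E u (u0s ! i) (at 0)" unfolding i(2) .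
      from limitinD[OF this openin_topspace limitin_topspace[OF this]] show ?thesis .
    qed
    then have "\<forall>\<^sub>F s in at 0. \<forall>u\<in>set us. u s \<in> topspace E" by (intro eventually_ball_finite) auto
    then show ?thesis by eventually_elim auto
  qed
  have w_in: "\<forall>\<^sub>F s in at 0. w s \<in> topspace E"
    using limitinD[OF w openin_topspace limitin_topspace[OF w]] .
  have lists: "list_all2 (\<lambda>u u0. limitin E u u0 G) (map (\<lambda>u. u \<circ> fst) us @ [w \<circ> fst]) (u0s @ [w0])"
  proof -
    have *: "limitin E (\<lambda>x. u (fst x)) l G" if "limitin E u l (at 0)" for u l
      by (rule limitin_compose_filterlim[OF that f1])
    show ?thesis
      using us w by (auto simp: list_all2_conv_all_nth nth_append o_def less_Suc_eq intro: *)
  qed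
  have "limitin F (\<lambda>(s, t). D (?us s @ [w s]) (z s + (t * s) *\<^sub>R w s)) L G"
    using D_limitin[OF zt _ lists] z(2) unfolding L_def by (simp add: o_def case_prod_unfold)
  note DL = this
  have Ltop: "L \<in> topspace F" using DL by (rule limitin_topspace)
  show "L \<in> topspace F" by fact
  have inV: "\<forall>\<^sub>F s in at 0. \<forall>t\<in>{0..1}. z s + (t * s) *\<^sub>R w s \<in> V"
  proof -
    have "\<forall>\<^sub>F p in G. (\<lambda>(s, t). z s + (t * s) *\<^sub>R w s) p \<in> V"
      using limitinD[OF zt openV] z(2) by simp
    then obtain Pf Pg where "eventually Pf (at 0)" "\<forall>t\<in>{0..1}. Pg t"
        "\<And>s t. Pf s \<Longrightarrow> Pg t \<Longrightarrow> z s + (t * s) *\<^sub>R w s \<in> V"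
      unfolding G_def eventually_prod_filter eventually_principal by force
    then show ?thesis by (auto elim: eventually_mono)
  qed
  show "\<forall>\<^sub>F s in at 0. (1 / s) *\<^sub>R (D (?us s) (z s + s *\<^sub>R w s) - D (?us s) (z s)) \<in> topspace F"
    using us_in inV
  proof eventually_elim
    case (elim s)
    show ?case
      using D_in[OF elim(1) bspec[OF elim(2), of 0]] D_in[OF elim(1) bspec[OF elim(2), of 1]]
      by (intro cod.scale_in cod.diff_in) auto
  qed
  fix q and e :: real assume "continuous_seminorm F q" "e > 0"
  then interpret q: csn F q using cod.csnI by blast
  have "L \<in> {x \<in> topspace F. q (x - L) < e / 2}" using Ltop \<open>e > 0\<close> by simp
  from limitinD[OF DL q.openin_ball[OF Ltop] this] obtain Pf Pg
    where "eventually Pf (at 0)" "\<forall>t\<in>{0..1}. Pg t"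
      "\<And>s t. Pf s \<Longrightarrow> Pg t \<Longrightarrow> q (D (?us s @ [w s]) (z s + (t * s) *\<^sub>R w s) - L) < e / 2"
    unfolding G_def eventually_prod_filter eventually_principal by force
  then have est: "\<forall>\<^sub>F s in at 0. \<forall>t\<in>{0..1}. q (D (?us s @ [w s]) (z s + (t * s) *\<^sub>R w s) - L) < e / 2"
    by (auto elim: eventually_mono)
  have "\<forall>\<^sub>F s in at 0. s \<noteq> (0::real)" by (simp add: eventually_at_filter)
  then show "\<forall>\<^sub>F s in at 0. q ((1 / s) *\<^sub>R (D (?us s) (z s + s *\<^sub>R w s) - D (?us s) (z s)) - L) < e"
    using us_in w_in inV est
  proof eventually_elim
    case (elim s)
    \<comment> \<open>Up to the factor 1/s this is \<open>D\<close> along the segment from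
      \<open>z s\<close> to \<open>z s + s *\<^sub>R w s\<close>. The factor cancels the s of the
      inner derivative, so the derivative of \<open>c\<close> is exactly \<open>D\<close> with
      \<open>w s\<close> appended.\<close>
    define c where "c t = (1 / s) *\<^sub>R D (?us s) (z s + (t * s) *\<^sub>R w s)" for t
    have "q (c 1 - c 0 - L) \<le> e / 2"
    proof (rule q.mean_value[where c' = "\<lambda>t. D (?us s @ [w s]) (z s + (t * s) *\<^sub>R w s)"])
      fix t :: real assume t: "t \<in> {0..1}"
      show "c t \<in> topspace F" unfolding c_def
        using elim t by (intro cod.scale_in D_in) auto
      let ?p = "z s + (t * s) *\<^sub>R w s"
      have "has_dir_deriv F (w s) (D (?us s)) ?p (D (?us s @ [w s]) ?p)"
        using elim t by (intro D_deriv) auto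
      moreover have "filterlim (\<lambda>h::real. h * s) (at 0) (at 0)"
        unfolding filterlim_at using elim(1)
        by (auto intro!: tendsto_eq_intros simp: eventually_at_filter)
      ultimately have "limitin F (\<lambda>h. (1 / (h * s)) *\<^sub>R (D (?us s) (?p + (h * s) *\<^sub>R w s) - D (?us s) ?p))
          (D (?us s @ [w s]) ?p) (at 0)"
        unfolding has_dir_deriv_def by (rule limitin_compose_filterlim)
      then show "limitin F (\<lambda>h. (1 / h) *\<^sub>R (c (t + h) - c t)) (D (?us s @ [w s]) ?p) (at 0)"
        unfolding c_def by (simp add: algebra_simps)
      show "q (D (?us s @ [w s]) ?p - L) \<le> e / 2" using elim t by (simp add: less_imp_le)
    qed (fact Ltop)
    moreover have "c 1 - c 0 = (1 / s) *\<^sub>R (D (?us s) (z s + s *\<^sub>R w s) - D (?us s) (z s))"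
      unfolding c_def by (simp add: scaleR_right_diff_distrib)
    ultimately show ?case using \<open>e > 0\<close> by simp
  qed
qed

lemma D_scale_last:
  assumes "set ys \<subseteq> topspace E" "a \<in> topspace E" "z \<in> V"
  shows "D (ys @ [c *\<^sub>R a]) z = c *\<^sub>R D (ys @ [a]) z"
proof -
  have "has_dir_deriv F (c *\<^sub>R a) (D ys) z (c *\<^sub>R D (ys @ [a]) z)"
  proof (cases "c = 0")
    case False
    have "filterlim (\<lambda>h::real. h * c) (at 0) (at 0)"
      unfolding filterlim_at using False
      by (auto intro!: tendsto_eq_intros simp: eventually_at_filter)
    from limitin_compose_filterlim[OF D_deriv[OF assms, unfolded has_dir_deriv_def] this]
    have "limitin F (\<lambda>h. (1 / (h * c)) *\<^sub>R (D ys (z + (h * c) *\<^sub>R a) - D ys z)) (D (ys @ [a]) z) (at 0)" .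
    from cod.limitin_scale[OF tendsto_const[of c] this] show ?thesis
      unfolding has_dir_deriv_def using False by simp
  qed (simp add: has_dir_deriv_def)
  then show ?thesis using cod.dir_deriv_eq unfolding D_snoc by blast
qed

text \<open>The difference quotient in direction a + b is the one in direction a at z plus the one
  in direction b at the moving point z + s a. \<open>D_increment\<close> gives the limit of the
  second; here continuity of the next derivative makes it additive.\<close>

lemma D_add_last:
  assumes ys: "set ys \<subseteq> topspace E" and ab: "a \<in> topspace E" "b \<in> topspace E" and z: "z \<in> V"
  shows "D (ys @ [a + b]) z = D (ys @ [a]) z + D (ys @ [b]) z"
proof -
  have "z \<in> topspace E" using z V_subset by blast
  then have lim: "limitin E (\<lambda>s. z + s *\<^sub>R a) z (at (0::real))"
    using dom.limitin_add[OF _ dom.limitin_scale[OF tendsto_ident_at, of "\<lambda>_. a" a 0]] ab by fastforce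
  have "list_all2 (\<lambda>u u0. limitin E u u0 (at (0::real))) (map (\<lambda>y _. y) ys) ys"
    using ys by (auto simp: list_all2_conv_all_nth subset_iff)
  from D_increment[OF lim z _ this, of "\<lambda>_. b" b] ab
  have "limitin F (\<lambda>s. (1 / s) *\<^sub>R (D ys (z + s *\<^sub>R a + s *\<^sub>R b) - D ys (z + s *\<^sub>R a))) (D (ys @ [b]) z) (at 0)"
    by (simp add: o_def)
  from cod.limitin_add[OF D_deriv[OF ys ab(1) z, unfolded has_dir_deriv_def] this]
  have "has_dir_deriv F (a + b) (D ys) z (D (ys @ [a]) z + D (ys @ [b]) z)"
    unfolding has_dir_deriv_def by (simp add: algebra_simps)
  then show ?thesis using cod.dir_deriv_eq unfolding D_snoc by blast
qed

text \<open>For the last slot this is \<open>D_add_last\<close> and \<open>D_scale_last\<close>. For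
  an earlier slot the identity for the shorter list holds on the whole open set \<open>V\<close>,
  and differentiating it appends one more later direction.\<close>

lemma D_linear:
  assumes "set xs \<subseteq> topspace E" "set ys \<subseteq> topspace E" "a \<in> topspace E" "b \<in> topspace E" "z \<in> V"
  shows "D (xs @ (c *\<^sub>R a + b) # ys) z = c *\<^sub>R D (xs @ a # ys) z + D (xs @ b # ys) z"
  using assms
proof (induction ys arbitrary: z rule: rev_induct)
  case Nil
  then show ?case using D_add_last[of xs "c *\<^sub>R a" b z] D_scale_last[of xs a z c] dom.scale_in by simp
next
  case (snoc y ys)
  have top: "set (xs @ a # ys) \<subseteq> topspace E" "set (xs @ b # ys) \<subseteq> topspace E" "y \<in> topspace E"
    using snoc.prems by auto
  have "has_dir_deriv F y (\<lambda>z. c *\<^sub>R D (xs @ a # ys) z + D (xs @ b # ys) z) z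
      (c *\<^sub>R D ((xs @ a # ys) @ [y]) z + D ((xs @ b # ys) @ [y]) z)"
    by (intro cod.has_dir_deriv_add cod.has_dir_deriv_scale D_deriv top snoc.prems)
  moreover have "\<forall>\<^sub>F t::real in at 0. z + t *\<^sub>R y \<in> V"
    by (intro dom.eventually_in_open openV snoc.prems top)
  then have "\<forall>\<^sub>F t in at 0. c *\<^sub>R D (xs @ a # ys) (z + t *\<^sub>R y) + D (xs @ b # ys) (z + t *\<^sub>R y)
      = D (xs @ (c *\<^sub>R a + b) # ys) (z + t *\<^sub>R y)"
    by eventually_elim (use snoc in auto)
  then have "has_dir_deriv F y (\<lambda>z. c *\<^sub>R D (xs @ a # ys) z + D (xs @ b # ys) z) z v
      = has_dir_deriv F y (D (xs @ (c *\<^sub>R a + b) # ys)) z v" for v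
    by (rule has_dir_deriv_cong) (use snoc in auto)
  ultimately have "dir_deriv F y (D (xs @ (c *\<^sub>R a + b) # ys)) z
      = c *\<^sub>R D ((xs @ a # ys) @ [y]) z + D ((xs @ b # ys) @ [y]) z"
    using cod.dir_deriv_eq by blast
  then show ?case using D_snoc[of "xs @ (c *\<^sub>R a + b) # ys" y] by simp
qed

text \<open>Slots are released one at a time: those in \<open>pre\<close> already move with s, those
  after the current one are frozen at their value at 0. Linearity turns the change in the current
  slot into \<open>D\<close> with the difference quotient in that slot, and the differences
  telescope.\<close>

lemma D_directions_deriv:
  assumes us: "list_all2 (\<lambda>u u'. u 0 \<in> topspace E \<and> limitin E (\<lambda>s::real. (1 / s) *\<^sub>R (u s - u 0)) u' (at 0)) us us'"
    and pre: "list_all2 (\<lambda>u u0. limitin E u u0 (at 0)) pre pre0" and z: "z \<in> V"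
  shows "limitin F (\<lambda>s. (1 / s) *\<^sub>R (D (map (\<lambda>u. u s) (pre @ us)) z - D (map (\<lambda>u. u s) pre @ map (\<lambda>u. u 0) us) z))
    (\<Sum>i<length us. D (pre0 @ (map (\<lambda>u. u 0) us)[i := us' ! i]) z) (at 0)"
  using us pre
proof (induction us us' arbitrary: pre pre0 rule: list_all2_induct)
  case Nil
  then show ?case by simp
next
  case (Cons u us u' us')
  have u: "u 0 \<in> topspace E" "limitin E (\<lambda>s. (1 / s) *\<^sub>R (u s - u 0)) u' (at 0)"
    using Cons.hyps by auto
  have zt: "z \<in> topspace E" using z V_subset by blast
  have ulim: "limitin E u (u 0) (at 0)" using dom.limitin_of_derivative[OF u(2,1)] .
  have us0: "set (map (\<lambda>u. u 0) us) \<subseteq> topspace E"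
    using Cons.hyps by (auto simp: list_all2_conv_all_nth in_set_conv_nth)
  let ?us0 = "map (\<lambda>u. u 0) us" and ?p = "\<lambda>s. map (\<lambda>u. u s) pre"
  have pre': "list_all2 (\<lambda>u u0. limitin E u u0 (at 0)) (pre @ [u]) (pre0 @ [u 0])"
    using Cons.prems ulim by (simp add: list_all2_appendI)
  note IH = Cons.IH[OF pre']
  have pre_in: "\<forall>\<^sub>F s in at 0. set (?p s) \<subseteq> topspace E"
  proof -
    have "\<forall>\<^sub>F s in at 0. u s \<in> topspace E" if "u \<in> set pre" for u
    proof -
      obtain i where i: "i < length pre" "u = pre ! i"
        using \<open>u \<in> set pre\<close> by (metis in_set_conv_nth)
      from list_all2_nthD[OF Cons.prems i(1)] have "limitin E u (pre0 ! i) (at 0)" unfolding i(2) .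
      from limitinD[OF this openin_topspace limitin_topspace[OF this]] show ?thesis .
    qed
    then have "\<forall>\<^sub>F s in at 0. \<forall>u\<in>set pre. u s \<in> topspace E" by (intro eventually_ball_finite) auto
    then show ?thesis by eventually_elim auto
  qed
  have lists: "list_all2 (\<lambda>u u0. limitin E u u0 (at 0))
      (pre @ (\<lambda>s. (1 / s) *\<^sub>R (u s - u 0)) # map (\<lambda>y _. y) ?us0) (pre0 @ u' # ?us0)"
    using Cons.prems u list_all2_const[OF us0] by (intro list_all2_appendI) auto
  have "limitin F (\<lambda>s. D (?p s @ ((1 / s) *\<^sub>R (u s - u 0)) # ?us0) z) (D (pre0 @ u' # ?us0) z) (at 0)"
    using D_limitin[OF _ z lists, of "\<lambda>_. z"] zt by (simp add: o_def)
  moreover have "\<forall>\<^sub>F s in at 0. D (?p s @ ((1 / s) *\<^sub>R (u s - u 0)) # ?us0) z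
      = (1 / s) *\<^sub>R (D (?p s @ u s # ?us0) z - D (?p s @ u 0 # ?us0) z)"
  proof -
    have "\<forall>\<^sub>F s in at 0. u s \<in> topspace E"
      using limitinD[OF ulim openin_topspace u(1)] .
    then show ?thesis using pre_in
    proof eventually_elim
      case (elim s)
      have us: "(1 / s) *\<^sub>R u s \<in> topspace E" using elim dom.scale_in by blast
      have u0: "(- 1 / s) *\<^sub>R u 0 \<in> topspace E" using u(1) dom.scale_in by blast
      have "D (?p s @ ((1 / s) *\<^sub>R u s + (- 1 / s) *\<^sub>R u 0) # ?us0) z
          = (1 / s) *\<^sub>R D (?p s @ u s # ?us0) z + D (?p s @ ((- 1 / s) *\<^sub>R u 0) # ?us0) z"
        by (rule D_linear) (use elim us0 u0 z in auto)
      also have "D (?p s @ ((- 1 / s) *\<^sub>R u 0 + 0) # ?us0) z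
          = (- 1 / s) *\<^sub>R D (?p s @ u 0 # ?us0) z + D (?p s @ 0 # ?us0) z"
        by (rule D_linear) (use elim us0 u z in auto)
      then have "D (?p s @ ((- 1 / s) *\<^sub>R u 0) # ?us0) z
          = (- 1 / s) *\<^sub>R D (?p s @ u 0 # ?us0) z + D (?p s @ 0 # ?us0) z" by simp
      \<comment> \<open>Linearity applied to two zero vectors says that the value with a zero slot
        is twice itself.\<close>
      also have "D (?p s @ (1 *\<^sub>R 0 + 0) # ?us0) z
          = 1 *\<^sub>R D (?p s @ 0 # ?us0) z + D (?p s @ 0 # ?us0) z"
        by (rule D_linear) (use elim us0 z in auto)
      then have "D (?p s @ 0 # ?us0) z = 0" by simp
      finally show ?case by (simp add: scaleR_right_diff_distrib)
    qed
  qed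
  ultimately have "limitin F (\<lambda>s. (1 / s) *\<^sub>R (D (?p s @ u s # ?us0) z - D (?p s @ u 0 # ?us0) z))
      (D (pre0 @ u' # ?us0) z) (at 0)"
    by (rule limitin_transform_eventually[rotated])
  from cod.limitin_add[OF this IH] show ?case
    by (simp add: sum.lessThan_Suc_shift algebra_simps del: sum.lessThan_Suc)
qed

text \<open>The increment splits into the change of the base point, with the directions already at
  time s, and the change of the directions at the fixed base point \<open>z 0\<close>. The first is
  \<open>D_increment\<close> with the difference quotient of \<open>z\<close> as moving direction,
  the second is \<open>D_directions_deriv\<close>.\<close>

lemma D_chain_deriv:
  assumes z: "limitin E (\<lambda>s::real. (1 / s) *\<^sub>R (z s - z 0)) z' (at 0)" "z 0 \<in> V"
    and us: "list_all2 (\<lambda>u u'. u 0 \<in> topspace E \<and> limitin E (\<lambda>s. (1 / s) *\<^sub>R (u s - u 0)) u' (at 0)) us us'"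
  shows "limitin F (\<lambda>s. (1 / s) *\<^sub>R (D (map (\<lambda>u. u s) us) (z s) - D (map (\<lambda>u. u 0) us) (z 0)))
    (D (map (\<lambda>u. u 0) us @ [z']) (z 0) + (\<Sum>i<length us. D ((map (\<lambda>u. u 0) us)[i := us' ! i]) (z 0))) (at 0)"
proof -
  have z0: "z 0 \<in> topspace E" using z V_subset by blast
  have "list_all2 (\<lambda>u u0. limitin E u u0 (at 0)) us (map (\<lambda>u. u 0) us)"
    using us dom.limitin_of_derivative by (auto simp: list_all2_conv_all_nth)
  from D_increment[OF _ z(2) z(1) this, of "\<lambda>_. z 0"] z0
  have "limitin F (\<lambda>s. (1 / s) *\<^sub>R (D (map (\<lambda>u. u s) us) (z 0 + s *\<^sub>R ((1 / s) *\<^sub>R (z s - z 0)))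
      - D (map (\<lambda>u. u s) us) (z 0))) (D (map (\<lambda>u. u 0) us @ [z']) (z 0)) (at 0)"
    by simp
  moreover have "\<forall>\<^sub>F s in at 0. (1 / s) *\<^sub>R (D (map (\<lambda>u. u s) us) (z 0 + s *\<^sub>R ((1 / s) *\<^sub>R (z s - z 0)))
      - D (map (\<lambda>u. u s) us) (z 0)) = (1 / s) *\<^sub>R (D (map (\<lambda>u. u s) us) (z s) - D (map (\<lambda>u. u s) us) (z 0))"
    unfolding eventually_at_filter by simp
  ultimately have "limitin F (\<lambda>s. (1 / s) *\<^sub>R (D (map (\<lambda>u. u s) us) (z s)
      - D (map (\<lambda>u. u s) us) (z 0))) (D (map (\<lambda>u. u 0) us @ [z']) (z 0)) (at 0)"
    by (rule limitin_transform_eventually[rotated])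
  from cod.limitin_add[OF this D_directions_deriv[OF us _ z(2), of "[]" "[]"]]
  show ?thesis by (simp add: algebra_simps)
qed

end

section \<open>The chain rule\<close>

text \<open>\<open>PC F k S f\<close> says that \<open>f ys\<close> is a \<open>C\<^sup>k\<close>-map on \<open>S\<close>, continuously in the parameter
  \<open>ys\<close>, which is a sequence of directions. All derivatives are taken in directions \<open>ys i\<close>:
  in this way the iterated derivatives of all orders live on one and the same type.\<close>

primrec PC :: "'f::real_vector topology \<Rightarrow> nat \<Rightarrow> 'a::real_normed_vector set
    \<Rightarrow> ((nat \<Rightarrow> 'a) \<Rightarrow> 'a \<Rightarrow> 'f) \<Rightarrow> bool" where
  "PC F 0 S f = continuous_map (top_of_set (UNIV \<times> S)) F (\<lambda>(ys, x). f ys x)"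
| "PC F (Suc k) S f = (continuous_map (top_of_set (UNIV \<times> S)) F (\<lambda>(ys, x). f ys x) \<and>
    (\<forall>i. (\<forall>ys. \<forall>x\<in>S. has_dir_deriv F (ys i) (f ys) x (dir_deriv F (ys i) (f ys) x)) \<and>
         PC F k S (\<lambda>ys. dir_deriv F (ys i) (f ys))))"

lemma PC_continuous: "PC F k S f \<Longrightarrow> continuous_map (top_of_set (UNIV \<times> S)) F (\<lambda>(ys, x). f ys x)"
  by (cases k) auto

lemma PC_continuous_fixed:
  assumes "PC F k S f"
  shows "continuous_map (top_of_set S) F (f ys)"
proof -
  have "continuous_map (top_of_set S) (top_of_set (UNIV \<times> S)) (\<lambda>x. (ys, x))"
    by (auto simp: continuous_map_in_subtopology intro!: continuous_intros)
  from continuous_map_compose[OF this PC_continuous[OF assms]] show ?thesis by (simp add: o_def)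
qed

lemma PC_in: "PC F k S f \<Longrightarrow> x \<in> S \<Longrightarrow> f ys x \<in> topspace F"
  using PC_continuous_fixed[of F k S f ys] by (auto simp: continuous_map_def)

lemma PC_Suc_imp: "PC F (Suc k) S f \<Longrightarrow> PC F k S f"
  by (induction k arbitrary: f) auto

lemma eventually_line_in_open:
  fixes x y :: "'a::real_normed_vector"
  assumes "open S" "x \<in> S"
  shows "\<forall>\<^sub>F t::real in at 0. x + t *\<^sub>R y \<in> S"
proof -
  have "((\<lambda>t. x + t *\<^sub>R y) \<longlongrightarrow> x + 0 *\<^sub>R y) (at 0)" by (intro tendsto_intros)
  then show ?thesis using topological_tendstoD assms by fastforce
qed

lemma PC_cong:
  assumes "open S" "\<And>ys x. x \<in> S \<Longrightarrow> f ys x = g ys x" "PC F k S f"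
  shows "PC F k S g"
  using assms(2,3)
proof (induction k arbitrary: f g)
  case 0
  then show ?case by (auto elim: continuous_map_eq)
next
  case (Suc k)
  have ev: "\<forall>\<^sub>F t in at 0. f ys (x + t *\<^sub>R y) = g ys (x + t *\<^sub>R y)" if "x \<in> S" for ys x y
    using eventually_line_in_open[OF assms(1) that, of y] by eventually_elim (rule Suc.prems)
  have "dir_deriv F y (f ys) x = dir_deriv F y (g ys) x"
    "has_dir_deriv F y (f ys) x v = has_dir_deriv F y (g ys) x v" if "x \<in> S" for ys x y v
    by (intro dir_deriv_cong has_dir_deriv_cong ev that Suc.prems)+
  note eq = this
  have "PC F k S (\<lambda>ys. dir_deriv F (ys i) (g ys))" for i
    by (rule Suc.IH[of "\<lambda>ys. dir_deriv F (ys i) (f ys)"]) (use eq Suc.prems in auto)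
  moreover have "continuous_map (top_of_set (UNIV \<times> S)) F (\<lambda>(ys, x). g ys x)"
    by (rule continuous_map_eq[OF PC_continuous[OF Suc.prems(2)]]) (use Suc.prems in auto)
  moreover have "has_dir_deriv F (ys i) (g ys) x (dir_deriv F (ys i) (g ys) x)"
    if "x \<in> S" for ys i x
    unfolding eq(1)[OF that, symmetric] eq(2)[OF that, symmetric] using Suc.prems(2) that by simp
  ultimately show ?case by simp
qed

lemma PC_mono:
  assumes "S' \<subseteq> S" "PC F k S f"
  shows "PC F k S' f"
  using assms(2)
proof (induction k arbitrary: f)
  case 0
  then show ?case using assms(1) by (auto intro: continuous_map_from_subtopology_mono)
next
  case (Suc k)
  have "continuous_map (top_of_set (UNIV \<times> S')) F (\<lambda>(ys, x). f ys x)"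
    using continuous_map_from_subtopology_mono[OF PC_continuous[OF Suc.prems], of "UNIV \<times> S'"] assms(1)
    by auto
  then show ?case using Suc assms(1) by auto
qed

lemma PC_Union:
  assumes "\<And>U. U \<in> \<U> \<Longrightarrow> open U" "\<And>U. U \<in> \<U> \<Longrightarrow> PC F k U f"
  shows "PC F k (\<Union>\<U>) f"
proof -
  have cont: "continuous_map (top_of_set (UNIV \<times> \<Union>\<U>)) F (\<lambda>(ys, x). f ys x)"
    if "\<And>U. U \<in> \<U> \<Longrightarrow> PC F k U f" for f k
  proof (rule pasting_lemma[where I = \<U> and T = "\<lambda>U. UNIV \<times> U" and f = "\<lambda>U (ys, x). f ys x"])
    fix U assume U: "U \<in> \<U>"
    show "openin (top_of_set (UNIV \<times> \<Union>\<U>)) (UNIV \<times> U)"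
      using U assms(1) by (auto intro!: open_subset open_Times)
    have eq: "(UNIV \<times> \<Union>\<U>) \<inter> (UNIV \<times> U) = UNIV \<times> U" using U by auto
    show "continuous_map (subtopology (top_of_set (UNIV \<times> \<Union>\<U>)) (UNIV \<times> U)) F (\<lambda>(ys, x). f ys x)"
      unfolding subtopology_subtopology eq using PC_continuous[OF that[OF U]] .
  qed auto
  show ?thesis using assms(2)
  proof (induction k arbitrary: f)
    case 0
    then show ?case using cont[of 0 f] by simp
  next
    case (Suc k)
    then have "PC F k (\<Union>\<U>) (\<lambda>ys. dir_deriv F (ys i) (f ys))" for i by simp
    then show ?case using Suc.prems cont[OF Suc.prems] by auto
  qed
qed

text \<open>A map into a manifold is differentiated in charts that change from point to point.
  Gluing works because continuity and directional derivatives are both local.\<close>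

lemma PC_local:
  assumes "\<And>x. x \<in> S \<Longrightarrow> \<exists>U. open U \<and> x \<in> U \<and> PC F k U f"
  shows "PC F k S f"
proof -
  have "PC F k (\<Union>{U. open U \<and> PC F k U f}) f" by (rule PC_Union) auto
  then show ?thesis by (rule PC_mono[rotated]) (use assms in blast)
qed

context lcs
begin

lemma PC_SucI:
  assumes "open S" "continuous_map (top_of_set (UNIV \<times> S)) E (\<lambda>(ys, x). f ys x)"
    and "\<And>i ys x. x \<in> S \<Longrightarrow> has_dir_deriv E (ys i) (f ys) x (f' i ys x)"
    and "\<And>i. PC E k S (f' i)"
  shows "PC E (Suc k) S f"
proof -
  have "dir_deriv E (ys i) (f ys) x = f' i ys x" if "x \<in> S" for i ys x
    using assms(3)[OF that] by (rule dir_deriv_eq)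
  moreover from this have "PC E k S (\<lambda>ys. dir_deriv E (ys i) (f ys))" for i
    by (intro PC_cong[OF assms(1) _ assms(4)[of i]]) simp
  ultimately show ?thesis using assms(2,3) by simp
qed

lemma PC_const: "c \<in> topspace E \<Longrightarrow> open S \<Longrightarrow> PC E k S (\<lambda>ys x. c)"
proof (induction k arbitrary: c)
  case (Suc k)
  show ?case
    by (rule PC_SucI[where f' = "\<lambda>_ _ _. 0"])
       (use Suc in \<open>auto simp: has_dir_deriv_const case_prod_unfold\<close>)
qed (simp add: case_prod_unfold)

lemma PC_add:
  assumes "open S" "PC E k S f" "PC E k S g"
  shows "PC E k S (\<lambda>ys x. f ys x + g ys x)"
  using assms(2,3)
proof (induction k arbitrary: f g)
  case 0
  then show ?case using continuous_map_add[of _ "\<lambda>(ys, x). f ys x" "\<lambda>(ys, x). g ys x"]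
    by (simp add: case_prod_unfold)
next
  case (Suc k)
  show ?case
  proof (rule PC_SucI[where f' = "\<lambda>i ys x. dir_deriv E (ys i) (f ys) x + dir_deriv E (ys i) (g ys) x"])
    show "continuous_map (top_of_set (UNIV \<times> S)) E (\<lambda>(ys, x). f ys x + g ys x)"
      using continuous_map_add[OF PC_continuous[OF Suc.prems(1)] PC_continuous[OF Suc.prems(2)]]
      by (simp add: case_prod_unfold)
  qed (use assms(1) Suc in \<open>auto intro: has_dir_deriv_add\<close>)
qed

lemma PC_sum:
  assumes "open S" "finite I" "\<And>i. i \<in> I \<Longrightarrow> PC E k S (f i)"
  shows "PC E k S (\<lambda>ys x. \<Sum>i\<in>I. f i ys x)"
  using assms(2,3)
  by (induction I rule: finite_induct) (use assms(1) in \<open>auto intro: PC_add PC_const\<close>)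

text \<open>The difference quotient is split with \<open>f\<close> taken at the moving point, so
  continuity of \<open>f\<close> along the line enters; it follows from differentiability.\<close>

lemma has_dir_deriv_scaleR:
  assumes c: "has_dir_deriv euclideanreal y c x c'" and f: "has_dir_deriv E y f x f'"
    and top: "\<And>x. x \<in> S \<Longrightarrow> f x \<in> topspace E" "open S" "x \<in> S"
  shows "has_dir_deriv E y (\<lambda>x. c x *\<^sub>R f x) x (c x *\<^sub>R f' + c' *\<^sub>R f x)"
proof -
  have fx: "f x \<in> topspace E" by (intro top)
  have "limitin E (\<lambda>s. f (x + s *\<^sub>R y)) (f (x + 0 *\<^sub>R y)) (at (0::real))"
    by (rule limitin_of_derivative) (use f fx in \<open>auto simp: has_dir_deriv_def\<close>)
  then have "limitin E (\<lambda>s. ((1 / s) *\<^sub>R (c (x + s *\<^sub>R y) - c x)) *\<^sub>R f (x + s *\<^sub>R y)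
      + c x *\<^sub>R ((1 / s) *\<^sub>R (f (x + s *\<^sub>R y) - f x))) (c' *\<^sub>R f (x + 0 *\<^sub>R y) + c x *\<^sub>R f') (at 0)"
    using c f by (intro limitin_add limitin_scale) (auto simp: has_dir_deriv_def)
  then show ?thesis
    unfolding has_dir_deriv_def by (simp add: algebra_simps)
qed

lemma PC_scaleR:
  assumes "open S" "PC euclideanreal k S c" "PC E k S f"
  shows "PC E k S (\<lambda>ys x. c ys x *\<^sub>R f ys x)"
  using assms(2,3)
proof (induction k arbitrary: c f)
  case 0
  then show ?case using continuous_map_scale[of _ "\<lambda>(ys, x). c ys x" "\<lambda>(ys, x). f ys x"]
    by (simp add: case_prod_unfold)
next
  case (Suc k)
  show ?case
  proof (rule PC_SucI[where f' = "\<lambda>i ys x. c ys x *\<^sub>R dir_deriv E (ys i) (f ys) x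
        + dir_deriv euclideanreal (ys i) (c ys) x *\<^sub>R f ys x"])
    show "continuous_map (top_of_set (UNIV \<times> S)) E (\<lambda>(ys, x). c ys x *\<^sub>R f ys x)"
      using continuous_map_scale[OF PC_continuous[OF Suc.prems(1)] PC_continuous[OF Suc.prems(2)]]
      by (simp add: case_prod_unfold)
    have "f ys x \<in> topspace E" if "x \<in> S" for ys x
      using PC_continuous_fixed[OF Suc.prems(2), of ys] that by (auto simp: continuous_map_def)
    then show "has_dir_deriv E (ys i) (\<lambda>x. c ys x *\<^sub>R f ys x) x
        (c ys x *\<^sub>R dir_deriv E (ys i) (f ys) x + dir_deriv euclideanreal (ys i) (c ys) x *\<^sub>R f ys x)"
      if "x \<in> S" for i ys x
      using Suc.prems that assms(1) by (intro has_dir_deriv_scaleR[where S = S]) auto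
    show "PC E k S (\<lambda>ys x. c ys x *\<^sub>R dir_deriv E (ys i) (f ys) x
        + dir_deriv euclideanreal (ys i) (c ys) x *\<^sub>R f ys x)" for i
      using Suc.prems PC_Suc_imp[OF Suc.prems(1)] PC_Suc_imp[OF Suc.prems(2)]
      by (intro PC_add assms(1) Suc.IH) auto
  qed (fact assms(1))
qed

end

text \<open>The derivative of \<open>g (f ys x)\<close> contains a direction that depends on x, so a
  statement about compositions alone would not pass through the induction. Expressions in
  \<open>D\<close> with moving directions do: their derivative is a sum of such expressions, where
  either the derivative of \<open>f\<close> is appended or one direction is replaced by its
  derivative. \<open>PC_compose\<close> is the case without directions.\<close>

lemma (in smooth_map) PC_chain:
  fixes S :: "'a::real_normed_vector set"
  assumes "open S" "PC E k S f" "\<And>ys x. x \<in> S \<Longrightarrow> f ys x \<in> V"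
    and "\<And>u. u \<in> set us \<Longrightarrow> PC E k S u"
  shows "PC F k S (\<lambda>ys x. D (map (\<lambda>u. u ys x) us) (f ys x))"
proof -
  have cont: "continuous_map (top_of_set (UNIV \<times> S)) F
      (\<lambda>(ys, x). D (map (\<lambda>u. u ys x) us) (f ys x))"
    if "PC E k S f" "\<And>ys x. x \<in> S \<Longrightarrow> f ys x \<in> V" "\<And>u. u \<in> set us \<Longrightarrow> PC E k S u" for k f us
    unfolding continuous_map_atin
  proof safe
    fix ys :: "nat \<Rightarrow> 'a" and x assume "(ys, x) \<in> topspace (top_of_set (UNIV \<times> S))"
    then have x: "x \<in> S" by auto
    let ?G = "atin (top_of_set (UNIV \<times> S)) (ys, x)"
    have lim: "limitin E (\<lambda>(ys, x). u ys x) (u ys x) ?G" if "PC E k S u" for u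
      using PC_continuous[OF that] x by (auto simp: continuous_map_atin)
    have "limitin F (\<lambda>p. D (map (\<lambda>u. u p) (map (\<lambda>u (ys, x). u ys x) us)) (case p of (ys, x) \<Rightarrow> f ys x))
        (D (map (\<lambda>u. u ys x) us) (f ys x)) ?G"
      by (rule D_limitin) (use lim that x in \<open>auto simp: list_all2_conv_all_nth\<close>)
    then show "limitin F (\<lambda>(ys, x). D (map (\<lambda>u. u ys x) us) (f ys x))
        (D (map (\<lambda>u. u ys x) us) (f ys x)) ?G"
      by (simp add: case_prod_unfold o_def)
  qed
  show ?thesis using assms(2-)
  proof (induction k arbitrary: f us)
    case 0
    then show ?case using cont[of 0 f us] by simp
  next
    case (Suc k)
    define d where "d i u = (\<lambda>ys. dir_deriv E (ys i) (u ys))" for i and u :: "(nat \<Rightarrow> 'a) \<Rightarrow> 'a \<Rightarrow> 'e"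
    have PCd: "PC E k S (d i u)" if "PC E (Suc k) S u" for i u
      using that unfolding d_def by simp
    have deriv: "limitin E (\<lambda>s. (1 / s) *\<^sub>R (u ys (x + s *\<^sub>R ys i) - u ys x)) (d i u ys x) (at 0)"
      if "PC E (Suc k) S u" "x \<in> S" for u ys x i
      using that unfolding d_def by (simp add: has_dir_deriv_def)
    show ?case
    proof (rule cod.PC_SucI[OF assms(1) cont[OF Suc.prems]])
      fix i
      show "PC F k S (\<lambda>ys x. D (map (\<lambda>u. u ys x) (us @ [d i f])) (f ys x)
          + (\<Sum>j<length us. D (map (\<lambda>u. u ys x) (us[j := d i (us ! j)])) (f ys x)))"
      proof -
        have f: "PC E k S f" and us: "\<And>u. u \<in> set us \<Longrightarrow> PC E k S u"
          using Suc.prems PC_Suc_imp by blast+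
        have "PC E k S u" if "u \<in> set (us[j := d i (us ! j)])" "j < length us" for u j
        proof -
          have "u = d i (us ! j) \<or> u \<in> set us"
            using set_update_subset_insert[THEN subsetD, OF that(1)] by simp
          moreover have "us ! j \<in> set us" using that(2) by simp
          ultimately show ?thesis using us PCd Suc.prems(3) by blast
        qed
        moreover have "PC E k S u" if "u \<in> set (us @ [d i f])" for u
          using that us PCd[OF Suc.prems(1), of i] by (simp del: PC.simps) blast
        ultimately show ?thesis
          by (intro cod.PC_add cod.PC_sum assms(1) Suc.IH f Suc.prems(2)) auto
      qed
      fix ys x assume x: "x \<in> S"
      have "list_all2 (\<lambda>u u'. u 0 \<in> topspace E \<and> limitin E (\<lambda>s. (1 / s) *\<^sub>R (u s - u 0)) u' (at 0))
          (map (\<lambda>u s. u ys (x + s *\<^sub>R ys i)) us) (map (\<lambda>u. d i u ys x) us)"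
        using deriv[OF Suc.prems(3) x] PC_in[OF Suc.prems(3) x]
        by (auto simp: list_all2_conv_all_nth)
      from D_chain_deriv[of "\<lambda>s. f ys (x + s *\<^sub>R ys i)", OF _ _ this] deriv[OF Suc.prems(1) x, of ys i]
        Suc.prems(2)[OF x]
      show "has_dir_deriv F (ys i) (\<lambda>x. D (map (\<lambda>u. u ys x) us) (f ys x)) x
        (D (map (\<lambda>u. u ys x) (us @ [d i f])) (f ys x)
          + (\<Sum>j<length us. D (map (\<lambda>u. u ys x) (us[j := d i (us ! j)])) (f ys x)))"
        unfolding has_dir_deriv_def by (simp add: o_def map_update)
    qed
  qed
qed

lemma (in smooth_map) PC_compose:
  assumes "open S" "PC E k S f" "\<And>ys x. x \<in> S \<Longrightarrow> f ys x \<in> V"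
  shows "PC F k S (\<lambda>ys x. g (f ys x))"
  using PC_chain[OF assms, of "[]"] by (simp add: D_Nil)

lemma (in lcs) Cr_on_imp_PC:
  fixes S :: "'a::real_normed_vector set"
  assumes "Cr_on r euclidean E S f" "enat k \<le> r"
  shows "PC E k S (\<lambda>ys. f)"
proof -
  have cont: "continuous_map (top_of_set (UNIV \<times> S)) E (\<lambda>(ys, x). fold (dir_deriv E) (map ys is) f x)"
    if "enat (length is) \<le> r" for "is" :: "nat list"
  proof -
    let ?m = "length is"
    have "continuous_map (prod_topology (top_of_set S) (product_topology (\<lambda>_. euclidean) {..<?m})) E
        (\<lambda>(x, y). fold (dir_deriv E) (map y [0..<?m]) f x)"
      using assms(1) that unfolding Cr_on_def by blast
    moreover have "continuous_map (top_of_set (UNIV \<times> S))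
        (prod_topology (top_of_set S) (product_topology (\<lambda>_. euclidean) {..<?m}))
        (\<lambda>(ys :: nat \<Rightarrow> 'a, x). (x, \<lambda>j\<in>{..<?m}. ys (is ! j)))"
      unfolding case_prod_unfold
    proof (rule continuous_map_pairedI)
      let ?X = "top_of_set (UNIV \<times> S) :: ((nat \<Rightarrow> 'a) \<times> 'a) topology"
      show "continuous_map ?X (top_of_set S) snd"
        by (auto simp: continuous_map_in_subtopology intro: continuous_on_snd continuous_on_id)
      have "continuous_map ?X euclidean (\<lambda>p. fst p (is ! j))" for j
        using continuous_on_product_then_coordinatewise[OF continuous_on_fst[OF continuous_on_id]]
        by simp
      then show "continuous_map ?X (product_topology (\<lambda>_. euclidean) {..<?m})
          (\<lambda>p. \<lambda>j\<in>{..<?m}. fst p (is ! j))"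
        unfolding continuous_map_componentwise by auto
    qed
    ultimately have "continuous_map (top_of_set (UNIV \<times> S)) E
        ((\<lambda>(x, y). fold (dir_deriv E) (map y [0..<?m]) f x) \<circ> (\<lambda>(ys, x). (x, \<lambda>j\<in>{..<?m}. ys (is ! j))))"
      by (rule continuous_map_compose[rotated])
    moreover have "map (\<lambda>j\<in>{..<?m}. ys (is ! j)) [0..<?m] = map ys is" for ys :: "nat \<Rightarrow> 'a"
      by (rule nth_equalityI) auto
    ultimately show ?thesis by (simp add: o_def case_prod_unfold)
  qed
  have "PC E k S (\<lambda>ys. fold (dir_deriv E) (map ys is) f)" if "enat (length is + k) \<le> r" for "is"
    using that
  proof (induction k arbitrary: "is")
    case 0
    then show ?case using cont by simp
  next
    case (Suc k)
    have "enat (length is) \<le> r"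
      by (rule order_trans[OF _ Suc.prems]) simp
    moreover have less: "enat (length is) < r"
      by (rule order_less_le_trans[OF _ Suc.prems]) simp
    moreover have "has_dir_deriv E (ys i) (fold (dir_deriv E) (map ys is) f) x
        (dir_deriv E (ys i) (fold (dir_deriv E) (map ys is) f) x)" if "x \<in> S" for ys i x
    proof -
      have "\<exists>v. has_dir_deriv E (ys i) (fold (dir_deriv E) (map ys is) f) x v"
        using assms(1) that less unfolding Cr_on_def by simp
      then show ?thesis using dir_deriv_eq by blast
    qed
    moreover have "PC E k S (\<lambda>ys. fold (dir_deriv E) (map ys (is @ [i])) f)" for i
      using Suc.prems by (intro Suc.IH) simp
    ultimately show ?case using cont by simp
  qed
  from this[of "[]"] assms(2) show ?thesis by simp
qed

lemma PC_fold:
  "PC E (length is + k) S f \<Longrightarrow> PC E k S (\<lambda>ys. fold (dir_deriv E) (map ys is) (f ys))"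
  by (induction "is" arbitrary: f) auto

lemma Cr_onI_PC:
  fixes f :: "'a::real_normed_vector \<Rightarrow> 'f::real_vector"
  assumes "\<And>k. enat k \<le> r \<Longrightarrow> PC E k S (\<lambda>ys. f)"
  shows "Cr_on r euclidean E S f"
  unfolding Cr_on_def
proof (intro conjI allI impI ballI; (elim conjE)?)
  fix ys :: "'a list" and y x assume *: "enat (length ys) < r" "x \<in> S"
  \<comment> \<open>\<open>PC\<close> only differentiates in directions that are members of a
    sequence, so the given directions become the beginning of one.\<close>
  let ?w = "\<lambda>j. (ys @ [y]) ! j"
  have "enat (Suc (length ys)) \<le> r" using *(1) by (simp add: Suc_ile_eq)
  from PC_fold[of E "[0..<length ys]" 1] assms[OF this]
  have "PC E 1 S (\<lambda>w. fold (dir_deriv E) (map w [0..<length ys]) f)" by simp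
  then have "has_dir_deriv E (?w (length ys)) (fold (dir_deriv E) (map ?w [0..<length ys]) f) x
      (dir_deriv E (?w (length ys)) (fold (dir_deriv E) (map ?w [0..<length ys]) f) x)"
    using *(2) unfolding One_nat_def PC.simps by blast
  moreover have "map ?w [0..<length ys] = ys" by (rule nth_equalityI) (auto simp: nth_append)
  ultimately show "\<exists>v. has_dir_deriv E y (fold (dir_deriv E) ys f) x v" by auto
next
  fix k assume "enat k \<le> r"
  from PC_fold[of E "[0..<k]" 0] assms[OF this]
  have "continuous_map (top_of_set (UNIV \<times> S)) E (\<lambda>(ys, x). fold (dir_deriv E) (map ys [0..<k]) f x)"
    by simp
  \<comment> \<open>A tuple indexed by \<open>{..<k}\<close> is extended by 0 to a full sequence of
    directions.\<close>
  moreover have "continuous_map (prod_topology (top_of_set S) (product_topology (\<lambda>_. euclidean) {..<k}))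
      (top_of_set (UNIV \<times> S)) (\<lambda>(x, y :: nat \<Rightarrow> 'a). (\<lambda>j. if j < k then y j else 0, x))"
  proof -
    let ?X = "prod_topology (top_of_set S) (product_topology (\<lambda>_. euclidean) {..<k}) :: ('a \<times> (nat \<Rightarrow> 'a)) topology"
    have "continuous_map ?X (product_topology (\<lambda>_. euclidean) UNIV) (\<lambda>p. \<lambda>j. if j < k then snd p j else 0)"
      unfolding continuous_map_componentwise_UNIV
    proof
      fix j
      show "continuous_map ?X euclidean (\<lambda>p. if j < k then snd p j else 0)"
        using continuous_map_compose[OF continuous_map_snd continuous_map_product_projection[of j "{..<k}" "\<lambda>_. euclidean"],
            of "top_of_set S"]
        by (cases "j < k") (simp_all add: o_def)
    qed
    moreover have "continuous_map ?X (top_of_set S) fst" by (rule continuous_map_fst)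
    then have "continuous_map ?X euclidean fst" by (simp add: continuous_map_in_subtopology)
    ultimately have "continuous_map ?X (prod_topology euclidean euclidean) (\<lambda>p. (\<lambda>j. if j < k then snd p j else 0, fst p))"
      unfolding euclidean_product_topology by (rule continuous_map_pairedI)
    then have "continuous_map ?X euclidean (\<lambda>p. (\<lambda>j. if j < k then snd p j else 0, fst p))"
      by simp
    then show ?thesis
      unfolding case_prod_unfold
      by (rule continuous_map_into_subtopology) (rule funcsetI, simp add: mem_Times_iff)
  qed
  ultimately have "continuous_map (prod_topology (top_of_set S) (product_topology (\<lambda>_. euclidean) {..<k})) E
      ((\<lambda>(ys, x). fold (dir_deriv E) (map ys [0..<k]) f x) \<circ> (\<lambda>(x, y). (\<lambda>j. if j < k then y j else 0, x)))"
    by (rule continuous_map_compose[rotated])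
  moreover have "map (\<lambda>j. if j < k then y j else 0) [0..<k] = map y [0..<k]" for y :: "nat \<Rightarrow> 'a"
    by simp
  ultimately show "continuous_map (prod_topology (top_of_set S) (product_topology (\<lambda>_. euclidean) {..<k})) E
      (\<lambda>(x, y). fold (dir_deriv E) (map y [0..<k]) f x)"
    by (simp add: o_def case_prod_unfold del: map_eq_conv)
qed

section \<open>Smooth bump functions and partitions of unity\<close>

interpretation real: lcs euclideanreal
proof
  have "neighbourhood_base_at 0 convex euclideanreal"
    unfolding neighbourhood_base_at_def
  proof safe
    fix W :: "real set" assume "openin euclidean W" "0 \<in> W"
    then obtain e where "e > 0" "ball 0 e \<subseteq> W" by (auto simp: open_contains_ball)
    then show "\<exists>U V. openin euclidean U \<and> convex V \<and> 0 \<in> U \<and> U \<subseteq> V \<and> V \<subseteq> W"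
      by (intro exI[of _ "ball 0 e"]) auto
  qed
  moreover have "continuous_map (prod_topology euclideanreal euclideanreal) euclideanreal (\<lambda>(x, y). x + y)"
    "continuous_map (prod_topology euclideanreal euclideanreal) euclideanreal (\<lambda>(x, y). x *\<^sub>R y)"
    by (auto simp: case_prod_unfold intro!: continuous_intros)
  ultimately show "locally_convex_space euclideanreal"
    unfolding locally_convex_space_def case_prod_unfold by simp
qed

lemma has_dir_deriv_realI:
  assumes "((\<lambda>t. f (x + t *\<^sub>R y)) has_real_derivative v) (at 0)"
  shows "has_dir_deriv euclideanreal y f x v"
  using assms unfolding has_dir_deriv_def DERIV_def by simp

text \<open>The classical function exp(-1/x) glued to 0, with powers of 1/x as factors. The
  derivative of \<open>flat m\<close> is a combination of \<open>flat (m + 2)\<close> and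
  \<open>flat (m + 1)\<close>, so a single induction covers all orders.\<close>

definition flat :: "nat \<Rightarrow> real \<Rightarrow> real" where
  "flat m x = (if x \<le> 0 then 0 else (1 / x) ^ m * exp (- (1 / x)))"

lemma flat_deriv: "(flat m has_real_derivative flat (m + 2) x - m * flat (m + 1) x) (at x)"
proof (cases x "0 :: real" rule: linorder_cases)
  case less
  have "((\<lambda>_. 0) has_real_derivative 0) (at x)" by simp
  then have "(flat m has_real_derivative 0) (at x)"
    by (rule has_field_derivative_transform_within_open[where S = "{..<0}"])
       (use less in \<open>auto simp: flat_def\<close>)
  then show ?thesis using less by (simp add: flat_def)
next
  case greater
  have "((\<lambda>x. (1 / x) ^ m * exp (- (1 / x))) has_real_derivative
      (flat (m + 2) x - m * flat (m + 1) x)) (at x)"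
    using greater
    by (auto intro!: derivative_eq_intros simp: flat_def power2_eq_square field_simps)
       (cases m; simp add: field_simps)
  then show ?thesis
    by (rule has_field_derivative_transform_within_open[where S = "{0<..}"])
       (use greater in \<open>auto simp: flat_def\<close>)
next
  case equal
  \<comment> \<open>With y = 1/h this becomes the right-hand difference quotient of
    \<open>flat m\<close> at 0.\<close>
  have "((\<lambda>y. y ^ (m + 1) / exp y) \<longlongrightarrow> 0) (at_top :: real filter)" by (rule tendsto_power_div_exp_0)
  then have "((\<lambda>h. (1 / h) ^ (m + 1) / exp (1 / h)) \<longlongrightarrow> (0::real)) (at_right 0)"
    by (rule filterlim_compose) (simp add: filterlim_inverse_at_top_right inverse_eq_divide[symmetric])
  then have "((\<lambda>h. flat m h / h) \<longlongrightarrow> 0) (at_right 0)"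
    by (rule Lim_transform_eventually)
       (auto simp: eventually_at_filter flat_def exp_minus field_simps)
  moreover have "((\<lambda>h. flat m h / h) \<longlongrightarrow> 0) (at_left 0)"
    by (rule Lim_transform_eventually[OF tendsto_const]) (auto simp: eventually_at_filter flat_def)
  ultimately have "((\<lambda>h. flat m h / h) \<longlongrightarrow> 0) (at 0)" by (rule filterlim_split_at[rotated])
  then show ?thesis using equal by (simp add: DERIV_def flat_def)
qed

text \<open>This is the inner derivative of an affine function \<open>x \<bullet> v + b\<close> in
  direction \<open>ys i\<close>. It is constant in x, but as the direction is a parameter it must
  itself be of class \<open>PC\<close> to occur as a factor.\<close>

lemma PC_inner: "PC euclideanreal k UNIV (\<lambda>ys x. ys i \<bullet> v)" for v :: "'a::euclidean_space"
proof (cases k)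
  have cont: "continuous_map (top_of_set (UNIV \<times> UNIV)) euclideanreal (\<lambda>(ys :: nat \<Rightarrow> 'a, x :: 'a). ys i \<bullet> v)"
    unfolding case_prod_unfold
    using continuous_on_product_then_coordinatewise[OF continuous_on_fst[OF continuous_on_id]]
    by (auto intro!: continuous_on_inner)
  case 0
  then show ?thesis using cont by simp
next
  have cont: "continuous_map (top_of_set (UNIV \<times> UNIV)) euclideanreal (\<lambda>(ys :: nat \<Rightarrow> 'a, x :: 'a). ys i \<bullet> v)"
    unfolding case_prod_unfold
    using continuous_on_product_then_coordinatewise[OF continuous_on_fst[OF continuous_on_id]]
    by (auto intro!: continuous_on_inner)
  case (Suc j)
  then show ?thesis
    using cont
    by (auto intro!: real.PC_SucI[where f' = "\<lambda>_ _ _. 0"] real.has_dir_deriv_const real.PC_const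
        simp del: PC.simps)
qed

lemma PC_mult:
  assumes "open S" "PC euclideanreal k S f" "PC euclideanreal k S g"
  shows "PC euclideanreal k S (\<lambda>ys x. f ys x * g ys x)"
  using real.PC_scaleR[OF assms] by simp

lemma PC_flat:
  fixes v :: "'a::euclidean_space"
  shows "PC euclideanreal k UNIV (\<lambda>ys x. flat m (x \<bullet> v + b))"
proof (induction k arbitrary: m)
  case 0
  have "continuous_on UNIV (flat m)"
    using flat_deriv by (intro continuous_at_imp_continuous_on) (auto intro: DERIV_isCont)
  then have "continuous_on UNIV (\<lambda>p :: (nat \<Rightarrow> 'a) \<times> 'a. flat m (snd p \<bullet> v + b))"
    by (rule continuous_on_compose2) (auto intro!: continuous_intros)
  then show ?case by (simp add: case_prod_unfold)
next
  case (Suc k)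
  have cont: "continuous_on UNIV (flat m)"
    using flat_deriv by (intro continuous_at_imp_continuous_on) (auto intro: DERIV_isCont)
  show ?case
  proof (rule real.PC_SucI[where f' = "\<lambda>i ys x. (ys i \<bullet> v) * (flat (m + 2) (x \<bullet> v + b) + (- m) * flat (m + 1) (x \<bullet> v + b))"])
    have "continuous_on UNIV (\<lambda>p :: (nat \<Rightarrow> 'a) \<times> 'a. flat m (snd p \<bullet> v + b))"
      using cont by (rule continuous_on_compose2) (auto intro!: continuous_intros)
    then show "continuous_map (top_of_set (UNIV \<times> UNIV)) euclideanreal (\<lambda>(ys :: nat \<Rightarrow> 'a, x). flat m (x \<bullet> v + b))"
      by (simp add: case_prod_unfold)
    show "PC euclideanreal k UNIV (\<lambda>ys x. (ys i \<bullet> v) * (flat (m + 2) (x \<bullet> v + b) + (- m) * flat (m + 1) (x \<bullet> v + b)))" for i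
      by (intro PC_mult real.PC_add PC_inner Suc.IH real.PC_const) auto
    fix ys :: "nat \<Rightarrow> 'a" and x i
    have "((\<lambda>t. flat m ((x + t *\<^sub>R ys i) \<bullet> v + b)) has_real_derivative
       (flat (m + 2) (x \<bullet> v + b) - m * flat (m + 1) (x \<bullet> v + b)) * (ys i \<bullet> v)) (at 0)"
      by (rule DERIV_chain2[where g = "\<lambda>t. (x + t *\<^sub>R ys i) \<bullet> v + b"])
         (use flat_deriv[of m "x \<bullet> v + b"] in \<open>auto intro!: derivative_eq_intros simp: inner_add_left\<close>)
    then show "has_dir_deriv euclideanreal (ys i) (\<lambda>x. flat m (x \<bullet> v + b)) x
      ((ys i \<bullet> v) * (flat (m + 2) (x \<bullet> v + b) + (- m) * flat (m + 1) (x \<bullet> v + b)))"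
      by (intro has_dir_deriv_realI) (simp add: mult.commute)
  qed simp
qed

text \<open>The derivative of 1/f is that of -f times two copies of 1/f itself, so the induction
  hypothesis and products close the step.\<close>

lemma PC_inverse:
  assumes "open S" "PC euclideanreal k S f" "\<And>ys x. x \<in> S \<Longrightarrow> f ys x \<noteq> 0"
  shows "PC euclideanreal k S (\<lambda>ys x. inverse (f ys x))"
  using assms(2,3)
proof (induction k)
  case 0
  then show ?case by (auto simp: case_prod_unfold intro!: continuous_on_inverse)
next
  case (Suc k)
  show ?case
  proof (rule real.PC_SucI[where f' = "\<lambda>i ys x. (- 1) * (dir_deriv euclideanreal (ys i) (f ys) x
        * (inverse (f ys x) * inverse (f ys x)))"])
    show "continuous_map (top_of_set (UNIV \<times> S)) euclideanreal (\<lambda>(ys, x). inverse (f ys x))"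
      using PC_continuous[OF Suc.prems(1)] Suc.prems(2)
      by (auto simp: case_prod_unfold intro!: continuous_on_inverse)
    have "PC euclideanreal k S (\<lambda>ys x. inverse (f ys x))"
      using Suc PC_Suc_imp by blast
    then show "PC euclideanreal k S (\<lambda>ys x. (- 1) * (dir_deriv euclideanreal (ys i) (f ys) x
        * (inverse (f ys x) * inverse (f ys x))))" for i
      using Suc.prems(1) by (intro PC_mult assms(1) real.PC_const) auto
    fix ys x i assume x: "x \<in> S"
    let ?d = "dir_deriv euclideanreal (ys i) (f ys) x"
    have "has_dir_deriv euclideanreal (ys i) (f ys) x ?d" using Suc.prems(1) x by simp
    then have "((\<lambda>t. f ys (x + t *\<^sub>R ys i)) has_real_derivative ?d) (at 0)"
      unfolding has_dir_deriv_def DERIV_def by simp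
    then have "((\<lambda>t. inverse (f ys (x + t *\<^sub>R ys i))) has_real_derivative
        - 1 * (?d * (inverse (f ys x) * inverse (f ys x)))) (at 0)"
      using Suc.prems(2)[OF x] by (auto intro!: derivative_eq_intros)
    then show "has_dir_deriv euclideanreal (ys i) (\<lambda>x. inverse (f ys x)) x
        (- 1 * (?d * (inverse (f ys x) * inverse (f ys x))))"
      by (rule has_dir_deriv_realI)
  qed (fact assms(1))
qed

text \<open>It varies between 1/4 and 3/4 only. These margins make the bumps below equal to 1 on a
  neighbourhood of a box and 0 near the boundary of the next larger one, which leaves open overlaps
  for gluing.\<close>

definition smooth_step :: "real \<Rightarrow> real" where
  "smooth_step x = flat 0 (x - 1/4) * inverse (flat 0 (x - 1/4) + flat 0 (3/4 - x))"

lemma flat_nonneg: "0 \<le> flat 0 x" by (simp add: flat_def)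
lemma flat_zero: "x \<le> 0 \<Longrightarrow> flat m x = 0" by (simp add: flat_def)
lemma flat_pos: "0 < x \<Longrightarrow> 0 < flat 0 x" by (simp add: flat_def)

lemma flat_sum_pos: "flat 0 (x - 1/4) + flat 0 (3/4 - x) > 0"
  using flat_pos[of "x - 1/4"] flat_pos[of "3/4 - x"] flat_nonneg[of "x - 1/4"] flat_nonneg[of "3/4 - x"]
  by (cases "x > 1/4") auto

lemma smooth_step_0: "x \<le> 1/4 \<Longrightarrow> smooth_step x = 0"
  by (simp add: smooth_step_def flat_zero)

lemma smooth_step_1: "x \<ge> 3/4 \<Longrightarrow> smooth_step x = 1"
  using flat_pos[of "x - 1/4"] by (simp add: smooth_step_def flat_zero[of "3/4 - x"])

lemma smooth_step_bounds: "0 \<le> smooth_step x" "smooth_step x \<le> 1"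
  using flat_sum_pos[of x] flat_nonneg[of "x - 1/4"] flat_nonneg[of "3/4 - x"]
  by (auto simp: smooth_step_def field_simps)

lemma PC_smooth_step:
  fixes v :: "'a::euclidean_space"
  shows "PC euclideanreal k UNIV (\<lambda>ys x. smooth_step (x \<bullet> v + b))"
proof -
  have "flat 0 (3/4 - (x \<bullet> v + b)) = flat 0 (x \<bullet> (- v) + (3/4 - b))" for x
    by (simp add: algebra_simps)
  moreover have "flat 0 ((x \<bullet> v + b) - 1/4) = flat 0 (x \<bullet> v + (b - 1/4))" for x
    by (simp add: algebra_simps)
  moreover have "PC euclideanreal k UNIV (\<lambda>ys x. flat 0 (x \<bullet> v + (b - 1/4))
      * inverse (flat 0 (x \<bullet> v + (b - 1/4)) + flat 0 (x \<bullet> (- v) + (3/4 - b))))"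
  proof (intro PC_mult PC_inverse real.PC_add PC_flat)
    fix x
    show "flat 0 (x \<bullet> v + (b - 1/4)) + flat 0 (x \<bullet> (- v) + (3/4 - b)) \<noteq> 0"
      using flat_sum_pos[of "x \<bullet> v + b"] by (simp add: algebra_simps)
  qed auto
  ultimately show ?thesis unfolding smooth_step_def by simp
qed

text \<open>In finite dimension, boundedness of the set of nonzeros amounts to compact
  support.\<close>

definition test_function :: "('a::euclidean_space \<Rightarrow> real) \<Rightarrow> bool" where
  "test_function \<phi> \<longleftrightarrow> (\<forall>k. PC euclideanreal k UNIV (\<lambda>ys. \<phi>)) \<and> bounded {x. \<phi> x \<noteq> 0}"

lemma PC_prod:
  assumes "open S" "finite I" "\<And>i. i \<in> I \<Longrightarrow> PC euclideanreal k S (f i)"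
  shows "PC euclideanreal k S (\<lambda>ys x. \<Prod>i\<in>I. f i ys x)"
  using assms(2,3)
  by (induction I rule: finite_induct) (use assms(1) in \<open>auto intro: PC_mult real.PC_const\<close>)

text \<open>As a difference of shifted steps, \<open>hat 0\<close> has integer translates whose sum
  telescopes to a wider hat, see \<open>sum_hat\<close>.\<close>

definition hat :: "real \<Rightarrow> real \<Rightarrow> real" where
  "hat a u = smooth_step (u + a + 1) - smooth_step (u - a)"

lemma hat_0: "a + 3/4 \<le> \<bar>u\<bar> \<Longrightarrow> a \<ge> 0 \<Longrightarrow> hat a u = 0"
  unfolding hat_def by (cases "u \<ge> 0") (auto simp: smooth_step_0 smooth_step_1)

lemma hat_1: "\<bar>u\<bar> \<le> a + 1/4 \<Longrightarrow> hat a u = 1"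
  unfolding hat_def by (auto simp: smooth_step_0 smooth_step_1)

lemma hat_bounds: "0 \<le> hat a u" "hat a u \<le> 1" if "a \<ge> 0"
proof -
  show "0 \<le> hat a u"
    using that smooth_step_0[of "u - a"] smooth_step_1[of "u + a + 1"] smooth_step_bounds[of "u - a"]
      smooth_step_bounds[of "u + a + 1"]
    unfolding hat_def by (cases "u - a \<le> 1/4") auto
  show "hat a u \<le> 1"
    using smooth_step_bounds[of "u - a"] smooth_step_bounds[of "u + a + 1"] unfolding hat_def by simp
qed

lemma sum_hat: "(\<Sum>j\<le>2 * M. hat 0 (u + real M - real j)) = hat (real M) u"
proof -
  have "(\<Sum>j\<le>2 * M. smooth_step (u + real M - real j + 1) - smooth_step (u + real M - real (Suc j) + 1))
     = smooth_step (u + real M - real 0 + 1) - smooth_step (u + real M - real (Suc (2 * M)) + 1)"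
    by (rule sum_telescope)
  then show ?thesis unfolding hat_def by (simp add: algebra_simps)
qed

definition box_bump :: "real \<Rightarrow> real \<Rightarrow> real ^ 'd \<Rightarrow> real ^ 'd \<Rightarrow> real" where
  "box_bump a N c x = (\<Prod>i\<in>UNIV. hat a (N * x $ i + c $ i))"

lemma box_bump_bounds: "0 \<le> box_bump a N c x" "box_bump a N c x \<le> 1" if "a \<ge> 0"
  unfolding box_bump_def using hat_bounds[OF that] by (auto intro: prod_nonneg prod_le_1)

lemma box_bump_nonzero:
  "box_bump a N c x \<noteq> 0 \<Longrightarrow> a \<ge> 0 \<Longrightarrow> \<bar>N * x $ i + c $ i\<bar> < a + 3/4"
  unfolding box_bump_def using hat_0 by (metis (mono_tags) UNIV_I finite linorder_not_less prod_zero_iff)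

lemma test_function_box_bump:
  fixes c :: "real ^ 'd"
  assumes "a \<ge> 0" "N > 0"
  shows "test_function (box_bump a N c)"
  unfolding test_function_def
proof (intro conjI allI)
  fix k
  have step: "PC euclideanreal k UNIV (\<lambda>ys x :: real ^ 'd. smooth_step (N * x $ i + b))" for i b
    using PC_smooth_step[of k "N *\<^sub>R axis i (1 :: real)" b] by (simp add: inner_axis)
  have "PC euclideanreal k UNIV (\<lambda>ys x :: real ^ 'd. smooth_step (N * x $ i + (c $ i + a + 1))
      + (- 1) * smooth_step (N * x $ i + (c $ i - a)))" for i
    by (intro real.PC_add PC_mult step real.PC_const) auto
  then have "PC euclideanreal k UNIV (\<lambda>ys x :: real ^ 'd. hat a (N * x $ i + c $ i))" for i
    unfolding hat_def by (simp add: algebra_simps)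
  then show "PC euclideanreal k UNIV (\<lambda>ys. box_bump a N c)"
    unfolding box_bump_def by (intro PC_prod) auto
  have "{x. box_bump a N c x \<noteq> 0} \<subseteq> cball 0 (\<Sum>i\<in>UNIV. (a + 3/4 + \<bar>c $ i\<bar>) / N)"
  proof safe
    fix x :: "real ^ 'd" assume "box_bump a N c x \<noteq> 0"
    then have "\<bar>N * x $ i\<bar> \<le> a + 3/4 + \<bar>c $ i\<bar>" for i
      using box_bump_nonzero[of a N c x i] assms(1) by linarith
    then have "\<bar>x $ i\<bar> \<le> (a + 3/4 + \<bar>c $ i\<bar>) / N" for i
      using assms(2) by (simp add: field_simps abs_mult)
    then have "norm x \<le> (\<Sum>i\<in>UNIV. (a + 3/4 + \<bar>c $ i\<bar>) / N)"
      using norm_le_l1_cart[of x] sum_mono[of UNIV "\<lambda>i. \<bar>x $ i\<bar>" "\<lambda>i. (a + 3/4 + \<bar>c $ i\<bar>) / N"]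
      by auto
    then show "x \<in> cball 0 (\<Sum>i\<in>UNIV. (a + 3/4 + \<bar>c $ i\<bar>) / N)" by simp
  qed
  then show "bounded {x. box_bump a N c x \<noteq> 0}" using bounded_subset bounded_cball by blast
qed

text \<open>The functions are products of one-dimensional hats centred on a grid of mesh 1/N. By
  distributivity their sum is a product of one-dimensional sums, each of which telescopes; so it is
  a single bump, at most 1 everywhere and equal to 1 on the prescribed box.\<close>

lemma partition_of_unity:
  fixes R \<delta> :: real
  assumes "\<delta> > 0"
  obtains J and \<phi> :: "('d::finite \<Rightarrow> nat) \<Rightarrow> real ^ 'd \<Rightarrow> real" and p where
    "finite J" "\<And>j. j \<in> J \<Longrightarrow> test_function (\<phi> j)" "\<And>j x. 0 \<le> \<phi> j x"
    "\<And>x. (\<Sum>j\<in>J. \<phi> j x) \<le> 1" "\<And>x. (\<And>i. \<bar>x $ i\<bar> \<le> R) \<Longrightarrow> (\<Sum>j\<in>J. \<phi> j x) = 1"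
    "\<And>j x. \<phi> j x \<noteq> 0 \<Longrightarrow> dist x (p j) < \<delta>"
proof -
  \<comment> \<open>Each coordinate of a point in the support of a grid bump is within 1/N of the
    centre, so the distance is at most \<open>CARD('d) / N\<close>.\<close>
  obtain N :: nat where N: "N > 0" "real CARD('d) / \<delta> < real N"
    using reals_Archimedean2[of "real CARD('d) / \<delta>"] assms
    by (metis divide_pos_pos of_nat_0_less_iff order_less_trans zero_less_card_finite)
  \<comment> \<open>In coordinates scaled by N the box lies in the cube of radius M, on which the
    wide hats equal 1.\<close>
  obtain M :: nat where M: "real N * R < real M" using reals_Archimedean2 by blast
  define J where "J = (UNIV :: 'd set) \<rightarrow>\<^sub>E {..2 * M}"
  define \<phi> where "\<phi> j = box_bump 0 (real N) (\<chi> i. real M - real (j i))" for j :: "'d \<Rightarrow> nat"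
  define p :: "('d \<Rightarrow> nat) \<Rightarrow> real ^ 'd" where "p j = (\<chi> i. (real (j i) - real M) / real N)" for j
  have sum: "(\<Sum>j\<in>J. \<phi> j x) = box_bump (real M) (real N) 0 x" for x
  proof -
    have "(\<Sum>j\<in>J. \<phi> j x) = (\<Sum>j\<in>J. \<Prod>i\<in>UNIV. hat 0 (real N * x $ i + real M - real (j i)))"
      unfolding \<phi>_def box_bump_def by (simp add: algebra_simps)
    also have "\<dots> = (\<Prod>i\<in>UNIV. \<Sum>j\<le>2 * M. hat 0 (real N * x $ i + real M - real j))"
      unfolding J_def by (subst prod_sum_PiE) auto
    also have "\<dots> = box_bump (real M) (real N) 0 x"
      unfolding box_bump_def by (simp add: sum_hat)
    finally show ?thesis .
  qed
  show thesis
  proof (rule that[of J \<phi> p])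
    show "finite J" unfolding J_def by (intro finite_PiE) auto
    show "test_function (\<phi> j)" for j
      unfolding \<phi>_def using N by (intro test_function_box_bump) auto
    show "0 \<le> \<phi> j x" for j x unfolding \<phi>_def by (simp add: box_bump_bounds)
    show "(\<Sum>j\<in>J. \<phi> j x) \<le> 1" for x unfolding sum by (simp add: box_bump_bounds)
    show "(\<Sum>j\<in>J. \<phi> j x) = 1" if "\<And>i. \<bar>x $ i\<bar> \<le> R" for x
    proof -
      have "hat (real M) (real N * x $ i) = 1" for i
      proof (rule hat_1)
        have "real N * \<bar>x $ i\<bar> \<le> real N * R" using that by (intro mult_left_mono) auto
        then show "\<bar>real N * x $ i\<bar> \<le> real M + 1/4" using M by (simp add: abs_mult)
      qed
      then show ?thesis unfolding sum box_bump_def by simp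
    qed
    show "dist x (p j) < \<delta>" if "\<phi> j x \<noteq> 0" for j x
    proof -
      have "\<bar>(x - p j) $ i\<bar> \<le> 1 / real N" for i
      proof -
        have "\<bar>real N * x $ i + (real M - real (j i))\<bar> < 1"
          using box_bump_nonzero[OF that[unfolded \<phi>_def], of i] by simp
        moreover have "real N * x $ i + (real M - real (j i)) = real N * (x - p j) $ i"
          using N unfolding p_def by (simp add: field_simps)
        ultimately have "\<bar>real N * (x - p j) $ i\<bar> < 1" by simp
        then have "real N * \<bar>(x - p j) $ i\<bar> < 1" by (simp only: abs_mult abs_of_nat)
        then show ?thesis using N by (simp add: field_simps del: vector_minus_component)
      qed
      then have "norm (x - p j) \<le> (\<Sum>i\<in>(UNIV :: 'd set). 1 / real N)"
        using norm_le_l1_cart[of "x - p j"] sum_mono[of UNIV "\<lambda>i. \<bar>(x - p j) $ i\<bar>" "\<lambda>i. 1 / real N"]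
        by auto
      also have "\<dots> < \<delta>" using N assms by (simp add: field_simps)
      finally show ?thesis by (simp add: dist_norm)
    qed
  qed
qed

section \<open>The tangent space is locally convex\<close>

text \<open>Preimages of convex sets under a linear map are convex, so a convex base at 0 pulls
  back; injectivity preserves the Hausdorff property.\<close>

lemma (in lcs) lcs_pullback_topology:
  fixes ev :: "'v::real_vector \<Rightarrow> 'e"
  assumes V: "subspace V" "ev ` V \<subseteq> topspace E" "inj_on ev V"
    and add: "\<And>x y. x \<in> V \<Longrightarrow> y \<in> V \<Longrightarrow> ev (x + y) = ev x + ev y"
    and scale: "\<And>c x. x \<in> V \<Longrightarrow> ev (c *\<^sub>R x) = c *\<^sub>R ev x"
  shows "locally_convex_space (pullback_topology V ev E)"
proof -
  let ?P = "pullback_topology V ev E"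
  have top: "topspace ?P = V" using V(2) by (auto simp: topspace_pullback_topology)
  have ev: "continuous_map ?P E ev"
    using continuous_map_pullback[OF continuous_map_id, of V ev E] by simp
  have "Hausdorff_space ?P"
    by (rule Hausdorff_space_injective_preimage[OF Hausdorff ev]) (simp add: top V)
  moreover have "continuous_map (prod_topology ?P ?P) ?P (\<lambda>(x, y). x + y)"
  proof (rule continuous_map_pullback')
    have "continuous_map (prod_topology ?P ?P) E (\<lambda>p. ev (fst p) + ev (snd p))"
      by (intro continuous_map_add continuous_map_compose[OF continuous_map_fst ev, unfolded o_def]
          continuous_map_compose[OF continuous_map_snd ev, unfolded o_def])
    then show "continuous_map (prod_topology ?P ?P) E (ev \<circ> (\<lambda>(x, y). x + y))"
      by (rule continuous_map_eq) (auto simp: top add)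
  qed (use V(1) in \<open>auto simp: top intro: subspace_add\<close>)
  moreover have "continuous_map (prod_topology euclideanreal ?P) ?P (\<lambda>(c, x). c *\<^sub>R x)"
  proof (rule continuous_map_pullback')
    have "continuous_map (prod_topology euclideanreal ?P) E (\<lambda>p. fst p *\<^sub>R ev (snd p))"
      by (intro continuous_map_scale continuous_map_fst
          continuous_map_compose[OF continuous_map_snd ev, unfolded o_def])
    then show "continuous_map (prod_topology euclideanreal ?P) E (ev \<circ> (\<lambda>(c, x). c *\<^sub>R x))"
      by (rule continuous_map_eq) (auto simp: top scale)
  qed (use V(1) in \<open>auto simp: top intro: subspace_scale\<close>)
  moreover have "neighbourhood_base_at 0 convex ?P"
    unfolding neighbourhood_base_at_def
  proof safe
    fix W assume "openin ?P W" "0 \<in> W"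
    then obtain U where U: "openin E U" "W = ev -` U \<inter> V" unfolding openin_pullback_topology by blast
    have ev0: "ev 0 = 0" using scale[of 0 0] subspace_0[OF V(1)] by simp
    have "0 \<in> U" using \<open>0 \<in> W\<close> ev0 U(2) by auto
    have "neighbourhood_base_at 0 convex E"
      using lcs by (simp add: locally_convex_space_def)
    then obtain O1 C where O1: "openin E O1" "convex C" "0 \<in> O1" "O1 \<subseteq> C" "C \<subseteq> U"
      using U(1) \<open>0 \<in> U\<close> unfolding neighbourhood_base_at_def by meson
    have "convex (ev -` C \<inter> V)"
    proof (rule convexI)
      fix x y and u v :: real
      assume *: "x \<in> ev -` C \<inter> V" "y \<in> ev -` C \<inter> V" "0 \<le> u" "0 \<le> v" "u + v = 1"
      then have "u *\<^sub>R x \<in> V" "v *\<^sub>R y \<in> V" using V(1) by (auto intro: subspace_scale)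
      moreover from this have "ev (u *\<^sub>R x + v *\<^sub>R y) = u *\<^sub>R ev x + v *\<^sub>R ev y"
        using * by (simp add: add scale)
      ultimately show "u *\<^sub>R x + v *\<^sub>R y \<in> ev -` C \<inter> V"
        using * O1(2) V(1) by (auto intro: subspace_add convexD)
    qed
    moreover have "openin ?P (ev -` O1 \<inter> V)" using O1(1) unfolding openin_pullback_topology by blast
    ultimately show "\<exists>U' V'. openin ?P U' \<and> convex V' \<and> 0 \<in> U' \<and> U' \<subseteq> V' \<and> V' \<subseteq> W"
      using O1 U(2) ev0 subspace_0[OF V(1)]
      by (intro exI[of _ "ev -` O1 \<inter> V"] exI[of _ "ev -` C \<inter> V"]) auto
  qed
  ultimately show ?thesis
    unfolding locally_convex_space_def top using V(1) by simp
qed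

lemma chart_image_openin:
  assumes "chart_homeomorphism M E U \<phi>" "openin M W" "W \<subseteq> U"
  shows "openin E (\<phi> ` W)"
proof -
  have hom: "homeomorphic_map (subtopology M U) (subtopology E (\<phi> ` U)) \<phi>"
    and "openin M U" and E: "openin E (\<phi> ` U)"
    using assms(1) unfolding chart_homeomorphism_def by auto
  have "openin (subtopology M U) W" using assms \<open>openin M U\<close> by (simp add: openin_open_subtopology)
  then have "openin (subtopology E (\<phi> ` U)) (\<phi> ` W)"
    using homeomorphic_imp_open_map[OF hom] unfolding open_map_def by blast
  then show ?thesis using E by (simp add: openin_open_subtopology)
qed

lemma chart_inj:
  assumes "chart_homeomorphism M E U \<phi>"
  shows "inj_on \<phi> U"
proof -
  have "topspace M \<inter> U = U"
    using assms openin_subset[of M U] by (auto simp: chart_homeomorphism_def)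
  then show ?thesis
    using assms by (simp add: chart_homeomorphism_def homeomorphic_eq_everything_map)
qed

locale smooth_mfd =
  fixes M :: "'m topology" and E :: "'e::real_vector topology" and A
  assumes mfd: "smooth_manifold M E A"
begin

sublocale lcs E
  using mfd by unfold_locales (simp add: smooth_manifold_def)

lemma chart: "(U, \<phi>) \<in> A \<Longrightarrow> chart_homeomorphism M E U \<phi>"
  using mfd by (auto simp: smooth_manifold_def)

lemma chart_open: "(U, \<phi>) \<in> A \<Longrightarrow> openin M U"
  using chart by (auto simp: chart_homeomorphism_def)

lemma transition_smooth_map:
  assumes "(U, \<phi>) \<in> A" "(V, \<psi>) \<in> A"
  shows "smooth_map E E (\<phi> ` (U \<inter> V)) (\<psi> \<circ> inv_into U \<phi>)"
proof unfold_locales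
  show "openin E (\<phi> ` (U \<inter> V))"
    by (rule chart_image_openin[OF chart[OF assms(1)]]) (use assms chart_open in auto)
  show "Cr_on \<infinity> E E (\<phi> ` (U \<inter> V)) (\<psi> \<circ> inv_into U \<phi>)"
  proof -
    have "\<forall>(U, \<phi>)\<in>A. \<forall>(V, \<psi>)\<in>A. Cr_on \<infinity> E E (\<phi> ` (U \<inter> V)) (\<psi> \<circ> inv_into U \<phi>)"
      using mfd by (simp add: smooth_manifold_def)
    from bspec[OF this assms(1)]
    have "\<forall>(V, \<psi>)\<in>A. Cr_on \<infinity> E E (\<phi> ` (U \<inter> V)) (\<psi> \<circ> inv_into U \<phi>)" by simp
    from bspec[OF this assms(2)] show ?thesis by simp
  qed
qed

text \<open>A tangent vector is determined by its representative in one chart, and passing to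
  another chart is a derivative of a transition map, which is linear and continuous. Hence the
  topology generated by all charts is the initial topology of the single injective linear map
  \<open>?ev\<close>.\<close>

lemma tangent_space_lcs:
  assumes p: "p \<in> topspace M"
  shows "locally_convex_space (tangent_space E A p)"
proof -
  let ?TV = "tangent_vectors E A p"
  have "p \<in> (\<Union>(U, \<phi>)\<in>A. U)" using p mfd unfolding smooth_manifold_def by blast
  then obtain U0 \<phi>0 where U0: "(U0, \<phi>0) \<in> A" "p \<in> U0" by blast
  let ?ev = "\<lambda>v. v (U0, \<phi>0)"
  define T where "T U \<phi> \<psi> w = dir_deriv E w (\<psi> \<circ> inv_into U \<phi>) (\<phi> p)" for U \<phi> V \<psi> and w :: 'e
  have T: "continuous_map E E (T U \<phi> \<psi>) \<and> (\<forall>c. \<forall>a\<in>topspace E. \<forall>b\<in>topspace E.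
      T U \<phi> \<psi> (c *\<^sub>R a + b) = c *\<^sub>R T U \<phi> \<psi> a + T U \<phi> \<psi> b)"
    if ch: "(U, \<phi>) \<in> A" "(V, \<psi>) \<in> A" "p \<in> U \<inter> V" for U \<phi> V \<psi>
  proof -
    interpret smooth_map E E "\<phi> ` (U \<inter> V)" "\<psi> \<circ> inv_into U \<phi>"
      by (rule transition_smooth_map[OF ch(1,2)])
    have TD: "T U \<phi> \<psi> = (\<lambda>w. D [w] (\<phi> p))"
      unfolding T_def using D_snoc[of "[]"] by (simp add: D_Nil)
    have \<phi>p: "\<phi> p \<in> \<phi> ` (U \<inter> V)" using ch(3) by blast
    have "limitin E (\<lambda>w. D (map (\<lambda>u. u w) [\<lambda>w. w]) (\<phi> p)) (D [w] (\<phi> p)) (atin E w)"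
      if "w \<in> topspace E" for w
      using that \<phi>p V_subset
      by (intro D_limitin[where z = "\<lambda>_. \<phi> p"])
         (auto intro: limitin_continuous_map[OF continuous_map_id[unfolded id_def]])
    then have "continuous_map E E (T U \<phi> \<psi>)"
      unfolding continuous_map_atin TD by simp
    then show ?thesis
      unfolding TD using D_linear[of "[]" "[]" _ _ "\<phi> p"] \<phi>p by simp
  qed
  have T_cont: "continuous_map E E (T U \<phi> \<psi>)"
    if "(U, \<phi>) \<in> A" "(V, \<psi>) \<in> A" "p \<in> U \<inter> V" for U \<phi> V \<psi>
    using T[OF that] by (rule conjunct1)
  have T_linear: "T U \<phi> \<psi> (c *\<^sub>R a + b) = c *\<^sub>R T U \<phi> \<psi> a + T U \<phi> \<psi> b"
    if "(U, \<phi>) \<in> A" "(V, \<psi>) \<in> A" "p \<in> U \<inter> V" "a \<in> topspace E" "b \<in> topspace E"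
    for U \<phi> V \<psi> c a b
    using T[OF that(1-3)] that(4,5) by simp
  have mem: "v \<in> ?TV \<longleftrightarrow> (\<forall>U \<phi>. \<not> ((U, \<phi>) \<in> A \<and> p \<in> U) \<longrightarrow> v (U, \<phi>) = 0) \<and>
         (\<forall>(U, \<phi>)\<in>A. p \<in> U \<longrightarrow> v (U, \<phi>) \<in> topspace E) \<and>
         (\<forall>(U, \<phi>)\<in>A. \<forall>(V, \<psi>)\<in>A. p \<in> U \<inter> V \<longrightarrow> v (V, \<psi>) = T U \<phi> \<psi> (v (U, \<phi>)))" for v
    unfolding tangent_vectors_def T_def by (simp only: mem_Collect_eq)
  have mem_0: "v (U, \<phi>) = 0" if "v \<in> ?TV" "\<not> ((U, \<phi>) \<in> A \<and> p \<in> U)" for v U \<phi>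
    using conjunct1[OF that(1)[unfolded mem], rule_format, OF that(2)] .
  have mem_in: "v (U, \<phi>) \<in> topspace E" if "v \<in> ?TV" "(U, \<phi>) \<in> A" "p \<in> U" for v U \<phi>
    using bspec[OF conjunct1[OF conjunct2[OF that(1)[unfolded mem]]] that(2)] that(3) by simp
  have mem_T: "v (V, \<psi>) = T U \<phi> \<psi> (v (U, \<phi>))"
    if "v \<in> ?TV" "(U, \<phi>) \<in> A" "p \<in> U" "(V, \<psi>) \<in> A" "p \<in> V" for v U \<phi> V \<psi>
  proof -
    from bspec[OF conjunct2[OF conjunct2[OF that(1)[unfolded mem]]] that(2)]
    have "\<forall>(V, \<psi>)\<in>A. p \<in> U \<inter> V \<longrightarrow> v (V, \<psi>) = T U \<phi> \<psi> (v (U, \<phi>))" by simp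
    from bspec[OF this that(4)] that(3,5) show ?thesis by simp
  qed
  have memI: "v \<in> ?TV"
    if "\<And>U \<phi>. \<not> ((U, \<phi>) \<in> A \<and> p \<in> U) \<Longrightarrow> v (U, \<phi>) = 0"
      "\<And>U \<phi>. (U, \<phi>) \<in> A \<Longrightarrow> p \<in> U \<Longrightarrow> v (U, \<phi>) \<in> topspace E"
      "\<And>U \<phi> V \<psi>. (U, \<phi>) \<in> A \<Longrightarrow> p \<in> U \<Longrightarrow> (V, \<psi>) \<in> A \<Longrightarrow> p \<in> V \<Longrightarrow> v (V, \<psi>) = T U \<phi> \<psi> (v (U, \<phi>))"
    for v
    unfolding mem
  proof (intro conjI)
    show "\<forall>U \<phi>. \<not> ((U, \<phi>) \<in> A \<and> p \<in> U) \<longrightarrow> v (U, \<phi>) = 0" using that(1) by simp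
    show "\<forall>(U, \<phi>)\<in>A. p \<in> U \<longrightarrow> v (U, \<phi>) \<in> topspace E" using that(2) by auto
    show "\<forall>(U, \<phi>)\<in>A. \<forall>(V, \<psi>)\<in>A. p \<in> U \<inter> V \<longrightarrow> v (V, \<psi>) = T U \<phi> \<psi> (v (U, \<phi>))"
    proof (intro ballI, clarify)
      fix U \<phi> V \<psi> assume "(U, \<phi>) \<in> A" "(V, \<psi>) \<in> A" "p \<in> U" "p \<in> V"
      then show "v (V, \<psi>) = T U \<phi> \<psi> (v (U, \<phi>))" by (intro that(3))
    qed
  qed
  have TV0: "(0::('m, 'e) tangent) \<in> ?TV"
  proof (rule memI)
    fix U \<phi> V \<psi> assume "(U, \<phi>) \<in> A" "p \<in> U" "(V, \<psi>) \<in> A" "p \<in> V"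
    then have "T U \<phi> \<psi> (1 *\<^sub>R 0 + 0) = 1 *\<^sub>R T U \<phi> \<psi> 0 + T U \<phi> \<psi> 0"
      by (intro T_linear[of U \<phi> V \<psi>]) auto
    then show "(0::('m, 'e) tangent) (V, \<psi>) = T U \<phi> \<psi> ((0::('m, 'e) tangent) (U, \<phi>))" by simp
  qed auto
  have TVlin: "c *\<^sub>R v + w \<in> ?TV" if v: "v \<in> ?TV" and w: "w \<in> ?TV" for c v w
  proof (rule memI)
    fix U \<phi> assume "\<not> ((U, \<phi>) \<in> A \<and> p \<in> U)"
    then show "(c *\<^sub>R v + w) (U, \<phi>) = 0"
      using mem_0[OF v] mem_0[OF w] by (simp add: scaleR_fun_def)
  next
    fix U \<phi> assume "(U, \<phi>) \<in> A" "p \<in> U"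
    then show "(c *\<^sub>R v + w) (U, \<phi>) \<in> topspace E"
      using mem_in[OF v] mem_in[OF w] by (simp add: scaleR_fun_def add_in scale_in)
  next
    fix U \<phi> V \<psi> assume *: "(U, \<phi>) \<in> A" "p \<in> U" "(V, \<psi>) \<in> A" "p \<in> V"
    then have "T U \<phi> \<psi> (c *\<^sub>R v (U, \<phi>) + w (U, \<phi>)) = c *\<^sub>R T U \<phi> \<psi> (v (U, \<phi>)) + T U \<phi> \<psi> (w (U, \<phi>))"
      using mem_in[OF v] mem_in[OF w] by (intro T_linear[of U \<phi> V \<psi>]) auto
    then show "(c *\<^sub>R v + w) (V, \<psi>) = T U \<phi> \<psi> ((c *\<^sub>R v + w) (U, \<phi>))"
      using mem_T[OF v *] mem_T[OF w *] by (simp add: scaleR_fun_def)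
  qed
  have sub: "subspace ?TV"
    unfolding subspace_def using TV0 TVlin[of _ 0] TVlin[of _ _ 1] by auto
  have T0: "v (V, \<psi>) = T U0 \<phi>0 \<psi> (v (U0, \<phi>0))" if "v \<in> ?TV" "(V, \<psi>) \<in> A" "p \<in> V" for v V \<psi>
    by (rule mem_T[OF that(1) U0 that(2,3)])
  have "tangent_space E A p = pullback_topology ?TV ?ev E"
    unfolding topology_eq
  proof (intro allI iffI)
    fix W assume "openin (pullback_topology ?TV ?ev E) W"
    then obtain O' where O': "openin E O'" "W = ?ev -` O' \<inter> ?TV"
      unfolding openin_pullback_topology by blast
    have "W = {v \<in> ?TV. v (U0, \<phi>0) \<in> O'}" using O'(2) by auto
    then show "openin (tangent_space E A p) W"
      unfolding tangent_space_def using U0 O'(1) by (intro topology_generated_by_Basis) blast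
  next
    fix W assume "openin (tangent_space E A p) W"
    then have "generate_topology_on {{v \<in> ?TV. v (U, \<phi>) \<in> O'} |U \<phi> O'. (U, \<phi>) \<in> A \<and> p \<in> U \<and> openin E O'} W"
      unfolding tangent_space_def openin_topology_generated_by_iff .
    then show "openin (pullback_topology ?TV ?ev E) W"
    proof induction
      case (Basis s)
      then obtain U \<phi> O' where s: "s = {v \<in> ?TV. v (U, \<phi>) \<in> O'}" "(U, \<phi>) \<in> A" "p \<in> U" "openin E O'"
        by blast
      have "openin E {w \<in> topspace E. T U0 \<phi>0 \<phi> w \<in> O'}"
        using U0 s(3) by (intro openin_continuous_map_preimage[OF T_cont[OF U0(1) s(2)] s(4)]) auto
      moreover have "s = ?ev -` {w \<in> topspace E. T U0 \<phi>0 \<phi> w \<in> O'} \<inter> ?TV"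
        unfolding s(1) using T0[OF _ s(2,3)] mem_in[OF _ U0] by auto
      ultimately show ?case unfolding openin_pullback_topology by blast
    qed auto
  qed
  moreover have "inj_on ?ev ?TV"
  proof (rule inj_onI, rule ext)
    fix v w and c :: "'m set \<times> ('m \<Rightarrow> 'e)" assume *: "v \<in> ?TV" "w \<in> ?TV" "v (U0, \<phi>0) = w (U0, \<phi>0)"
    obtain U \<phi> where c: "c = (U, \<phi>)" by (cases c)
    show "v c = w c"
    proof (cases "(U, \<phi>) \<in> A \<and> p \<in> U")
      case True
      then show ?thesis unfolding c using T0[of v U \<phi>] T0[of w U \<phi>] * by simp
    next
      case False
      then show ?thesis using mem_0[OF *(1)] mem_0[OF *(2)] by (simp add: c)
    qed
  qed
  moreover have "?ev ` ?TV \<subseteq> topspace E" using mem_in[OF _ U0] by blast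
  ultimately show ?thesis
    using lcs_pullback_topology[OF sub, of ?ev] by (simp add: scaleR_fun_def)
qed

end

section \<open>Weighted function spaces\<close>

text \<open>On the line through x in direction v, differentiating in the parameter is
  differentiating in direction v. The weighted seminorms thereby become statements about iterated
  directional derivatives.\<close>

lemma gateaux_eq_fold:
  fixes \<gamma> :: "'a::real_vector \<Rightarrow> 'b::real_vector"
  shows "gateaux F k \<gamma> x v = fold (dir_deriv F) (replicate k v) \<gamma> x"
proof -
  have shift: "dir_deriv F 1 (\<lambda>t. g (x + t *\<^sub>R v)) t = dir_deriv F v g (x + t *\<^sub>R v)"
    for g :: "'a \<Rightarrow> 'b" and t :: real
    unfolding dir_deriv_def has_dir_deriv_def by (simp add: algebra_simps)
  have "(dir_deriv F (1::real) ^^ k) (\<lambda>t. \<gamma> (x + t *\<^sub>R v)) = (\<lambda>t. fold (dir_deriv F) (replicate k v) \<gamma> (x + t *\<^sub>R v))"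
  proof (induction k)
    case (Suc k)
    have "fold (dir_deriv F) (replicate (Suc k) v) \<gamma> = dir_deriv F v (fold (dir_deriv F) (replicate k v) \<gamma>)"
      unfolding replicate_Suc replicate_append_same[symmetric] by simp
    moreover have "(dir_deriv F (1::real) ^^ Suc k) (\<lambda>t. \<gamma> (x + t *\<^sub>R v))
        = dir_deriv F 1 (\<lambda>t. fold (dir_deriv F) (replicate k v) \<gamma> (x + t *\<^sub>R v))"
      by (simp only: funpow.simps o_apply Suc)
    ultimately show ?case using shift by (intro ext) (simp only:)
  qed simp
  then show ?thesis unfolding gateaux_def by simp
qed

lemma gateaux_0: "gateaux F 0 \<gamma> x v = \<gamma> x"
  by (simp add: gateaux_eq_fold)

context lcs
begin

lemma fold_dir_deriv_vanish:
  fixes f :: "'a::real_normed_vector \<Rightarrow> 'e"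
  assumes "open U" "\<And>x. x \<in> U \<Longrightarrow> f x = 0" "x \<in> U"
  shows "fold (dir_deriv E) ys f x = 0"
  using assms(3)
proof (induction ys arbitrary: x rule: rev_induct)
  case (snoc y ys)
  have "\<forall>\<^sub>F t in at 0. fold (dir_deriv E) ys f (x + t *\<^sub>R y) = 0"
    using eventually_line_in_open[OF assms(1) snoc.prems, of y] by eventually_elim (rule snoc.IH)
  then have "dir_deriv E y (fold (dir_deriv E) ys f) x = dir_deriv E y (\<lambda>x. 0) x"
    by (intro dir_deriv_cong) (use snoc in auto)
  then show ?case using dir_deriv_eq[OF has_dir_deriv_const] by simp
qed (simp add: assms(2))

lemma Cr_on_fold_in:
  fixes f :: "'a::real_normed_vector \<Rightarrow> 'e"
  assumes "Cr_on r euclidean E S f" "enat k \<le> r" "x \<in> S"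
  shows "fold (dir_deriv E) (replicate k v) f x \<in> topspace E"
proof -
  have "PC E 0 S (\<lambda>ys. fold (dir_deriv E) (map ys (replicate k 0)) f)"
    using PC_fold[of E "replicate k 0" 0 S "\<lambda>_. f"] Cr_on_imp_PC[OF assms(1,2)] by simp
  from PC_in[OF this assms(3), of "\<lambda>_. v"] show ?thesis by simp
qed

lemma Cr_on_has_dir_deriv:
  fixes f :: "'a::real_normed_vector \<Rightarrow> 'e"
  assumes "Cr_on r euclidean E S f" "enat (length ys) < r" "x \<in> S"
  shows "has_dir_deriv E y (fold (dir_deriv E) ys f) x (fold (dir_deriv E) (ys @ [y]) f x)"
proof -
  obtain v where "has_dir_deriv E y (fold (dir_deriv E) ys f) x v"
    using assms unfolding Cr_on_def by (simp; blast)
  with dir_deriv_eq[OF this] show ?thesis by simp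
qed

lemma Cr_on_fold_add:
  fixes f :: "'a::real_normed_vector \<Rightarrow> 'e"
  assumes "Cr_on r euclidean E UNIV f" "Cr_on r euclidean E UNIV g" "enat (length ys) \<le> r"
  shows "fold (dir_deriv E) ys (f + g) = fold (dir_deriv E) ys f + fold (dir_deriv E) ys g"
  using assms(3)
proof (induction ys rule: rev_induct)
  case (snoc y ys)
  have less: "enat (length ys) < r"
    by (rule order_less_le_trans[OF _ snoc.prems]) simp
  then have IH: "fold (dir_deriv E) ys (f + g) = fold (dir_deriv E) ys f + fold (dir_deriv E) ys g"
    by (intro snoc.IH) simp
  have "dir_deriv E y (fold (dir_deriv E) ys f + fold (dir_deriv E) ys g) x
      = fold (dir_deriv E) (ys @ [y]) f x + fold (dir_deriv E) (ys @ [y]) g x" for x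
    using has_dir_deriv_add[OF Cr_on_has_dir_deriv[OF assms(1) less, of x y]
        Cr_on_has_dir_deriv[OF assms(2) less, of x y]]
    by (intro dir_deriv_eq) (simp add: plus_fun_def)
  note sum = this
  have step: "fold (dir_deriv E) (ys @ [y]) (f + g) = dir_deriv E y (fold (dir_deriv E) ys f + fold (dir_deriv E) ys g)"
    by (simp only: fold_append o_apply fold_simps IH)
  show ?case
  proof
    fix x
    have "(fold (dir_deriv E) (ys @ [y]) f + fold (dir_deriv E) (ys @ [y]) g) x
        = fold (dir_deriv E) (ys @ [y]) f x + fold (dir_deriv E) (ys @ [y]) g x"
      by (rule plus_fun_apply)
    then show "fold (dir_deriv E) (ys @ [y]) (f + g) x
        = (fold (dir_deriv E) (ys @ [y]) f + fold (dir_deriv E) (ys @ [y]) g) x"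
      by (simp only: step sum)
  qed
qed simp

lemma fold_dir_deriv_scaleR:
  fixes \<phi> :: "'a::real_normed_vector \<Rightarrow> real"
  assumes "Cr_on \<infinity> euclidean euclideanreal UNIV \<phi>" "y \<in> topspace E"
  shows "fold (dir_deriv E) ys (\<lambda>x. \<phi> x *\<^sub>R y) = (\<lambda>x. fold (dir_deriv euclideanreal) ys \<phi> x *\<^sub>R y)"
proof (induction ys rule: rev_induct)
  case (snoc w ys)
  have "dir_deriv E w (\<lambda>x. fold (dir_deriv euclideanreal) ys \<phi> x *\<^sub>R y) x
      = fold (dir_deriv euclideanreal) (ys @ [w]) \<phi> x *\<^sub>R y" for x
  proof (rule dir_deriv_eq)
    have "has_dir_deriv euclideanreal w (fold (dir_deriv euclideanreal) ys \<phi>) x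
        (fold (dir_deriv euclideanreal) (ys @ [w]) \<phi> x)"
      by (rule real.Cr_on_has_dir_deriv[OF assms(1)]) auto
    from has_dir_deriv_scaleR[OF this has_dir_deriv_const, of UNIV y] assms(2)
    show "has_dir_deriv E w (\<lambda>x. fold (dir_deriv euclideanreal) ys \<phi> x *\<^sub>R y) x
        (fold (dir_deriv euclideanreal) (ys @ [w]) \<phi> x *\<^sub>R y)" by simp
  qed
  moreover have "fold (dir_deriv E) (ys @ [w]) (\<lambda>x. \<phi> x *\<^sub>R y)
      = dir_deriv E w (\<lambda>x. fold (dir_deriv euclideanreal) ys \<phi> x *\<^sub>R y)"
    by (simp only: fold_append o_apply fold_simps snoc)
  ultimately show ?case by (intro ext) (simp only:)
qed simp

end

text \<open>The open neighbourhoods of infinity are the complements of closed compact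
  subsets.\<close>

lemma eventually_atin_Alexandroff:
  fixes \<Omega> :: "'a::euclidean_space set"
  shows "eventually P (atin (Alexandroff_compactification (top_of_set \<Omega>)) None)
    \<longleftrightarrow> (\<exists>C. compact C \<and> C \<subseteq> \<Omega> \<and> (\<forall>x\<in>\<Omega> - C. P (Some x)))" (is "?L \<longleftrightarrow> ?R")
proof
  assume ?L
  then obtain U where U: "openin (Alexandroff_compactification (top_of_set \<Omega>)) U" "None \<in> U"
      "\<And>z. z \<in> U - {None} \<Longrightarrow> P z"
    by (auto simp: eventually_atin)
  then obtain C where "compactin (top_of_set \<Omega>) C" "U = insert None (Some ` (\<Omega> - C))"
    unfolding openin_Alexandroff_compactification by auto
  then show ?R using U(3) by (intro exI[of _ C]) (auto simp: compactin_subtopology)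
next
  assume ?R
  then obtain C where C: "compact C" "C \<subseteq> \<Omega>" "\<And>x. x \<in> \<Omega> - C \<Longrightarrow> P (Some x)" by auto
  have "openin (Alexandroff_compactification (top_of_set \<Omega>)) (insert None (Some ` (\<Omega> - C)))"
    unfolding openin_Alexandroff_compactification
    using C by (auto simp: compactin_subtopology intro!: exI[of _ C] closed_subset compact_imp_closed)
  then show ?L
    unfolding eventually_atin using C(3)
    by (auto intro!: exI[of _ "insert None (Some ` (\<Omega> - C))"])
qed

text \<open>The norm n is bounded by a multiple of the Euclidean one, hence continuous, and attains
  a positive minimum on the compact Euclidean sphere. The reciprocal of this minimum is the
  radius.\<close>

lemma is_norm_ball_bounded:
  fixes n :: "'a::euclidean_space \<Rightarrow> real"
  assumes "is_norm n"
  obtains R where "\<And>v. n v \<le> 1 \<Longrightarrow> norm v \<le> R" "R > 0"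
proof -
  have tri: "n (x + y) \<le> n x + n y" and sc: "n (c *\<^sub>R x) = \<bar>c\<bar> * n x" and def: "n x = 0 \<Longrightarrow> x = 0" for x y c
    using assms unfolding is_norm_def seminorm_on_def by auto
  have n0: "n 0 = 0" using sc[of 0 0] by simp
  have minus: "n (- x) = n x" for x using sc[of "-1" x] by simp
  have nonneg: "n x \<ge> 0" for x using tri[of x "-x"] n0 minus[of x] by simp
  define C where "C = (\<Sum>b\<in>Basis. n b)"
  have sum: "n (sum f I) \<le> (\<Sum>i\<in>I. n (f i))" if "finite I" for f :: "'a \<Rightarrow> 'a" and I
    using that by (induction I rule: finite_induct) (use n0 in \<open>auto intro!: order_trans[OF tri]\<close>)
  have "n x \<le> C * norm x" for x
  proof -
    have "n x = n (\<Sum>b\<in>Basis. (x \<bullet> b) *\<^sub>R b)" by (simp add: euclidean_representation)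
    also have "\<dots> \<le> (\<Sum>b\<in>Basis. n ((x \<bullet> b) *\<^sub>R b))" by (rule sum) simp
    also have "\<dots> \<le> (\<Sum>b\<in>Basis. norm x * n b)"
      unfolding sc by (intro sum_mono mult_right_mono nonneg Basis_le_norm)
    finally show ?thesis unfolding C_def by (simp add: sum_distrib_left mult.commute)
  qed
  note upper = this
  have "\<bar>n x - n y\<bar> \<le> C * norm (x - y)" for x y
    using tri[of "x - y" y] tri[of "y - x" x] upper[of "x - y"] upper[of "y - x"]
    by (simp add: norm_minus_commute)
  then have "\<bar>n x - n y\<bar> \<le> max C 0 * norm (x - y)" for x y
    by (rule order_trans) (intro mult_right_mono, auto)
  then have "continuous_on (sphere 0 1) n"
    by (intro lipschitz_on_continuous_on[of "max C 0"] lipschitz_onI) (auto simp: dist_norm)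
  moreover have "sphere (0::'a) 1 \<noteq> {}" using nonempty_Basis norm_Basis by fastforce
  ultimately obtain x0 where x0: "x0 \<in> sphere 0 1" "\<And>x. x \<in> sphere 0 1 \<Longrightarrow> n x0 \<le> n x"
    using continuous_attains_inf[of "sphere (0::'a) 1" n] by auto
  have pos: "n x0 > 0" using nonneg[of x0] def[of x0] x0(1) by fastforce
  show thesis
  proof (rule that[of "1 / n x0"])
    fix v assume "n v \<le> 1"
    show "norm v \<le> 1 / n x0"
    proof (cases "v = 0")
      case False
      have "n x0 \<le> n ((1 / norm v) *\<^sub>R v)" using False by (intro x0(2)) simp
      also have "\<dots> = n v / norm v" by (simp add: sc)
      finally show ?thesis using pos \<open>n v \<le> 1\<close> False by (simp add: field_simps)
    qed (use pos in simp)
  qed (use pos in simp)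
qed

lemma poly_norm_const_0:
  assumes "q 0 = 0"
  shows "poly_norm n q (\<lambda>v. 0) = 0"
  using assms by (simp add: poly_norm_def image_constant_conv bot_ennreal)

text \<open>Local convexity of the weighted space is an assumption here; it will come from the Lie
  group structure, whose modelling space it is.\<close>

locale weighted = cod: lcs Y + F: lcs "weighted_space n r W (UNIV :: 'a::euclidean_space set) Y"
  for n :: "'a::euclidean_space \<Rightarrow> real" and r :: enat and W :: "('a::euclidean_space \<Rightarrow> real) set" and Y :: "'y::real_vector topology" +
  assumes norm: "is_norm n" and one_in_W: "(\<lambda>x. 1) \<in> W"
    and smooth_weights: "\<And>f. f \<in> W \<Longrightarrow> Cr_on \<infinity> euclidean euclideanreal UNIV f"
    and weights_nonneg: "\<And>f x. f \<in> W \<Longrightarrow> f x \<ge> 0"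
begin

abbreviation "F \<equiv> weighted_space n r W (UNIV :: 'a set) Y"

lemma topspace_F: "topspace F = weighted_maps_vanishing n r W UNIV Y"
  unfolding weighted_space_def seminorm_topology_def by auto

lemma openin_F:
  assumes "f \<in> W" "enat k \<le> r" "continuous_seminorm Y q" "u \<in> topspace F" "e > 0"
  shows "openin F {v \<in> topspace F. enn2real (weighted_seminorm n UNIV Y f k q (v - u)) < e}"
  unfolding topspace_F
  unfolding weighted_space_def seminorm_topology_def
proof (rule topology_generated_by_Basis, rule insertI2, intro CollectI exI conjI)
  show "{v \<in> weighted_maps_vanishing n r W UNIV Y. enn2real (weighted_seminorm n UNIV Y f k q (v - u)) < e}
    = {v \<in> weighted_maps_vanishing n r W UNIV Y. (\<lambda>\<gamma>. enn2real (weighted_seminorm n UNIV Y f k q \<gamma>)) (v - u) < e}"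
    by simp
qed (use assms topspace_F in auto)

lemma n_0: "n 0 = 0"
  using norm unfolding is_norm_def seminorm_on_def by (metis UNIV_I abs_zero mult_zero_left scaleR_zero_left)

lemma weighted_maps_Cr: "\<gamma> \<in> topspace F \<Longrightarrow> Cr_on r euclidean Y UNIV \<gamma>"
  unfolding topspace_F weighted_maps_vanishing_def weighted_maps_def by simp

lemma weighted_seminorm_finite:
  "\<gamma> \<in> topspace F \<Longrightarrow> f \<in> W \<Longrightarrow> enat k \<le> r \<Longrightarrow> continuous_seminorm Y q
    \<Longrightarrow> weighted_seminorm n UNIV Y f k q \<gamma> < \<infinity>"
  unfolding topspace_F weighted_maps_vanishing_def weighted_maps_def by simp

lemma poly_norm_gateaux_0: "poly_norm n q (gateaux Y 0 \<gamma> x) = ennreal (q (\<gamma> x))"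
  unfolding poly_norm_def gateaux_0 using n_0 by (intro SUP_const) (auto intro: exI[of _ 0])

lemma weighted_seminorm_0:
  "weighted_seminorm n UNIV Y (\<lambda>x. 1) 0 q \<gamma> = (SUP x. ennreal (q (\<gamma> x)))"
  unfolding weighted_seminorm_def by (simp add: poly_norm_gateaux_0)

lemma sup_neighbourhood:
  assumes q: "continuous_seminorm Y q"
  obtains N where "openin F N" "0 \<in> N" "\<And>\<eta> x. \<eta> \<in> N \<Longrightarrow> q (\<eta> x) < 1"
proof -
  interpret q: csn Y q by (rule cod.csnI[OF q])
  let ?p = "\<lambda>\<eta>. weighted_seminorm n UNIV Y (\<lambda>x. 1) 0 q \<eta>"
  have r: "enat 0 \<le> r" by (simp add: zero_enat_def[symmetric])
  define N where "N = {v \<in> topspace F. enn2real (?p (v - 0)) < 1}"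
  show thesis
  proof (rule that[of N])
    show "openin F N" unfolding N_def by (rule openin_F[OF one_in_W r q]) auto
    show "0 \<in> N" unfolding N_def weighted_seminorm_0 by simp
    fix \<eta> x assume "\<eta> \<in> N"
    then have \<eta>: "\<eta> \<in> topspace F" "enn2real (?p \<eta>) < 1" unfolding N_def by auto
    then have "\<eta> x \<in> topspace Y"
      using cod.Cr_on_fold_in[OF weighted_maps_Cr[OF \<eta>(1)], of 0 x] r by simp
    have "ennreal (q (\<eta> x)) \<le> ?p \<eta>" unfolding weighted_seminorm_0 by (rule SUP_upper) simp
    also have "\<dots> = ennreal (enn2real (?p \<eta>))"
      using weighted_seminorm_finite[OF \<eta>(1) one_in_W r q] by simp
    finally have "q (\<eta> x) \<le> enn2real (?p \<eta>)" by simp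
    then show "q (\<eta> x) < 1" using \<eta>(2) by simp
  qed
qed

lemma weighted_seminorm_triangle:
  assumes a: "a \<in> topspace F" and b: "b \<in> topspace F"
    and f: "f \<in> W" and k: "enat k \<le> r" and q: "continuous_seminorm Y q"
  shows "weighted_seminorm n UNIV Y f k q (a + b)
    \<le> weighted_seminorm n UNIV Y f k q a + weighted_seminorm n UNIV Y f k q b"
proof -
  interpret q: csn Y q by (rule cod.csnI[OF q])
  note Ca = weighted_maps_Cr[OF a] and Cb = weighted_maps_Cr[OF b]
  have "poly_norm n q (gateaux Y k (a + b) x)
      \<le> poly_norm n q (gateaux Y k a x) + poly_norm n q (gateaux Y k b x)" for x
    unfolding poly_norm_def
  proof (rule SUP_least)
    fix v assume v: "v \<in> {v. n v \<le> 1}"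
    have in_Y: "gateaux Y k a x v \<in> topspace Y" "gateaux Y k b x v \<in> topspace Y"
      unfolding gateaux_eq_fold
      using cod.Cr_on_fold_in[OF Ca k, of x v] cod.Cr_on_fold_in[OF Cb k, of x v] by simp_all
    have "gateaux Y k (a + b) x v = gateaux Y k a x v + gateaux Y k b x v"
      unfolding gateaux_eq_fold using cod.Cr_on_fold_add[OF Ca Cb, of "replicate k v"] k by simp
    then have "ennreal (q (gateaux Y k (a + b) x v)) \<le> ennreal (q (gateaux Y k a x v) + q (gateaux Y k b x v))"
      using q.triangle[OF in_Y] by (simp add: ennreal_leI)
    also have "\<dots> = ennreal (q (gateaux Y k a x v)) + ennreal (q (gateaux Y k b x v))"
      using q.nonneg in_Y by simp
    also have "\<dots> \<le> (SUP v\<in>{v. n v \<le> 1}. ennreal (q (gateaux Y k a x v))) + (SUP v\<in>{v. n v \<le> 1}. ennreal (q (gateaux Y k b x v)))"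
      using v by (intro add_mono SUP_upper)
    finally show "ennreal (q (gateaux Y k (a + b) x v)) \<le> \<dots>" .
  qed
  note pn = this
  show ?thesis
    unfolding weighted_seminorm_def
  proof (rule SUP_least)
    fix x
    have "ennreal (f x) * poly_norm n q (gateaux Y k (a + b) x)
        \<le> ennreal (f x) * poly_norm n q (gateaux Y k a x) + ennreal (f x) * poly_norm n q (gateaux Y k b x)"
      using mult_left_mono[OF pn[of x], of "ennreal (f x)"] by (simp add: distrib_left)
    also have "\<dots> \<le> (SUP x. ennreal (f x) * poly_norm n q (gateaux Y k a x))
        + (SUP x. ennreal (f x) * poly_norm n q (gateaux Y k b x))"
      by (intro add_mono SUP_upper) auto
    finally show "ennreal (f x) * poly_norm n q (gateaux Y k (a + b) x) \<le> \<dots>" .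
  qed
qed

lemma test_function_Cr: "test_function \<phi> \<Longrightarrow> Cr_on \<infinity> euclidean euclideanreal UNIV \<phi>"
  unfolding test_function_def by (intro Cr_onI_PC) auto

text \<open>The expression is jointly continuous in x and v on the compact product of the support
  and a Euclidean ball containing the unit ball of n. Off the support all derivatives
  vanish.\<close>

lemma test_function_bound:
  fixes \<phi> :: "'a \<Rightarrow> real"
  assumes \<phi>: "test_function \<phi>" and f: "f \<in> W"
  obtains C where "C \<ge> 0" "\<And>x v. n v \<le> 1 \<Longrightarrow> f x * \<bar>gateaux euclideanreal k \<phi> x v\<bar> \<le> C"
proof -
  let ?S = "closure {x. \<phi> x \<noteq> 0}"
  have comp: "compact ?S" using \<phi> unfolding test_function_def by simp
  obtain R where R: "\<And>v. n v \<le> 1 \<Longrightarrow> norm v \<le> R" using is_norm_ball_bounded[OF norm] by metis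
  \<comment> \<open>\<open>map ys (replicate k 0)\<close> repeats the direction \<open>ys 0\<close>,
    so v can be fed in as \<open>ys 0\<close> and continuity in the sequence becomes continuity in
    v.\<close>
  have "PC euclideanreal 0 UNIV (\<lambda>ys. fold (dir_deriv euclideanreal) (map ys (replicate k 0)) \<phi>)"
    using PC_fold[of euclideanreal "replicate k 0" 0 UNIV "\<lambda>_. \<phi>"] \<phi> unfolding test_function_def by simp
  then have cont: "continuous_on UNIV (\<lambda>(ys :: nat \<Rightarrow> 'a, x). gateaux euclideanreal k \<phi> x (ys 0))"
    by (simp add: gateaux_eq_fold)
  have "continuous_on UNIV (\<lambda>p :: 'a \<times> 'a. (\<lambda>_ :: nat. snd p, fst p))"
    by (intro continuous_on_Pair continuous_on_coordinatewise_then_product continuous_intros)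
  from continuous_on_compose2[OF cont this]
  have "continuous_on UNIV (\<lambda>p :: 'a \<times> 'a. gateaux euclideanreal k \<phi> (fst p) (snd p))" by simp
  then have "continuous_on (?S \<times> cball 0 R) (\<lambda>p. f (fst p) * gateaux euclideanreal k \<phi> (fst p) (snd p))"
  proof (intro continuous_on_mult)
    have "continuous_map (top_of_set UNIV) euclideanreal f"
      using PC_continuous_fixed[OF real.Cr_on_imp_PC[OF smooth_weights[OF f]], of 0] by simp
    then have "continuous_on UNIV f" by simp
    then show "continuous_on (?S \<times> cball 0 R) (\<lambda>p. f (fst p))"
      by (rule continuous_on_compose2) (auto intro: continuous_intros)
  qed (auto elim: continuous_on_subset)
  then have "compact ((\<lambda>p. f (fst p) * gateaux euclideanreal k \<phi> (fst p) (snd p)) ` (?S \<times> cball 0 R))"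
    by (intro compact_continuous_image compact_Times comp compact_cball)
  then obtain C where C: "C > 0" "\<And>p. p \<in> ?S \<times> cball 0 R \<Longrightarrow> norm (f (fst p) * gateaux euclideanreal k \<phi> (fst p) (snd p)) \<le> C"
    using compact_imp_bounded bounded_pos by (metis (no_types, lifting) imageI)
  show thesis
  proof (rule that[of C])
    fix x v assume v: "n v \<le> 1"
    show "f x * \<bar>gateaux euclideanreal k \<phi> x v\<bar> \<le> C"
    proof (cases "x \<in> ?S")
      case True
      then show ?thesis using C(2)[of "(x, v)"] R[OF v] weights_nonneg[OF f, of x]
        by (auto simp: abs_mult)
    next
      case False
      have "gateaux euclideanreal k \<phi> x v = 0"
        unfolding gateaux_eq_fold
        by (rule real.fold_dir_deriv_vanish[of "- ?S"])
           (use False closure_subset[of "{x. \<phi> x \<noteq> 0}"] in auto)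
      then show ?thesis using C by simp
    qed
  qed (use C in simp)
qed

lemma weighted_seminorm_test_function:
  assumes \<phi>: "test_function \<phi>" and f: "f \<in> W" and q: "continuous_seminorm Y q" and y: "y \<in> topspace Y"
    and C: "C \<ge> 0" "\<And>x v. n v \<le> 1 \<Longrightarrow> f x * \<bar>gateaux euclideanreal k \<phi> x v\<bar> \<le> C"
  shows "weighted_seminorm n UNIV Y f k q (\<lambda>x. \<phi> x *\<^sub>R y) \<le> ennreal (C * q y)"
  unfolding weighted_seminorm_def
proof (rule SUP_least)
  interpret q: csn Y q by (rule cod.csnI[OF q])
  fix x
  have "ennreal (f x) * poly_norm n q (gateaux Y k (\<lambda>x. \<phi> x *\<^sub>R y) x)
      = (SUP v\<in>{v. n v \<le> 1}. ennreal (f x) * ennreal (q (gateaux Y k (\<lambda>x. \<phi> x *\<^sub>R y) x v)))"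
    unfolding poly_norm_def using n_0 by (subst SUP_mult_left_ennreal) auto
  also have "\<dots> \<le> ennreal (C * q y)"
  proof (rule SUP_least)
    fix v assume "v \<in> {v. n v \<le> 1}"
    then have v: "n v \<le> 1" by simp
    have "q (gateaux Y k (\<lambda>x. \<phi> x *\<^sub>R y) x v) = \<bar>gateaux euclideanreal k \<phi> x v\<bar> * q y"
      unfolding gateaux_eq_fold cod.fold_dir_deriv_scaleR[OF test_function_Cr[OF \<phi>] y]
      by (rule q.scale[OF y])
    moreover have "f x * \<bar>gateaux euclideanreal k \<phi> x v\<bar> * q y \<le> C * q y"
      using C(2)[OF v] q.nonneg[OF y] by (rule mult_right_mono)
    ultimately show "ennreal (f x) * ennreal (q (gateaux Y k (\<lambda>x. \<phi> x *\<^sub>R y) x v)) \<le> ennreal (C * q y)"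
      using weights_nonneg[OF f] q.nonneg[OF y]
      by (simp add: ennreal_mult[symmetric] ennreal_leI mult.assoc)
  qed
  finally show "ennreal (f x) * poly_norm n q (gateaux Y k (\<lambda>x. \<phi> x *\<^sub>R y) x) \<le> ennreal (C * q y)" .
qed

lemma test_function_in_F:
  assumes \<phi>: "test_function \<phi>" and y: "y \<in> topspace Y"
  shows "(\<lambda>x. \<phi> x *\<^sub>R y) \<in> topspace F"
  unfolding topspace_F weighted_maps_vanishing_def weighted_maps_def
proof (intro CollectI conjI allI impI ballI; (elim conjE)?)
  have "PC Y k UNIV (\<lambda>ys x. \<phi> x *\<^sub>R y)" for k
    by (rule cod.PC_scaleR) (use \<phi> y in \<open>auto simp: test_function_def intro: cod.PC_const\<close>)
  then show "Cr_on r euclidean Y UNIV (\<lambda>x. \<phi> x *\<^sub>R y)" by (rule Cr_onI_PC)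
next
  fix f k q assume *: "f \<in> W" "enat k \<le> r" "continuous_seminorm Y q"
  obtain C where C: "C \<ge> 0" "\<And>x v. n v \<le> 1 \<Longrightarrow> f x * \<bar>gateaux euclideanreal k \<phi> x v\<bar> \<le> C"
    using test_function_bound[OF \<phi> *(1)] by metis
  show "weighted_seminorm n UNIV Y f k q (\<lambda>x. \<phi> x *\<^sub>R y) < \<infinity>"
    by (rule order_le_less_trans[OF weighted_seminorm_test_function[OF \<phi> *(1,3) y C]]) auto
next
  fix f k q assume *: "f \<in> W" "enat k \<le> r" "continuous_seminorm Y q"
  interpret q: csn Y q by (rule cod.csnI[OF *(3)])
  let ?S = "closure {x. \<phi> x \<noteq> 0}"
  have "compact ?S" using \<phi> unfolding test_function_def by simp
  moreover have "gateaux Y k (\<lambda>x. \<phi> x *\<^sub>R y) x = (\<lambda>v. 0)" if "x \<notin> ?S" for x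
    unfolding gateaux_eq_fold
    by (rule ext, rule cod.fold_dir_deriv_vanish[of "- ?S"]) (use that closure_subset[of "{x. \<phi> x \<noteq> 0}"] in auto)
  ultimately have "\<forall>\<^sub>F z in atin (Alexandroff_compactification (top_of_set UNIV)) None.
      ennreal (f (the z)) * poly_norm n q (gateaux Y k (\<lambda>x. \<phi> x *\<^sub>R y) (the z)) = 0"
    unfolding eventually_atin_Alexandroff
    by (intro exI[of _ ?S]) (auto simp: poly_norm_const_0)
  then show "((\<lambda>z. ennreal (f (the z)) * poly_norm n q (gateaux Y k (\<lambda>x. \<phi> x *\<^sub>R y) (the z))) \<longlongrightarrow> 0)
      (atin (Alexandroff_compactification (top_of_set UNIV)) None)"
    by (rule tendsto_eventually)
qed simp

text \<open>The map is linear, and each defining seminorm of its value at y is at most C times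
  \<open>q y\<close>. As the subbasic sets are balls about arbitrary centres u, the estimate is
  applied to y - y0 and combined with the triangle inequality.\<close>

lemma test_function_continuous_map:
  assumes \<phi>: "test_function \<phi>"
  shows "continuous_map Y F (\<lambda>y x. \<phi> x *\<^sub>R y)"
proof -
  let ?T = "\<lambda>y x. \<phi> x *\<^sub>R y"
  have T: "?T y \<in> topspace F" if "y \<in> topspace Y" for y
    using test_function_in_F[OF \<phi> that] .
  have gen: "openin Y (?T -` {v \<in> topspace F. enn2real (weighted_seminorm n UNIV Y f k q (v - u)) < e} \<inter> topspace Y)"
    if *: "f \<in> W" "enat k \<le> r" "continuous_seminorm Y q" "u \<in> topspace F" for f k q u e
  proof (subst openin_subopen, safe)
    interpret q: csn Y q by (rule cod.csnI[OF *(3)])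
    let ?p = "\<lambda>\<eta>. weighted_seminorm n UNIV Y f k q \<eta>"
    fix y0 assume y0: "y0 \<in> topspace Y" "enn2real (?p (?T y0 - u)) < e"
    define d where "d = e - enn2real (?p (?T y0 - u))"
    have d: "d > 0" using y0 unfolding d_def by simp
    obtain C where C: "C \<ge> 0" "\<And>x v. n v \<le> 1 \<Longrightarrow> f x * \<bar>gateaux euclideanreal k \<phi> x v\<bar> \<le> C"
      using test_function_bound[OF \<phi> *(1)] by metis
    \<comment> \<open>C may be 0, hence the denominator C + 1.\<close>
    let ?O = "{y \<in> topspace Y. q (y - y0) < d / (C + 1)}"
    have "enn2real (?p (?T y - u)) < e" if y: "y \<in> topspace Y" "q (y - y0) < d / (C + 1)" for y
    proof -
      have yy: "y - y0 \<in> topspace Y" using y y0 cod.diff_in by blast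
      have eq: "?T y - u = ?T (y - y0) + (?T y0 - u)" by (auto simp: fun_eq_iff scaleR_right_diff_distrib)
      have in_F: "?T (y - y0) \<in> topspace F" "?T y0 - u \<in> topspace F"
        using T[OF yy] F.diff_in[OF T[OF y0(1)] *(4)] by auto
      have fin: "?p (?T y0 - u) < \<infinity>" "?p (?T (y - y0)) < \<infinity>"
        using weighted_seminorm_finite[OF in_F(2) *(1-3)] weighted_seminorm_finite[OF in_F(1) *(1-3)] by auto
      have "?p (?T y - u) \<le> ?p (?T (y - y0)) + ?p (?T y0 - u)"
        unfolding eq by (rule weighted_seminorm_triangle[OF in_F *(1-3)])
      then have "enn2real (?p (?T y - u)) \<le> enn2real (?p (?T (y - y0)) + ?p (?T y0 - u))"
        using fin by (intro enn2real_mono) auto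
      also have "\<dots> = enn2real (?p (?T (y - y0))) + enn2real (?p (?T y0 - u))"
        using fin by (intro enn2real_plus) auto
      also have "enn2real (?p (?T (y - y0))) \<le> C * q (y - y0)"
        using weighted_seminorm_test_function[OF \<phi> *(1,3) yy C] q.nonneg[OF yy] C(1)
        by (intro enn2real_leI) auto
      also have "C * q (y - y0) \<le> (C + 1) * q (y - y0)"
        using q.nonneg[OF yy] by (intro mult_right_mono) auto
      also have "(C + 1) * q (y - y0) < d" using y(2) C(1) by (simp add: field_simps)
      finally show ?thesis unfolding d_def by linarith
    qed
    moreover have "openin Y ?O" by (rule q.openin_ball[OF y0(1)])
    moreover have "y0 \<in> ?O" using y0 d C by simp
    ultimately show "\<exists>T'. openin Y T' \<and> y0 \<in> T' \<and>
        T' \<subseteq> ?T -` {v \<in> topspace F. enn2real (?p (v - u)) < e} \<inter> topspace Y"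
      using T by (intro exI[of _ ?O]) auto
  qed
  define B where "B = insert (topspace F) {{v \<in> topspace F. p (v - u) < \<epsilon>} |u p \<epsilon>.
      u \<in> topspace F \<and> p \<in> {\<lambda>\<gamma>. enn2real (weighted_seminorm n UNIV Y f k q \<gamma>) |f k q.
          f \<in> W \<and> enat k \<le> r \<and> continuous_seminorm Y q} \<and> \<epsilon> > 0}"
  have F_eq: "F = topology_generated_by B"
    unfolding B_def topspace_F unfolding weighted_space_def seminorm_topology_def by (rule refl)
  have "continuous_map Y (topology_generated_by B) ?T"
    unfolding continuous_on_generated_topo_iff
  proof (intro conjI allI impI)
    fix U assume "U \<in> B"
    then consider "U = topspace F" | f k q u e where "f \<in> W" "enat k \<le> r" "continuous_seminorm Y q" "u \<in> topspace F"
        "U = {v \<in> topspace F. enn2real (weighted_seminorm n UNIV Y f k q (v - u)) < e}"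
      unfolding B_def by blast
    then show "openin Y (?T -` U \<inter> topspace Y)"
    proof cases
      case 1
      then have "?T -` U \<inter> topspace Y = topspace Y" using T by auto
      then show ?thesis by simp
    qed (use gen in simp)
  next
    show "?T ` topspace Y \<subseteq> \<Union> B" using T unfolding B_def by auto
  qed
  then show ?thesis by (rule ssubst[where P = "\<lambda>X. continuous_map Y X ?T", OF F_eq])
qed

end

section \<open>Topological groups\<close>

text \<open>Tube lemma: projection along a compact factor is a closed map, and the set in question
  is the complement of the projected complement.\<close>

lemma openin_tube:
  assumes "compact_space Z" "openin (prod_topology X Z) W"
  shows "openin X {x \<in> topspace X. \<forall>z\<in>topspace Z. (x, z) \<in> W}"
proof -
  have "closedin (prod_topology X Z) (topspace (prod_topology X Z) - W)"
    using assms(2) by (rule closedin_diff[OF closedin_topspace])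
  then have "closedin X (fst ` (topspace (prod_topology X Z) - W))"
    using closed_map_fst[OF assms(1)] unfolding closed_map_def by blast
  then have "openin X (topspace X - fst ` (topspace (prod_topology X Z) - W))" by blast
  also have "topspace X - fst ` (topspace (prod_topology X Z) - W)
      = {x \<in> topspace X. \<forall>z\<in>topspace Z. (x, z) \<in> W}"
    by (force simp: image_iff)
  finally show ?thesis .
qed

text \<open>The diagonal of a compact set is compact, so W contains a metric neighbourhood of it.
  This gives uniform continuity of maps whose target has no metric: W will be the set of pairs with
  close values.\<close>

lemma Lebesgue_number_diagonal:
  fixes S :: "'a::metric_space set"
  assumes "compact S" "openin (prod_topology (top_of_set S) (top_of_set S)) W"
    and "\<And>u. u \<in> S \<Longrightarrow> (u, u) \<in> W"
  obtains \<delta> where "\<delta> > 0" "\<And>u v. u \<in> S \<Longrightarrow> v \<in> S \<Longrightarrow> dist u v < \<delta> \<Longrightarrow> (u, v) \<in> W"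
proof -
  have "openin (top_of_set (S \<times> S)) W"
    using assms(2) by (simp add: subtopology_Times[symmetric])
  then obtain W' where W': "open W'" "W = (S \<times> S) \<inter> W'" unfolding openin_open by blast
  have "compact ((\<lambda>u. (u, u)) ` S)"
    by (intro compact_continuous_image assms(1) continuous_intros)
  moreover have "(\<lambda>u. (u, u)) ` S \<subseteq> W'" using assms(3) W'(2) by auto
  ultimately obtain e where e: "e > 0" "(\<Union>x\<in>(\<lambda>u. (u, u)) ` S. ball x e) \<subseteq> W'"
    using compact_subset_open_imp_ball_epsilon_subset W'(1) by metis
  show thesis
  proof (rule that[OF e(1)])
    fix u v assume uv: "u \<in> S" "v \<in> S" "dist u v < e"
    then have "(u, v) \<in> ball (u, u) e" by (simp add: dist_Pair_Pair)
    then show "(u, v) \<in> W" using e(2) uv W'(2) by blast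
  qed
qed

locale topological_group = group H for H :: "('h, 'z) monoid_scheme" (structure) +
  fixes M :: "'h topology"
  assumes topspace_carrier: "topspace M = carrier H"
    and mult_continuous: "continuous_map (prod_topology M M) M (\<lambda>(x, y). x \<otimes> y)"
    and inv_continuous: "continuous_map M M (\<lambda>x. inv x)"
begin

lemma cancel_left:
  assumes "x \<in> carrier H" "y \<in> carrier H"
  shows "inv x \<otimes> (x \<otimes> y) = y" "x \<otimes> (inv x \<otimes> y) = y"
  using assms by (simp_all add: m_assoc[symmetric])

lemma continuous_map_carrier: "continuous_map X M f \<Longrightarrow> x \<in> topspace X \<Longrightarrow> f x \<in> carrier H"
  using topspace_carrier by (auto simp: continuous_map_def)

lemma continuous_map_mult:
  assumes "continuous_map X M f" "continuous_map X M g"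
  shows "continuous_map X M (\<lambda>x. f x \<otimes> g x)"
  using continuous_map_compose[OF continuous_map_pairedI[OF assms] mult_continuous]
  by (simp add: o_def)

lemma continuous_map_inv:
  assumes "continuous_map X M f"
  shows "continuous_map X M (\<lambda>x. inv (f x))"
  using continuous_map_compose[OF assms inv_continuous] by (simp add: o_def)

lemma continuous_map_one: "continuous_map X M (\<lambda>x. \<one>)"
  by (simp add: topspace_carrier)

lemma open_carrier: "openin M U \<Longrightarrow> x \<in> U \<Longrightarrow> x \<in> carrier H"
  using openin_subset topspace_carrier by blast

lemma split_neighbourhood:
  assumes "openin M U" "\<one> \<in> U"
  obtains V where "openin M V" "\<one> \<in> V" "\<And>x y. x \<in> V \<Longrightarrow> y \<in> V \<Longrightarrow> x \<otimes> y \<in> U" "V \<subseteq> U"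
proof -
  let ?S = "{p \<in> topspace (prod_topology M M). (case p of (x, y) \<Rightarrow> x \<otimes> y) \<in> U}"
  have opn: "openin (prod_topology M M) ?S"
    by (rule openin_continuous_map_preimage[OF mult_continuous assms(1)])
  have "(\<one>, \<one>) \<in> ?S"
    using assms by (simp add: topspace_carrier)
  from opn[unfolded openin_prod_topology_alt, rule_format, OF this] obtain V1 V2
    where V: "openin M V1" "openin M V2" "\<one> \<in> V1" "\<one> \<in> V2" "V1 \<times> V2 \<subseteq> ?S"
    by blast
  have *: "x \<otimes> y \<in> U" if "x \<in> V1" "y \<in> V2" for x y using V(5) that by auto
  show thesis
  proof (rule that[of "V1 \<inter> V2 \<inter> U"])
    show "openin M (V1 \<inter> V2 \<inter> U)" using V assms by blast
  qed (use V * assms in auto)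
qed

lemma split_neighbourhood_inv:
  assumes "openin M U" "\<one> \<in> U"
  obtains V where "openin M V" "\<one> \<in> V" "\<And>x y. x \<in> V \<Longrightarrow> y \<in> V \<Longrightarrow> inv x \<otimes> y \<in> U"
    "\<And>x y. x \<in> V \<Longrightarrow> y \<in> V \<Longrightarrow> x \<otimes> inv y \<in> U" "V \<subseteq> U"
proof -
  obtain V where V: "openin M V" "\<one> \<in> V" "\<And>x y. x \<in> V \<Longrightarrow> y \<in> V \<Longrightarrow> x \<otimes> y \<in> U" "V \<subseteq> U"
    using split_neighbourhood[OF assms] by blast
  define V' where "V' = V \<inter> {x \<in> topspace M. inv x \<in> V}"
  show thesis
  proof (rule that[of V'])
    show "openin M V'"
      unfolding V'_def using V openin_continuous_map_preimage[OF inv_continuous V(1)] by blast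
  qed (use V in \<open>auto simp: V'_def topspace_carrier\<close>)
qed

text \<open>In a product of approximated factors, the error of one factor appears conjugated by the
  product of those after it. Over a compact parameter space the tube lemma makes these conjugations
  equicontinuous at \<one>.\<close>

lemma conjugation_neighbourhood:
  assumes "compact_space Z" "continuous_map Z M a" "openin M U" "\<one> \<in> U"
  obtains V where "openin M V" "\<one> \<in> V" "\<And>z v. z \<in> topspace Z \<Longrightarrow> v \<in> V \<Longrightarrow> inv (a z) \<otimes> v \<otimes> a z \<in> U"
proof -
  let ?f = "\<lambda>p. inv (a (snd p)) \<otimes> fst p \<otimes> a (snd p)"
  have a: "continuous_map (prod_topology M Z) M (\<lambda>p. a (snd p))"
    using continuous_map_compose[OF continuous_map_snd assms(2)] by (simp add: o_def)
  have "continuous_map (prod_topology M Z) M ?f"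
    by (intro continuous_map_mult continuous_map_inv a continuous_map_fst)
  then have "openin (prod_topology M Z) {p \<in> topspace (prod_topology M Z). ?f p \<in> U}"
    by (rule openin_continuous_map_preimage[OF _ assms(3)])
  from openin_tube[OF assms(1) this]
  have "openin M {v \<in> topspace M. \<forall>z\<in>topspace Z. (v, z) \<in> {p \<in> topspace (prod_topology M Z). ?f p \<in> U}}" .
  moreover have "\<one> \<in> {v \<in> topspace M. \<forall>z\<in>topspace Z. (v, z) \<in> {p \<in> topspace (prod_topology M Z). ?f p \<in> U}}"
    using assms(4) continuous_map_carrier[OF assms(2)] by (simp add: topspace_carrier)
  ultimately show thesis by (rule that) auto
qed

text \<open>As Z is compact, the pairs (u, v) whose increment lies in U for every z form an open
  neighbourhood of the diagonal. A Lebesgue number for it bounds the step 1/N.\<close>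

lemma subdivision:
  assumes "compact_space Z" "continuous_map (prod_topology (top_of_set {0..1::real}) Z) M g"
    and "openin M U" "\<one> \<in> U"
  obtains N :: nat where "N > 0"
    "\<And>i z. i < N \<Longrightarrow> z \<in> topspace Z \<Longrightarrow> inv (g (real i / real N, z)) \<otimes> g (real (Suc i) / real N, z) \<in> U"
proof -
  let ?I = "top_of_set {0..1::real}"
  let ?X = "prod_topology (prod_topology ?I ?I) Z"
  let ?f = "\<lambda>p. inv (g (fst (fst p), snd p)) \<otimes> g (snd (fst p), snd p)"
  have "continuous_map ?X (prod_topology ?I Z) (\<lambda>p. (fst (fst p), snd p))"
    "continuous_map ?X (prod_topology ?I Z) (\<lambda>p. (snd (fst p), snd p))"
    by (intro continuous_map_pairedI continuous_map_snd
        continuous_map_compose[OF continuous_map_fst continuous_map_fst, unfolded o_def]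
        continuous_map_compose[OF continuous_map_fst continuous_map_snd, unfolded o_def])+
  from this[THEN continuous_map_compose, OF assms(2)]
  have "continuous_map ?X M ?f"
    by (intro continuous_map_mult continuous_map_inv) (auto simp: o_def)
  then have "openin ?X {p \<in> topspace ?X. ?f p \<in> U}"
    by (rule openin_continuous_map_preimage[OF _ assms(3)])
  define D where "D = {x \<in> topspace (prod_topology ?I ?I). \<forall>z\<in>topspace Z. (x, z) \<in> {p \<in> topspace ?X. ?f p \<in> U}}"
  have opn: "openin (prod_topology ?I ?I) D"
    unfolding D_def by (rule openin_tube[OF assms(1)]) fact
  have diag: "(u, u) \<in> D" if u: "u \<in> {0..1}" for u
  proof -
    have "g (u, z) \<in> carrier H" if "z \<in> topspace Z" for z
      using continuous_map_carrier[OF assms(2)] u that by simp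
    then show ?thesis using u assms(4) unfolding D_def by simp
  qed
  obtain \<delta> where \<delta>: "\<delta> > 0"
      "\<And>u v. u \<in> {0..1} \<Longrightarrow> v \<in> {0..1} \<Longrightarrow> dist u v < \<delta> \<Longrightarrow> (u, v) \<in> D"
    using Lebesgue_number_diagonal[OF compact_Icc opn diag] by blast
  obtain N :: nat where N: "N > 0" "1 / real N < \<delta>"
    using \<delta>(1) by (metis nat_approx_posE zero_less_Suc)
  show thesis
  proof (rule that[OF N(1)])
    fix i z assume i: "i < N" "z \<in> topspace Z"
    have "dist (real i / real N) (real (Suc i) / real N) = 1 / real N"
      by (simp add: dist_real_def diff_divide_distrib[symmetric])
    then have "(real i / real N, real (Suc i) / real N) \<in> D"
      using i N by (intro \<delta>(2)) auto
    then show "inv (g (real i / real N, z)) \<otimes> g (real (Suc i) / real N, z) \<in> U"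
      using i(2) unfolding D_def by simp
  qed
qed

definition prod_maps :: "('x \<Rightarrow> 'h) list \<Rightarrow> 'x \<Rightarrow> 'h" where
  "prod_maps ps z = foldr (\<lambda>p a. p z \<otimes> a) ps \<one>"

lemma prod_maps_Nil [simp]: "prod_maps [] z = \<one>"
  and prod_maps_Cons [simp]: "prod_maps (p # ps) z = p z \<otimes> prod_maps ps z"
  by (simp_all add: prod_maps_def)

lemma continuous_map_prod_maps:
  "(\<And>p. p \<in> set ps \<Longrightarrow> continuous_map Z M p) \<Longrightarrow> continuous_map Z M (prod_maps ps)"
proof (induction ps)
  case Nil
  show ?case by (rule continuous_map_eq[OF continuous_map_one]) simp
next
  case (Cons p ps)
  have "prod_maps (p # ps) = (\<lambda>z. p z \<otimes> prod_maps ps z)" by (rule ext) simp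
  moreover have "continuous_map Z M (\<lambda>z. p z \<otimes> prod_maps ps z)"
    by (intro continuous_map_mult Cons) (auto intro: Cons.prems)
  ultimately show ?case by (simp only:)
qed

text \<open>The induction counts the last k factors, because \<open>prod_maps\<close> multiplies on
  the left and the list has to grow at the front.\<close>

lemma prod_maps_telescope:
  assumes "\<And>i. i \<le> N \<Longrightarrow> g i z \<in> carrier H" "k \<le> N"
  shows "prod_maps (map (\<lambda>i z. inv (g i z) \<otimes> g (Suc i) z) [N - k..<N]) z = inv (g (N - k) z) \<otimes> g N z"
  using assms(2)
proof (induction k)
  case 0
  then show ?case using assms(1)[of N] by simp
next
  case (Suc k)
  have "[N - Suc k..<N] = (N - Suc k) # [N - k..<N]"
    using Suc.prems by (subst upt_rec) (simp add: Suc_diff_Suc)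
  moreover have "inv (g (N - Suc k) z) \<otimes> g (N - k) z \<otimes> (inv (g (N - k) z) \<otimes> g N z) = inv (g (N - Suc k) z) \<otimes> g N z"
    using assms(1)[of "N - k"] assms(1)[of "N - Suc k"] assms(1)[of N] by (simp add: m_assoc cancel_left)
  ultimately show ?case using Suc by (simp add: Suc_diff_Suc)
qed

end

section \<open>Mapping groups and their evaluation on the cube\<close>

abbreviation "I01 \<equiv> top_of_set {0..1::real}"

lemma chart_continuous:
  assumes "chart_homeomorphism M E U \<phi>"
  shows "continuous_map (subtopology M U) E \<phi>"
proof -
  have "homeomorphic_map (subtopology M U) (subtopology E (\<phi> ` U)) \<phi>"
    using assms by (simp add: chart_homeomorphism_def)
  from homeomorphic_imp_continuous_map[OF this] show ?thesis
    by (simp add: continuous_map_in_subtopology)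
qed

lemma chart_inverse_continuous:
  assumes ch: "chart_homeomorphism M E U \<phi>"
  shows "continuous_map (subtopology E (\<phi> ` U)) M (inv_into U \<phi>)"
proof -
  have U: "U \<subseteq> topspace M" "\<phi> ` U \<subseteq> topspace E"
    using ch openin_subset unfolding chart_homeomorphism_def by blast+
  obtain g where g: "homeomorphic_maps (subtopology M U) (subtopology E (\<phi> ` U)) \<phi> g"
    using ch unfolding chart_homeomorphism_def homeomorphic_map_maps by blast
  then have g': "continuous_map (subtopology E (\<phi> ` U)) (subtopology M U) g"
      "\<And>x. x \<in> U \<Longrightarrow> g (\<phi> x) = x"
    using U unfolding homeomorphic_maps_def by auto
  then have "continuous_map (subtopology E (\<phi> ` U)) M g"
    by (simp add: continuous_map_in_subtopology)
  then show ?thesis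
  proof (rule continuous_map_eq)
    fix y assume "y \<in> topspace (subtopology E (\<phi> ` U))"
    then obtain x where "x \<in> U" "y = \<phi> x" by auto
    then show "g y = inv_into U \<phi> y"
      using g'(2) inv_into_f_f[OF chart_inj[OF ch]] by simp
  qed
qed

definition pointwise_group :: "('h, 'z) monoid_scheme \<Rightarrow> ('a \<Rightarrow> 'h) set \<Rightarrow> ('a \<Rightarrow> 'h) monoid" where
  "pointwise_group H \<G> = \<lparr>carrier = \<G>, monoid.mult = (\<lambda>\<gamma> \<eta> x. \<gamma> x \<otimes>\<^bsub>H\<^esub> \<eta> x), one = (\<lambda>x. \<one>\<^bsub>H\<^esub>)\<rparr>"

definition squash :: "real ^ 'd \<Rightarrow> real ^ 'd" where
  "squash x = (\<chi> i. arctan (x $ i) / pi + 1/2)"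

definition unsquash :: "real ^ 'd \<Rightarrow> real ^ 'd" where
  "unsquash u = (\<chi> i. tan (pi * (u $ i - 1/2)))"

abbreviation unit_box :: "(real ^ 'd) set" where "unit_box \<equiv> cbox 0 1"
abbreviation open_box :: "(real ^ 'd) set" where "open_box \<equiv> box 0 1"

lemma squash_in: "squash x \<in> open_box"
proof -
  have "0 < arctan z / pi + 1/2 \<and> arctan z / pi + 1/2 < 1" for z
    using arctan_lbound[of z] arctan_ubound[of z] by (simp add: field_simps)
  then show ?thesis unfolding squash_def mem_box_cart by auto
qed

lemma squash_in_unit: "squash x \<in> unit_box"
  using squash_in box_subset_cbox by blast

lemma unsquash_squash [simp]: "unsquash (squash x) = x"
  by (simp add: squash_def unsquash_def vec_eq_iff tan_arctan)

lemma squash_unsquash: "u \<in> open_box \<Longrightarrow> squash (unsquash u) = u"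
proof -
  assume "u \<in> open_box"
  then have "arctan (tan (pi * (u $ i - 1/2))) = pi * (u $ i - 1/2)" for i
    by (intro arctan_tan) (auto simp: mem_box_cart field_simps)
  then show ?thesis by (simp add: squash_def unsquash_def vec_eq_iff)
qed

text \<open>The derivative of arctan is at most 1. So a fine mesh on the whole space gives nearby
  points of the cube, where uniform continuity is available.\<close>

lemma dist_squash: "dist (squash x) (squash y) \<le> dist x y"
  unfolding dist_norm
proof (rule norm_le_componentwise_cart)
  fix i
  have "\<bar>arctan a - arctan b\<bar> \<le> \<bar>a - b\<bar>" for a b
  proof -
    have "arctan b - arctan a \<le> b - a" if "a \<le> b" for a b
    proof (cases "a = b")
      case False
      have "\<exists>z>a. z < b \<and> arctan b - arctan a = (b - a) * inverse (1 + z\<^sup>2)"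
        by (rule MVT2) (use that False in \<open>auto intro!: DERIV_arctan\<close>)
      then obtain z where "arctan b - arctan a = (b - a) * inverse (1 + z\<^sup>2)" by blast
      moreover have "inverse (1 + z\<^sup>2) \<le> 1" by (intro inverse_le_1_iff[THEN iffD2]) auto
      ultimately show ?thesis using mult_left_mono[of "inverse (1 + z\<^sup>2)" 1 "b - a"] that by simp
    qed simp
    from this[of a b] this[of b a] show ?thesis
      by (cases "a \<le> b") (auto simp: abs_if arctan_le_iff not_le dest: arctan_less_iff[THEN iffD2])
  qed
  then have *: "\<bar>arctan (x $ i) - arctan (y $ i)\<bar> \<le> \<bar>x $ i - y $ i\<bar>" .
  have "\<bar>arctan (x $ i) - arctan (y $ i)\<bar> / pi \<le> \<bar>arctan (x $ i) - arctan (y $ i)\<bar> / 1"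
    using pi_ge_two by (intro divide_left_mono) auto
  with * show "norm ((squash x - squash y) $ i) \<le> norm ((x - y) $ i)"
    by (simp add: squash_def diff_divide_distrib[symmetric] abs_divide)
qed

lemma continuous_on_squash: "continuous_on S squash"
  unfolding squash_def by (intro continuous_on_vec_lambda continuous_intros ballI) auto

lemma continuous_on_unsquash: "continuous_on (open_box :: (real ^ 'd) set) unsquash"
  unfolding unsquash_def
proof (rule continuous_on_vec_lambda)
  fix i :: 'd
  have "continuous_on {- (pi / 2)<..<pi / 2} (tan :: real \<Rightarrow> real)"
    using cos_gt_zero_pi by (intro continuous_on_tan continuous_on_id) force
  then show "continuous_on open_box (\<lambda>u :: real ^ 'd. tan (pi * (u $ i - 1/2)))"
    by (rule continuous_on_compose2) (auto intro!: continuous_intros simp: mem_box_cart field_simps)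
qed

text \<open>A compact part of the open box corresponds to a bounded set, on which a finite partition
  of unity can sum to 1.\<close>

lemma compact_subset_box_bounded:
  fixes C :: "(real ^ 'd) set"
  assumes "compact C" "C \<subseteq> open_box"
  obtains R where "\<And>x i. squash x \<in> C \<Longrightarrow> \<bar>x $ i\<bar> \<le> R"
proof -
  have "compact (unsquash ` C)"
    using assms by (intro compact_continuous_image continuous_on_subset[OF continuous_on_unsquash])
  then obtain R where R: "\<And>x. x \<in> unsquash ` C \<Longrightarrow> norm x \<le> R"
    using compact_imp_bounded bounded_iff by metis
  show thesis
  proof (rule that[of R])
    fix x :: "real ^ 'd" and i assume "squash x \<in> C"
    then have "x \<in> unsquash ` C" by (metis imageI unsquash_squash)
    then show "\<bar>x $ i\<bar> \<le> R" using R component_le_norm_cart[of x i] order_trans by blast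
  qed
qed

text \<open>The properties of the weighted groups on which the homotopy argument rests.
  \<open>sup_nbhd\<close> compares the topology of F with uniform convergence, \<open>bump\<close>
  puts multiples of test functions into F, and \<open>cutoff\<close> makes an element that is close
  to \<one> on a shell equal to \<one> beyond it; the last serves surjectivity for
  \<open>k = 0\<close>.\<close>

locale mapping_group = topological_group H M + G: topological_group "pointwise_group H \<G>" T
    + Y: lcs Y + F: lcs F
  for H :: "('h, 'z) monoid_scheme" (structure) and M
    and \<G> :: "(real ^ 'd::finite \<Rightarrow> 'h) set" and T and Y :: "'y::real_vector topology"
    and F :: "(real ^ 'd \<Rightarrow> 'y) topology" +
  fixes P :: "'h set" and \<kappa> :: "'h \<Rightarrow> 'y"
  assumes chart: "chart_homeomorphism M Y P \<kappa>" and one_P: "\<one> \<in> P" and \<kappa>_one: "\<kappa> \<one> = 0"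
    and G_chart: "chart_homeomorphism T F {\<gamma> \<in> \<G>. range \<gamma> \<subseteq> P} (\<lambda>\<gamma>. \<kappa> \<circ> \<gamma>)"
    and G_chart_image: "(\<lambda>\<gamma>. \<kappa> \<circ> \<gamma>) ` {\<gamma> \<in> \<G>. range \<gamma> \<subseteq> P} = {\<eta> \<in> topspace F. range \<eta> \<subseteq> \<kappa> ` P}"
    and F_in: "\<eta> \<in> topspace F \<Longrightarrow> \<eta> x \<in> topspace Y"
    and maps_continuous: "\<gamma> \<in> \<G> \<Longrightarrow> continuous_map euclidean M \<gamma>"
    and vanishing: "\<gamma> \<in> \<G> \<Longrightarrow> openin M U \<Longrightarrow> \<one> \<in> U \<Longrightarrow> \<exists>K. compact K \<and> (\<forall>x. x \<notin> K \<longrightarrow> \<gamma> x \<in> U)"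
    and sup_nbhd: "continuous_seminorm Y q \<Longrightarrow> \<exists>N. openin F N \<and> 0 \<in> N \<and> (\<forall>\<eta>\<in>N. \<forall>x. q (\<eta> x) < 1)"
    and bump: "test_function \<phi> \<Longrightarrow> continuous_map Y F (\<lambda>y x. \<phi> x *\<^sub>R y)"
    and cutoff: "\<gamma> \<in> \<G> \<Longrightarrow> continuous_seminorm Y q \<Longrightarrow> {y \<in> topspace Y. q y < 1} \<subseteq> \<kappa> ` P
      \<Longrightarrow> (\<And>x. (\<forall>i. \<bar>x $ i\<bar> \<le> real m + 1) \<Longrightarrow> \<not> (\<forall>i. \<bar>x $ i\<bar> \<le> real m) \<Longrightarrow> \<gamma> x \<in> P \<and> q (\<kappa> (\<gamma> x)) < 1)
      \<Longrightarrow> \<exists>\<gamma>'\<in>\<G>. \<forall>x. if \<forall>i. \<bar>x $ i\<bar> \<le> real m then \<gamma>' x = \<gamma> x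
          else if \<forall>i. \<bar>x $ i\<bar> \<le> real m + 1 then \<exists>c\<in>{0..1}. \<gamma>' x = inv_into P \<kappa> (c *\<^sub>R \<kappa> (\<gamma> x))
          else \<gamma>' x = \<one>"
begin

abbreviation "G \<equiv> pointwise_group H \<G>"

lemma G_simps [simp]: "carrier G = \<G>" "\<gamma> \<otimes>\<^bsub>G\<^esub> \<eta> = (\<lambda>x. \<gamma> x \<otimes> \<eta> x)" "\<one>\<^bsub>G\<^esub> = (\<lambda>x. \<one>)"
  by (simp_all add: pointwise_group_def)

lemma topspace_T: "topspace T = \<G>"
  using G.topspace_carrier by simp

lemma maps_in: "\<gamma> \<in> \<G> \<Longrightarrow> \<gamma> x \<in> carrier H"
  using continuous_map_carrier[OF maps_continuous, of \<gamma> x] by simp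

lemma inv_G: "\<gamma> \<in> \<G> \<Longrightarrow> inv\<^bsub>G\<^esub> \<gamma> = (\<lambda>x. inv (\<gamma> x))"
proof
  fix x assume \<gamma>: "\<gamma> \<in> \<G>"
  have "inv\<^bsub>G\<^esub> \<gamma> \<in> \<G>" using G.inv_closed[of \<gamma>] \<gamma> by simp
  moreover have "inv\<^bsub>G\<^esub> \<gamma> \<otimes>\<^bsub>G\<^esub> \<gamma> = \<one>\<^bsub>G\<^esub>" using G.l_inv[of \<gamma>] \<gamma> by simp
  then have "(inv\<^bsub>G\<^esub> \<gamma>) x \<otimes> \<gamma> x = \<one>" by (simp add: fun_eq_iff)
  ultimately show "(inv\<^bsub>G\<^esub> \<gamma>) x = inv (\<gamma> x)"
    using maps_in \<gamma> by (metis inv_equality)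
qed

lemma continuous_map_in_G: "continuous_map X T f \<Longrightarrow> t \<in> topspace X \<Longrightarrow> f t \<in> \<G>"
  using G.continuous_map_carrier by simp

lemma continuous_map_G_mult:
  "continuous_map X T f \<Longrightarrow> continuous_map X T g \<Longrightarrow> continuous_map X T (\<lambda>t x. f t x \<otimes> g t x)"
  using G.continuous_map_mult by simp

lemma continuous_map_G_inv:
  assumes "continuous_map X T f"
  shows "continuous_map X T (\<lambda>t x. inv (f t x))"
  using G.continuous_map_inv[OF assms]
  by (rule continuous_map_eq) (simp add: inv_G continuous_map_in_G[OF assms])

lemma P_open: "openin M P"
  using chart by (simp add: chart_homeomorphism_def)

abbreviation "ex \<equiv> inv_into P \<kappa>"

lemma \<kappa>_inj: "inj_on \<kappa> P" using chart by (rule chart_inj)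

lemma ex_\<kappa> [simp]: "p \<in> P \<Longrightarrow> ex (\<kappa> p) = p" by (rule inv_into_f_f[OF \<kappa>_inj])

lemma \<kappa>_in: "p \<in> P \<Longrightarrow> \<kappa> p \<in> topspace Y"
  using chart openin_subset unfolding chart_homeomorphism_def by blast

lemma ex_0 [simp]: "ex 0 = \<one>" using ex_\<kappa>[OF one_P] by (simp add: \<kappa>_one)

text \<open>The range of the chart need not be star-shaped, but a seminorm ball inside it is. All
  scaling of logarithms takes place in this ball, and \<open>U0\<close> is the corresponding
  neighbourhood of \<one>.\<close>

definition q0 :: "'y \<Rightarrow> real" where
  "q0 = (SOME q. continuous_seminorm Y q \<and> {y \<in> topspace Y. q y < 1} \<subseteq> \<kappa> ` P)"

lemma q0: "continuous_seminorm Y q0" "{y \<in> topspace Y. q0 y < 1} \<subseteq> \<kappa> ` P"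
proof -
  have "openin Y (\<kappa> ` P)" using chart by (simp add: chart_homeomorphism_def)
  moreover have "0 \<in> \<kappa> ` P" using one_P \<kappa>_one by force
  ultimately have "\<exists>q. continuous_seminorm Y q \<and> {y \<in> topspace Y. q y < 1} \<subseteq> \<kappa> ` P"
    by (metis Y.seminorm_below)
  from someI_ex[OF this, folded q0_def]
  show "continuous_seminorm Y q0" "{y \<in> topspace Y. q0 y < 1} \<subseteq> \<kappa> ` P" by auto
qed

sublocale q0: csn Y q0 by (rule Y.csnI[OF q0(1)])

lemma in_ball: "y \<in> topspace Y \<Longrightarrow> q0 y < 1 \<Longrightarrow> y \<in> \<kappa> ` P" using q0(2) by blast

lemma ex_in_P: "y \<in> topspace Y \<Longrightarrow> q0 y < 1 \<Longrightarrow> ex y \<in> P"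
  by (rule inv_into_into) (rule in_ball)

definition U0 :: "'h set" where "U0 = {p \<in> P. q0 (\<kappa> p) < 1}"

lemma U0: "openin M U0" "\<one> \<in> U0"
proof -
  have "continuous_map (subtopology M P) euclideanreal (q0 \<circ> \<kappa>)"
    by (rule continuous_map_compose[OF chart_continuous[OF chart] q0.cont])
  then have "openin (subtopology M P) {p \<in> topspace (subtopology M P). (q0 \<circ> \<kappa>) p \<in> {..<1}}"
    by (rule openin_continuous_map_preimage) simp
  then have "openin M {p \<in> topspace (subtopology M P). (q0 \<circ> \<kappa>) p \<in> {..<1}}"
    using P_open by (simp add: openin_open_subtopology)
  also have "{p \<in> topspace (subtopology M P). (q0 \<circ> \<kappa>) p \<in> {..<1}} = U0"
    unfolding U0_def using openin_subset[OF P_open] by auto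
  finally show "openin M U0" .
  show "\<one> \<in> U0" unfolding U0_def using one_P by (simp add: \<kappa>_one)
qed

lemma log_continuous:
  assumes "continuous_map X M f" "\<And>x. x \<in> topspace X \<Longrightarrow> f x \<in> P"
  shows "continuous_map X Y (\<lambda>x. \<kappa> (f x))"
  using continuous_map_compose[of X "subtopology M P" f, OF _ chart_continuous[OF chart]] assms
  by (auto simp: o_def continuous_map_in_subtopology)

lemma exp_continuous:
  assumes "continuous_map X Y f" "\<And>x. x \<in> topspace X \<Longrightarrow> q0 (f x) < 1"
  shows "continuous_map X M (\<lambda>x. ex (f x))"
proof -
  have "f x \<in> \<kappa> ` P" if "x \<in> topspace X" for x
    using in_ball assms that by (auto simp: continuous_map_def)
  then show ?thesis
    using continuous_map_compose[of X "subtopology Y (\<kappa> ` P)" f, OF _ chart_inverse_continuous[OF chart]] assms(1)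
    by (auto simp: o_def continuous_map_in_subtopology)
qed

lemma G_log_continuous:
  assumes "continuous_map X T f" "\<And>t x. t \<in> topspace X \<Longrightarrow> f t x \<in> P"
  shows "continuous_map X F (\<lambda>t x. \<kappa> (f t x))"
  using continuous_map_compose[of X "subtopology T {\<gamma> \<in> \<G>. range \<gamma> \<subseteq> P}" f, OF _ chart_continuous[OF G_chart]]
    assms continuous_map_in_G[OF assms(1)]
  by (auto simp: o_def continuous_map_in_subtopology)

text \<open>By \<open>G_chart_image\<close> every element of F with values in the range of
  \<open>\<kappa>\<close> is the logarithm of a group element, so applying \<open>ex\<close>
  pointwise is the inverse of the chart of T.\<close>

lemma G_exp_continuous:
  assumes "continuous_map X F f" "\<And>t x. t \<in> topspace X \<Longrightarrow> q0 (f t x) < 1"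
  shows "continuous_map X T (\<lambda>t x. ex (f t x))"
proof -
  let ?L = "\<lambda>\<gamma>. \<kappa> \<circ> \<gamma>" and ?U = "{\<gamma> \<in> \<G>. range \<gamma> \<subseteq> P}"
  have f_in: "f t \<in> ?L ` ?U" if "t \<in> topspace X" for t
  proof -
    have "f t \<in> topspace F" using assms(1) that by (auto simp: continuous_map_def)
    then show ?thesis unfolding G_chart_image using in_ball F_in assms(2)[OF that] by auto
  qed
  then have "continuous_map X T (inv_into ?U ?L \<circ> f)"
    using continuous_map_compose[of X "subtopology F (?L ` ?U)" f, OF _ chart_inverse_continuous[OF G_chart]] assms(1)
    by (auto simp: continuous_map_in_subtopology)
  then show ?thesis
  proof (rule continuous_map_eq)
    fix t assume t: "t \<in> topspace X"
    then obtain \<gamma> where \<gamma>: "\<gamma> \<in> ?U" "f t = ?L \<gamma>" using f_in by blast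
    then have "inv_into ?U ?L (f t) = \<gamma>" using inv_into_f_f[OF chart_inj[OF G_chart] \<gamma>(1)] by simp
    moreover have "\<gamma> x \<in> P" for x using \<gamma>(1) by blast
    then have "ex (f t x) = \<gamma> x" for x using \<gamma>(2) by simp
    ultimately show "(inv_into ?U ?L \<circ> f) t = (\<lambda>x. ex (f t x))" by (simp add: fun_eq_iff)
  qed
qed

lemma G_neighbourhood:
  assumes U: "openin M U" "\<one> \<in> U"
  obtains N where "openin T N" "(\<lambda>x. \<one>) \<in> N" "\<And>\<gamma> x. \<gamma> \<in> N \<Longrightarrow> \<gamma> x \<in> U"
proof -
  let ?U = "{\<gamma> \<in> \<G>. range \<gamma> \<subseteq> P}"
  have "openin Y (\<kappa> ` (P \<inter> U))" by (rule chart_image_openin[OF chart]) (use P_open U in auto)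
  moreover have "0 \<in> \<kappa> ` (P \<inter> U)" using one_P U \<kappa>_one by force
  ultimately obtain q where q: "continuous_seminorm Y q" "{y \<in> topspace Y. q y < 1} \<subseteq> \<kappa> ` (P \<inter> U)"
    using Y.seminorm_below by blast
  obtain N where N: "openin F N" "0 \<in> N" "\<And>\<eta> x. \<eta> \<in> N \<Longrightarrow> q (\<eta> x) < 1"
    using sup_nbhd[OF q(1)] by blast
  have "openin (subtopology T ?U) {\<gamma> \<in> topspace (subtopology T ?U). \<kappa> \<circ> \<gamma> \<in> N}"
    by (rule openin_continuous_map_preimage[OF chart_continuous[OF G_chart] N(1)])
  moreover have "openin T ?U" using G_chart by (simp add: chart_homeomorphism_def)
  ultimately have "openin T {\<gamma> \<in> topspace (subtopology T ?U). \<kappa> \<circ> \<gamma> \<in> N}"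
    by (simp add: openin_open_subtopology)
  moreover have "{\<gamma> \<in> topspace (subtopology T ?U). \<kappa> \<circ> \<gamma> \<in> N} = {\<gamma> \<in> ?U. \<kappa> \<circ> \<gamma> \<in> N}"
    using topspace_T by auto
  ultimately have *: "openin T {\<gamma> \<in> ?U. \<kappa> \<circ> \<gamma> \<in> N}" by simp
  show thesis
  proof (rule that[OF *])
    have "(\<lambda>x. \<one>) \<in> \<G>" using G.one_closed by simp
    moreover have "\<kappa> \<circ> (\<lambda>x. \<one>) = (0 :: real ^ 'd \<Rightarrow> 'y)" by (simp add: fun_eq_iff \<kappa>_one)
    ultimately show "(\<lambda>x. \<one>) \<in> {\<gamma> \<in> ?U. \<kappa> \<circ> \<gamma> \<in> N}" using one_P N(2) by (auto simp del: o_apply)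
    fix \<gamma> x assume "\<gamma> \<in> {\<gamma> \<in> ?U. \<kappa> \<circ> \<gamma> \<in> N}"
    then have \<gamma>: "\<gamma> x \<in> P" "q (\<kappa> (\<gamma> x)) < 1" using N(3)[of "\<kappa> \<circ> \<gamma>" x] by auto
    then have "\<kappa> (\<gamma> x) \<in> \<kappa> ` (P \<inter> U)" using q(2) \<kappa>_in by blast
    then show "\<gamma> x \<in> U" using \<gamma>(1) \<kappa>_inj by (auto dest: inj_onD)
  qed
qed

text \<open>Translation by the inverse of \<open>f t0\<close> moves the question to the neutral
  element, where \<open>G_neighbourhood\<close> gives closeness for all x at once.\<close>

lemma uniform_neighbourhood:
  assumes f: "continuous_map X T f" and t0: "t0 \<in> topspace X" and U: "openin M U" "\<one> \<in> U"
  obtains N where "openin X N" "t0 \<in> N" "\<And>t x. t \<in> N \<Longrightarrow> inv (f t0 x) \<otimes> f t x \<in> U"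
proof -
  obtain N where N: "openin T N" "(\<lambda>x. \<one>) \<in> N" "\<And>\<gamma> x. \<gamma> \<in> N \<Longrightarrow> \<gamma> x \<in> U"
    using G_neighbourhood[OF U] by blast
  have ft0: "f t0 \<in> \<G>" using continuous_map_in_G[OF f t0] .
  have "(\<lambda>x. inv (f t0 x)) \<in> \<G>" using G.inv_closed[of "f t0"] ft0 by (simp add: inv_G)
  then have "continuous_map X T (\<lambda>t x. inv (f t0 x) \<otimes> f t x)"
    by (intro continuous_map_G_mult f) (simp add: topspace_T)
  from openin_continuous_map_preimage[OF this N(1)]
  have "openin X {t \<in> topspace X. (\<lambda>x. inv (f t0 x) \<otimes> f t x) \<in> N}" .
  moreover have "t0 \<in> {t \<in> topspace X. (\<lambda>x. inv (f t0 x) \<otimes> f t x) \<in> N}"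
    using t0 N(2) maps_in[OF ft0] by simp
  ultimately show thesis by (rule that) (use N(3) in force)
qed

definition on_cube :: "(real ^ 'd \<Rightarrow> 'h) \<Rightarrow> real ^ 'd \<Rightarrow> 'h" where
  "on_cube \<gamma> u = (if u \<in> open_box then \<gamma> (unsquash u) else \<one>)"

lemma on_cube_squash [simp]: "on_cube \<gamma> (squash x) = \<gamma> x"
  by (simp add: on_cube_def squash_in)

lemma on_cube_boundary: "u \<notin> open_box \<Longrightarrow> on_cube \<gamma> u = \<one>"
  by (simp add: on_cube_def)

lemma on_cube_interior: "u \<in> open_box \<Longrightarrow> \<exists>x. u = squash x \<and> on_cube \<gamma> u = \<gamma> x"
  by (metis on_cube_squash squash_unsquash)

text \<open>At an interior point, a change of t costs a factor that is small uniformly in x, and a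
  change of u is handled by continuity of the fixed map \<open>f t0\<close>. At a boundary point,
  \<open>f t0\<close> is close to \<one> off a compact set whose squashed image stays away from the
  boundary, and t again costs a uniformly small factor.\<close>

lemma on_cube_continuous:
  assumes f: "continuous_map X T f"
  shows "continuous_map (prod_topology X (top_of_set unit_box)) M (\<lambda>(t, u). on_cube (f t) u)"
  unfolding continuous_map_eq_topcontinuous_at topcontinuous_at_def
proof (intro ballI conjI allI impI)
  let ?Z = "prod_topology X (top_of_set (unit_box :: (real ^ 'd) set))"
  have f_in: "f t \<in> \<G>" if "t \<in> topspace X" for t using continuous_map_in_G[OF f that] .
  fix p assume p: "p \<in> topspace ?Z"
  obtain t0 u0 where p_eq: "p = (t0, u0)" by (cases p)
  have t0: "t0 \<in> topspace X" and u0: "u0 \<in> unit_box" using p p_eq by auto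
  show "(\<lambda>(t, u). on_cube (f t) u) \<in> topspace ?Z \<rightarrow> topspace M"
    using maps_in[OF f_in] by (auto simp: topspace_carrier on_cube_def)
  show "p \<in> topspace ?Z" by fact
  fix V assume V: "openin M V \<and> (case p of (t, u) \<Rightarrow> on_cube (f t) u) \<in> V"
  show "\<exists>U. openin ?Z U \<and> p \<in> U \<and> (\<forall>y\<in>U. (case y of (t, u) \<Rightarrow> on_cube (f t) u) \<in> V)"
  proof (cases "u0 \<in> open_box")
    case True
    let ?a = "unsquash u0"
    have v: "f t0 ?a \<in> V" "openin M V" using V True by (auto simp: p_eq on_cube_def)
    define A where "A = {a \<in> topspace M. f t0 ?a \<otimes> a \<in> V}"
    have "continuous_map M M (\<lambda>a. f t0 ?a \<otimes> a)"
      by (intro continuous_map_mult continuous_map_id[unfolded id_def])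
         (simp add: topspace_carrier maps_in[OF f_in[OF t0]])
    from openin_continuous_map_preimage[OF this v(2)]
    have "openin M A" "\<one> \<in> A"
      unfolding A_def using v(1) maps_in[OF f_in[OF t0]] by (auto simp: topspace_carrier)
    then obtain A' where A': "openin M A'" "\<one> \<in> A'" "\<And>x y. x \<in> A' \<Longrightarrow> y \<in> A' \<Longrightarrow> x \<otimes> y \<in> A"
      using split_neighbourhood by metis
    obtain N where N: "openin X N" "t0 \<in> N" "\<And>t x. t \<in> N \<Longrightarrow> inv (f t0 x) \<otimes> f t x \<in> A'"
      using uniform_neighbourhood[OF f t0 A'(1,2)] by blast
    have "continuous_map (top_of_set open_box) euclidean (unsquash :: real ^ 'd \<Rightarrow> real ^ 'd)"
      using continuous_on_unsquash by simp
    from continuous_map_compose[OF this maps_continuous[OF f_in[OF t0]]]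
    have "continuous_map (top_of_set open_box) M (\<lambda>u. inv (f t0 ?a) \<otimes> f t0 (unsquash u))"
      by (intro continuous_map_mult)
         (auto simp: topspace_carrier maps_in[OF f_in[OF t0]] o_def)
    from openin_continuous_map_preimage[OF this A'(1)]
    have "openin (top_of_set open_box) {u \<in> open_box. inv (f t0 ?a) \<otimes> f t0 (unsquash u) \<in> A'}"
      by simp
    then have "open {u \<in> open_box. inv (f t0 ?a) \<otimes> f t0 (unsquash u) \<in> A'}"
      by (meson open_box openin_open_trans)
    then have "openin (top_of_set unit_box) {u \<in> open_box. inv (f t0 ?a) \<otimes> f t0 (unsquash u) \<in> A'}"
      using box_subset_cbox by (intro open_subset) auto
    then have "openin ?Z (N \<times> {u \<in> open_box. inv (f t0 ?a) \<otimes> f t0 (unsquash u) \<in> A'})"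
      using N(1) by (simp add: openin_prod_Times_iff)
    moreover have "on_cube (f t) u \<in> V"
      if tu: "t \<in> N" "u \<in> open_box" "inv (f t0 ?a) \<otimes> f t0 (unsquash u) \<in> A'" for t u
    proof -
      have t: "t \<in> topspace X" using tu(1) N(1) openin_subset by blast
      let ?x = "unsquash u"
      have "inv (f t0 ?a) \<otimes> f t0 ?x \<otimes> (inv (f t0 ?x) \<otimes> f t ?x) \<in> A" by (rule A'(3)[OF tu(3) N(3)[OF tu(1)]])
      then have "f t0 ?a \<otimes> (inv (f t0 ?a) \<otimes> f t0 ?x \<otimes> (inv (f t0 ?x) \<otimes> f t ?x)) \<in> V" unfolding A_def by simp
      then have "f t ?x \<in> V" using maps_in[OF f_in[OF t]] maps_in[OF f_in[OF t0]] by (simp add: m_assoc cancel_left)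
      then show ?thesis using tu(2) by (simp add: on_cube_def)
    qed
    ultimately show ?thesis
      using N(2) True A'(2) maps_in[OF f_in[OF t0]] unfolding p_eq
      by (intro exI[of _ "N \<times> {u \<in> open_box. inv (f t0 ?a) \<otimes> f t0 (unsquash u) \<in> A'}"]) auto
  next
    case False
    then have v: "\<one> \<in> V" "openin M V" using V by (auto simp: p_eq on_cube_def)
    obtain A where A: "openin M A" "\<one> \<in> A" "\<And>x y. x \<in> A \<Longrightarrow> y \<in> A \<Longrightarrow> x \<otimes> y \<in> V"
      using split_neighbourhood[OF v(2,1)] by metis
    obtain N where N: "openin X N" "t0 \<in> N" "\<And>t x. t \<in> N \<Longrightarrow> inv (f t0 x) \<otimes> f t x \<in> A"
      using uniform_neighbourhood[OF f t0 A(1,2)] by blast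
    obtain K where K: "compact K" "\<And>x. x \<notin> K \<Longrightarrow> f t0 x \<in> A"
      using vanishing[OF f_in[OF t0] A(1,2)] by blast
    have cK: "compact (squash ` K)" by (intro compact_continuous_image continuous_on_squash K(1))
    have "openin (top_of_set unit_box) (unit_box - squash ` K)"
      using cK by (intro openin_diff closed_subset compact_imp_closed) (use squash_in_unit in auto)
    then have "openin ?Z (N \<times> (unit_box - squash ` K))"
      using N(1) by (simp add: openin_prod_Times_iff)
    moreover have "on_cube (f t) u \<in> V" if tu: "t \<in> N" "u \<in> unit_box - squash ` K" for t u
    proof (cases "u \<in> open_box")
      case True
      have t: "t \<in> topspace X" using tu(1) N(1) openin_subset by blast
      let ?x = "unsquash u"
      have "?x \<notin> K" using tu(2) squash_unsquash[OF True] by force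
      then have "f t0 ?x \<otimes> (inv (f t0 ?x) \<otimes> f t ?x) \<in> V" by (rule A(3)[OF K(2) N(3)[OF tu(1)]])
      then show ?thesis
        using True maps_in[OF f_in[OF t]] maps_in[OF f_in[OF t0]] by (simp add: on_cube_def cancel_left)
    qed (use v in \<open>simp add: on_cube_def\<close>)
    moreover have "u0 \<notin> squash ` K" using False squash_in by blast
    ultimately show ?thesis
      using N(2) u0 unfolding p_eq by (intro exI[of _ "N \<times> (unit_box - squash ` K)"]) auto
  qed
qed

end

section \<open>Approximation by elements of the mapping group\<close>

lemma (in lcs) csn_zero: "continuous_seminorm E (\<lambda>_. 0)"
  by (simp add: continuous_seminorm_def seminorm_on_def)

lemma (in lcs) csn_finite_bound:
  assumes "finite Q" "\<And>p. p \<in> Q \<Longrightarrow> continuous_seminorm E p"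
  obtains q where "continuous_seminorm E q" "\<And>p y. p \<in> Q \<Longrightarrow> y \<in> topspace E \<Longrightarrow> p y \<le> q y"
proof -
  have "\<exists>q. continuous_seminorm E q \<and> (\<forall>p\<in>Q. \<forall>y\<in>topspace E. p y \<le> q y)"
    using assms
  proof (induction Q rule: finite_induct)
    case empty
    then show ?case using csn_zero by blast
  next
    case (insert p Q)
    then obtain q where q: "continuous_seminorm E q" "\<forall>p\<in>Q. \<forall>y\<in>topspace E. p y \<le> q y" by auto
    then show ?case
      using csn_max[OF _ q(1), of p] insert.prems
      by (intro exI[of _ "\<lambda>x. max (p x) (q x)"]) (auto simp: le_max_iff_disj)
  qed
  then show thesis using that by blast
qed

context mapping_group
begin

text \<open>Each point of the compact family has a seminorm that controls \<open>ex\<close> near it.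
  Finitely many half-balls cover, and a common bound of their seminorms works throughout.\<close>

lemma exp_modulus:
  assumes Z: "compact_space Z" and \<zeta>: "continuous_map Z Y \<zeta>" "\<And>z. z \<in> topspace Z \<Longrightarrow> q0 (\<zeta> z) < 1"
    and U: "openin M U" "\<one> \<in> U"
  obtains q where "continuous_seminorm Y q"
    "\<And>z y. z \<in> topspace Z \<Longrightarrow> y \<in> topspace Y \<Longrightarrow> q0 y < 1 \<Longrightarrow> q (y - \<zeta> z) < 1 \<Longrightarrow> inv (ex y) \<otimes> ex (\<zeta> z) \<in> U"
proof -
  define B where "B = {y \<in> topspace Y. q0 y < 1}"
  have B: "openin Y B" using q0.openin_ball[of 0 1] unfolding B_def by simp
  have \<zeta>_in: "\<zeta> z \<in> topspace Y" if "z \<in> topspace Z" for z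
    using \<zeta>(1) that by (auto simp: continuous_map_def)
  let ?BB = "prod_topology (subtopology Y B) (subtopology Y B)"
  have ex: "continuous_map (subtopology Y B) M ex"
    by (rule exp_continuous) (auto simp: B_def)
  have "continuous_map ?BB M (\<lambda>p. inv (ex (fst p)) \<otimes> ex (snd p))"
    by (intro continuous_map_mult continuous_map_inv
        continuous_map_compose[OF continuous_map_fst ex, unfolded o_def]
        continuous_map_compose[OF continuous_map_snd ex, unfolded o_def])
  note opn = openin_continuous_map_preimage[OF this U(1)]
  have "\<exists>q. continuous_seminorm Y q \<and> (\<forall>y\<in>topspace Y. \<forall>y'\<in>topspace Y. q (y - \<zeta> z) < 1 \<longrightarrow> q (y' - \<zeta> z) < 1
      \<longrightarrow> inv (ex y) \<otimes> ex y' \<in> U)" if z: "z \<in> topspace Z" for z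
  proof -
    have "\<zeta> z \<in> B" unfolding B_def using \<zeta>_in \<zeta>(2) z by simp
    moreover from this have "ex (\<zeta> z) \<in> carrier H"
      using continuous_map_carrier[OF ex, of "\<zeta> z"] openin_subset[OF B] by auto
    ultimately have "(\<zeta> z, \<zeta> z) \<in> {p \<in> topspace ?BB. inv (ex (fst p)) \<otimes> ex (snd p) \<in> U}"
      using U(2) openin_subset[OF B] by auto
    from opn[unfolded openin_prod_topology_alt, rule_format, OF this] obtain O1 O2 where O12:
      "openin (subtopology Y B) O1" "openin (subtopology Y B) O2" "\<zeta> z \<in> O1" "\<zeta> z \<in> O2"
      "O1 \<times> O2 \<subseteq> {p \<in> topspace ?BB. inv (ex (fst p)) \<otimes> ex (snd p) \<in> U}" by blast
    have "openin Y (O1 \<inter> O2)" using O12(1,2) B by (auto simp: openin_open_subtopology)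
    then obtain q where q: "continuous_seminorm Y q" "{y \<in> topspace Y. q (y - \<zeta> z) < 1} \<subseteq> O1 \<inter> O2"
      using Y.seminorm_ball_below[of "O1 \<inter> O2" "\<zeta> z"] O12(3,4) by blast
    have "inv (ex y) \<otimes> ex y' \<in> U"
      if "y \<in> topspace Y" "y' \<in> topspace Y" "q (y - \<zeta> z) < 1" "q (y' - \<zeta> z) < 1" for y y'
    proof -
      have "(y, y') \<in> O1 \<times> O2" using q(2) that by blast
      then show ?thesis using O12(5) by auto
    qed
    with q(1) show ?thesis by blast
  qed
  then obtain Q where Q: "\<And>z. z \<in> topspace Z \<Longrightarrow> continuous_seminorm Y (Q z)"
    "\<And>z y y'. z \<in> topspace Z \<Longrightarrow> y \<in> topspace Y \<Longrightarrow> y' \<in> topspace Y \<Longrightarrow> Q z (y - \<zeta> z) < 1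
      \<Longrightarrow> Q z (y' - \<zeta> z) < 1 \<Longrightarrow> inv (ex y) \<otimes> ex y' \<in> U"
    by metis
  define C where "C z = {z' \<in> topspace Z. \<zeta> z' \<in> {y \<in> topspace Y. Q z (y - \<zeta> z) < 1/2}}" for z
  have C: "openin Z (C z)" "z \<in> C z" if "z \<in> topspace Z" for z
  proof -
    interpret q: csn Y "Q z" by (rule Y.csnI[OF Q(1)[OF that]])
    show "openin Z (C z)" unfolding C_def
      by (rule openin_continuous_map_preimage[OF \<zeta>(1) q.openin_ball[OF \<zeta>_in[OF that]]])
    show "z \<in> C z" unfolding C_def using that \<zeta>_in by simp
  qed
  have "topspace Z \<subseteq> \<Union> (C ` topspace Z)" using C(2) by auto
  moreover have "openin Z U" if "U \<in> C ` topspace Z" for U using that C(1) by auto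
  ultimately obtain \<F> where \<F>: "finite \<F>" "\<F> \<subseteq> C ` topspace Z" "topspace Z \<subseteq> \<Union>\<F>"
    using Z[unfolded compact_space_alt, rule_format, of "C ` topspace Z"] by auto
  obtain D where D': "D \<subseteq> topspace Z" "finite D" "\<F> = C ` D"
    using finite_subset_image[OF \<F>(1,2)] by metis
  have D: "finite D" "D \<subseteq> topspace Z" "topspace Z \<subseteq> (\<Union>z\<in>D. C z)"
    using D' \<F>(3) by simp_all
  have "continuous_seminorm Y p" if "p \<in> Q ` D" for p using that D(2) Q(1) by auto
  from Y.csn_finite_bound[OF finite_imageI[OF D(1)] this, of Q] obtain q
    where "continuous_seminorm Y q" "\<And>p y. p \<in> Q ` D \<Longrightarrow> y \<in> topspace Y \<Longrightarrow> p y \<le> q y"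
    by auto
  then have q: "continuous_seminorm Y q" "\<And>z y. z \<in> D \<Longrightarrow> y \<in> topspace Y \<Longrightarrow> Q z y \<le> q y"
    by auto
  show thesis
  \<comment> \<open>The factor 2 leaves the other half of the unit ball for the distance from
    \<open>\<zeta> z\<close> to the centre of the covering half-ball.\<close>
  proof (rule that[of "\<lambda>y. 2 * q y"])
    show "continuous_seminorm Y (\<lambda>y. 2 * q y)" by (rule Y.csn_scaled[OF q(1)]) simp
    fix z y assume *: "z \<in> topspace Z" "y \<in> topspace Y" "2 * q (y - \<zeta> z) < 1"
    obtain z' where z': "z' \<in> D" "z \<in> C z'" using D(3) *(1) by blast
    then have z'Z: "z' \<in> topspace Z" using D(2) by blast
    interpret q: csn Y "Q z'" by (rule Y.csnI[OF Q(1)[OF z'Z]])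
    have "Q z' (y - \<zeta> z) \<le> q (y - \<zeta> z)" by (intro q(2) z'(1) Y.diff_in *(2) \<zeta>_in *(1))
    moreover have 1: "Q z' (\<zeta> z - \<zeta> z') < 1/2" using z'(2) unfolding C_def by simp
    moreover have "Q z' ((y - \<zeta> z) + (\<zeta> z - \<zeta> z')) \<le> Q z' (y - \<zeta> z) + Q z' (\<zeta> z - \<zeta> z')"
      by (intro q.triangle Y.diff_in *(2) \<zeta>_in *(1) z'Z)
    ultimately have "Q z' (y - \<zeta> z') < 1" using *(3) by simp
    then show "inv (ex y) \<otimes> ex (\<zeta> z) \<in> U" using 1 by (intro Q(2)[OF z'Z *(2) \<zeta>_in[OF *(1)]]) auto
  qed
qed

abbreviation "cube_space X \<equiv> prod_topology X (top_of_set (unit_box :: (real ^ 'd) set))"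

lemma compact_cube_space: "compact_space X \<Longrightarrow> compact_space (cube_space X)"
  by (simp add: compact_space_prod_topology compact_space_subtopology)

text \<open>L is the part of the box on which an approximation is wanted. The boundary condition is
  imposed on L only and so is void when L lies in the open box, as it does in
  \<open>lift_map\<close>.\<close>

definition small_map :: "'x topology \<Rightarrow> (real ^ 'd) set \<Rightarrow> ('x \<times> (real ^ 'd) \<Rightarrow> 'h) \<Rightarrow> bool" where
  "small_map X L p \<longleftrightarrow> continuous_map (cube_space X) M p \<and> (\<forall>z\<in>topspace (cube_space X). p z \<in> U0) \<and>
    (\<forall>t\<in>topspace X. \<forall>u\<in>L - open_box. p (t, u) = \<one>)"

text \<open>The logarithm \<open>\<zeta>\<close> is sampled at the grid points and interpolated by
  the partition of unity. Where the partition does not sum to 1, the missing mass falls on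
  \<open>\<zeta>\<close> itself, but such points of L lie in the region \<open>V\<close> where
  \<open>\<zeta>\<close> is small for all parameters.\<close>

lemma approximation:
  assumes X: "compact_space X" and L: "compact L" "L \<subseteq> unit_box" and p: "small_map X L p"
    and U: "openin M U" "\<one> \<in> U"
  obtains \<eta> where "continuous_map X F \<eta>" "\<And>t x. t \<in> topspace X \<Longrightarrow> q0 (\<eta> t x) < 1"
    "\<And>t. t \<in> topspace X \<Longrightarrow> (\<And>u. u \<in> unit_box \<Longrightarrow> p (t, u) = \<one>) \<Longrightarrow> \<eta> t = 0"
    "\<And>t x. t \<in> topspace X \<Longrightarrow> squash x \<in> L \<Longrightarrow> inv (ex (\<eta> t x)) \<otimes> p (t, squash x) \<in> U"
proof -
  let ?Z = "cube_space X"
  define \<zeta> where "\<zeta> z = \<kappa> (p z)" for z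
  have p_U0: "p z \<in> U0" if "z \<in> topspace ?Z" for z using p that unfolding small_map_def by blast
  have \<zeta>: "continuous_map ?Z Y \<zeta>" unfolding \<zeta>_def
    by (rule log_continuous) (use p p_U0 in \<open>auto simp: small_map_def U0_def\<close>)
  have \<zeta>_in: "\<zeta> z \<in> topspace Y" if "z \<in> topspace ?Z" for z
    using \<zeta> that by (auto simp: continuous_map_def)
  have \<zeta>1: "q0 (\<zeta> z) < 1" if "z \<in> topspace ?Z" for z using p_U0[OF that] unfolding U0_def \<zeta>_def by simp
  have p_ex: "p z = ex (\<zeta> z)" if "z \<in> topspace ?Z" for z using p_U0[OF that] unfolding U0_def \<zeta>_def by simp
  obtain q where q: "continuous_seminorm Y q"
    "\<And>z y. z \<in> topspace ?Z \<Longrightarrow> y \<in> topspace Y \<Longrightarrow> q0 y < 1 \<Longrightarrow> q (y - \<zeta> z) < 1 \<Longrightarrow> inv (ex y) \<otimes> ex (\<zeta> z) \<in> U"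
    using exp_modulus[OF compact_cube_space[OF X] \<zeta> \<zeta>1 U] by blast
  interpret q: csn Y q by (rule Y.csnI[OF q(1)])
  let ?B = "top_of_set (unit_box :: (real ^ 'd) set)"
  \<comment> \<open>Equicontinuity of \<open>\<zeta>\<close> in the box variable: the tube lemma
    absorbs the parameter, and a Lebesgue number gives \<delta>.\<close>
  obtain \<delta> where \<delta>: "\<delta> > 0"
    "\<And>t u v. t \<in> topspace X \<Longrightarrow> u \<in> unit_box \<Longrightarrow> v \<in> unit_box \<Longrightarrow> dist u v < \<delta> \<Longrightarrow> q (\<zeta> (t, u) - \<zeta> (t, v)) < 1/2"
  proof -
    let ?W = "prod_topology (prod_topology ?B ?B) X"
    have "continuous_map ?W ?Z (\<lambda>w. (snd w, fst (fst w)))" "continuous_map ?W ?Z (\<lambda>w. (snd w, snd (fst w)))"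
      by (intro continuous_map_pairedI continuous_map_snd
          continuous_map_compose[OF continuous_map_fst continuous_map_fst, unfolded o_def]
          continuous_map_compose[OF continuous_map_fst continuous_map_snd, unfolded o_def])+
    from this[THEN continuous_map_compose, OF \<zeta>]
    have "continuous_map ?W Y (\<lambda>w. \<zeta> (snd w, fst (fst w)) - \<zeta> (snd w, snd (fst w)))"
      by (intro Y.continuous_map_diff) (auto simp: o_def)
    from continuous_map_compose[OF this q.cont]
    have "openin ?W {w \<in> topspace ?W. q (\<zeta> (snd w, fst (fst w)) - \<zeta> (snd w, snd (fst w))) \<in> {..<1/2}}"
      by (intro openin_continuous_map_preimage) (auto simp: o_def)
    note tube = openin_tube[OF X this]
    define W where "W = {x \<in> topspace (prod_topology ?B ?B). \<forall>t\<in>topspace X. q (\<zeta> (t, fst x) - \<zeta> (t, snd x)) < 1/2}"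
    have "openin (prod_topology ?B ?B) W"
      using tube unfolding W_def by (simp add: mem_Times_iff cong: conj_cong)
    moreover have "(u, u) \<in> W" if "u \<in> unit_box" for u using that unfolding W_def by simp
    ultimately obtain \<delta> where "\<delta> > 0" "\<And>u v. u \<in> unit_box \<Longrightarrow> v \<in> unit_box \<Longrightarrow> dist u v < \<delta> \<Longrightarrow> (u, v) \<in> W"
      using Lebesgue_number_diagonal[OF compact_cbox] by metis
    then show thesis by (intro that) (auto simp: W_def)
  qed
  define V where "V = {u \<in> topspace ?B. \<forall>t\<in>topspace X. q (\<zeta> (t, u)) < 1/2}"
  have "openin ?B V"
  proof -
    let ?W = "prod_topology ?B X"
    have "continuous_map ?W ?Z (\<lambda>w. (snd w, fst w))"
      by (intro continuous_map_pairedI continuous_map_snd continuous_map_fst)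
    from continuous_map_compose[OF continuous_map_compose[OF this \<zeta>] q.cont]
    have "openin ?W {w \<in> topspace ?W. q (\<zeta> (snd w, fst w)) \<in> {..<1/2}}"
      by (intro openin_continuous_map_preimage) (auto simp: o_def)
    from openin_tube[OF X this] show ?thesis
      unfolding V_def by (simp add: mem_Times_iff cong: conj_cong)
  qed
  then obtain V' where V': "open V'" "V = unit_box \<inter> V'" unfolding openin_open by blast
  have "L - V = L - V'" using L(2) V'(2) by blast
  then have "compact (L - V)" using L(1) V'(1) by (simp add: compact_diff)
  \<comment> \<open>At points of L on the faces of the box the logarithm is 0 for all parameters, so
    they belong to \<open>V\<close>. What remains of L is compact in the open box, hence bounded in
    the original coordinates.\<close>
  moreover have "L - V \<subseteq> open_box"
  proof
    fix u assume u: "u \<in> L - V"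
    show "u \<in> open_box"
    proof (rule ccontr)
      assume "u \<notin> open_box"
      then have "\<zeta> (t, u) = 0" if "t \<in> topspace X" for t
        using p u that unfolding small_map_def \<zeta>_def by (simp add: \<kappa>_one)
      then have "u \<in> V" using u L(2) unfolding V_def by auto
      then show False using u by simp
    qed
  qed
  ultimately obtain R where R: "\<And>x i. squash x \<in> L - V \<Longrightarrow> \<bar>x $ i\<bar> \<le> R"
    using compact_subset_box_bounded by metis
  obtain J and \<phi> :: "('d \<Rightarrow> nat) \<Rightarrow> real ^ 'd \<Rightarrow> real" and pt where J:
    "finite J" "\<And>j. j \<in> J \<Longrightarrow> test_function (\<phi> j)" "\<And>j x. 0 \<le> \<phi> j x"
    "\<And>x. (\<Sum>j\<in>J. \<phi> j x) \<le> 1" "\<And>x. (\<And>i. \<bar>x $ i\<bar> \<le> R) \<Longrightarrow> (\<Sum>j\<in>J. \<phi> j x) = 1"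
    "\<And>j x. \<phi> j x \<noteq> 0 \<Longrightarrow> dist x (pt j) < \<delta>"
    using partition_of_unity[OF \<delta>(1)] by metis
  define \<zeta>j where "\<zeta>j t j = \<zeta> (t, squash (pt j))" for t j
  have mem: "(t, squash x) \<in> topspace ?Z" if "t \<in> topspace X" for t x
    using that squash_in_unit by simp
  have \<zeta>j_in: "\<zeta>j t j \<in> topspace Y" and \<zeta>j1: "q0 (\<zeta>j t j) < 1" if "t \<in> topspace X" for t j
    unfolding \<zeta>j_def using \<zeta>_in \<zeta>1 mem[OF that] by auto
  define \<eta> where "\<eta> t = (\<Sum>j\<in>J. (\<lambda>x. \<phi> j x *\<^sub>R \<zeta>j t j))" for t
  have \<eta>_eq: "\<eta> t x = (\<Sum>j\<in>J. \<phi> j x *\<^sub>R \<zeta>j t j)" for t x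
    unfolding \<eta>_def using J(1) by (induction J rule: finite_induct) auto
  have \<eta>_in: "\<eta> t x \<in> topspace Y" if "t \<in> topspace X" for t x
    unfolding \<eta>_eq using \<zeta>j_in[OF that] by (intro Y.sum_in Y.scale_in)
  have \<eta>1: "q0 (\<eta> t x) < 1" if t: "t \<in> topspace X" for t x
  proof -
    \<comment> \<open>A maximum of finitely many numbers below 1 is below 1, and the coefficients
      sum to at most 1. Inserting 0 makes the set nonempty and \<open>c\<close> nonnegative.\<close>
    define c where "c = Max (insert 0 ((\<lambda>j. q0 (\<zeta>j t j)) ` J))"
    have c: "c < 1" "c \<ge> 0" "\<And>j. j \<in> J \<Longrightarrow> q0 (\<zeta>j t j) \<le> c"
      unfolding c_def using J(1) \<zeta>j1[OF t] by auto
    have "q0 (\<eta> t x) \<le> (\<Sum>j\<in>J. q0 (\<phi> j x *\<^sub>R \<zeta>j t j))"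
      unfolding \<eta>_eq using \<zeta>j_in[OF t] by (intro q0.sum_le J(1) Y.scale_in)
    also have "\<dots> = (\<Sum>j\<in>J. \<phi> j x * q0 (\<zeta>j t j))"
      using \<zeta>j_in[OF t] J(3) by (simp add: q0.scale)
    also have "\<dots> \<le> (\<Sum>j\<in>J. \<phi> j x * c)" using c J(3) by (intro sum_mono mult_left_mono)
    also have "\<dots> = (\<Sum>j\<in>J. \<phi> j x) * c" by (simp add: sum_distrib_right)
    also have "\<dots> \<le> 1 * c" using c J(4) by (intro mult_right_mono)
    finally show ?thesis using c by simp
  qed
  show thesis
  proof (rule that[of \<eta>])
    show "continuous_map X F \<eta>"
      unfolding \<eta>_def
    proof (intro F.continuous_map_sum J(1))
      fix j assume "j \<in> J"
      have "continuous_map X ?Z (\<lambda>t. (t, squash (pt j)))"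
        using squash_in_unit by (intro continuous_map_pairedI) (auto simp: id_def[symmetric])
      from continuous_map_compose[OF this \<zeta>] have "continuous_map X Y (\<lambda>t. \<zeta>j t j)"
        unfolding \<zeta>j_def by (simp add: o_def)
      from continuous_map_compose[OF this bump[OF J(2)[OF \<open>j \<in> J\<close>]]]
      show "continuous_map X F (\<lambda>t x. \<phi> j x *\<^sub>R \<zeta>j t j)" by (simp add: o_def)
    qed
    show "q0 (\<eta> t x) < 1" if "t \<in> topspace X" for t x using \<eta>1[OF that] .
    show "\<eta> t = 0" if "t \<in> topspace X" "\<And>u. u \<in> unit_box \<Longrightarrow> p (t, u) = \<one>" for t
    proof -
      have "\<zeta>j t j = 0" for j unfolding \<zeta>j_def \<zeta>_def using that(2)[OF squash_in_unit] by (simp add: \<kappa>_one)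
      then show ?thesis by (simp add: fun_eq_iff \<eta>_eq)
    qed
    fix t x assume t: "t \<in> topspace X" and x: "squash x \<in> L"
    let ?z = "(t, squash x)" and ?s = "\<Sum>j\<in>J. \<phi> j x"
    have z_in: "\<zeta> ?z \<in> topspace Y" using \<zeta>_in mem[OF t] by simp
    \<comment> \<open>The error is a weighted sum of oscillations over distances below \<delta>,
      minus the missing mass times \<open>\<zeta> ?z\<close>. Each part is at most half its weight,
      and the weights add up to 1.\<close>
    have "\<eta> t x - \<zeta> ?z = (\<Sum>j\<in>J. \<phi> j x *\<^sub>R (\<zeta>j t j - \<zeta> ?z)) - (1 - ?s) *\<^sub>R \<zeta> ?z"
      unfolding \<eta>_eq by (simp add: scaleR_right_diff_distrib sum_subtractf scaleR_left_diff_distrib scaleR_sum_left)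
    then have "q (\<eta> t x - \<zeta> ?z) \<le> q (\<Sum>j\<in>J. \<phi> j x *\<^sub>R (\<zeta>j t j - \<zeta> ?z)) + q ((1 - ?s) *\<^sub>R \<zeta> ?z)"
      using \<zeta>j_in[OF t] z_in by (auto intro!: q.triangle_diff Y.sum_in Y.scale_in Y.diff_in)
    also have "q (\<Sum>j\<in>J. \<phi> j x *\<^sub>R (\<zeta>j t j - \<zeta> ?z)) \<le> (\<Sum>j\<in>J. q (\<phi> j x *\<^sub>R (\<zeta>j t j - \<zeta> ?z)))"
      using \<zeta>j_in[OF t] z_in by (intro q.sum_le J(1) Y.scale_in Y.diff_in)
    also have "\<dots> \<le> (\<Sum>j\<in>J. \<phi> j x * (1/2))"
    proof (rule sum_mono)
      fix j assume "j \<in> J"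
      have "\<phi> j x * q (\<zeta>j t j - \<zeta> ?z) \<le> \<phi> j x * (1/2)"
      proof (cases "\<phi> j x = 0")
        case False
        have "dist (squash (pt j)) (squash x) < \<delta>"
          using dist_squash[of "pt j" x] J(6)[OF False] by (simp add: dist_commute)
        then have "q (\<zeta>j t j - \<zeta> ?z) < 1/2"
          unfolding \<zeta>j_def by (intro \<delta>(2) t squash_in_unit)
        then show ?thesis using J(3) by (intro mult_left_mono) auto
      qed simp
      then show "q (\<phi> j x *\<^sub>R (\<zeta>j t j - \<zeta> ?z)) \<le> \<phi> j x * (1/2)"
        using q.scale[OF Y.diff_in[OF \<zeta>j_in[OF t] z_in]] J(3) by simp
    qed
    also have "(\<Sum>j\<in>J. \<phi> j x * (1/2)) = ?s * (1/2)" by (simp add: sum_distrib_right)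
    also have "q ((1 - ?s) *\<^sub>R \<zeta> ?z) \<le> (1 - ?s) * (1/2)"
    proof (cases "squash x \<in> V")
      case True
      then have "q (\<zeta> ?z) \<le> 1/2" using t unfolding V_def by (simp add: less_imp_le)
      then have "(1 - ?s) * q (\<zeta> ?z) \<le> (1 - ?s) * (1/2)" using J(4)[of x] by (intro mult_left_mono) auto
      then show ?thesis using q.scale[OF z_in, of "1 - ?s"] J(4)[of x] by simp
    next
      case False
      then have "?s = 1" using x R J(5) by simp
      then show ?thesis by simp
    qed
    also have "?s * (1/2) + (1 - ?s) * (1/2) < 1" by (simp add: field_simps)
    finally have "q (\<eta> t x - \<zeta> ?z) < 1" by simp
    then have "inv (ex (\<eta> t x)) \<otimes> ex (\<zeta> ?z) \<in> U" by (intro q(2) mem t \<eta>_in \<eta>1)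
    then show "inv (ex (\<eta> t x)) \<otimes> p ?z \<in> U" using p_ex[OF mem[OF t]] by simp
  qed
qed

text \<open>Every factor of the product is approximated in the chart, hence by an element that can be
  scaled to \<open>0\<close>.\<close>

lemma approximate_product:
  assumes X: "compact_space X" and L: "compact L" "L \<subseteq> unit_box"
    and ps: "\<forall>p\<in>set ps. small_map X L p" and U: "openin M U" "\<one> \<in> U"
  shows "\<exists>h. continuous_map (prod_topology I01 X) T h \<and> (\<forall>t\<in>topspace X. h (0, t) = (\<lambda>x. \<one>)) \<and>
    (\<forall>s\<in>{0..1}. \<forall>t\<in>topspace X. (\<forall>p\<in>set ps. \<forall>u\<in>unit_box. p (t, u) = \<one>) \<longrightarrow> h (s, t) = (\<lambda>x. \<one>)) \<and>
    (\<forall>t\<in>topspace X. \<forall>x. squash x \<in> L \<longrightarrow> inv (h (1, t) x) \<otimes> prod_maps ps (t, squash x) \<in> U)"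
  using ps U
proof (induction ps arbitrary: U)
  case Nil
  have "(\<lambda>x. \<one>) \<in> topspace T" using G.one_closed topspace_T by simp
  then have "continuous_map (prod_topology I01 X) T (\<lambda>_ _. \<one>)" by simp
  then show ?case using Nil by (intro exI[of _ "\<lambda>_ _. \<one>"]) auto
next
  case (Cons p ps)
  let ?A = "prod_maps ps"
  have cA: "continuous_map (cube_space X) M ?A"
    by (rule continuous_map_prod_maps) (use Cons.prems in \<open>auto simp: small_map_def\<close>)
  obtain U2 where U2: "openin M U2" "\<one> \<in> U2" "\<And>x y. x \<in> U2 \<Longrightarrow> y \<in> U2 \<Longrightarrow> x \<otimes> y \<in> U"
    using split_neighbourhood[OF Cons.prems(2,3)] by metis
  obtain U1 where U1: "openin M U1" "\<one> \<in> U1"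
      "\<And>z v. z \<in> topspace (cube_space X) \<Longrightarrow> v \<in> U1 \<Longrightarrow> inv (?A z) \<otimes> v \<otimes> ?A z \<in> U2"
    using conjugation_neighbourhood[OF compact_cube_space[OF X] cA U2(1,2)] by metis
  have "\<forall>p\<in>set ps. small_map X L p" using Cons.prems(1) by simp
  from Cons.IH[OF this U2(1,2)] obtain h where h': "continuous_map (prod_topology I01 X) T h" "\<forall>t\<in>topspace X. h (0, t) = (\<lambda>x. \<one>)"
    "\<forall>s\<in>{0..1}. \<forall>t\<in>topspace X. (\<forall>p\<in>set ps. \<forall>u\<in>unit_box. p (t, u) = \<one>) \<longrightarrow> h (s, t) = (\<lambda>x. \<one>)"
    "\<forall>t\<in>topspace X. \<forall>x. squash x \<in> L \<longrightarrow> inv (h (1, t) x) \<otimes> ?A (t, squash x) \<in> U2"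
    by (elim exE conjE) (rule that)
  note h = h'(1) h'(2)[rule_format] h'(3)[rule_format] h'(4)[rule_format]
  have p: "small_map X L p" using Cons.prems(1) by simp
  obtain \<eta> where \<eta>: "continuous_map X F \<eta>" "\<And>t x. t \<in> topspace X \<Longrightarrow> q0 (\<eta> t x) < 1"
    "\<And>t. t \<in> topspace X \<Longrightarrow> (\<And>u. u \<in> unit_box \<Longrightarrow> p (t, u) = \<one>) \<Longrightarrow> \<eta> t = 0"
    "\<And>t x. t \<in> topspace X \<Longrightarrow> squash x \<in> L \<Longrightarrow> inv (ex (\<eta> t x)) \<otimes> p (t, squash x) \<in> U1"
    using approximation[OF X L p U1(1,2)] by metis
  have \<eta>_in: "\<eta> t x \<in> topspace Y" if "t \<in> topspace X" for t x
    using \<eta>(1) that by (intro F_in) (auto simp: continuous_map_def)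
  define k where "k = (\<lambda>(s, t) x. ex (s *\<^sub>R \<eta> t x) \<otimes> h (s, t) x)"
  have "continuous_map (prod_topology I01 X) F (\<lambda>w. fst w *\<^sub>R \<eta> (snd w))"
    by (intro F.continuous_map_scale continuous_map_compose[OF continuous_map_snd \<eta>(1), unfolded o_def])
       (use continuous_map_fst[of I01 X] in \<open>simp add: continuous_map_in_subtopology\<close>)
  then have "continuous_map (prod_topology I01 X) T (\<lambda>w x. ex ((fst w *\<^sub>R \<eta> (snd w)) x))"
  proof (rule G_exp_continuous)
    fix w x assume "w \<in> topspace (prod_topology I01 X)"
    then have w: "fst w \<in> {0..1}" "snd w \<in> topspace X" by auto
    have "q0 (fst w *\<^sub>R \<eta> (snd w) x) = fst w * q0 (\<eta> (snd w) x)"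
      using q0.scale[OF \<eta>_in[OF w(2)]] w(1) by simp
    also have "\<dots> \<le> 1 * q0 (\<eta> (snd w) x)"
      using w q0.nonneg[OF \<eta>_in[OF w(2)]] by (intro mult_right_mono) auto
    finally show "q0 ((fst w *\<^sub>R \<eta> (snd w)) x) < 1" using \<eta>(2)[OF w(2), of x] by (simp add: scaleR_fun_def)
  qed
  from continuous_map_G_mult[OF this h(1)] have "continuous_map (prod_topology I01 X) T k"
    by (simp add: k_def case_prod_unfold scaleR_fun_def)
  moreover have "k (0, t) = (\<lambda>x. \<one>)" if "t \<in> topspace X" for t
    unfolding k_def using h(2)[OF that] by simp
  moreover have "k (s, t) = (\<lambda>x. \<one>)"
    if "s \<in> {0..1}" "t \<in> topspace X" "\<forall>p\<in>set (p # ps). \<forall>u\<in>unit_box. p (t, u) = \<one>" for s t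
  proof -
    have "\<eta> t = 0" using \<eta>(3) that by simp
    then show ?thesis unfolding k_def using h(3)[OF that(1,2)] that(3) by simp
  qed
  moreover have "inv (k (1, t) x) \<otimes> prod_maps (p # ps) (t, squash x) \<in> U"
    if t: "t \<in> topspace X" and x: "squash x \<in> L" for t x
  proof -
    let ?z = "(t, squash x)"
    have z: "?z \<in> topspace (cube_space X)" using t squash_in_unit by simp
    have in_H: "ex (\<eta> t x) \<in> carrier H" "p ?z \<in> carrier H" "?A ?z \<in> carrier H" "h (1, t) x \<in> carrier H"
      using open_carrier[OF P_open ex_in_P[OF \<eta>_in[OF t] \<eta>(2)[OF t]]] continuous_map_carrier[OF cA z]
        continuous_map_carrier[of "cube_space X" p ?z] p z maps_in[OF continuous_map_in_G[OF h(1)], of "(1, t)" x] t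
      by (auto simp: small_map_def)
    \<comment> \<open>Multiplied out, this is the error of the whole product: the error of the
      remaining factors times the error of the first one, conjugated by their product
      \<open>?A ?z\<close>.\<close>
    have "inv (h (1, t) x) \<otimes> ?A ?z \<otimes> (inv (?A ?z) \<otimes> (inv (ex (\<eta> t x)) \<otimes> p ?z) \<otimes> ?A ?z) \<in> U"
      by (intro U2(3) h(4) U1(3) \<eta>(4) t x z)
    then show ?thesis
      unfolding k_def using in_H by (simp add: m_assoc cancel_left inv_mult_group)
  qed
  ultimately show ?case by (intro exI[of _ k]) blast
qed

end

section \<open>Homotopies in the group and their lifts to the mapping group\<close>

context mapping_group
begin

lemma U0_D: "p \<in> U0 \<Longrightarrow> p \<in> P" "p \<in> U0 \<Longrightarrow> q0 (\<kappa> p) < 1"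
  by (auto simp: U0_def)

lemma q0_scale_less: "p \<in> U0 \<Longrightarrow> c \<in> {0..1} \<Longrightarrow> q0 (c *\<^sub>R \<kappa> p) < 1"
proof -
  assume p: "p \<in> U0" and c: "c \<in> {0..1}"
  have "q0 (c *\<^sub>R \<kappa> p) = c * q0 (\<kappa> p)" using q0.scale[OF \<kappa>_in[OF U0_D(1)[OF p]]] c by simp
  also have "\<dots> \<le> 1 * q0 (\<kappa> p)"
    using c q0.nonneg[OF \<kappa>_in[OF U0_D(1)[OF p]]] by (intro mult_right_mono) auto
  finally show ?thesis using U0_D(2)[OF p] by simp
qed

lemma scale_continuous:
  assumes "continuous_map X M f" "\<And>x. x \<in> topspace X \<Longrightarrow> f x \<in> U0"
    and "continuous_map X euclideanreal s" "\<And>x. x \<in> topspace X \<Longrightarrow> s x \<in> {0..1}"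
  shows "continuous_map X M (\<lambda>x. ex (s x *\<^sub>R \<kappa> (f x)))"
  by (intro exp_continuous Y.continuous_map_scale log_continuous assms q0_scale_less U0_D)

lemma G_scale_continuous:
  assumes "continuous_map X T f" "\<And>t x. t \<in> topspace X \<Longrightarrow> f t x \<in> U0"
    and "continuous_map X euclideanreal s" "\<And>t. t \<in> topspace X \<Longrightarrow> s t \<in> {0..1}"
  shows "continuous_map X T (\<lambda>t x. ex (s t *\<^sub>R \<kappa> (f t x)))"
proof -
  have "continuous_map X F (\<lambda>t. s t *\<^sub>R (\<lambda>x. \<kappa> (f t x)))"
    by (intro F.continuous_map_scale G_log_continuous assms U0_D)
  then have "continuous_map X F (\<lambda>t x. s t *\<^sub>R \<kappa> (f t x))" by (simp add: scaleR_fun_def)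
  then show ?thesis by (rule G_exp_continuous) (intro q0_scale_less assms)
qed

lemma continuous_map_fst_I01: "continuous_map (prod_topology I01 X) euclideanreal fst"
  using continuous_map_fst[of I01 X] by (simp add: continuous_map_in_subtopology)

text \<open>Maps that differ by a small factor are homotopic through scaling of that factor in the chart.\<close>

lemma close_homotopic:
  assumes f: "continuous_map X M f" and g: "continuous_map X M g"
    and close: "\<And>x. x \<in> topspace X \<Longrightarrow> inv (f x) \<otimes> g x \<in> U0"
  obtains h where "continuous_map (prod_topology I01 X) M h"
    "\<And>x. x \<in> topspace X \<Longrightarrow> h (0, x) = f x" "\<And>x. x \<in> topspace X \<Longrightarrow> h (1, x) = g x"
    "\<And>s x. x \<in> topspace X \<Longrightarrow> f x = g x \<Longrightarrow> h (s, x) = f x"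
proof -
  define h where "h = (\<lambda>(s, x). f x \<otimes> ex (s *\<^sub>R \<kappa> (inv (f x) \<otimes> g x)))"
  have in_H: "f x \<in> carrier H" "g x \<in> carrier H" if "x \<in> topspace X" for x
    using continuous_map_carrier[OF f that] continuous_map_carrier[OF g that] by simp_all
  have snd: "continuous_map (prod_topology I01 X) M (\<lambda>w. k (snd w))" if "continuous_map X M k" for k
    using continuous_map_compose[OF continuous_map_snd that] by (simp add: o_def)
  have "continuous_map (prod_topology I01 X) M (\<lambda>w. ex (fst w *\<^sub>R \<kappa> (inv (f (snd w)) \<otimes> g (snd w))))"
  proof (rule scale_continuous)
    show "continuous_map (prod_topology I01 X) M (\<lambda>w. inv (f (snd w)) \<otimes> g (snd w))"
      by (intro continuous_map_mult continuous_map_inv snd f g)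
  qed (use close continuous_map_fst_I01 in auto)
  then have "continuous_map (prod_topology I01 X) M h"
    unfolding h_def case_prod_unfold by (intro continuous_map_mult snd f)
  moreover have "h (0, x) = f x" if "x \<in> topspace X" for x
    unfolding h_def using in_H[OF that] by simp
  moreover have "h (1, x) = g x" if "x \<in> topspace X" for x
    unfolding h_def using in_H[OF that] U0_D(1)[OF close[OF that]] by (simp add: cancel_left)
  moreover have "h (s, x) = f x" if "x \<in> topspace X" "f x = g x" for s x
    unfolding h_def using in_H[OF that(1)] that(2) by (simp add: \<kappa>_one)
  ultimately show thesis by (rule that)
qed

text \<open>A parameter at which \<open>g\<close> is constantly \<one> has trivial increments and
  hence a trivial lift at all times. In this way boundary conditions on the parameter cube are
  inherited.\<close>

lemma approximate_homotopy:
  assumes X: "compact_space X" and L: "compact L" "L \<subseteq> unit_box"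
    and g: "continuous_map (prod_topology I01 (cube_space X)) M g"
    and g0: "\<forall>z\<in>topspace (cube_space X). g (0, z) = \<one>"
    and gL: "\<forall>s\<in>{0..1}. \<forall>t\<in>topspace X. \<forall>u\<in>L - open_box. g (s, (t, u)) = \<one>"
    and U: "openin M U" "\<one> \<in> U"
  shows "\<exists>h. continuous_map (prod_topology I01 X) T h \<and> (\<forall>t\<in>topspace X. h (0, t) = (\<lambda>x. \<one>)) \<and>
    (\<forall>s\<in>{0..1}. \<forall>t\<in>topspace X. (\<forall>s'\<in>{0..1}. \<forall>u\<in>unit_box. g (s', (t, u)) = \<one>) \<longrightarrow> h (s, t) = (\<lambda>x. \<one>)) \<and>
    (\<forall>t\<in>topspace X. \<forall>x. squash x \<in> L \<longrightarrow> inv (h (1, t) x) \<otimes> g (1, (t, squash x)) \<in> U)"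
proof -
  let ?Z = "cube_space X"
  obtain N :: nat where N: "N > 0"
    "\<And>i z. i < N \<Longrightarrow> z \<in> topspace ?Z \<Longrightarrow> inv (g (real i / real N, z)) \<otimes> g (real (Suc i) / real N, z) \<in> U0"
    by (rule subdivision[OF compact_cube_space[OF X] g U0]) (rule that; assumption)
  let ?g = "\<lambda>i z. g (real i / real N, z)"
  define ps where "ps = map (\<lambda>i z. inv (?g i z) \<otimes> ?g (Suc i) z) [0..<N]"
  have frac: "real i / real N \<in> {0..1}" if "i \<le> N" for i using that N(1) by simp
  have cont: "continuous_map ?Z M (\<lambda>z. g (s, z))" if "s \<in> {0..1}" for s
  proof -
    have "continuous_map ?Z (prod_topology I01 ?Z) (\<lambda>z. (s, z))"
      using that by (intro continuous_map_pairedI) (auto simp: id_def[symmetric])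
    from continuous_map_compose[OF this g] show ?thesis by (simp add: o_def)
  qed
  have small: "small_map X L p" if p: "p \<in> set ps" for p
  proof -
    obtain i where i: "i < N" "p = (\<lambda>z. inv (?g i z) \<otimes> ?g (Suc i) z)" using p unfolding ps_def by auto
    show ?thesis unfolding small_map_def i(2)
    proof (intro conjI ballI)
      show "continuous_map ?Z M (\<lambda>z. inv (?g i z) \<otimes> ?g (Suc i) z)"
        by (intro continuous_map_mult continuous_map_inv cont frac) (use i in auto)
      show "inv (?g i z) \<otimes> ?g (Suc i) z \<in> U0" if "z \<in> topspace ?Z" for z
        using N(2)[OF i(1) that] .
      show "inv (?g i (t, u)) \<otimes> ?g (Suc i) (t, u) = \<one>" if "t \<in> topspace X" "u \<in> L - open_box" for t u
        using gL frac[of i] frac[of "Suc i"] that i(1) by simp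
    qed
  qed
  have prod: "prod_maps ps z = g (1, z)" if z: "z \<in> topspace ?Z" for z
  proof -
    have in_H: "?g i z \<in> carrier H" if "i \<le> N" for i
      using continuous_map_carrier[OF cont[OF frac[OF that]] z] .
    have "prod_maps ps z = inv (?g 0 z) \<otimes> ?g N z"
      unfolding ps_def using prod_maps_telescope[of N ?g z N] in_H by simp
    then show ?thesis using bspec[OF g0 z] N(1) in_H[of N] by simp
  qed
  have "\<forall>p\<in>set ps. small_map X L p" using small by blast
  from approximate_product[OF X L this U] obtain h where h: "continuous_map (prod_topology I01 X) T h"
    "\<forall>t\<in>topspace X. h (0, t) = (\<lambda>x. \<one>)"
    "\<forall>s\<in>{0..1}. \<forall>t\<in>topspace X. (\<forall>p\<in>set ps. \<forall>u\<in>unit_box. p (t, u) = \<one>) \<longrightarrow> h (s, t) = (\<lambda>x. \<one>)"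
    "\<forall>t\<in>topspace X. \<forall>x. squash x \<in> L \<longrightarrow> inv (h (1, t) x) \<otimes> prod_maps ps (t, squash x) \<in> U"
    by (elim exE conjE) (rule that)
  have "h (s, t) = (\<lambda>x. \<one>)" if st: "s \<in> {0..1}" "t \<in> topspace X"
    and g1: "\<forall>s'\<in>{0..1}. \<forall>u\<in>unit_box. g (s', (t, u)) = \<one>" for s t
  proof -
    have "p (t, u) = \<one>" if p: "p \<in> set ps" and u: "u \<in> unit_box" for p u
    proof -
      obtain i where i: "i < N" "p = (\<lambda>z. inv (?g i z) \<otimes> ?g (Suc i) z)" using p unfolding ps_def by auto
      show ?thesis
        unfolding i(2) using g1 frac[of i] frac[of "Suc i"] u i(1) by simp
    qed
    then show ?thesis using h(3) st by simp
  qed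
  moreover have "inv (h (1, t) x) \<otimes> g (1, (t, squash x)) \<in> U"
    if tx: "t \<in> topspace X" "squash x \<in> L" for t x
  proof -
    have "inv (h (1, t) x) \<otimes> prod_maps ps (t, squash x) \<in> U" using h(4) tx by blast
    then show ?thesis using prod[of "(t, squash x)"] tx(1) squash_in_unit[of x] by simp
  qed
  ultimately show ?thesis using h(1,2) by (intro exI[of _ h]) simp
qed

text \<open>The lift at time 1 and \<open>f\<close> are both families in the mapping group, hence so
  is their quotient \<open>c\<close>. Its values lie in \<open>U0\<close>, and scaling its logarithm
  from 0 to 1 in the chart of T corrects the end without changing the start.\<close>

lemma lift_null_homotopy:
  assumes X: "compact_space X"
    and g: "continuous_map (prod_topology I01 (cube_space X)) M g"
    and g0: "\<forall>z\<in>topspace (cube_space X). g (0, z) = \<one>"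
    and gL: "\<forall>s\<in>{0..1}. \<forall>t\<in>topspace X. \<forall>u\<in>unit_box - open_box. g (s, (t, u)) = \<one>"
    and f: "continuous_map X T f"
    and g1: "\<forall>t\<in>topspace X. \<forall>u\<in>unit_box. g (1, (t, u)) = on_cube (f t) u"
  shows "\<exists>h. continuous_map (prod_topology I01 X) T h \<and>
    (\<forall>t\<in>topspace X. h (0, t) = (\<lambda>x. \<one>)) \<and> (\<forall>t\<in>topspace X. h (1, t) = f t) \<and>
    (\<forall>s\<in>{0..1}. \<forall>t\<in>topspace X. (\<forall>s'\<in>{0..1}. \<forall>u\<in>unit_box. g (s', (t, u)) = \<one>) \<longrightarrow> h (s, t) = (\<lambda>x. \<one>))"
proof -
  let ?IX = "prod_topology I01 X"
  from approximate_homotopy[OF X compact_cbox order_refl g g0 gL U0] obtain h where h: "continuous_map ?IX T h"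
    "\<forall>t\<in>topspace X. h (0, t) = (\<lambda>x. \<one>)"
    "\<forall>s\<in>{0..1}. \<forall>t\<in>topspace X. (\<forall>s'\<in>{0..1}. \<forall>u\<in>unit_box. g (s', (t, u)) = \<one>) \<longrightarrow> h (s, t) = (\<lambda>x. \<one>)"
    "\<forall>t\<in>topspace X. \<forall>x. squash x \<in> unit_box \<longrightarrow> inv (h (1, t) x) \<otimes> g (1, (t, squash x)) \<in> U0"
    by (elim exE conjE) (rule that)
  define c where "c t x = inv (h (1, t) x) \<otimes> f t x" for t x
  have "continuous_map X ?IX (\<lambda>t. (1, t))"
    by (intro continuous_map_pairedI) (auto simp: id_def[symmetric])
  from continuous_map_compose[OF this h(1)] have h1: "continuous_map X T (\<lambda>t. h (1, t))"
    by (simp add: o_def)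
  have c: "continuous_map X T c"
    unfolding c_def using continuous_map_G_mult[OF continuous_map_G_inv[OF h1] f] .
  have c_U0: "c t x \<in> U0" if "t \<in> topspace X" for t x
    using h(4) g1 that squash_in_unit[of x] unfolding c_def by simp
  define k where "k = (\<lambda>(s, t) x. h (s, t) x \<otimes> ex (s *\<^sub>R \<kappa> (c t x)))"
  have "continuous_map ?IX T (\<lambda>w x. ex (fst w *\<^sub>R \<kappa> (c (snd w) x)))"
    by (rule G_scale_continuous)
       (use c_U0 continuous_map_compose[OF continuous_map_snd c] continuous_map_fst_I01 in \<open>auto simp: o_def\<close>)
  from continuous_map_G_mult[OF h(1) this]
  have "continuous_map ?IX T k" unfolding k_def by (simp add: case_prod_unfold)
  moreover have "k (0, t) = (\<lambda>x. \<one>)" if "t \<in> topspace X" for t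
    unfolding k_def using h(2) that by simp
  moreover have "k (1, t) = f t" if t: "t \<in> topspace X" for t
  proof
    fix x
    have "ex (\<kappa> (c t x)) = c t x" using U0_D(1)[OF c_U0[OF t]] by simp
    then show "k (1, t) x = f t x"
      unfolding k_def c_def
      using maps_in[OF continuous_map_in_G[OF h1 t], of x] maps_in[OF continuous_map_in_G[OF f t], of x]
      by (simp add: cancel_left)
  qed
  moreover have "k (s, t) = (\<lambda>x. \<one>)"
    if st: "s \<in> {0..1}" "t \<in> topspace X" and triv: "\<forall>s'\<in>{0..1}. \<forall>u\<in>unit_box. g (s', (t, u)) = \<one>" for s t
  proof -
    have "h (s', t) = (\<lambda>x. \<one>)" if "s' \<in> {0..1}" for s' using h(3) that st(2) triv by blast
    then have hs: "h (s, t) = (\<lambda>x. \<one>)" "h (1, t) = (\<lambda>x. \<one>)" using st by auto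
    have "f t x = \<one>" for x
      using g1 triv st(2) squash_in_unit[of x] by fastforce
    then have "c t x = \<one>" for x unfolding c_def using hs by simp
    then show ?thesis unfolding k_def using hs by (simp add: \<kappa>_one)
  qed
  ultimately show ?thesis by (intro exI[of _ k]) simp
qed

text \<open>At w = \<one> the expression is \<one> for every c, and compactness of the interval of
  factors makes this uniform. It bounds the error that arises when a value near \<one> is scaled
  down by a cut-off.\<close>

lemma scaling_neighbourhood:
  assumes U: "openin M U" "\<one> \<in> U"
  obtains W where "openin M W" "\<one> \<in> W" "W \<subseteq> U0"
    "\<And>w c. w \<in> W \<Longrightarrow> c \<in> {0..1} \<Longrightarrow> inv (ex (c *\<^sub>R \<kappa> w)) \<otimes> w \<in> U"
proof -
  let ?X = "subtopology M U0"
  let ?XI = "prod_topology ?X I01"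
  have top: "topspace ?X = U0" using openin_subset[OF U0(1)] by auto
  have id: "continuous_map ?XI M fst"
    using continuous_map_fst[of ?X I01] by (simp add: continuous_map_in_subtopology)
  have "continuous_map ?XI euclideanreal snd"
    using continuous_map_snd[of ?X I01] by (simp add: continuous_map_in_subtopology)
  then have "continuous_map ?XI M (\<lambda>w. inv (ex (snd w *\<^sub>R \<kappa> (fst w))) \<otimes> fst w)"
    by (intro continuous_map_mult continuous_map_inv scale_continuous id) (auto simp: top)
  from openin_continuous_map_preimage[OF this U(1)]
  have "openin ?XI {w \<in> topspace ?XI. inv (ex (snd w *\<^sub>R \<kappa> (fst w))) \<otimes> fst w \<in> U}" .
  from openin_tube[OF _ this]
  have "openin ?X {w \<in> topspace ?X. \<forall>c\<in>topspace I01. (w, c) \<in> {w \<in> topspace ?XI. inv (ex (snd w *\<^sub>R \<kappa> (fst w))) \<otimes> fst w \<in> U}}"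
    by (simp add: compact_space_subtopology)
  also have "{w \<in> topspace ?X. \<forall>c\<in>topspace I01. (w, c) \<in> {w \<in> topspace ?XI. inv (ex (snd w *\<^sub>R \<kappa> (fst w))) \<otimes> fst w \<in> U}}
      = {w \<in> U0. \<forall>c\<in>{0..1}. inv (ex (c *\<^sub>R \<kappa> w)) \<otimes> w \<in> U}"
    unfolding topspace_prod_topology top by auto
  finally have "openin M {w \<in> U0. \<forall>c\<in>{0..1}. inv (ex (c *\<^sub>R \<kappa> w)) \<otimes> w \<in> U}"
    using U0(1) by (simp add: openin_open_subtopology)
  then show thesis
    by (rule that) (use U0(2) U(2) in \<open>auto simp: \<kappa>_one\<close>)
qed

text \<open>Over \<open>X0\<close> the family is trivial at time 1 but perhaps not earlier, so the
  approximation is only close to \<one> there. It remains close on a neighbourhood \<open>V\<close>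
  of \<open>X0\<close>, where its logarithm is multiplied by a function vanishing on
  \<open>X0\<close>.\<close>

lemma lift_contractible_family:
  assumes X: "compact_space X" "normal_space X" and X0: "closedin X X0"
    and g: "continuous_map (prod_topology I01 (cube_space X)) M g"
    and g0: "\<forall>z\<in>topspace (cube_space X). g (0, z) = \<one>"
    and gL: "\<forall>s\<in>{0..1}. \<forall>t\<in>topspace X. \<forall>u\<in>unit_box - open_box. g (s, (t, u)) = \<one>"
    and gX0: "\<forall>t\<in>X0. \<forall>u\<in>unit_box. g (1, (t, u)) = \<one>"
  shows "\<exists>f. continuous_map X T f \<and> (\<forall>t\<in>X0. f t = (\<lambda>x. \<one>)) \<and>
    (\<forall>t\<in>topspace X. \<forall>u\<in>unit_box. inv (on_cube (f t) u) \<otimes> g (1, (t, u)) \<in> U0)"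
proof -
  let ?IX = "prod_topology I01 X"
  \<comment> \<open>The final error is the error from flattening, controlled through
    \<open>W\<close>, times the error of the approximation, controlled through \<open>U2\<close>.
    \<open>U1\<close> leaves room for both within \<open>U0\<close>.\<close>
  obtain U1 where U1: "openin M U1" "\<one> \<in> U1" "\<And>x y. x \<in> U1 \<Longrightarrow> y \<in> U1 \<Longrightarrow> x \<otimes> y \<in> U0" "U1 \<subseteq> U0"
    using split_neighbourhood[OF U0] by metis
  obtain W where W: "openin M W" "\<one> \<in> W" "W \<subseteq> U0"
    "\<And>w c. w \<in> W \<Longrightarrow> c \<in> {0..1} \<Longrightarrow> inv (ex (c *\<^sub>R \<kappa> w)) \<otimes> w \<in> U1"
    using scaling_neighbourhood[OF U1(1,2)] by metis
  have "openin M (W \<inter> U1)" "\<one> \<in> W \<inter> U1" using W U1 by auto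
  then obtain U2 where U2: "openin M U2" "\<one> \<in> U2" "\<And>x y. x \<in> U2 \<Longrightarrow> y \<in> U2 \<Longrightarrow> inv x \<otimes> y \<in> W \<inter> U1"
    "U2 \<subseteq> W \<inter> U1"
    using split_neighbourhood_inv by metis
  from approximate_homotopy[OF X(1) compact_cbox order_refl g g0 gL U2(1,2)] obtain h where h: "continuous_map ?IX T h"
    "\<forall>t\<in>topspace X. \<forall>x. squash x \<in> unit_box \<longrightarrow> inv (h (1, t) x) \<otimes> g (1, (t, squash x)) \<in> U2"
    by (elim exE conjE) (rule that)
  define f' where "f' t = h (1, t)" for t
  have "continuous_map X ?IX (\<lambda>t. (1, t))"
    by (intro continuous_map_pairedI) (auto simp: id_def[symmetric])
  from continuous_map_compose[OF this h(1)] have f': "continuous_map X T f'"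
    unfolding f'_def by (simp add: o_def)
  have f'_in: "f' t x \<in> carrier H" if "t \<in> topspace X" for t x
    using maps_in[OF continuous_map_in_G[OF f' that]] .
  have f'g: "inv (f' t x) \<otimes> g (1, (t, squash x)) \<in> U2" if "t \<in> topspace X" for t x
    unfolding f'_def using h(2) that squash_in_unit by blast
  have X0_sub: "X0 \<subseteq> topspace X" using X0 by (rule closedin_subset)
  have "\<exists>N. openin X N \<and> t \<in> N \<and> (\<forall>t'\<in>N. \<forall>x. f' t' x \<in> W)" if t: "t \<in> X0" for t
  proof -
    have tX: "t \<in> topspace X" using t X0_sub by blast
    obtain N where N: "openin X N" "t \<in> N" "\<And>t' x. t' \<in> N \<Longrightarrow> inv (f' t x) \<otimes> f' t' x \<in> U2"
      using uniform_neighbourhood[OF f' tX U2(1,2)] by blast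
    have "f' t' x \<in> W" if "t' \<in> N" for t' x
    proof -
      have t'X: "t' \<in> topspace X" using N(1) that openin_subset by blast
      \<comment> \<open>Over \<open>X0\<close> the target is \<one>, so the error of the
        approximation is the inverse of \<open>f'\<close> itself.\<close>
      have "inv (f' t x) \<in> U2"
        using f'g[OF tX, of x] gX0 t squash_in_unit[of x] f'_in[OF tX, of x] by simp
      then have "inv (inv (f' t x)) \<otimes> (inv (f' t x) \<otimes> f' t' x) \<in> W \<inter> U1"
        by (intro U2(3) N(3) that)
      then show ?thesis using f'_in[OF tX, of x] f'_in[OF t'X, of x] by (simp add: cancel_left)
    qed
    then show ?thesis using N(1,2) by blast
  qed
  then obtain N where N: "\<And>t. t \<in> X0 \<Longrightarrow> openin X (N t) \<and> t \<in> N t \<and> (\<forall>t'\<in>N t. \<forall>x. f' t' x \<in> W)" by metis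
  define V where "V = (\<Union>t\<in>X0. N t)"
  have V: "openin X V" "X0 \<subseteq> V" "\<And>t x. t \<in> V \<Longrightarrow> f' t x \<in> W"
    unfolding V_def using N by auto
  have "closedin X (topspace X - V)" using V(1) by blast
  moreover have "disjnt X0 (topspace X - V)" using V(2) by (auto simp: disjnt_def)
  ultimately obtain \<rho>0 where \<rho>0: "continuous_map X I01 \<rho>0" "\<rho>0 ` X0 \<subseteq> {0}" "\<rho>0 ` (topspace X - V) \<subseteq> {1}"
    using Urysohn_lemma[OF X(2) X0, of "topspace X - V" 0 1] by auto
  have \<rho>0_cont: "continuous_map X euclideanreal \<rho>0" and \<rho>0_in: "\<And>t. t \<in> topspace X \<Longrightarrow> \<rho>0 t \<in> {0..1}"
    using \<rho>0(1) by (auto simp: continuous_map_in_subtopology)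
  \<comment> \<open>Truncation makes the factor equal to 1 on the whole open set where
    \<open>\<rho>0\<close> exceeds 1/2. The flattened and the original map therefore agree on an
    open overlap and can be pasted.\<close>
  define \<rho> where "\<rho> t = min 1 (2 * \<rho>0 t)" for t
  have \<rho>: "continuous_map X euclideanreal \<rho>" "\<And>t. t \<in> topspace X \<Longrightarrow> \<rho> t \<in> {0..1}"
    unfolding \<rho>_def using \<rho>0_cont \<rho>0_in by (auto intro!: continuous_map_real_min continuous_map_real_mult_left)
  define V' where "V' = {t \<in> topspace X. \<rho>0 t \<in> {1/2<..}}"
  have V': "openin X V'" unfolding V'_def
    by (rule openin_continuous_map_preimage[OF \<rho>0_cont]) simp
  define f where "f t = (if t \<in> V then (\<lambda>x. ex (\<rho> t *\<^sub>R \<kappa> (f' t x))) else f' t)" for t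
  have f_V': "f t = f' t" if "t \<in> V'" for t
  proof -
    have "\<rho> t = 1" using that unfolding V'_def \<rho>_def by auto
    moreover have "f' t x \<in> P" if "t \<in> V" for x using V(3)[OF that] W(3) U0_D(1) by blast
    ultimately show ?thesis unfolding f_def by (auto simp: fun_eq_iff)
  qed
  have f: "continuous_map X T f"
  proof (rule pasting_lemma[where I = "{True, False}" and T = "\<lambda>b. if b then V else V'"
      and f = "\<lambda>b t. if b then (\<lambda>x. ex (\<rho> t *\<^sub>R \<kappa> (f' t x))) else f' t"])
    fix b
    show "openin X (if b then V else V')" using V(1) V' by simp
    have "continuous_map (subtopology X V) T (\<lambda>t x. ex (\<rho> t *\<^sub>R \<kappa> (f' t x)))"
      by (rule G_scale_continuous)
         (use V(3) W(3) \<rho>(2) continuous_map_from_subtopology[OF f'] continuous_map_from_subtopology[OF \<rho>(1)] in auto)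
    then show "continuous_map (subtopology X (if b then V else V')) T
        (\<lambda>t. if b then (\<lambda>x. ex (\<rho> t *\<^sub>R \<kappa> (f' t x))) else f' t)"
      using continuous_map_from_subtopology[OF f'] by simp
  next
    fix i j t assume "t \<in> topspace X \<inter> (if i then V else V') \<inter> (if j then V else V')"
    then show "(if i then (\<lambda>x. ex (\<rho> t *\<^sub>R \<kappa> (f' t x))) else f' t) = (if j then (\<lambda>x. ex (\<rho> t *\<^sub>R \<kappa> (f' t x))) else f' t)"
      using f_V'[of t] unfolding f_def by (auto split: if_splits)
  next
    fix t assume t: "t \<in> topspace X"
    show "\<exists>b. b \<in> {True, False} \<and> t \<in> (if b then V else V') \<and>
        f t = (if b then (\<lambda>x. ex (\<rho> t *\<^sub>R \<kappa> (f' t x))) else f' t)"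
    proof (cases "t \<in> V")
      case False
      then have "\<rho>0 t = 1" using \<rho>0(3) t by auto
      then have "t \<in> V'" unfolding V'_def using t by simp
      then show ?thesis using False unfolding f_def by auto
    qed (auto simp: f_def)
  qed
  show ?thesis
  proof (intro exI conjI ballI)
    show "continuous_map X T f" by fact
    fix t assume t: "t \<in> X0"
    then have "\<rho> t = 0" "t \<in> V" using \<rho>0(2) V(2) unfolding \<rho>_def by auto
    then show "f t = (\<lambda>x. \<one>)" unfolding f_def by simp
  next
    fix t and u :: "real ^ 'd" assume t: "t \<in> topspace X" and u: "u \<in> unit_box"
    show "inv (on_cube (f t) u) \<otimes> g (1, (t, u)) \<in> U0"
    proof (cases "u \<in> open_box")
      case True
      then obtain x where x: "u = squash x" "on_cube (f t) u = f t x" using on_cube_interior by blast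
      have g_in: "g (1, (t, u)) \<in> carrier H" using continuous_map_carrier[OF g, of "(1, (t, u))"] t u by simp
      show ?thesis
      proof (cases "t \<in> V")
        case True
        have w: "f' t x \<in> W" using V(3)[OF True] .
        have "f t x \<in> carrier H" using maps_in[OF continuous_map_in_G[OF f t]] .
        moreover have "inv (f t x) \<otimes> f' t x \<in> U1"
          unfolding f_def using True W(4)[OF w \<rho>(2)[OF t]] by simp
        then have "inv (f t x) \<otimes> f' t x \<otimes> (inv (f' t x) \<otimes> g (1, (t, u))) \<in> U0"
          using f'g[OF t, of x] U2(4) x(1) by (intro U1(3)) auto
        ultimately show ?thesis using x(2) f'_in[OF t, of x] g_in by (simp add: m_assoc cancel_left)
      next
        case False
        then have "f t x = f' t x" unfolding f_def by simp
        then show ?thesis using f'g[OF t, of x] x U2(4) U1(4) by auto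
      qed
    next
      case False
      then have "g (1, (t, u)) = \<one>" using gL t u by simp
      then show ?thesis using False U0(2) by (simp add: on_cube_boundary)
    qed
  qed
qed

text \<open>In the shell between the boxes \<open>K m\<close> and \<open>K (m + 1)\<close> both g
  and its approximation are close to \<one>. There the approximation can be scaled down, and further
  out \<one> is itself a good approximation of g.\<close>

lemma lift_map:
  assumes g: "continuous_map (top_of_set unit_box) M g"
    and g1: "\<And>u. u \<in> unit_box - open_box \<Longrightarrow> g u = \<one>"
  obtains \<gamma> where "\<gamma> \<in> \<G>" "\<And>u. u \<in> unit_box \<Longrightarrow> inv (on_cube \<gamma> u) \<otimes> g u \<in> U0"
proof -
  obtain U1 where U1: "openin M U1" "\<one> \<in> U1" "\<And>x y. x \<in> U1 \<Longrightarrow> y \<in> U1 \<Longrightarrow> x \<otimes> y \<in> U0" "U1 \<subseteq> U0"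
    using split_neighbourhood[OF U0] by metis
  obtain W where W: "openin M W" "\<one> \<in> W" "W \<subseteq> U0"
    "\<And>w c. w \<in> W \<Longrightarrow> c \<in> {0..1} \<Longrightarrow> inv (ex (c *\<^sub>R \<kappa> w)) \<otimes> w \<in> U1"
    using scaling_neighbourhood[OF U1(1,2)] by metis
  have "openin M (W \<inter> U1)" "\<one> \<in> W \<inter> U1" using W U1 by auto
  then obtain U2 where U2: "openin M U2" "\<one> \<in> U2" "\<And>x y. x \<in> U2 \<Longrightarrow> y \<in> U2 \<Longrightarrow> x \<otimes> inv y \<in> W \<inter> U1"
    "U2 \<subseteq> W \<inter> U1"
    using split_neighbourhood_inv by metis
  have "openin (top_of_set unit_box) {u \<in> topspace (top_of_set unit_box). g u \<in> U2}"
    by (rule openin_continuous_map_preimage[OF g U2(1)])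
  then obtain O' where O': "open O'" "{u \<in> unit_box. g u \<in> U2} = unit_box \<inter> O'"
    unfolding openin_open by auto
  have "unit_box - {u \<in> unit_box. g u \<in> U2} = unit_box - O'" using O'(2) by blast
  then have "compact (unit_box - {u \<in> unit_box. g u \<in> U2})"
    using O'(1) by (simp add: compact_diff)
  moreover have "unit_box - {u \<in> unit_box. g u \<in> U2} \<subseteq> open_box"
    using g1 U2(2) by auto
  ultimately obtain R where R: "\<And>x i. squash x \<in> unit_box - {u \<in> unit_box. g u \<in> U2} \<Longrightarrow> \<bar>x $ i\<bar> \<le> R"
    using compact_subset_box_bounded by metis
  obtain m :: nat where m: "R \<le> real m" using real_arch_simple by blast
  define K where "K m = {x :: real ^ 'd. \<forall>i. \<bar>x $ i\<bar> \<le> m}" for m :: real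
  have K_compact: "compact (K m)" for m
  proof -
    have "K m = cbox (\<chi> i. - m) (\<chi> i. m)"
      unfolding K_def by (auto simp: mem_box_cart abs_le_iff minus_le_iff)
    then show ?thesis by simp
  qed
  have small: "g (squash x) \<in> U2" if "x \<notin> K (real m)" for x
  proof (rule ccontr)
    assume "g (squash x) \<notin> U2"
    then have "\<bar>x $ i\<bar> \<le> R" for i using R[of x i] squash_in_unit by auto
    then have "x \<in> K (real m)" unfolding K_def using m order_trans by blast
    then show False using that by blast
  qed
  \<comment> \<open>Compact in the open box, so that the boundary condition of
    \<open>approximate_homotopy\<close> is void. It extends one unit beyond \<open>K m\<close>,
    outside of which g already takes values in \<open>U2\<close>.\<close>
  let ?L = "squash ` K (real m + 1)"
  \<comment> \<open>A one-point parameter space: a family without parameters.\<close>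
  let ?X = "discrete_topology {()}"
  let ?Z = "cube_space ?X"
  define h where "h = (\<lambda>(s :: real, (t :: unit, u)). g (s *\<^sub>R u))"
  have scale_in: "s *\<^sub>R u \<in> unit_box" if "s \<in> {0..1}" "u \<in> unit_box" for s and u :: "real ^ 'd"
    using that by (auto simp: mem_box_cart mult_le_one)
  have "continuous_map (prod_topology I01 ?Z) (top_of_set unit_box) (\<lambda>w. fst w *\<^sub>R snd (snd w))"
  proof -
    have "continuous_map (prod_topology I01 ?Z) euclidean (\<lambda>w. snd (snd w))"
      using continuous_map_compose[OF continuous_map_snd[of I01 ?Z] continuous_map_snd]
      by (simp add: continuous_map_in_subtopology o_def)
    then have "continuous_map (prod_topology I01 ?Z) euclidean (\<lambda>w. fst w *\<^sub>R snd (snd w))"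
      using continuous_map_fst_I01[of ?Z] unfolding continuous_map_atin limitin_canonical_iff
      by (auto intro: tendsto_scaleR)
    then show ?thesis using scale_in by (auto simp: continuous_map_in_subtopology)
  qed
  from continuous_map_compose[OF this g] have h: "continuous_map (prod_topology I01 ?Z) M h"
    unfolding h_def by (simp add: o_def case_prod_unfold)
  have "0 \<in> unit_box - (open_box :: (real ^ 'd) set)" by (simp add: mem_box_cart)
  then have g0: "g 0 = \<one>" by (rule g1)
  have "compact ?L" by (intro compact_continuous_image continuous_on_squash K_compact)
  moreover have "?L \<subseteq> unit_box" using squash_in_unit by blast
  moreover have "\<forall>z\<in>topspace ?Z. h (0, z) = \<one>" unfolding h_def by (simp add: case_prod_unfold g0)
  moreover have "\<forall>s\<in>{0..1}. \<forall>t\<in>topspace ?X. \<forall>u\<in>?L - open_box. h (s, (t, u)) = \<one>"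
    using squash_in by blast
  ultimately have "\<exists>k. continuous_map (prod_topology I01 ?X) T k \<and> (\<forall>t\<in>topspace ?X. k (0, t) = (\<lambda>x. \<one>)) \<and>
    (\<forall>s\<in>{0..1}. \<forall>t\<in>topspace ?X. (\<forall>s'\<in>{0..1}. \<forall>u\<in>unit_box. h (s', (t, u)) = \<one>) \<longrightarrow> k (s, t) = (\<lambda>x. \<one>)) \<and>
    (\<forall>t\<in>topspace ?X. \<forall>x. squash x \<in> ?L \<longrightarrow> inv (k (1, t) x) \<otimes> h (1, (t, squash x)) \<in> U2)"
    using h U2(1,2) by (intro approximate_homotopy) (auto simp: compact_space_discrete_topology)
  then obtain k where k: "continuous_map (prod_topology I01 ?X) T k"
    "\<forall>t\<in>topspace ?X. \<forall>x. squash x \<in> ?L \<longrightarrow> inv (k (1, t) x) \<otimes> h (1, (t, squash x)) \<in> U2"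
    by (elim exE conjE) (rule that)
  define \<gamma> where "\<gamma> = k (1, ())"
  have \<gamma>: "\<gamma> \<in> \<G>" unfolding \<gamma>_def using continuous_map_in_G[OF k(1)] by simp
  have \<gamma>g: "inv (\<gamma> x) \<otimes> g (squash x) \<in> U2" if "x \<in> K (real m + 1)" for x
    using k(2) that unfolding \<gamma>_def h_def by simp
  have g_in: "g (squash x) \<in> carrier H" for x
    using continuous_map_carrier[OF g, of "squash x"] squash_in_unit[of x] by simp
  have shell: "\<gamma> x \<in> W" if "x \<in> K (real m + 1)" "x \<notin> K (real m)" for x
  proof -
    \<comment> \<open>This product cancels to \<open>\<gamma> x\<close>.\<close>
    have "g (squash x) \<otimes> inv (inv (\<gamma> x) \<otimes> g (squash x)) \<in> W \<inter> U1"
      by (intro U2(3) small \<gamma>g that)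
    then show ?thesis using g_in[of x] maps_in[OF \<gamma>, of x] by (simp add: inv_mult_group cancel_left)
  qed
  have "\<exists>\<gamma>'\<in>\<G>. \<forall>x. if \<forall>i. \<bar>x $ i\<bar> \<le> real m then \<gamma>' x = \<gamma> x
          else if \<forall>i. \<bar>x $ i\<bar> \<le> real m + 1 then \<exists>c\<in>{0..1}. \<gamma>' x = ex (c *\<^sub>R \<kappa> (\<gamma> x))
          else \<gamma>' x = \<one>"
    by (rule cutoff[OF \<gamma> q0]) (use shell W(3) in \<open>auto simp: K_def U0_def\<close>)
  then obtain \<gamma>' where \<gamma>': "\<gamma>' \<in> \<G>" "\<And>x. x \<in> K (real m) \<Longrightarrow> \<gamma>' x = \<gamma> x"
    "\<And>x. x \<notin> K (real m) \<Longrightarrow> x \<in> K (real m + 1) \<Longrightarrow> \<exists>c\<in>{0..1}. \<gamma>' x = ex (c *\<^sub>R \<kappa> (\<gamma> x))"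
    "\<And>x. x \<notin> K (real m) \<Longrightarrow> x \<notin> K (real m + 1) \<Longrightarrow> \<gamma>' x = \<one>"
    unfolding K_def mem_Collect_eq by metis
  show thesis
  proof (rule that[OF \<gamma>'(1)])
    fix u :: "real ^ 'd" assume u: "u \<in> unit_box"
    show "inv (on_cube \<gamma>' u) \<otimes> g u \<in> U0"
    proof (cases "u \<in> open_box")
      case True
      then obtain x where x: "u = squash x" "on_cube \<gamma>' u = \<gamma>' x" using on_cube_interior by blast
      \<comment> \<open>The core carries only the approximation error, the shell in addition the
        scaling error, and outside g itself is the error.\<close>
      consider "x \<in> K (real m)" | "x \<notin> K (real m)" "x \<in> K (real m + 1)"
        | "x \<notin> K (real m)" "x \<notin> K (real m + 1)" by blast
      then have "inv (\<gamma>' x) \<otimes> g (squash x) \<in> U0"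
      proof cases
        case 1
        then have "x \<in> K (real m + 1)" unfolding K_def by (auto intro: order_trans)
        then show ?thesis using \<gamma>g \<gamma>'(2)[OF 1] U2(4) U1(4) by auto
      next
        case 2
        obtain c where c: "c \<in> {0..1}" "\<gamma>' x = ex (c *\<^sub>R \<kappa> (\<gamma> x))" using \<gamma>'(3)[OF 2] by blast
        have "inv (\<gamma>' x) \<otimes> \<gamma> x \<otimes> (inv (\<gamma> x) \<otimes> g (squash x)) \<in> U0"
          using W(4)[OF shell[OF 2(2,1)] c(1)] \<gamma>g[OF 2(2)] U2(4) c(2) by (intro U1(3)) auto
        then show ?thesis using maps_in[OF \<gamma>, of x] maps_in[OF \<gamma>'(1), of x] g_in[of x]
          by (simp add: m_assoc cancel_left)
      next
        case 3
        then show ?thesis using \<gamma>'(4)[OF 3] small[OF 3(1)] g_in[of x] U2(4) U1(4) by auto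
      qed
      then show ?thesis using x by simp
    next
      case False
      then show ?thesis using g1[of u] u U0(2) by (simp add: on_cube_boundary)
    qed
  qed
qed

end

section \<open>Weighted mapping groups are mapping groups\<close>

lemma lie_group_topological_group:
  assumes "lie_group H M E A"
  shows "topological_group H M"
proof -
  interpret group H using assms by (simp add: lie_group_def)
  show ?thesis
    using assms by unfold_locales (auto simp: lie_group_def manifold_Cr_map_def)
qed

locale weighted_mapping_group =
  fixes n :: "real ^ 'd::finite \<Rightarrow> real" and r :: enat and W :: "(real ^ 'd \<Rightarrow> real) set"
    and H :: "('h, 'z) monoid_scheme" and M :: "'h topology" and E :: "'e::real_vector topology"
    and A :: "('h, 'e) chart set" and T :: "(real ^ 'd \<Rightarrow> 'h) topology"
    and B :: "(real ^ 'd \<Rightarrow> 'h, real ^ 'd \<Rightarrow> ('h, 'e) tangent) chart set"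
    and P :: "'h set" and \<kappa> :: "'h \<Rightarrow> ('h, 'e) tangent"
  assumes norm: "is_norm n"
    and smooth_weights: "\<And>f. f \<in> W \<Longrightarrow> Cr_on \<infinity> euclidean euclideanreal UNIV f"
    and one_in_W: "(\<lambda>x. 1) \<in> W"
    and weights_nonneg: "\<And>f x. f \<in> W \<Longrightarrow> f x \<ge> 0"
    and H_lie: "lie_group H M E A"
    and G_lie: "lie_group (weighted_group n r W H M E A) T
      (weighted_space n r W UNIV (lie_algebra_space H E A)) B"
    and \<kappa>_chart: "centred_chart H M E A P \<kappa>"
    and G_manifold_chart: "manifold_chart T (weighted_space n r W UNIV (lie_algebra_space H E A)) B
      (weighted_space n r W UNIV (lie_algebra_space H E A))
      {\<gamma> \<in> carrier (weighted_group n r W H M E A). range \<gamma> \<subseteq> P} (\<lambda>\<gamma>. \<kappa> \<circ> \<gamma>)"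
    and G_image: "(\<lambda>\<gamma>. \<kappa> \<circ> \<gamma>) ` {\<gamma> \<in> carrier (weighted_group n r W H M E A). range \<gamma> \<subseteq> P}
      = {\<eta> \<in> topspace (weighted_space n r W UNIV (lie_algebra_space H E A)). range \<eta> \<subseteq> \<kappa> ` P}"
begin

abbreviation "Y \<equiv> lie_algebra_space H E A"
abbreviation "\<G> \<equiv> weighted_group_maps n r W H M E A"

lemma weighted_group_eq: "weighted_group n r W H M E A = pointwise_group H \<G>"
  by (simp add: weighted_group_def pointwise_group_def)

sublocale mfd: smooth_mfd M E A
  using H_lie by unfold_locales (simp add: lie_group_def)

sublocale H: topological_group H M
  using H_lie by (rule lie_group_topological_group)

sublocale w: weighted n r W Y
proof unfold_locales
  show "locally_convex_space Y"
    by (rule mfd.tangent_space_lcs) (simp add: H.topspace_carrier)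
  show "locally_convex_space (weighted_space n r W UNIV Y)"
    using G_lie by (simp add: lie_group_def smooth_manifold_def)
qed (use norm smooth_weights one_in_W weights_nonneg in auto)

lemma chart_of_P: "chart_homeomorphism M Y P \<kappa>" "\<one>\<^bsub>H\<^esub> \<in> P" "\<kappa> \<one>\<^bsub>H\<^esub> = 0"
  using \<kappa>_chart by (auto simp: centred_chart_def manifold_chart_def)

lemma \<kappa>_smooth:
  assumes "(U, \<phi>) \<in> A"
  shows "smooth_map E Y (\<phi> ` (U \<inter> P)) (\<kappa> \<circ> inv_into U \<phi>)"
    and "smooth_map Y E (\<kappa> ` (P \<inter> U)) (\<phi> \<circ> inv_into P \<kappa>)"
proof -
  have "\<forall>(U, \<phi>)\<in>A. Cr_on \<infinity> E Y (\<phi> ` (U \<inter> P)) (\<kappa> \<circ> inv_into U \<phi>) \<and>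
                Cr_on \<infinity> Y E (\<kappa> ` (P \<inter> U)) (\<phi> \<circ> inv_into P \<kappa>)"
    using \<kappa>_chart by (simp add: centred_chart_def manifold_chart_def)
  from bspec[OF this assms]
  have Cr: "Cr_on \<infinity> E Y (\<phi> ` (U \<inter> P)) (\<kappa> \<circ> inv_into U \<phi>)"
    "Cr_on \<infinity> Y E (\<kappa> ` (P \<inter> U)) (\<phi> \<circ> inv_into P \<kappa>)" by simp_all
  have P: "openin M P" using chart_of_P(1) by (simp add: chart_homeomorphism_def)
  have U: "openin M U" using mfd.chart_open[OF assms] .
  have "openin E (\<phi> ` (U \<inter> P))" by (rule chart_image_openin[OF mfd.chart[OF assms]]) (use U P in auto)
  with Cr(1) show "smooth_map E Y (\<phi> ` (U \<inter> P)) (\<kappa> \<circ> inv_into U \<phi>)" by unfold_locales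
  have "openin Y (\<kappa> ` (P \<inter> U))" by (rule chart_image_openin[OF chart_of_P(1)]) (use U P in auto)
  with Cr(2) show "smooth_map Y E (\<kappa> ` (P \<inter> U)) (\<phi> \<circ> inv_into P \<kappa>)" by unfold_locales
qed

lemma map_continuous: "\<gamma> \<in> \<G> \<Longrightarrow> continuous_map euclidean M \<gamma>"
  by (simp add: weighted_group_maps_def manifold_Cr_map_def)

lemma map_PC:
  assumes "\<gamma> \<in> \<G>" "(V, \<psi>) \<in> A" "enat k \<le> r"
  shows "PC E k (\<gamma> -` V) (\<lambda>ys x. \<psi> (\<gamma> x))"
proof -
  have "\<forall>(V, \<psi>)\<in>A. Cr_on r euclidean E (id ` (UNIV \<inter> \<gamma> -` V)) (\<psi> \<circ> \<gamma> \<circ> inv_into UNIV id)"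
    using assms(1) by (simp add: weighted_group_maps_def manifold_Cr_map_def)
  from bspec[OF this assms(2)]
  have "Cr_on r euclidean E (\<gamma> -` V) (\<psi> \<circ> \<gamma>)"
    by (simp add: inv_id[unfolded id_def] comp_def)
  from mfd.Cr_on_imp_PC[OF this assms(3)] show ?thesis by (simp add: o_def)
qed

text \<open>The chart \<open>\<kappa>'\<close> comes with \<gamma> and may differ from
  \<open>\<kappa>\<close>. Off K and the support of h the cut-off function is the logarithm of
  \<gamma> in this chart, and its seminorm for the weight 1 and order 0 tends to 0.\<close>

lemma vanishing_at_infinity:
  assumes \<gamma>: "\<gamma> \<in> \<G>" and U: "openin M U" "\<one>\<^bsub>H\<^esub> \<in> U"
  shows "\<exists>K. compact K \<and> (\<forall>x. x \<notin> K \<longrightarrow> \<gamma> x \<in> U)"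
proof -
  obtain P' \<kappa>' K h where ch: "centred_chart H M E A P' \<kappa>'" and K: "compact K" "\<gamma> ` (- K) \<subseteq> P'"
    and h: "compact (closure {x. h x \<noteq> 0})"
    and \<zeta>: "(\<lambda>x. if x \<in> - K then (1 - h x) *\<^sub>R \<kappa>' (\<gamma> x) else 0) \<in> weighted_maps_vanishing n r W (- K) Y"
    using \<gamma> unfolding weighted_group_maps_def by blast
  define \<zeta> where "\<zeta> = (\<lambda>x. if x \<in> - K then (1 - h x) *\<^sub>R \<kappa>' (\<gamma> x) else 0)"
  have ch': "chart_homeomorphism M Y P' \<kappa>'" "\<one>\<^bsub>H\<^esub> \<in> P'" "\<kappa>' \<one>\<^bsub>H\<^esub> = 0"
    using ch by (auto simp: centred_chart_def manifold_chart_def)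
  have P': "openin M P'" using ch'(1) by (simp add: chart_homeomorphism_def)
  have "openin Y (\<kappa>' ` (P' \<inter> U))" by (rule chart_image_openin[OF ch'(1)]) (use P' U in auto)
  moreover have "0 \<in> \<kappa>' ` (P' \<inter> U)" using ch'(2,3) U(2) by force
  ultimately obtain q where q: "continuous_seminorm Y q" "{y \<in> topspace Y. q y < 1} \<subseteq> \<kappa>' ` (P' \<inter> U)"
    using w.cod.seminorm_below by blast
  have r0: "enat 0 \<le> r" by (simp add: zero_enat_def[symmetric])
  have "\<forall>f\<in>W. \<forall>k q. enat k \<le> r \<and> continuous_seminorm Y q \<longrightarrow>
      ((\<lambda>z. ennreal (f (the z)) * poly_norm n q (gateaux Y k \<zeta> (the z))) \<longlongrightarrow> 0)
        (atin (Alexandroff_compactification (top_of_set (- K))) None)"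
    using \<zeta> unfolding weighted_maps_vanishing_def \<zeta>_def by simp
  from bspec[OF this one_in_W, rule_format, of 0 q] r0 q(1)
  have "((\<lambda>z. ennreal 1 * poly_norm n q (gateaux Y 0 \<zeta> (the z))) \<longlongrightarrow> 0)
        (atin (Alexandroff_compactification (top_of_set (- K))) None)" by simp
  then have "((\<lambda>z. ennreal (q (\<zeta> (the z)))) \<longlongrightarrow> 0) (atin (Alexandroff_compactification (top_of_set (- K))) None)"
    by (simp add: w.poly_norm_gateaux_0)
  from order_tendstoD(2)[OF this, of 1]
  have "\<forall>\<^sub>F z in atin (Alexandroff_compactification (top_of_set (- K))) None. ennreal (q (\<zeta> (the z))) < 1"
    by simp
  then obtain C where C: "compact C" "\<forall>x\<in>- K - C. ennreal (q (\<zeta> x)) < 1"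
    unfolding eventually_atin_Alexandroff by auto
  show ?thesis
  proof (intro exI[of _ "K \<union> C \<union> closure {x. h x \<noteq> 0}"] conjI allI impI)
    show "compact (K \<union> C \<union> closure {x. h x \<noteq> 0})" by (intro compact_Un K C h)
    fix x assume x: "x \<notin> K \<union> C \<union> closure {x. h x \<noteq> 0}"
    then have "h x = 0" using closure_subset[of "{x. h x \<noteq> 0}"] by blast
    then have "\<zeta> x = \<kappa>' (\<gamma> x)" using x unfolding \<zeta>_def by simp
    moreover have "ennreal (q (\<zeta> x)) < 1" using C(2) x by simp
    then have "q (\<zeta> x) < 1" using ennreal_leI[of 1 "q (\<zeta> x)"] by (cases "q (\<zeta> x) < 1") auto
    moreover have \<gamma>x: "\<gamma> x \<in> P'" using K(2) x by blast
    moreover from this have "\<kappa>' (\<gamma> x) \<in> topspace Y"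
      using ch'(1) openin_subset unfolding chart_homeomorphism_def by blast
    ultimately have "\<kappa>' (\<gamma> x) \<in> \<kappa>' ` (P' \<inter> U)" using q(2) by auto
    then show "\<gamma> x \<in> U" using \<gamma>x chart_inj[OF ch'(1)] by (auto dest: inj_onD)
  qed
qed

text \<open>Here the chain rule enters: \<open>\<kappa> \<circ> \<gamma>\<close> is of class \<open>C\<^sup>r\<close> although \<open>\<kappa>\<close> need not belong to the atlas,
  and the modified map has to be checked in all charts of the atlas.\<close>

lemma cut_off:
  assumes \<gamma>: "\<gamma> \<in> \<G>" and q: "continuous_seminorm Y q" "{y \<in> topspace Y. q y < 1} \<subseteq> \<kappa> ` P"
    and shell: "\<And>x. (\<forall>i. \<bar>x $ i\<bar> \<le> real m + 1) \<Longrightarrow> \<not> (\<forall>i. \<bar>x $ i\<bar> \<le> real m) \<Longrightarrow> \<gamma> x \<in> P \<and> q (\<kappa> (\<gamma> x)) < 1"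
  shows "\<exists>\<gamma>'\<in>\<G>. \<forall>x. if \<forall>i. \<bar>x $ i\<bar> \<le> real m then \<gamma>' x = \<gamma> x
          else if \<forall>i. \<bar>x $ i\<bar> \<le> real m + 1 then \<exists>c\<in>{0..1}. \<gamma>' x = inv_into P \<kappa> (c *\<^sub>R \<kappa> (\<gamma> x))
          else \<gamma>' x = \<one>\<^bsub>H\<^esub>"
proof -
  interpret q: csn Y q by (rule w.cod.csnI[OF q(1)])
  let ?ex = "inv_into P \<kappa>"
  have inj: "inj_on \<kappa> P" by (rule chart_inj[OF chart_of_P(1)])
  have ex: "?ex (\<kappa> p) = p" if "p \<in> P" for p using inv_into_f_f[OF inj that] .
  have ex0: "?ex 0 = \<one>\<^bsub>H\<^esub>" using ex[OF chart_of_P(2)] chart_of_P(3) by simp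
  have \<kappa>_top: "\<kappa> p \<in> topspace Y" if "p \<in> P" for p
    using chart_of_P(1) that openin_subset unfolding chart_homeomorphism_def by blast
  \<comment> \<open>It is 1 while all coordinates are below m + 1/4 in absolute value and 0 once one
    exceeds m + 3/4, so the transition lies well inside the shell where \<gamma> takes values in the
    chart.\<close>
  define \<theta> :: "real ^ 'd \<Rightarrow> real" where "\<theta> = box_bump (real m) 1 0"
  have \<theta>_test: "test_function \<theta>" unfolding \<theta>_def by (rule test_function_box_bump) auto
  have \<theta>_bounds: "\<theta> x \<in> {0..1}" for x unfolding \<theta>_def using box_bump_bounds[of "real m" 1 0 x] by simp
  define K where "K a = {x :: real ^ 'd. \<forall>i. \<bar>x $ i\<bar> \<le> a}" for a :: real
  have K_cbox: "K a = cbox (\<chi> i. - a) (\<chi> i. a)" for a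
    unfolding K_def by (auto simp: mem_box_cart abs_le_iff minus_le_iff)
  have K_compact: "compact (K a)" for a unfolding K_cbox by simp
  define K' where "K' a = {x :: real ^ 'd. \<forall>i. \<bar>x $ i\<bar> < a}" for a :: real
  have K'_box: "K' a = box (\<chi> i. - a) (\<chi> i. a)" for a
    unfolding K'_def by (auto simp: mem_box_cart abs_less_iff minus_less_iff)
  have K_mono: "K a \<subseteq> K b" if "a \<le> b" for a b
  proof
    fix x assume x: "x \<in> K a"
    have "\<bar>x $ i\<bar> \<le> b" for i using x that unfolding K_def by (auto intro: order_trans)
    then show "x \<in> K b" unfolding K_def by simp
  qed
  have K'_sub: "K' a \<subseteq> K b" if "a \<le> b" for a b
    using K_mono[OF that] unfolding K_def K'_def by (auto intro: less_imp_le)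
  have K'_open: "open (K' a)" for a unfolding K'_box by (rule open_box)
  have bump_1: "box_bump a 1 0 x = 1" if "x \<in> K' (a + 1/4)" for a and x :: "real ^ 'd"
    using that unfolding box_bump_def K'_def by (intro prod.neutral ballI) (auto intro!: hat_1 less_imp_le)
  have \<theta>_0: "\<theta> x = 0" if "x \<notin> K (real m + 3/4)" for x
  proof (rule ccontr)
    assume "\<theta> x \<noteq> 0"
    then have "\<bar>1 * x $ i + 0 $ i\<bar> < real m + 3/4" for i
      unfolding \<theta>_def by (rule box_bump_nonzero) simp
    then show False using that unfolding K_def by (auto intro: less_imp_le)
  qed
  define \<gamma>' where "\<gamma>' x = (if x \<in> K (real m) then \<gamma> x
      else if x \<in> K (real m + 1) then ?ex (\<theta> x *\<^sub>R \<kappa> (\<gamma> x)) else \<one>\<^bsub>H\<^esub>)" for x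
  \<comment> \<open>Three overlapping open sets, each with a single formula for
    \<open>\<gamma>'\<close>: \<gamma> around the core, the scaled logarithm in the open shell,
    \<one> outside.\<close>
  define O1 where "O1 = K' (real m + 1/4)"
  define O2 where "O2 = K' (real m + 1) - K (real m)"
  define O3 where "O3 = - K (real m + 3/4)"
  have opens: "open O1" "open O2" "open O3"
    unfolding O1_def O2_def O3_def
    by (intro open_Diff K'_open compact_imp_closed K_compact open_Compl)+
  have cover: "x \<in> O1 \<or> x \<in> O2 \<or> x \<in> O3" for x
  proof (cases "x \<in> O1 \<or> x \<in> O3")
    case False
    then have x: "\<And>i. \<bar>x $ i\<bar> \<le> real m + 3/4" "\<exists>i. real m + 1/4 \<le> \<bar>x $ i\<bar>"
      unfolding O1_def O3_def K_def K'_def by (auto simp: not_less)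
    have "\<bar>x $ i\<bar> < real m + 1" for i using x(1)[of i] by linarith
    moreover obtain i where "real m + 1/4 \<le> \<bar>x $ i\<bar>" using x(2) by blast
    then have "real m < \<bar>x $ i\<bar>" by linarith
    ultimately show ?thesis unfolding O2_def K_def K'_def by (auto simp: not_le)
  qed auto
  have sub: "O1 \<subseteq> K (real m + 1)" "O2 \<subseteq> K (real m + 1)" "K (real m) \<subseteq> K (real m + 3/4)"
    using K'_sub[of "real m + 1/4" "real m + 1"] K'_sub[of "real m + 1" "real m + 1"]
      K_mono[of "real m" "real m + 3/4"] unfolding O1_def O2_def by auto
  have in_shell: "\<gamma> x \<in> P \<and> q (\<kappa> (\<gamma> x)) < 1" if "x \<in> K (real m + 1)" "x \<notin> K (real m)" for x
    using shell[of x] that unfolding K_def by auto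
  have scaled: "\<theta> x *\<^sub>R \<kappa> (\<gamma> x) \<in> topspace Y" "q (\<theta> x *\<^sub>R \<kappa> (\<gamma> x)) < 1"
    if "x \<in> K (real m + 1)" "x \<notin> K (real m)" for x
  proof -
    have top: "\<kappa> (\<gamma> x) \<in> topspace Y" using in_shell[OF that] \<kappa>_top by blast
    then show "\<theta> x *\<^sub>R \<kappa> (\<gamma> x) \<in> topspace Y" by (rule w.cod.scale_in)
    have "q (\<theta> x *\<^sub>R \<kappa> (\<gamma> x)) = \<theta> x * q (\<kappa> (\<gamma> x))" using q.scale[OF top] \<theta>_bounds[of x] by simp
    also have "\<dots> \<le> 1 * q (\<kappa> (\<gamma> x))" using \<theta>_bounds[of x] q.nonneg[OF top] by (intro mult_right_mono) auto
    finally show "q (\<theta> x *\<^sub>R \<kappa> (\<gamma> x)) < 1" using in_shell[OF that] by simp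
  qed
  have on1: "\<gamma>' x = \<gamma> x" if "x \<in> O1" for x
    using that sub(1) bump_1[of x "real m"] in_shell[of x] ex unfolding \<gamma>'_def O1_def \<theta>_def by auto
  have on2: "\<gamma>' x = ?ex (\<theta> x *\<^sub>R \<kappa> (\<gamma> x))" if "x \<in> O2" for x
    using that sub(2) unfolding \<gamma>'_def O2_def by auto
  have on3: "\<gamma>' x = \<one>\<^bsub>H\<^esub>" if "x \<in> O3" for x
    using that sub(3) \<theta>_0[of x] ex0 unfolding \<gamma>'_def O3_def by auto
  have PC_log: "PC Y k O2 (\<lambda>ys x. \<theta> x *\<^sub>R \<kappa> (\<gamma> x))" if k: "enat k \<le> r" for k
  proof (rule w.cod.PC_scaleR[OF opens(2)])
    show "PC euclideanreal k O2 (\<lambda>ys. \<theta>)"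
      by (rule PC_mono[of _ UNIV]) (use \<theta>_test in \<open>auto simp: test_function_def\<close>)
    show "PC Y k O2 (\<lambda>ys x. \<kappa> (\<gamma> x))"
    proof (rule PC_local)
      fix x assume x: "x \<in> O2"
      have "\<gamma> x \<in> topspace M" using map_continuous[OF \<gamma>] by (auto simp: continuous_map_def)
      then have "\<gamma> x \<in> (\<Union>(U, \<phi>)\<in>A. U)" using mfd.mfd by (simp add: smooth_manifold_def)
      then obtain U \<phi> where U: "(U, \<phi>) \<in> A" "\<gamma> x \<in> U" by blast
      interpret sm: smooth_map E Y "\<phi> ` (U \<inter> P)" "\<kappa> \<circ> inv_into U \<phi>" by (rule \<kappa>_smooth(1)[OF U(1)])
      have "openin euclidean {x \<in> topspace euclidean. \<gamma> x \<in> U}"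
        by (rule openin_continuous_map_preimage[OF map_continuous[OF \<gamma>] mfd.chart_open[OF U(1)]])
      then have opn: "open (\<gamma> -` U)" by (simp add: vimage_def)
      let ?N = "O2 \<inter> \<gamma> -` U"
      have in_P: "\<gamma> x \<in> P" if "x \<in> ?N" for x using in_shell that sub(2) unfolding O2_def by blast
      have "PC Y k ?N (\<lambda>ys x. (\<kappa> \<circ> inv_into U \<phi>) (\<phi> (\<gamma> x)))"
      proof (rule sm.PC_compose)
        show "open ?N" using opens(2) opn by blast
        show "PC E k ?N (\<lambda>ys x. \<phi> (\<gamma> x))" by (rule PC_mono[OF _ map_PC[OF \<gamma> U(1) k]]) blast
        show "\<phi> (\<gamma> x) \<in> \<phi> ` (U \<inter> P)" if "x \<in> ?N" for x using in_P[OF that] that by blast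
      qed
      then have "PC Y k ?N (\<lambda>ys x. \<kappa> (\<gamma> x))"
        by (rule PC_cong[rotated 2])
           (use opens(2) opn inv_into_f_f[OF chart_inj[OF mfd.chart[OF U(1)]]] in auto)
      then show "\<exists>N. open N \<and> x \<in> N \<and> PC Y k N (\<lambda>ys x. \<kappa> (\<gamma> x))"
        using x U(2) opens(2) opn by (intro exI[of _ ?N]) auto
    qed
  qed
  have cont: "continuous_map euclidean M \<gamma>'"
  proof (rule pasting_lemma[where I = "{O1, O2, O3}" and T = id and f = "\<lambda>_. \<gamma>'"])
    fix S assume S: "S \<in> {O1, O2, O3}"
    then show "openin euclidean (id S)" using opens by auto
    have c1: "continuous_map (top_of_set O1) M \<gamma>'"
      by (rule continuous_map_eq[OF continuous_map_from_subtopology[OF map_continuous[OF \<gamma>]]]) (simp add: on1)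
    have c3: "continuous_map (top_of_set O3) M \<gamma>'"
      by (rule continuous_map_eq[OF H.continuous_map_one]) (simp add: on3)
    have c2: "continuous_map (top_of_set O2) M \<gamma>'"
    proof -
      have "PC Y 0 O2 (\<lambda>ys x. \<theta> x *\<^sub>R \<kappa> (\<gamma> x))" by (rule PC_log) (simp add: zero_enat_def[symmetric])
      from PC_continuous_fixed[OF this] have "continuous_map (top_of_set O2) Y (\<lambda>x. \<theta> x *\<^sub>R \<kappa> (\<gamma> x))" .
      moreover have "\<theta> x *\<^sub>R \<kappa> (\<gamma> x) \<in> \<kappa> ` P" if "x \<in> O2" for x
        using scaled[of x] q(2) that sub(2) unfolding O2_def by blast
      ultimately have "continuous_map (top_of_set O2) (subtopology Y (\<kappa> ` P)) (\<lambda>x. \<theta> x *\<^sub>R \<kappa> (\<gamma> x))"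
        by (auto simp: continuous_map_in_subtopology)
      from continuous_map_compose[OF this chart_inverse_continuous[OF chart_of_P(1)]]
      show ?thesis by (rule continuous_map_eq) (simp add: on2)
    qed
    show "continuous_map (subtopology euclidean (id S)) M \<gamma>'" using S c1 c2 c3 by auto
  qed (use cover in auto)
  have Cr: "manifold_Cr_map r euclidean euclidean {(UNIV, id)} M E A \<gamma>'"
    unfolding manifold_Cr_map_def
  proof (intro conjI cont ballI, clarify)
    fix U :: "(real ^ 'd) set" and \<phi> :: "real ^ 'd \<Rightarrow> real ^ 'd" and V \<psi>
    assume V: "(V, \<psi>) \<in> A"
    have "openin euclidean {x \<in> topspace euclidean. \<gamma>' x \<in> V}"
      by (rule openin_continuous_map_preimage[OF cont mfd.chart_open[OF V]])
    then have opn: "open (\<gamma>' -` V)" by (simp add: vimage_def)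
    have "PC E k (\<gamma>' -` V) (\<lambda>ys x. \<psi> (\<gamma>' x))" if k: "enat k \<le> r" for k
    proof (rule PC_local)
      fix x assume x: "x \<in> \<gamma>' -` V"
      have p1: "PC E k (O1 \<inter> \<gamma>' -` V) (\<lambda>ys x. \<psi> (\<gamma>' x))"
      proof (rule PC_cong)
        show "PC E k (O1 \<inter> \<gamma>' -` V) (\<lambda>ys x. \<psi> (\<gamma> x))"
          by (rule PC_mono[OF _ map_PC[OF \<gamma> V k]]) (auto simp: on1)
      qed (use opens opn on1 in auto)
      have p2: "PC E k (O2 \<inter> \<gamma>' -` V) (\<lambda>ys x. \<psi> (\<gamma>' x))"
      proof -
        interpret sm: smooth_map Y E "\<kappa> ` (P \<inter> V)" "\<psi> \<circ> ?ex" by (rule \<kappa>_smooth(2)[OF V])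
        have "PC E k (O2 \<inter> \<gamma>' -` V) (\<lambda>ys x. (\<psi> \<circ> ?ex) (\<theta> x *\<^sub>R \<kappa> (\<gamma> x)))"
        proof (rule sm.PC_compose)
          show "PC Y k (O2 \<inter> \<gamma>' -` V) (\<lambda>ys x. \<theta> x *\<^sub>R \<kappa> (\<gamma> x))"
            by (rule PC_mono[OF _ PC_log[OF k]]) blast
          fix x assume x: "x \<in> O2 \<inter> \<gamma>' -` V"
          then have "\<theta> x *\<^sub>R \<kappa> (\<gamma> x) \<in> \<kappa> ` P" using scaled[of x] q(2) sub(2) unfolding O2_def by blast
          then have "?ex (\<theta> x *\<^sub>R \<kappa> (\<gamma> x)) \<in> P" "\<kappa> (?ex (\<theta> x *\<^sub>R \<kappa> (\<gamma> x))) = \<theta> x *\<^sub>R \<kappa> (\<gamma> x)"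
            by (rule inv_into_into, rule f_inv_into_f)
          moreover have "?ex (\<theta> x *\<^sub>R \<kappa> (\<gamma> x)) \<in> V" using x on2 by auto
          ultimately show "\<theta> x *\<^sub>R \<kappa> (\<gamma> x) \<in> \<kappa> ` (P \<inter> V)" by (metis IntI imageI)
        qed (use opens opn in blast)
        then show ?thesis by (rule PC_cong[rotated 2]) (use opens opn on2 in auto)
      qed
      have p3: "PC E k (O3 \<inter> \<gamma>' -` V) (\<lambda>ys x. \<psi> (\<gamma>' x))" if "x \<in> O3"
      proof (rule PC_cong[OF _ _ mfd.PC_const])
        have "\<one>\<^bsub>H\<^esub> \<in> V" using that x on3 by auto
        then show "\<psi> \<one>\<^bsub>H\<^esub> \<in> topspace E"
          using mfd.chart[OF V] openin_subset unfolding chart_homeomorphism_def by blast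
      qed (use opens opn on3 in auto)
      show "\<exists>N. open N \<and> x \<in> N \<and> PC E k N (\<lambda>ys x. \<psi> (\<gamma>' x))"
        using cover[of x] p1 p2 p3 x opens opn by (meson IntI open_Int)
    qed
    then have "Cr_on r euclidean E (\<gamma>' -` V) (\<lambda>x. \<psi> (\<gamma>' x))" by (rule Cr_onI_PC)
    then show "Cr_on r euclidean E (id ` (UNIV \<inter> \<gamma>' -` V)) (\<psi> \<circ> \<gamma>' \<circ> inv_into UNIV id)"
      by (simp add: inv_id[unfolded id_def] comp_def)
  qed
  have \<gamma>'_out: "\<gamma>' x = \<one>\<^bsub>H\<^esub>" if "x \<notin> K (real m + 1)" for x
    using that K_mono[of "real m" "real m + 1"] unfolding \<gamma>'_def by auto
  \<comment> \<open>As \<open>\<gamma>'\<close> is \<one> off \<open>K (m + 1)\<close>, the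
    logarithm demanded by the definition of the group vanishes identically there. The bump only has
    to be 1 around that box.\<close>
  let ?h = "box_bump (real m + 2) 1 0 :: real ^ 'd \<Rightarrow> real"
  have h_test: "test_function ?h" by (rule test_function_box_bump) auto
  have "\<gamma>' \<in> \<G>"
    unfolding weighted_group_maps_def
  proof (rule CollectI, rule conjI[OF Cr], rule exI[of _ P], rule exI[of _ \<kappa>], rule exI[of _ "K (real m + 1)"],
      rule exI[of _ ?h], intro conjI \<kappa>_chart K_compact)
    show "\<gamma>' ` (- K (real m + 1)) \<subseteq> P" using \<gamma>'_out chart_of_P(2) by auto
    show "Cr_on \<infinity> euclidean euclideanreal UNIV ?h" by (rule w.test_function_Cr[OF h_test])
    show "range ?h \<subseteq> {0..1}" using box_bump_bounds[of "real m + 2" 1 0] by auto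
    show "compact (closure {x. ?h x \<noteq> 0})" using h_test by (simp add: test_function_def)
    show "\<exists>V. open V \<and> K (real m + 1) \<subseteq> V \<and> (\<forall>x\<in>V. ?h x = 1)"
    proof (intro exI[of _ "K' (real m + 2 + 1/4)"] conjI ballI K'_open)
      show "K (real m + 1) \<subseteq> K' (real m + 2 + 1/4)"
      proof
        fix x assume x: "x \<in> K (real m + 1)"
        have "\<bar>x $ i\<bar> < real m + 2 + 1/4" for i
          by (rule order_le_less_trans[of _ "real m + 1"]) (use x in \<open>auto simp: K_def\<close>)
        then show "x \<in> K' (real m + 2 + 1/4)" unfolding K'_def by simp
      qed
    next
      fix x assume "x \<in> K' (real m + 2 + 1/4)"
      then show "?h x = 1" by (rule bump_1)
    qed
    let ?Z = "\<lambda>x. if x \<in> - K (real m + 1) then (1 - ?h x) *\<^sub>R \<kappa> (\<gamma>' x) else 0"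
    have Z: "?Z = (\<lambda>x. 0)" using \<gamma>'_out chart_of_P(3) by auto
    have opn: "open (- K (real m + 1))" using K_compact by (simp add: compact_imp_closed open_Compl)
    have g0: "gateaux Y k (\<lambda>x. 0) x = (\<lambda>v. 0)" for k and x :: "real ^ 'd"
      unfolding gateaux_eq_fold by (rule ext, rule w.cod.fold_dir_deriv_vanish[of UNIV]) auto
    have pn: "poly_norm n p (\<lambda>v. 0) = 0" if "continuous_seminorm Y p" for p
    proof -
      interpret p: csn Y p by (rule w.cod.csnI[OF that])
      show ?thesis by (rule poly_norm_const_0) simp
    qed
    show "?Z \<in> weighted_maps_vanishing n r W (- K (real m + 1)) Y"
      unfolding Z weighted_maps_vanishing_def weighted_maps_def
    proof (intro CollectI conjI allI impI ballI; (elim conjE)?)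
      show "Cr_on r euclidean Y (- K (real m + 1)) (\<lambda>x. 0)"
        by (rule Cr_onI_PC) (simp add: w.cod.PC_const opn)
    qed (simp_all add: weighted_seminorm_def g0 pn image_constant_conv bot_ennreal)
  qed
  moreover have "\<forall>x. if \<forall>i. \<bar>x $ i\<bar> \<le> real m then \<gamma>' x = \<gamma> x
          else if \<forall>i. \<bar>x $ i\<bar> \<le> real m + 1 then \<exists>c\<in>{0..1}. \<gamma>' x = ?ex (c *\<^sub>R \<kappa> (\<gamma> x))
          else \<gamma>' x = \<one>\<^bsub>H\<^esub>"
    unfolding \<gamma>'_def K_def using \<theta>_bounds by auto
  ultimately show ?thesis by blast
qed

sublocale mapping_group H M \<G> T Y "weighted_space n r W UNIV Y" P \<kappa>
proof -
  interpret G: topological_group "pointwise_group H \<G>" T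
    using lie_group_topological_group[OF G_lie] by (simp add: weighted_group_eq)
  have carrier: "carrier (weighted_group n r W H M E A) = \<G>" by (simp add: weighted_group_def)
  show "mapping_group H M \<G> T Y (weighted_space n r W UNIV Y) P \<kappa>"
  proof unfold_locales
    show "chart_homeomorphism T (weighted_space n r W UNIV Y) {\<gamma> \<in> \<G>. range \<gamma> \<subseteq> P} (\<lambda>\<gamma>. \<kappa> \<circ> \<gamma>)"
      using G_manifold_chart by (simp add: manifold_chart_def carrier)
    show "(\<lambda>\<gamma>. \<kappa> \<circ> \<gamma>) ` {\<gamma> \<in> \<G>. range \<gamma> \<subseteq> P} = {\<eta> \<in> topspace (weighted_space n r W UNIV Y). range \<eta> \<subseteq> \<kappa> ` P}"
      using G_image by (simp add: carrier)
    show "\<eta> x \<in> topspace Y" if "\<eta> \<in> topspace (weighted_space n r W UNIV Y)" for \<eta> x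
      using w.cod.Cr_on_fold_in[OF w.weighted_maps_Cr[OF that], of 0 x] by (simp add: zero_enat_def[symmetric])
    show "\<exists>N. openin (weighted_space n r W UNIV Y) N \<and> 0 \<in> N \<and> (\<forall>\<eta>\<in>N. \<forall>x. q (\<eta> x) < 1)"
      if "continuous_seminorm Y q" for q
      using w.sup_neighbourhood[OF that] by metis
    show "\<exists>\<gamma>'\<in>\<G>. \<forall>x. if \<forall>i. \<bar>x $ i\<bar> \<le> real m then \<gamma>' x = \<gamma> x
          else if \<forall>i. \<bar>x $ i\<bar> \<le> real m + 1 then \<exists>c\<in>{0..1}. \<gamma>' x = inv_into P \<kappa> (c *\<^sub>R \<kappa> (\<gamma> x))
          else \<gamma>' x = \<one>\<^bsub>H\<^esub>"
      if "\<gamma> \<in> \<G>" "continuous_seminorm Y q" "{y \<in> topspace Y. q y < 1} \<subseteq> \<kappa> ` P"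
        "\<And>x. (\<forall>i. \<bar>x $ i\<bar> \<le> real m + 1) \<Longrightarrow> \<not> (\<forall>i. \<bar>x $ i\<bar> \<le> real m) \<Longrightarrow> \<gamma> x \<in> P \<and> q (\<kappa> (\<gamma> x)) < 1"
      for \<gamma> q m
      by (rule cut_off[OF that(1-3)]) (rule that(4))
  qed (fact chart_of_P | rule map_continuous vanishing_at_infinity w.test_function_continuous_map; assumption)+
qed

end

section \<open>Homotopy groups\<close>

text \<open>Both groups consist of classes, so the homomorphism is given on representatives.
  Well-definedness and injectivity are the two directions of \<open>eq\<close>.\<close>

lemma is_iso_by_representatives:
  assumes A: "carrier A = q ` S" and m_closed: "\<And>x y. x \<in> S \<Longrightarrow> y \<in> S \<Longrightarrow> m x y \<in> S"
    and q_mult: "\<And>x y. x \<in> S \<Longrightarrow> y \<in> S \<Longrightarrow> q x \<otimes>\<^bsub>A\<^esub> q y = q (m x y)"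
    and \<Psi>: "\<Psi> ` S = carrier B" and \<Psi>_mult: "\<And>x y. x \<in> S \<Longrightarrow> y \<in> S \<Longrightarrow> \<Psi> (m x y) = \<Psi> x \<otimes>\<^bsub>B\<^esub> \<Psi> y"
    and eq: "\<And>x y. x \<in> S \<Longrightarrow> y \<in> S \<Longrightarrow> q x = q y \<longleftrightarrow> \<Psi> x = \<Psi> y"
  shows "A \<cong> B"
proof -
  define h where "h a = \<Psi> (inv_into S q a)" for a
  have h: "h (q x) = \<Psi> x" if "x \<in> S" for x
  proof -
    have "inv_into S q (q x) \<in> S" "q (inv_into S q (q x)) = q x"
      using that by (auto intro: inv_into_into f_inv_into_f)
    then show ?thesis unfolding h_def using eq that by blast
  qed
  have "h \<in> hom A B"
  proof (rule homI)
    fix a assume "a \<in> carrier A"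
    then show "h a \<in> carrier B" using h \<Psi> unfolding A by auto
  next
    fix a b assume "a \<in> carrier A" "b \<in> carrier A"
    then obtain x y where "x \<in> S" "y \<in> S" "a = q x" "b = q y" unfolding A by blast
    then show "h (a \<otimes>\<^bsub>A\<^esub> b) = h a \<otimes>\<^bsub>B\<^esub> h b" using h m_closed q_mult \<Psi>_mult by simp
  qed
  moreover have "bij_betw h (carrier A) (carrier B)"
  proof (rule bij_betw_imageI)
    show "inj_on h (carrier A)" unfolding A by (rule inj_onI) (use h eq in auto)
    show "h ` carrier A = carrier B" unfolding A image_image using h \<Psi> by auto
  qed
  ultimately show ?thesis unfolding is_iso_def iso_def by blast
qed

section \<open>Cubes, homotopy relative to the boundary, and concatenation\<close>

lemma topspace_cube: "topspace (cube k) = (\<Pi>\<^sub>E i\<in>{..<k}. {0..1})"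
  by (simp add: cube_def)

lemma cube_coordinate_in: "t \<in> topspace (cube k) \<Longrightarrow> i < k \<Longrightarrow> t i \<in> {0..1}"
  using PiE_mem[of t "{..<k}" "\<lambda>_. {0..1}" i] unfolding topspace_cube by simp

lemma cube_update_in:
  assumes "t \<in> topspace (cube k)" "c \<in> {0..1}" "i < k"
  shows "t(i := c) \<in> topspace (cube k)"
  using assms unfolding topspace_cube PiE_iff by (simp add: extensional_def)

lemma continuous_map_into_cube:
  "continuous_map Z (cube k) f \<longleftrightarrow> f ` topspace Z \<subseteq> extensional {..<k} \<and>
    (\<forall>i<k. continuous_map Z euclideanreal (\<lambda>z. f z i) \<and> (\<forall>z\<in>topspace Z. f z i \<in> {0..1}))"
  unfolding cube_def continuous_map_componentwise
  by (auto simp: continuous_map_in_subtopology Pi_iff)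

lemma cube_coordinate_continuous: "i < k \<Longrightarrow> continuous_map (cube k) euclideanreal (\<lambda>t. t i)"
  using continuous_map_id[of "cube k"] unfolding continuous_map_into_cube by simp

lemma continuous_map_coordinate:
  "continuous_map Z (cube k) f \<Longrightarrow> i < k \<Longrightarrow> continuous_map Z euclideanreal (\<lambda>z. f z i)"
  unfolding continuous_map_into_cube by blast

lemma cube_update_continuous:
  assumes f: "continuous_map Z (cube k) f" and c: "continuous_map Z euclideanreal c"
    and c01: "\<And>z. z \<in> topspace Z \<Longrightarrow> c z \<in> {0..1}" and k: "0 < k"
  shows "continuous_map Z (cube k) (\<lambda>z. (f z)(0 := c z))"
  unfolding continuous_map_into_cube
proof (intro conjI allI impI)
  show "(\<lambda>z. (f z)(0 := c z)) ` topspace Z \<subseteq> extensional {..<k}"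
    using f k unfolding continuous_map_into_cube by (auto simp: extensional_def)
  fix i assume i: "i < k"
  show "continuous_map Z euclideanreal (\<lambda>z. ((f z)(0 := c z)) i)"
    using f c i unfolding continuous_map_into_cube by (cases "i = 0") auto
  show "\<forall>z\<in>topspace Z. ((f z)(0 := c z)) i \<in> {0..1}"
    using f c01 i unfolding continuous_map_into_cube by (cases "i = 0") auto
qed

lemma compact_cube: "compact_space (cube k)"
  unfolding cube_def by (auto simp: compact_space_product_topology compact_space_subtopology)

lemma Hausdorff_cube: "Hausdorff_space (cube k)"
  unfolding cube_def by (auto simp: Hausdorff_space_product_topology Hausdorff_space_subtopology)

lemma normal_cube: "normal_space (cube k)"
  using compact_Hausdorff_or_regular_imp_normal_space compact_cube Hausdorff_cube by blast

definition cube_boundary :: "nat \<Rightarrow> (nat \<Rightarrow> real) set" where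
  "cube_boundary k = {t \<in> topspace (cube k). \<exists>i<k. t i = 0 \<or> t i = 1}"

lemma closedin_cube_boundary: "closedin (cube k) (cube_boundary k)"
proof -
  have "closedin (cube k) {t \<in> topspace (cube k). t i \<in> {0, 1}}" if "i < k" for i
    by (rule closedin_continuous_map_preimage[OF cube_coordinate_continuous[OF that]]) auto
  then have "closedin (cube k) (\<Union>i\<in>{..<k}. {t \<in> topspace (cube k). t i \<in> {0, 1}})"
    by (intro closedin_Union) auto
  also have "(\<Union>i\<in>{..<k}. {t \<in> topspace (cube k). t i \<in> {0, 1}}) = cube_boundary k"
    unfolding cube_boundary_def by auto
  finally show ?thesis .
qed

lemma sends_boundary_to_iff: "sends_boundary_to k p f \<longleftrightarrow> (\<forall>t\<in>cube_boundary k. f t = p)"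
  unfolding sends_boundary_to_def cube_boundary_def by blast

definition cube_maps :: "nat \<Rightarrow> 'x topology \<Rightarrow> 'x \<Rightarrow> ((nat \<Rightarrow> real) \<Rightarrow> 'x) set" where
  "cube_maps k X p = {f. continuous_map (cube k) X f \<and> sends_boundary_to k p f}"

abbreviation cube_homotopic :: "nat \<Rightarrow> 'x topology \<Rightarrow> 'x \<Rightarrow> ((nat \<Rightarrow> real) \<Rightarrow> 'x) \<Rightarrow> ((nat \<Rightarrow> real) \<Rightarrow> 'x) \<Rightarrow> bool" where
  "cube_homotopic k X p \<equiv> homotopic_with (sends_boundary_to k p) (cube k) X"

lemma cube_homotopic_iff:
  "cube_homotopic k X p f g \<longleftrightarrow>
    (\<exists>h. continuous_map (prod_topology I01 (cube k)) X h \<and> (\<forall>t\<in>topspace (cube k). h (0, t) = f t) \<and>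
      (\<forall>t\<in>topspace (cube k). h (1, t) = g t) \<and> (\<forall>s\<in>{0..1}. \<forall>t\<in>cube_boundary k. h (s, t) = p))"
proof -
  have "sends_boundary_to k p h \<longleftrightarrow> sends_boundary_to k p h'"
    if "\<And>t. t \<in> topspace (cube k) \<Longrightarrow> h t = h' t" for h h'
    using that unfolding sends_boundary_to_def by auto
  from homotopic_with[of "cube k" "sends_boundary_to k p", OF this] show ?thesis
    by (simp add: sends_boundary_to_iff)
qed

lemma cube_homotopic_maps: "cube_homotopic k X p f g \<Longrightarrow> f \<in> cube_maps k X p \<and> g \<in> cube_maps k X p"
  using homotopic_with_imp_continuous_maps homotopic_with_imp_property unfolding cube_maps_def by blast

lemma cube_homotopic_refl: "f \<in> cube_maps k X p \<Longrightarrow> cube_homotopic k X p f f"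
  by (simp add: cube_maps_def)

lemma homotopy_class_eq_iff:
  assumes "f \<in> cube_maps k X p" "g \<in> cube_maps k X p"
  shows "homotopy_class k X p f = homotopy_class k X p g \<longleftrightarrow> cube_homotopic k X p f g"
proof
  assume "homotopy_class k X p f = homotopy_class k X p g"
  moreover have "g \<in> homotopy_class k X p g"
    unfolding homotopy_class_def mem_Collect_eq by (rule cube_homotopic_refl[OF assms(2)])
  ultimately show "cube_homotopic k X p f g" unfolding homotopy_class_def by blast
next
  assume fg: "cube_homotopic k X p f g"
  show "homotopy_class k X p f = homotopy_class k X p g"
    unfolding homotopy_class_def
    using homotopic_with_trans[OF fg] homotopic_with_trans[OF homotopic_with_symD[OF fg]] by blast
qed

lemma cube_concat_boundary:
  assumes f: "\<And>t. t \<in> cube_boundary k \<Longrightarrow> f t = p" and g: "\<And>t. t \<in> cube_boundary k \<Longrightarrow> g t = p"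
    and t: "t \<in> cube_boundary k" and k: "0 < k"
  shows "cube_concat f g t = p"
proof -
  have top: "t \<in> topspace (cube k)" using t by (simp add: cube_boundary_def)
  then have t0: "t 0 \<in> {0..1}" using k by (rule cube_coordinate_in)
  have upd: "t(0 := c) \<in> topspace (cube k)" if "c \<in> {0..1}" for c
    using top that k by (rule cube_update_in)
  obtain i where i: "i < k" "t i = 0 \<or> t i = 1" using t by (auto simp: cube_boundary_def)
  show ?thesis
  proof (cases "t 0 \<le> 1/2")
    case True
    have "(t(0 := 2 * t 0)) i = 0 \<or> (t(0 := 2 * t 0)) i = 1" using i True by (cases "i = 0") auto
    moreover have "t(0 := 2 * t 0) \<in> topspace (cube k)" using t0 True by (intro upd) auto
    ultimately have "t(0 := 2 * t 0) \<in> cube_boundary k" using i(1) unfolding cube_boundary_def by blast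
    then show ?thesis using f True unfolding cube_concat_def by simp
  next
    case False
    have "(t(0 := 2 * t 0 - 1)) i = 0 \<or> (t(0 := 2 * t 0 - 1)) i = 1" using i False by (cases "i = 0") auto
    moreover have "t(0 := 2 * t 0 - 1) \<in> topspace (cube k)" using t0 False by (intro upd) auto
    ultimately have "t(0 := 2 * t 0 - 1) \<in> cube_boundary k" using i(1) unfolding cube_boundary_def by blast
    then show ?thesis using g False unfolding cube_concat_def by simp
  qed
qed

text \<open>The two homotopies are concatenated at each time. Where \<open>t 0 = 1/2\<close>, both
  halves are evaluated on a face of the cube and give p, so they can be pasted.\<close>

lemma cube_concat_homotopic:
  assumes "cube_homotopic k X p f f'" "cube_homotopic k X p g g'" and k: "0 < k"
  shows "cube_homotopic k X p (cube_concat f g) (cube_concat f' g')"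
proof -
  let ?Z = "prod_topology I01 (cube k)"
  obtain h1 where h1: "continuous_map ?Z X h1" "\<forall>t\<in>topspace (cube k). h1 (0, t) = f t"
    "\<forall>t\<in>topspace (cube k). h1 (1, t) = f' t" "\<forall>s\<in>{0..1}. \<forall>t\<in>cube_boundary k. h1 (s, t) = p"
    using assms(1) unfolding cube_homotopic_iff by blast
  obtain h2 where h2: "continuous_map ?Z X h2" "\<forall>t\<in>topspace (cube k). h2 (0, t) = g t"
    "\<forall>t\<in>topspace (cube k). h2 (1, t) = g' t" "\<forall>s\<in>{0..1}. \<forall>t\<in>cube_boundary k. h2 (s, t) = p"
    using assms(2) unfolding cube_homotopic_iff by blast
  define h where "h = (\<lambda>(s, t). cube_concat (\<lambda>t. h1 (s, t)) (\<lambda>t. h2 (s, t)) t)"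
  have t0: "continuous_map ?Z euclideanreal (\<lambda>w. snd w 0)"
    using continuous_map_compose[OF continuous_map_snd cube_coordinate_continuous[OF k]] by (simp add: o_def)
  have upd: "t(0 := c) \<in> topspace (cube k)" if "t \<in> topspace (cube k)" "c \<in> {0..1}" for t c
    using that k by (rule cube_update_in)
  have t01: "t 0 \<in> {0..1}" if "t \<in> topspace (cube k)" for t using that k by (rule cube_coordinate_in)
  have sub: "continuous_map (subtopology ?Z S) ?Z (\<lambda>w. (fst w, (snd w)(0 := c (snd w 0))))"
    if c: "continuous_on UNIV c" and S: "\<And>w. w \<in> topspace ?Z \<Longrightarrow> w \<in> S \<Longrightarrow> c (snd w 0) \<in> {0..1}"
    for S and c :: "real \<Rightarrow> real"
  proof (rule continuous_map_pairedI)
    show "continuous_map (subtopology ?Z S) I01 fst"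
      by (rule continuous_map_from_subtopology[OF continuous_map_fst])
    have "continuous_map (subtopology ?Z S) euclideanreal (\<lambda>w. snd w 0)"
      by (rule continuous_map_from_subtopology[OF t0])
    from continuous_map_compose[OF this, of euclideanreal c] c
    have "continuous_map (subtopology ?Z S) euclideanreal (\<lambda>w. c (snd w 0))" by (simp add: o_def)
    then show "continuous_map (subtopology ?Z S) (cube k) (\<lambda>w. (snd w)(0 := c (snd w 0)))"
      by (intro cube_update_continuous continuous_map_from_subtopology[OF continuous_map_snd] k) (use S in auto)
  qed
  have affine: "continuous_on UNIV (\<lambda>x :: real. 2 * x)" "continuous_on UNIV (\<lambda>x :: real. 2 * x - 1)"
    by (intro continuous_intros)+
  have "continuous_map ?Z X (\<lambda>w. if snd w 0 \<le> 1/2 then h1 (fst w, (snd w)(0 := 2 * snd w 0))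
      else h2 (fst w, (snd w)(0 := 2 * snd w 0 - 1)))"
  proof (rule continuous_map_cases_le[OF t0])
    show "continuous_map (subtopology ?Z {w \<in> topspace ?Z. snd w 0 \<le> 1/2}) X
        (\<lambda>w. h1 (fst w, (snd w)(0 := 2 * snd w 0)))"
      using continuous_map_compose[OF sub[OF affine(1)] h1(1), of "{w \<in> topspace ?Z. snd w 0 \<le> 1/2}"] t01
      by (auto simp: o_def)
    show "continuous_map (subtopology ?Z {w \<in> topspace ?Z. 1/2 \<le> snd w 0}) X
        (\<lambda>w. h2 (fst w, (snd w)(0 := 2 * snd w 0 - 1)))"
      using continuous_map_compose[OF sub[OF affine(2)] h2(1), of "{w \<in> topspace ?Z. 1/2 \<le> snd w 0}"] t01
      by (auto simp: o_def)
    fix w assume w: "w \<in> topspace ?Z" "snd w 0 = 1/2"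
    have "(snd w)(0 := 1) \<in> cube_boundary k" "(snd w)(0 := 0) \<in> cube_boundary k"
      unfolding cube_boundary_def using upd[of "snd w"] w k by auto
    moreover have "2 * snd w 0 = 1" "2 * snd w 0 - 1 = 0" "fst w \<in> {0..1}" using w by auto
    ultimately show "h1 (fst w, (snd w)(0 := 2 * snd w 0)) = h2 (fst w, (snd w)(0 := 2 * snd w 0 - 1))"
      using h1(4) h2(4) by metis
  qed simp
  then have "continuous_map ?Z X h" unfolding h_def cube_concat_def by (simp add: case_prod_unfold)
  moreover have "h (0, t) = cube_concat f g t" "h (1, t) = cube_concat f' g' t"
    if t: "t \<in> topspace (cube k)" for t
    using h1(2,3) h2(2,3) upd[OF t] t01[OF t] unfolding h_def cube_concat_def by auto
  moreover have "h (s, t) = p" if "s \<in> {0..1}" "t \<in> cube_boundary k" for s t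
    unfolding h_def using cube_concat_boundary[of k "\<lambda>t. h1 (s, t)" p "\<lambda>t. h2 (s, t)" t] h1(4) h2(4) that k
    by simp
  ultimately show ?thesis unfolding cube_homotopic_iff by (intro exI[of _ h]) blast
qed

text \<open>Continuity and boundary values are read off from \<open>cube_concat_homotopic\<close>
  for constant homotopies.\<close>

lemma cube_concat_in:
  assumes "f \<in> cube_maps k X p" "g \<in> cube_maps k X p" "0 < k"
  shows "cube_concat f g \<in> cube_maps k X p"
proof -
  have "cube_homotopic k X p f f" "cube_homotopic k X p g g"
    by (rule cube_homotopic_refl, fact)+
  from cube_homotopic_maps[OF cube_concat_homotopic[OF this assms(3)]] show ?thesis by (rule conjunct1)
qed

lemma homotopy_group_carrier: "carrier (homotopy_group k X p) = homotopy_class k X p ` cube_maps k X p"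
  by (simp add: homotopy_group_def cube_maps_def)

text \<open>The product is a union over all pairs of representatives. All members of this union are
  one and the same class, so the union is that class.\<close>

lemma homotopy_group_mult:
  assumes f: "f \<in> cube_maps k X p" and g: "g \<in> cube_maps k X p" and k: "0 < k"
  shows "homotopy_class k X p f \<otimes>\<^bsub>homotopy_group k X p\<^esub> homotopy_class k X p g
    = homotopy_class k X p (cube_concat f g)"
proof -
  have "homotopy_class k X p (cube_concat f' g') = homotopy_class k X p (cube_concat f g)"
    if "f' \<in> homotopy_class k X p f" "g' \<in> homotopy_class k X p g" for f' g'
  proof -
    have fg: "cube_homotopic k X p f f'" "cube_homotopic k X p g g'"
      using that by (auto simp: homotopy_class_def)
    from cube_homotopic_maps[OF fg(1)] cube_homotopic_maps[OF fg(2)]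
    have "cube_concat f g \<in> cube_maps k X p" "cube_concat f' g' \<in> cube_maps k X p"
      using k by (simp_all add: cube_concat_in)
    from homotopy_class_eq_iff[OF this] cube_concat_homotopic[OF fg k] show ?thesis by simp
  qed
  moreover have "f \<in> homotopy_class k X p f" "g \<in> homotopy_class k X p g"
    unfolding homotopy_class_def mem_Collect_eq by (rule cube_homotopic_refl, fact)+
  ultimately have "(\<Union>f'\<in>homotopy_class k X p f. \<Union>g'\<in>homotopy_class k X p g. homotopy_class k X p (cube_concat f' g'))
      = homotopy_class k X p (cube_concat f g)" by blast
  then show ?thesis by (simp add: homotopy_group_def)
qed

section \<open>Pointwise products against concatenation, and the group of path components\<close>

context topological_group
begin

text \<open>The Eckmann--Hilton argument: \<open>cube_concat f g = cube_concat f 1 \<cdot> cube_concat 1 g\<close>, and both factors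
  are reparametrizations.\<close>

lemma pointwise_product_homotopic_concat:
  assumes f: "f \<in> cube_maps k M \<one>" and g: "g \<in> cube_maps k M \<one>" and k: "0 < k"
  shows "cube_homotopic k M \<one> (\<lambda>t. f t \<otimes> g t) (cube_concat f g)"
proof -
  let ?Z = "prod_topology I01 (cube k)"
  have fc: "continuous_map (cube k) M f" and gc: "continuous_map (cube k) M g"
    and fb: "\<And>t. t \<in> cube_boundary k \<Longrightarrow> f t = \<one>" and gb: "\<And>t. t \<in> cube_boundary k \<Longrightarrow> g t = \<one>"
    using f g by (auto simp: cube_maps_def sends_boundary_to_iff)
  \<comment> \<open>At time 0 both are the identity. At time 1, \<open>a\<close> traverses the cube
    during the first half and then rests on the face \<open>t 0 = 1\<close>, while \<open>b\<close>
    rests on the face \<open>t 0 = 0\<close> and traverses during the second half. A resting factor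
    contributes \<one>.\<close>
  define a where "a = (\<lambda>(s :: real, t :: nat \<Rightarrow> real). t(0 := min 1 ((1 + s) * t 0)))"
  define b where "b = (\<lambda>(s :: real, t :: nat \<Rightarrow> real). t(0 := max 0 ((1 + s) * t 0 - s)))"
  have t0: "continuous_map ?Z euclideanreal (\<lambda>w. snd w 0)"
    using continuous_map_compose[OF continuous_map_snd cube_coordinate_continuous[OF k]] by (simp add: o_def)
  have s: "continuous_map ?Z euclideanreal fst"
    using continuous_map_fst[of I01 "cube k"] by (simp add: continuous_map_in_subtopology)
  have t01: "t 0 \<in> {0..1}" if "t \<in> topspace (cube k)" for t using that k by (rule cube_coordinate_in)
  have upd: "t(0 := c) \<in> topspace (cube k)" if "t \<in> topspace (cube k)" "c \<in> {0..1}" for t c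
    using that k by (rule cube_update_in)
  have le: "(1 + s) * c - s \<le> 1" if "s \<ge> 0" "c \<le> 1" for s c :: real
    using mult_left_le[of c s] that by (simp add: algebra_simps)
  have a: "continuous_map ?Z (cube k) a"
    unfolding a_def case_prod_unfold
    by (rule cube_update_continuous[OF continuous_map_snd _ _ k])
       (use t01 in \<open>auto intro!: continuous_map_real_min continuous_map_real_mult continuous_map_add s t0\<close>)
  have b: "continuous_map ?Z (cube k) b"
    unfolding b_def case_prod_unfold
    by (rule cube_update_continuous[OF continuous_map_snd _ _ k])
       (use t01 le in \<open>auto intro!: continuous_map_real_max continuous_map_diff continuous_map_real_mult continuous_map_add s t0\<close>)
  have a_bd: "a (s, t) \<in> cube_boundary k" and b_bd: "b (s, t) \<in> cube_boundary k"
    if st: "s \<in> {0..1}" "t \<in> cube_boundary k" for s t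
  proof -
    have t: "t \<in> topspace (cube k)" using st(2) by (simp add: cube_boundary_def)
    obtain i where i: "i < k" "t i = 0 \<or> t i = 1" using st(2) by (auto simp: cube_boundary_def)
    have "a (s, t) \<in> topspace (cube k)" "b (s, t) \<in> topspace (cube k)"
      using a b st(1) t by (auto simp: continuous_map_def)
    moreover have "a (s, t) i = 0 \<or> a (s, t) i = 1" "b (s, t) i = 0 \<or> b (s, t) i = 1"
      using i st(1) by (cases "i = 0"; auto simp: a_def b_def)+
    ultimately show "a (s, t) \<in> cube_boundary k" "b (s, t) \<in> cube_boundary k"
      using i(1) unfolding cube_boundary_def by blast+
  qed
  define h where "h w = f (a w) \<otimes> g (b w)" for w
  have "continuous_map ?Z M h"
    unfolding h_def
    by (intro continuous_map_mult continuous_map_compose[OF a fc, unfolded o_def] continuous_map_compose[OF b gc, unfolded o_def])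
  moreover have "h (0, t) = f t \<otimes> g t" if "t \<in> topspace (cube k)" for t
  proof -
    have "a (0, t) = t" "b (0, t) = t" using t01[OF that] by (auto simp: a_def b_def)
    then show ?thesis unfolding h_def by simp
  qed
  moreover have "h (1, t) = cube_concat f g t" if t: "t \<in> topspace (cube k)" for t
  proof (cases "t 0 \<le> 1/2")
    case True
    then have "b (1, t) = t(0 := 0)" "a (1, t) = t(0 := 2 * t 0)" by (auto simp: a_def b_def)
    moreover have "t(0 := 0) \<in> cube_boundary k" using upd[OF t, of 0] k by (auto simp: cube_boundary_def)
    moreover have "f (t(0 := 2 * t 0)) \<in> carrier H"
      using True t01[OF t] by (intro continuous_map_carrier[OF fc] upd[OF t]) auto
    ultimately show ?thesis using True gb unfolding h_def cube_concat_def by simp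
  next
    case False
    then have "b (1, t) = t(0 := 2 * t 0 - 1)" "a (1, t) = t(0 := 1)" by (auto simp: a_def b_def)
    moreover have "t(0 := 1) \<in> cube_boundary k" using upd[OF t, of 1] k by (auto simp: cube_boundary_def)
    moreover have "g (t(0 := 2 * t 0 - 1)) \<in> carrier H"
      using False t01[OF t] by (intro continuous_map_carrier[OF gc] upd[OF t]) auto
    ultimately show ?thesis using False fb unfolding h_def cube_concat_def by simp
  qed
  moreover have "h (s, t) = \<one>" if "s \<in> {0..1}" "t \<in> cube_boundary k" for s t
    unfolding h_def using fb[OF a_bd[OF that]] gb[OF b_bd[OF that]] by simp
  ultimately show ?thesis unfolding cube_homotopic_iff by blast
qed

lemma path_component_mult:
  assumes "path_component_of M x y" "path_component_of M x' y'"
  shows "path_component_of M (x \<otimes> x') (y \<otimes> y')"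
proof -
  obtain f g where "pathin M f" "f 0 = x" "f 1 = y" "pathin M g" "g 0 = x'" "g 1 = y'"
    using assms unfolding path_component_of_def by blast
  then show ?thesis
    unfolding path_component_of_def pathin_def
    by (intro exI[of _ "\<lambda>t. f t \<otimes> g t"]) (auto intro: continuous_map_mult)
qed

lemma path_component_refl: "x \<in> carrier H \<Longrightarrow> path_component_of M x x"
  by (simp add: path_component_of_refl topspace_carrier)

lemma path_component_carrier: "path_component_of M x y \<Longrightarrow> x \<in> carrier H \<and> y \<in> carrier H"
  using path_component_in_topspace by (metis topspace_carrier)

abbreviation "H0 \<equiv> path_component_of_set M \<one>"

lemma path_component_inv:
  assumes "path_component_of M x y"
  shows "path_component_of M \<one> (y \<otimes> inv x)"
proof -
  have "x \<in> carrier H" "y \<in> carrier H" using path_component_carrier[OF assms] by auto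
  then show ?thesis
    using path_component_mult[OF assms path_component_refl[of "inv x"]] by simp
qed

lemma path_component_normal: "H0 \<lhd> H"
  unfolding normal_inv_iff
proof (intro conjI ballI)
  show "subgroup H0 H"
  proof (rule subgroupI)
    show "H0 \<subseteq> carrier H" using path_component_carrier by auto
    show "H0 \<noteq> {}" using path_component_refl[of \<one>] by auto
    show "inv x \<in> H0" if "x \<in> H0" for x
    proof -
      have x: "path_component_of M \<one> x" using that by simp
      then have "path_component_of M x \<one>" by (simp add: path_component_of_sym)
      from path_component_inv[OF this] show ?thesis using path_component_carrier[OF x] by simp
    qed
    show "x \<otimes> y \<in> H0" if "x \<in> H0" "y \<in> H0" for x y
      using path_component_mult[of \<one> x \<one> y] that by simp
  qed
  fix x h assume x: "x \<in> carrier H" and h: "h \<in> H0"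
  have "path_component_of M (x \<otimes> \<one> \<otimes> inv x) (x \<otimes> h \<otimes> inv x)"
    using x h by (intro path_component_mult path_component_refl) auto
  then show "x \<otimes> h \<otimes> inv x \<in> H0" using x by simp
qed

text \<open>Multiplying paths by a constant path carries path components to path components.\<close>

lemma path_component_coset:
  assumes "x \<in> carrier H"
  shows "H0 #> x = path_component_of_set M x"
proof (intro equalityI subsetI)
  fix y assume "y \<in> H0 #> x"
  then obtain h where "h \<in> H0" "y = h \<otimes> x" unfolding r_coset_def by blast
  then show "y \<in> path_component_of_set M x"
    using path_component_mult[of \<one> h x x] path_component_refl[OF assms] assms by simp
next
  fix y assume "y \<in> path_component_of_set M x"
  then have xy: "path_component_of M x y" by simp
  then have "y \<otimes> inv x \<in> H0" using path_component_inv by simp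
  moreover have "y = y \<otimes> inv x \<otimes> x"
    using path_component_carrier[OF xy] by (simp add: m_assoc)
  ultimately show "y \<in> H0 #> x" unfolding r_coset_def by blast
qed

end

section \<open>The large cube as parameter cube times unit box\<close>

definition box_coordinate :: "'d::finite \<Rightarrow> nat" where
  "box_coordinate = (SOME f. bij_betw f UNIV {..<CARD('d)})"

lemma bij_box_coordinate: "bij_betw (box_coordinate :: 'd::finite \<Rightarrow> nat) UNIV {..<CARD('d)}"
proof -
  have "\<exists>f :: 'd \<Rightarrow> nat. bij_betw f UNIV {..<CARD('d)}"
    using ex_bij_betw_finite_nat[of "UNIV :: 'd set"] by (simp add: atLeast0LessThan)
  then show ?thesis unfolding box_coordinate_def by (rule someI_ex)
qed

lemma box_coordinate_less: "box_coordinate (i :: 'd::finite) < CARD('d)"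
  using bij_betw_apply[OF bij_box_coordinate, of i] by simp

lemma inv_box_coordinate: "inv_into UNIV box_coordinate (box_coordinate i) = (i :: 'd::finite)"
  by (rule inv_f_f) (rule bij_betw_imp_inj_on[OF bij_box_coordinate])

lemma box_coordinate_inv: "j < CARD('d) \<Longrightarrow> box_coordinate (inv_into UNIV box_coordinate j :: 'd::finite) = j"
  using bij_betw_imp_surj_on[OF bij_box_coordinate[where 'd = 'd]] by (intro f_inv_into_f) simp

text \<open>The parameter coordinates come first. For \<open>k > 0\<close> the coordinate 0, along
  which cubes are concatenated, is then a parameter, so that \<open>adjoint_concat\<close> is an
  equality of maps and not just a homotopy.\<close>

definition cube_join :: "nat \<Rightarrow> (nat \<Rightarrow> real) \<times> (real ^ 'd) \<Rightarrow> nat \<Rightarrow> real" where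
  "cube_join k w = (\<lambda>j\<in>{..<k + CARD('d)}. if j < k then fst w j else snd w $ inv_into UNIV box_coordinate (j - k))"

definition cube_split :: "nat \<Rightarrow> (nat \<Rightarrow> real) \<Rightarrow> (nat \<Rightarrow> real) \<times> (real ^ 'd)" where
  "cube_split k s = (restrict s {..<k}, \<chi> i. s (k + box_coordinate i))"

lemma split_join:
  assumes "t \<in> topspace (cube k)"
  shows "cube_split k (cube_join k (t, u)) = (t, u :: real ^ 'd)"
proof -
  have "restrict (cube_join k (t, u)) {..<k} = t"
    using assms unfolding topspace_cube cube_join_def
    by (auto simp: fun_eq_iff PiE_def extensional_def)
  then show ?thesis
    by (simp add: cube_split_def cube_join_def vec_eq_iff inv_box_coordinate box_coordinate_less)
qed

lemma join_split:
  assumes "s \<in> topspace (cube (k + CARD('d)))"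
  shows "cube_join k (cube_split k s :: _ \<times> (real ^ 'd)) = s"
proof
  fix j
  have "s \<in> extensional {..<k + CARD('d)}" using assms unfolding topspace_cube PiE_def by blast
  then show "cube_join k (cube_split k s :: _ \<times> (real ^ 'd)) j = s j"
    by (auto simp: cube_join_def cube_split_def box_coordinate_inv extensional_def)
qed

lemma continuous_map_coordinate_box:
  "continuous_map (prod_topology X (top_of_set unit_box)) euclideanreal (\<lambda>w. snd w $ (i :: 'd::finite))"
proof -
  have "continuous_map (top_of_set (unit_box :: (real ^ 'd) set)) euclideanreal (\<lambda>u. u $ i)"
    by (simp add: continuous_intros)
  from continuous_map_compose[OF continuous_map_snd this] show ?thesis by (simp add: o_def)
qed

lemma continuous_map_join:
  "continuous_map (prod_topology (cube k) (top_of_set unit_box)) (cube (k + CARD('d)))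
    (cube_join k :: _ \<times> (real ^ 'd) \<Rightarrow> _)"
  unfolding continuous_map_into_cube
proof (intro conjI allI impI)
  let ?Z = "prod_topology (cube k) (top_of_set (unit_box :: (real ^ 'd) set))"
  show "(cube_join k :: _ \<times> (real ^ 'd) \<Rightarrow> _) ` topspace ?Z \<subseteq> extensional {..<k + CARD('d)}"
    by (auto simp: cube_join_def)
  fix i assume i: "i < k + CARD('d)"
  show "continuous_map ?Z euclideanreal (\<lambda>w. cube_join k w i)"
  proof (cases "i < k")
    case True
    have "continuous_map ?Z euclideanreal (\<lambda>w. fst w i)"
      using continuous_map_compose[OF continuous_map_fst cube_coordinate_continuous[OF True]] by (simp add: o_def)
    then show ?thesis using True i by (simp add: cube_join_def)
  next
    case False
    then show ?thesis using i continuous_map_coordinate_box by (simp add: cube_join_def)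
  qed
  show "\<forall>w\<in>topspace ?Z. cube_join k w i \<in> {0..1}"
  proof
    fix w assume w: "w \<in> topspace ?Z"
    then have "fst w i \<in> {0..1}" if "i < k" using cube_coordinate_in[of "fst w" k i] that by auto
    moreover have "snd w $ j \<in> {0..1}" for j using w by (auto simp: mem_box_cart)
    ultimately show "cube_join k w i \<in> {0..1}" using i by (simp add: cube_join_def)
  qed
qed

lemma continuous_map_split:
  "continuous_map (cube (k + CARD('d))) (prod_topology (cube k) (top_of_set unit_box))
    (cube_split k :: _ \<Rightarrow> _ \<times> (real ^ 'd))"
  unfolding cube_split_def
proof (rule continuous_map_pairedI)
  let ?C = "cube (k + CARD('d))"
  show "continuous_map ?C (cube k) (\<lambda>s. restrict s {..<k})"
    unfolding continuous_map_into_cube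
    using cube_coordinate_continuous[of _ "k + CARD('d)"] cube_coordinate_in[of _ "k + CARD('d)"] by auto
  have "continuous_map ?C euclideanreal (\<lambda>s. s (k + box_coordinate (i :: 'd)))" for i
    using box_coordinate_less[of i] by (intro cube_coordinate_continuous) simp
  then have "continuous_map ?C euclidean (\<lambda>s. \<chi> i :: 'd. s (k + box_coordinate i))"
    unfolding continuous_map_atin limitin_canonical_iff by (auto intro: tendsto_vec_lambda)
  moreover have "(\<chi> i :: 'd. s (k + box_coordinate i)) \<in> unit_box" if "s \<in> topspace ?C" for s
    using cube_coordinate_in[OF that] box_coordinate_less[where 'd = 'd] by (auto simp: mem_box_cart)
  ultimately show "continuous_map ?C (top_of_set unit_box) (\<lambda>s. \<chi> i :: 'd. s (k + box_coordinate i))"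
    by (auto simp: continuous_map_in_subtopology)
qed

lemma box_boundary:
  "u \<in> unit_box \<Longrightarrow> u \<notin> open_box \<longleftrightarrow> (\<exists>i :: 'd::finite. u $ i = 0 \<or> u $ i = 1)"
  by (force simp: mem_box_cart less_le)

lemma split_in:
  assumes "s \<in> topspace (cube (k + CARD('d)))"
  shows "fst (cube_split k s :: _ \<times> (real ^ 'd)) \<in> topspace (cube k)"
    "snd (cube_split k s :: _ \<times> (real ^ 'd)) \<in> unit_box"
proof -
  have "(cube_split k s :: _ \<times> (real ^ 'd)) \<in> topspace (prod_topology (cube k) (top_of_set unit_box))"
    using continuous_map_split[where 'd = 'd, of k] assms unfolding continuous_map_def by blast
  then show "fst (cube_split k s :: _ \<times> (real ^ 'd)) \<in> topspace (cube k)"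
    "snd (cube_split k s :: _ \<times> (real ^ 'd)) \<in> unit_box" by auto
qed

lemma join_in:
  assumes "t \<in> topspace (cube k)" "u \<in> unit_box"
  shows "cube_join k (t, u :: real ^ 'd) \<in> topspace (cube (k + CARD('d)))"
  using continuous_map_join[where 'd = 'd, of k] assms unfolding continuous_map_def by auto

text \<open>Every coordinate of the large cube is a parameter coordinate or a box coordinate, and
  its faces are sorted accordingly.\<close>

lemma split_boundary:
  assumes s: "s \<in> topspace (cube (k + CARD('d)))"
  shows "s \<in> cube_boundary (k + CARD('d)) \<longleftrightarrow>
    fst (cube_split k s :: _ \<times> (real ^ 'd)) \<in> cube_boundary k \<or> snd (cube_split k s :: _ \<times> (real ^ 'd)) \<notin> open_box"
    (is "_ \<longleftrightarrow> fst ?w \<in> _ \<or> _")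
proof -
  have 1: "fst ?w \<in> cube_boundary k \<longleftrightarrow> (\<exists>i<k. s i = 0 \<or> s i = 1)"
    using split_in(1)[OF s] unfolding cube_boundary_def by (auto simp: cube_split_def)
  have 2: "snd ?w \<notin> open_box \<longleftrightarrow> (\<exists>i :: 'd. s (k + box_coordinate i) = 0 \<or> s (k + box_coordinate i) = 1)"
    unfolding box_boundary[OF split_in(2)[OF s]] by (simp add: cube_split_def)
  have "(\<exists>i<k + CARD('d). Q i) \<longleftrightarrow> (\<exists>i<k. Q i) \<or> (\<exists>i :: 'd. Q (k + box_coordinate i))" for Q
  proof
    assume "\<exists>i<k + CARD('d). Q i"
    then obtain i where i: "i < k + CARD('d)" "Q i" by blast
    show "(\<exists>i<k. Q i) \<or> (\<exists>i :: 'd. Q (k + box_coordinate i))"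
    proof (cases "i < k")
      case False
      then have "k + box_coordinate (inv_into UNIV box_coordinate (i - k) :: 'd) = i"
        using i(1) box_coordinate_inv[where 'd = 'd, of "i - k"] by simp
      then show ?thesis using i(2) by metis
    qed (use i in blast)
  next
    assume "(\<exists>i<k. Q i) \<or> (\<exists>i :: 'd. Q (k + box_coordinate i))"
    then show "\<exists>i<k + CARD('d). Q i"
      using box_coordinate_less[where 'd = 'd] by (meson nat_add_left_cancel_less trans_less_add1)
  qed
  from this[of "\<lambda>i. s i = 0 \<or> s i = 1"] show ?thesis
    unfolding 1 2 using s by (simp add: cube_boundary_def)
qed

lemma join_boundary:
  assumes t: "t \<in> topspace (cube k)" and u: "u \<in> unit_box"
  shows "cube_join k (t, u :: real ^ 'd) \<in> cube_boundary (k + CARD('d)) \<longleftrightarrow> t \<in> cube_boundary k \<or> u \<notin> open_box"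
  using split_boundary[OF join_in[OF t u]] unfolding split_join[OF t] by simp

lemma split_update:
  "0 < k \<Longrightarrow> cube_split k (s(0 := c)) = ((fst (cube_split k s :: _ \<times> (real ^ 'd)))(0 := c), snd (cube_split k s :: _ \<times> (real ^ 'd)))"
  by (auto simp: cube_split_def fun_eq_iff vec_eq_iff)

lemma split_0: "0 < k \<Longrightarrow> fst (cube_split k s :: _ \<times> (real ^ 'd)) 0 = s 0"
  by (simp add: cube_split_def)

lemma topspace_cube_0: "topspace (cube 0) = {\<lambda>_. undefined}"
  by (simp add: topspace_cube)

lemma cube_boundary_0: "cube_boundary 0 = {}"
  by (simp add: cube_boundary_def)

section \<open>Adjoint maps and the isomorphisms\<close>

context mapping_group
begin

abbreviation cut :: "nat \<Rightarrow> (nat \<Rightarrow> real) \<Rightarrow> (nat \<Rightarrow> real) \<times> (real ^ 'd)" where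
  "cut \<equiv> cube_split"

definition adjoint :: "nat \<Rightarrow> ((nat \<Rightarrow> real) \<Rightarrow> real ^ 'd \<Rightarrow> 'h) \<Rightarrow> (nat \<Rightarrow> real) \<Rightarrow> 'h" where
  "adjoint k f s = on_cube (f (fst (cut k s))) (snd (cut k s))"

lemma on_cube_one [simp]: "on_cube (\<lambda>x. \<one>) u = \<one>"
  by (simp add: on_cube_def)

lemma adjoint_homotopic:
  assumes "cube_homotopic k T (\<lambda>x. \<one>) f f'"
  shows "cube_homotopic (k + CARD('d)) M \<one> (adjoint k f) (adjoint k f')"
proof -
  let ?C = "cube (k + CARD('d))"
  obtain h where h: "continuous_map (prod_topology I01 (cube k)) T h" "\<forall>t\<in>topspace (cube k). h (0, t) = f t"
    "\<forall>t\<in>topspace (cube k). h (1, t) = f' t" "\<forall>s\<in>{0..1}. \<forall>t\<in>cube_boundary k. h (s, t) = (\<lambda>x. \<one>)"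
    using assms unfolding cube_homotopic_iff by (elim exE conjE) (rule that)
  define g where "g w = on_cube (h (fst w, fst (cut k (snd w)))) (snd (cut k (snd w)))" for w
  have split: "continuous_map (prod_topology I01 ?C) (cube_space (cube k)) (\<lambda>w. cut k (snd w))"
    using continuous_map_compose[OF continuous_map_snd continuous_map_split] by (simp add: o_def)
  have "continuous_map (prod_topology I01 ?C) (cube_space (prod_topology I01 (cube k)))
      (\<lambda>w. ((fst w, fst (cut k (snd w))), snd (cut k (snd w))))"
    using continuous_map_compose[OF split continuous_map_fst] continuous_map_compose[OF split continuous_map_snd]
    by (intro continuous_map_pairedI continuous_map_fst) (simp_all add: o_def)
  from continuous_map_compose[OF this on_cube_continuous[OF h(1)]]
  have "continuous_map (prod_topology I01 ?C) M g" unfolding g_def by (simp add: o_def)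
  moreover have "\<forall>s\<in>topspace ?C. g (0, s) = adjoint k f s" "\<forall>s\<in>topspace ?C. g (1, s) = adjoint k f' s"
    using h(2,3) split_in(1)[where 'd = 'd] unfolding g_def adjoint_def by auto
  moreover have "g (c, s) = \<one>" if cs: "c \<in> {0..1}" "s \<in> cube_boundary (k + CARD('d))" for c s
  proof -
    have "s \<in> topspace ?C" using cs(2) by (simp add: cube_boundary_def)
    from split_boundary[OF this] cs(2) consider "fst (cut k s) \<in> cube_boundary k"
      | "snd (cut k s) \<notin> open_box" by blast
    then show ?thesis
      by cases (use h(4) cs(1) in \<open>simp_all add: g_def on_cube_boundary\<close>)
  qed
  ultimately show ?thesis unfolding cube_homotopic_iff by (intro exI[of _ g] conjI ballI) simp_all
qed

lemma adjoint_in: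
  "f \<in> cube_maps k T (\<lambda>x. \<one>) \<Longrightarrow> adjoint k f \<in> cube_maps (k + CARD('d)) M \<one>"
  using cube_homotopic_maps[OF adjoint_homotopic[OF cube_homotopic_refl]] by (rule conjunct1)

lemma adjoint_concat: "0 < k \<Longrightarrow> adjoint k (cube_concat f f') = cube_concat (adjoint k f) (adjoint k f')"
  by (rule ext) (simp add: adjoint_def cube_concat_def split_update split_0)

text \<open>Divided by its initial map, the homotopy starts at \<one> and ends at the adjoint of the
  pointwise quotient of \<open>f'\<close> by \<open>f\<close>, so \<open>lift_null_homotopy\<close>
  applies. Multiplying the lift by \<open>f\<close> restores the end points.\<close>

lemma homotopic_of_adjoint_homotopic:
  assumes f: "f \<in> cube_maps k T (\<lambda>x. \<one>)" and f': "f' \<in> cube_maps k T (\<lambda>x. \<one>)"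
    and hom: "cube_homotopic (k + CARD('d)) M \<one> (adjoint k f) (adjoint k f')"
  shows "cube_homotopic k T (\<lambda>x. \<one>) f f'"
proof -
  let ?C = "cube (k + CARD('d))" and ?Z = "cube_space (cube k)"
  have fc: "continuous_map (cube k) T f" "continuous_map (cube k) T f'"
    and fb: "\<And>t. t \<in> cube_boundary k \<Longrightarrow> f t = (\<lambda>x. \<one>)"
    using f f' by (auto simp: cube_maps_def sends_boundary_to_iff)
  have f_in: "f t \<in> \<G>" "f' t \<in> \<G>" if "t \<in> topspace (cube k)" for t
    using continuous_map_in_G[OF fc(1) that] continuous_map_in_G[OF fc(2) that] by simp_all
  obtain h where h: "continuous_map (prod_topology I01 ?C) M h" "\<forall>s\<in>topspace ?C. h (0, s) = adjoint k f s"
    "\<forall>s\<in>topspace ?C. h (1, s) = adjoint k f' s" "\<forall>c\<in>{0..1}. \<forall>s\<in>cube_boundary (k + CARD('d)). h (c, s) = \<one>"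
    using hom unfolding cube_homotopic_iff by (elim exE conjE) (rule that)
  define g where "g w = inv (h (0, cube_join k (snd w))) \<otimes> h (fst w, cube_join k (snd w))"
    for w :: "real \<times> (nat \<Rightarrow> real) \<times> (real ^ 'd)"
  have join: "continuous_map (prod_topology I01 ?Z) ?C (\<lambda>w. cube_join k (snd w))"
    using continuous_map_compose[OF continuous_map_snd continuous_map_join] by (simp add: o_def)
  have "continuous_map (prod_topology I01 ?Z) (prod_topology I01 ?C) (\<lambda>w. (fst w, cube_join k (snd w)))"
    "continuous_map (prod_topology I01 ?Z) (prod_topology I01 ?C) (\<lambda>w. (0, cube_join k (snd w)))"
    by (intro continuous_map_pairedI continuous_map_fst join; simp)+
  from continuous_map_compose[OF this(1) h(1)] continuous_map_compose[OF this(2) h(1)]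
  have g: "continuous_map (prod_topology I01 ?Z) M g"
    unfolding g_def by (intro continuous_map_mult continuous_map_inv) (simp_all add: o_def)
  have h_in: "h (c, s) \<in> carrier H" if "c \<in> {0..1}" "s \<in> topspace ?C" for c s
    using continuous_map_carrier[OF h(1), of "(c, s)"] that by simp
  have g0: "\<forall>z\<in>topspace ?Z. g (0, z) = \<one>"
    unfolding g_def using h_in join_in[where 'd = 'd] by auto
  have bd: "g (c, (t, u)) = \<one>"
    if "c \<in> {0..1}" "t \<in> topspace (cube k)" "u \<in> unit_box" "t \<in> cube_boundary k \<or> u \<notin> open_box" for c t u
  proof -
    have "cube_join k (t, u) \<in> cube_boundary (k + CARD('d))" using join_boundary[of t k u] that by blast
    then show ?thesis using h(4) that(1) by (simp add: g_def)
  qed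
  have gL: "\<forall>s\<in>{0..1}. \<forall>t\<in>topspace (cube k). \<forall>u\<in>unit_box - open_box. g (s, (t, u)) = \<one>"
    using bd by blast
  let ?F = "\<lambda>t x. inv (f t x) \<otimes> f' t x"
  have F: "continuous_map (cube k) T ?F" by (intro continuous_map_G_mult continuous_map_G_inv fc)
  have g1: "\<forall>t\<in>topspace (cube k). \<forall>u\<in>unit_box. g (1, (t, u)) = on_cube (?F t) u"
  proof (intro ballI)
    fix t and u :: "real ^ 'd" assume tu: "t \<in> topspace (cube k)" "u \<in> unit_box"
    have "g (1, (t, u)) = inv (adjoint k f (cube_join k (t, u))) \<otimes> adjoint k f' (cube_join k (t, u))"
      unfolding g_def using h(2,3) join_in[OF tu] by simp
    also have "\<dots> = inv (on_cube (f t) u) \<otimes> on_cube (f' t) u"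
      unfolding adjoint_def split_join[OF tu(1)] by simp
    finally show "g (1, (t, u)) = on_cube (?F t) u" by (simp add: on_cube_def)
  qed
  obtain j where j: "continuous_map (prod_topology I01 (cube k)) T j"
    "\<forall>t\<in>topspace (cube k). j (0, t) = (\<lambda>x. \<one>)" "\<forall>t\<in>topspace (cube k). j (1, t) = ?F t"
    "\<forall>s\<in>{0..1}. \<forall>t\<in>topspace (cube k). (\<forall>s'\<in>{0..1}. \<forall>u\<in>unit_box. g (s', (t, u)) = \<one>) \<longrightarrow> j (s, t) = (\<lambda>x. \<one>)"
    using lift_null_homotopy[OF compact_cube g g0 gL F g1] by (elim exE conjE) (rule that)
  define l where "l w = (\<lambda>x. f (snd w) x \<otimes> j w x)" for w
  have "continuous_map (prod_topology I01 (cube k)) T (\<lambda>w. f (snd w))"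
    using continuous_map_compose[OF continuous_map_snd fc(1)] by (simp add: o_def)
  then have "continuous_map (prod_topology I01 (cube k)) T l"
    unfolding l_def by (intro continuous_map_G_mult j(1))
  moreover have "l (0, t) = f t" "l (1, t) = f' t" if t: "t \<in> topspace (cube k)" for t
    unfolding l_def using j(2,3) t maps_in[OF f_in(1)[OF t]] maps_in[OF f_in(2)[OF t]] by (simp_all add: cancel_left)
  moreover have "l (s, t) = (\<lambda>x. \<one>)" if st: "s \<in> {0..1}" "t \<in> cube_boundary k" for s t
  proof -
    have "t \<in> topspace (cube k)" using st(2) by (simp add: cube_boundary_def)
    moreover from this have "\<forall>s'\<in>{0..1}. \<forall>u\<in>unit_box. g (s', (t, u)) = \<one>" using bd st(2) by blast
    ultimately have "j (s, t) = (\<lambda>x. \<one>)" using j(4) st(1) by blast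
    then show ?thesis unfolding l_def using fb[OF st(2)] by simp
  qed
  ultimately show ?thesis unfolding cube_homotopic_iff by (intro exI[of _ l] conjI ballI) simp_all
qed

text \<open>On the boundary of the large cube both maps are \<one>, and the homotopy of
  \<open>close_homotopic\<close> rests wherever the two maps agree.\<close>

lemma adjoint_homotopic_of_close:
  assumes f: "f \<in> cube_maps k T (\<lambda>x. \<one>)" and g: "g \<in> cube_maps (k + CARD('d)) M \<one>"
    and close: "\<And>t u. t \<in> topspace (cube k) \<Longrightarrow> u \<in> unit_box \<Longrightarrow> inv (on_cube (f t) u) \<otimes> g (cube_join k (t, u)) \<in> U0"
  shows "cube_homotopic (k + CARD('d)) M \<one> (adjoint k f) g"
proof -
  let ?C = "cube (k + CARD('d))"
  have gc: "continuous_map ?C M g" and gb: "\<And>s. s \<in> cube_boundary (k + CARD('d)) \<Longrightarrow> g s = \<one>"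
    using g by (auto simp: cube_maps_def sends_boundary_to_iff)
  have ac: "continuous_map ?C M (adjoint k f)" and ab: "\<And>s. s \<in> cube_boundary (k + CARD('d)) \<Longrightarrow> adjoint k f s = \<one>"
    using adjoint_in[OF f] by (auto simp: cube_maps_def sends_boundary_to_iff)
  have close': "inv (adjoint k f s) \<otimes> g s \<in> U0" if s: "s \<in> topspace ?C" for s
    using close[OF split_in[OF s]] join_split[where 'd = 'd, OF s] unfolding adjoint_def by simp
  obtain h where h: "continuous_map (prod_topology I01 ?C) M h"
    "\<And>s. s \<in> topspace ?C \<Longrightarrow> h (0, s) = adjoint k f s" "\<And>s. s \<in> topspace ?C \<Longrightarrow> h (1, s) = g s"
    "\<And>c s. s \<in> topspace ?C \<Longrightarrow> adjoint k f s = g s \<Longrightarrow> h (c, s) = adjoint k f s"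
    by (rule close_homotopic[OF ac gc close']) (assumption, rule that)
  have "h (c, s) = \<one>" if "s \<in> cube_boundary (k + CARD('d))" for c s
    using h(4)[of s c] ab[OF that] gb[OF that] that by (simp add: cube_boundary_def)
  then show ?thesis unfolding cube_homotopic_iff using h(1-3) by (intro exI[of _ h] conjI ballI) simp_all
qed

lemma adjoint_surj:
  assumes k: "0 < k" and g: "g \<in> cube_maps (k + CARD('d)) M \<one>"
  shows "\<exists>f\<in>cube_maps k T (\<lambda>x. \<one>). cube_homotopic (k + CARD('d)) M \<one> (adjoint k f) g"
proof -
  let ?C = "cube (k + CARD('d))" and ?Z = "cube_space (cube k)"
  have gc: "continuous_map ?C M g" and gb: "\<And>s. s \<in> cube_boundary (k + CARD('d)) \<Longrightarrow> g s = \<one>"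
    using g by (auto simp: cube_maps_def sends_boundary_to_iff)
  \<comment> \<open>Since \<open>k > 0\<close>, the vertex 0 is a boundary point, so g becomes
    \<one> at s = 0. The restriction keeps the result extensional, as points of
    \<open>cube k\<close> are.\<close>
  define c where "c s t = (\<lambda>j\<in>{..<k}. s * t j)" for s :: real and t :: "nat \<Rightarrow> real"
  have c_in: "c s t \<in> topspace (cube k)" if "s \<in> {0..1}" "t \<in> topspace (cube k)" for s t
    using cube_coordinate_in[OF that(2)] that(1) unfolding topspace_cube c_def
    by (auto simp: mult_le_one)
  have c1: "c 1 t = t" if "t \<in> topspace (cube k)" for t
    using that unfolding topspace_cube c_def by (auto simp: fun_eq_iff PiE_def extensional_def)
  have c0: "c 0 t \<in> cube_boundary k" if "t \<in> topspace (cube k)" for t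
    using c_in[OF _ that, of 0] k unfolding cube_boundary_def c_def by auto
  define gg where "gg w = g (cube_join k (c (fst w) (fst (snd w)), snd (snd w)))" 
    for w :: "real \<times> (nat \<Rightarrow> real) \<times> (real ^ 'd)"
  have tu: "continuous_map (prod_topology I01 ?Z) (cube k) (\<lambda>w. fst (snd w))"
    "continuous_map (prod_topology I01 ?Z) (top_of_set unit_box) (\<lambda>w. snd (snd w))"
    using continuous_map_compose[OF continuous_map_snd[of I01 ?Z] continuous_map_fst]
      continuous_map_compose[OF continuous_map_snd[of I01 ?Z] continuous_map_snd] by (simp_all add: o_def)
  have s: "continuous_map (prod_topology I01 ?Z) euclideanreal fst"
    using continuous_map_fst[of I01 ?Z] by (simp add: continuous_map_in_subtopology)
  have "continuous_map (prod_topology I01 ?Z) (cube k) (\<lambda>w. c (fst w) (fst (snd w)))"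
    unfolding continuous_map_into_cube
  proof (intro conjI allI impI ballI)
    show "(\<lambda>w. c (fst w) (fst (snd w))) ` topspace (prod_topology I01 ?Z) \<subseteq> extensional {..<k}"
      by (auto simp: c_def)
    fix i assume i: "i < k"
    have "continuous_map (prod_topology I01 ?Z) euclideanreal (\<lambda>w. fst w * fst (snd w) i)"
      by (intro continuous_map_real_mult s continuous_map_coordinate[OF tu(1) i])
    then show "continuous_map (prod_topology I01 ?Z) euclideanreal (\<lambda>w. c (fst w) (fst (snd w)) i)"
      using i by (simp add: c_def)
    fix w assume "w \<in> topspace (prod_topology I01 ?Z)"
    then show "c (fst w) (fst (snd w)) i \<in> {0..1}" by (intro cube_coordinate_in[OF c_in i]) auto
  qed
  from continuous_map_compose[OF continuous_map_compose[OF continuous_map_pairedI[OF this tu(2)] continuous_map_join] gc]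
  have gg: "continuous_map (prod_topology I01 ?Z) M gg" unfolding gg_def by (simp add: o_def)
  have bd: "gg (s, (t, u)) = \<one>" if "s \<in> {0..1}" "t \<in> topspace (cube k)" "u \<in> unit_box"
    "c s t \<in> cube_boundary k \<or> u \<notin> open_box" for s t u
    unfolding gg_def using join_boundary[OF c_in[OF that(1,2)] that(3)] that(4) by (auto intro: gb)
  have gg0: "\<forall>z\<in>topspace ?Z. gg (0, z) = \<one>"
    using bd[of 0] c0 by auto
  have ggL: "\<forall>s\<in>{0..1}. \<forall>t\<in>topspace (cube k). \<forall>u\<in>unit_box - open_box. gg (s, (t, u)) = \<one>"
    using bd by blast
  have ggX: "\<forall>t\<in>cube_boundary k. \<forall>u\<in>unit_box. gg (1, (t, u)) = \<one>"
  proof (intro ballI)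
    fix t and u :: "real ^ 'd" assume t: "t \<in> cube_boundary k" and u: "u \<in> unit_box"
    have top: "t \<in> topspace (cube k)" using t by (simp add: cube_boundary_def)
    show "gg (1, (t, u)) = \<one>" by (rule bd) (use t u top c1[OF top] in simp_all)
  qed
  obtain f where f: "continuous_map (cube k) T f" "\<forall>t\<in>cube_boundary k. f t = (\<lambda>x. \<one>)"
    "\<forall>t\<in>topspace (cube k). \<forall>u\<in>unit_box. inv (on_cube (f t) u) \<otimes> gg (1, (t, u)) \<in> U0"
    using lift_contractible_family[OF compact_cube normal_cube closedin_cube_boundary gg gg0 ggL ggX]
    by (elim exE conjE) (rule that)
  have f_in: "f \<in> cube_maps k T (\<lambda>x. \<one>)" using f(1,2) by (simp add: cube_maps_def sends_boundary_to_iff)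
  have "inv (on_cube (f t) u) \<otimes> g (cube_join k (t, u)) \<in> U0"
    if "t \<in> topspace (cube k)" "u \<in> unit_box" for t u
  proof -
    have "inv (on_cube (f t) u) \<otimes> gg (1, (t, u)) \<in> U0" using f(3) that by blast
    then show ?thesis using c1[OF that(1)] by (simp add: gg_def)
  qed
  from adjoint_homotopic_of_close[OF f_in g this] f_in show ?thesis by blast
qed

lemma const_in_cube_maps: "\<gamma> \<in> \<G> \<Longrightarrow> (\<lambda>_. \<gamma>) \<in> cube_maps 0 T p"
  by (simp add: cube_maps_def sends_boundary_to_iff cube_boundary_0 topspace_T)

lemma adjoint_surj_0:
  assumes g: "g \<in> cube_maps CARD('d) M \<one>"
  shows "\<exists>\<gamma>\<in>\<G>. cube_homotopic CARD('d) M \<one> (adjoint 0 (\<lambda>_. \<gamma>)) g"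
proof -
  \<comment> \<open>The only point of \<open>cube 0\<close>: a function extensional on the empty
    index set.\<close>
  let ?p = "\<lambda>_ :: nat. undefined :: real"
  have g': "g \<in> cube_maps (0 + CARD('d)) M \<one>" using g by simp
  have gc: "continuous_map (cube (0 + CARD('d))) M g"
    and gb: "\<And>s. s \<in> cube_boundary (0 + CARD('d)) \<Longrightarrow> g s = \<one>"
    using g' by (simp_all add: cube_maps_def sends_boundary_to_iff)
  have p: "?p \<in> topspace (cube 0)" by (simp add: topspace_cube_0)
  have "continuous_map (top_of_set unit_box) (cube_space (cube 0)) (\<lambda>u. (?p, u))"
    using p by (intro continuous_map_pairedI) auto
  from continuous_map_compose[OF continuous_map_compose[OF this continuous_map_join] gc]
  have "continuous_map (top_of_set unit_box) M (\<lambda>u :: real ^ 'd. g (cube_join 0 (?p, u)))" by (simp add: o_def)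
  moreover have "g (cube_join 0 (?p, u)) = \<one>" if "u \<in> unit_box - open_box" for u :: "real ^ 'd"
    using join_boundary[OF p, of u] that by (intro gb) simp
  ultimately obtain \<gamma> where \<gamma>: "\<gamma> \<in> \<G>"
    "\<And>u. u \<in> unit_box \<Longrightarrow> inv (on_cube \<gamma> u) \<otimes> g (cube_join 0 (?p, u)) \<in> U0"
    using lift_map[of "\<lambda>u. g (cube_join 0 (?p, u))"] by metis
  have "cube_homotopic (0 + CARD('d)) M \<one> (adjoint 0 (\<lambda>_. \<gamma>)) g"
    by (rule adjoint_homotopic_of_close[OF const_in_cube_maps[OF \<gamma>(1)] g']) (use \<gamma>(2) in \<open>simp add: topspace_cube_0\<close>)
  then show ?thesis using \<gamma>(1) by auto
qed

text \<open>\<open>cube 0\<close> is a single point with empty boundary, so homotopies between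
  constant maps are paths, and the base point p is arbitrary.\<close>

lemma path_component_iff:
  assumes "\<gamma> \<in> \<G>" "\<gamma>' \<in> \<G>"
  shows "path_component_of T \<gamma> \<gamma>' \<longleftrightarrow> cube_homotopic 0 T p (\<lambda>_. \<gamma>) (\<lambda>_. \<gamma>')"
proof
  assume "path_component_of T \<gamma> \<gamma>'"
  then obtain c where c: "continuous_map I01 T c" "c 0 = \<gamma>" "c 1 = \<gamma>'"
    unfolding path_component_of_def pathin_def by blast
  have "continuous_map (prod_topology I01 (cube 0)) T (\<lambda>w. c (fst w))"
    using continuous_map_compose[OF continuous_map_fst c(1)] by (simp add: o_def)
  then show "cube_homotopic 0 T p (\<lambda>_. \<gamma>) (\<lambda>_. \<gamma>')"
    unfolding cube_homotopic_iff using c(2,3) by (intro exI[of _ "\<lambda>w. c (fst w)"]) (simp add: cube_boundary_0)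
next
  assume "cube_homotopic 0 T p (\<lambda>_. \<gamma>) (\<lambda>_. \<gamma>')"
  then obtain h where h: "continuous_map (prod_topology I01 (cube 0)) T h"
    "\<forall>t\<in>topspace (cube 0). h (0, t) = \<gamma>" "\<forall>t\<in>topspace (cube 0). h (1, t) = \<gamma>'"
    unfolding cube_homotopic_iff by (elim exE conjE) (rule that)
  have "continuous_map I01 (prod_topology I01 (cube 0)) (\<lambda>s. (s, \<lambda>_. undefined))"
    by (intro continuous_map_pairedI continuous_map_id[unfolded id_def]) (simp add: topspace_cube_0)
  from continuous_map_compose[OF this h(1)] show "path_component_of T \<gamma> \<gamma>'"
    unfolding path_component_of_def pathin_def using h(2,3)
    by (intro exI[of _ "\<lambda>s. h (s, \<lambda>_. undefined)"]) (simp add: o_def topspace_cube_0)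
qed

lemma adjoint_class_eq_iff:
  assumes "f \<in> cube_maps k T (\<lambda>x. \<one>)" "f' \<in> cube_maps k T (\<lambda>x. \<one>)"
  shows "cube_homotopic k T (\<lambda>x. \<one>) f f' \<longleftrightarrow>
    homotopy_class (k + CARD('d)) M \<one> (adjoint k f) = homotopy_class (k + CARD('d)) M \<one> (adjoint k f')"
  unfolding homotopy_class_eq_iff[OF adjoint_in[OF assms(1)] adjoint_in[OF assms(2)]]
  using adjoint_homotopic homotopic_of_adjoint_homotopic[OF assms] by blast

lemma homotopy_group_iso:
  assumes k: "0 < k"
  shows "homotopy_group k T \<one>\<^bsub>G\<^esub> \<cong> homotopy_group (k + CARD('d)) M \<one>"
proof (rule is_iso_by_representatives[where q = "homotopy_class k T (\<lambda>x. \<one>)" and S = "cube_maps k T (\<lambda>x. \<one>)"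
      and m = cube_concat and \<Psi> = "\<lambda>f. homotopy_class (k + CARD('d)) M \<one> (adjoint k f)"])
  let ?S = "cube_maps k T (\<lambda>x. \<one>)" and ?\<Psi> = "\<lambda>f. homotopy_class (k + CARD('d)) M \<one> (adjoint k f)"
  show "carrier (homotopy_group k T \<one>\<^bsub>G\<^esub>) = homotopy_class k T (\<lambda>x. \<one>) ` ?S"
    by (simp add: homotopy_group_carrier)
  show "cube_concat f f' \<in> ?S" if "f \<in> ?S" "f' \<in> ?S" for f f'
    using cube_concat_in[OF that k] .
  show "homotopy_class k T (\<lambda>x. \<one>) f \<otimes>\<^bsub>homotopy_group k T \<one>\<^bsub>G\<^esub>\<^esub> homotopy_class k T (\<lambda>x. \<one>) f'
      = homotopy_class k T (\<lambda>x. \<one>) (cube_concat f f')" if "f \<in> ?S" "f' \<in> ?S" for f f'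
    using homotopy_group_mult[OF that k] by simp
  show "?\<Psi> (cube_concat f f') = ?\<Psi> f \<otimes>\<^bsub>homotopy_group (k + CARD('d)) M \<one>\<^esub> ?\<Psi> f'" if "f \<in> ?S" "f' \<in> ?S" for f f'
    using homotopy_group_mult[OF adjoint_in[OF that(1)] adjoint_in[OF that(2)]] k by (simp add: adjoint_concat)
  show "homotopy_class k T (\<lambda>x. \<one>) f = homotopy_class k T (\<lambda>x. \<one>) f' \<longleftrightarrow> ?\<Psi> f = ?\<Psi> f'"
    if "f \<in> ?S" "f' \<in> ?S" for f f'
    unfolding homotopy_class_eq_iff[OF that] by (rule adjoint_class_eq_iff[OF that])
  have "homotopy_class (k + CARD('d)) M \<one> g \<in> ?\<Psi> ` ?S" if g: "g \<in> cube_maps (k + CARD('d)) M \<one>" for g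
  proof -
    obtain f where f: "f \<in> ?S" "cube_homotopic (k + CARD('d)) M \<one> (adjoint k f) g"
      using adjoint_surj[OF k g] by blast
    then show ?thesis using homotopy_class_eq_iff[OF adjoint_in[OF f(1)] g] by auto
  qed
  then show "?\<Psi> ` ?S = carrier (homotopy_group (k + CARD('d)) M \<one>)"
    unfolding homotopy_group_carrier using adjoint_in by blast
qed

text \<open>Components are multiplied pointwise, classes of cube maps by concatenation;
  \<open>pointwise_product_homotopic_concat\<close> reconciles the two products.\<close>

lemma pi0_group_iso: "pi0_group G T \<cong> homotopy_group CARD('d) M \<one>"
proof (rule is_iso_by_representatives[where q = "\<lambda>\<gamma>. G.H0 #>\<^bsub>G\<^esub> \<gamma>" and S = \<G>
      and m = "\<lambda>\<gamma> \<eta> x. \<gamma> x \<otimes> \<eta> x" and \<Psi> = "\<lambda>\<gamma>. homotopy_class CARD('d) M \<one> (adjoint 0 (\<lambda>_. \<gamma>))"])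
  interpret N: normal G.H0 G by (rule G.path_component_normal)
  let ?q = "\<lambda>\<gamma>. G.H0 #>\<^bsub>G\<^esub> \<gamma>" and ?a = "\<lambda>\<gamma>. adjoint 0 (\<lambda>_. \<gamma>)"
  let ?m = "\<lambda>\<gamma> \<eta> x. \<gamma> x \<otimes> \<eta> x" and ?\<Psi> = "\<lambda>\<gamma>. homotopy_class CARD('d) M \<one> (?a \<gamma>)"
  have a_in: "?a \<gamma> \<in> cube_maps CARD('d) M \<one>" if "\<gamma> \<in> \<G>" for \<gamma>
    using adjoint_in[OF const_in_cube_maps[OF that]] by simp
  show "carrier (pi0_group G T) = ?q ` \<G>"
    by (auto simp: pi0_group_def FactGroup_def RCOSETS_def)
  show m_in: "?m \<gamma> \<eta> \<in> \<G>" if "\<gamma> \<in> \<G>" "\<eta> \<in> \<G>" for \<gamma> \<eta>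
    using G.m_closed[of \<gamma> \<eta>] that by simp
  show "?q \<gamma> \<otimes>\<^bsub>pi0_group G T\<^esub> ?q \<eta> = ?q (?m \<gamma> \<eta>)" if "\<gamma> \<in> \<G>" "\<eta> \<in> \<G>" for \<gamma> \<eta>
    using N.rcos_sum[of \<gamma> \<eta>] that by (simp add: pi0_group_def FactGroup_def)
  show "?\<Psi> (?m \<gamma> \<eta>) = ?\<Psi> \<gamma> \<otimes>\<^bsub>homotopy_group CARD('d) M \<one>\<^esub> ?\<Psi> \<eta>" if \<gamma>\<eta>: "\<gamma> \<in> \<G>" "\<eta> \<in> \<G>" for \<gamma> \<eta>
  proof -
    have "?a (?m \<gamma> \<eta>) = (\<lambda>s. ?a \<gamma> s \<otimes> ?a \<eta> s)" by (rule ext) (simp add: adjoint_def on_cube_def)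
    then have hom: "cube_homotopic CARD('d) M \<one> (?a (?m \<gamma> \<eta>)) (cube_concat (?a \<gamma>) (?a \<eta>))"
      using pointwise_product_homotopic_concat[OF a_in[OF \<gamma>\<eta>(1)] a_in[OF \<gamma>\<eta>(2)]] by simp
    have "?\<Psi> (?m \<gamma> \<eta>) = homotopy_class CARD('d) M \<one> (cube_concat (?a \<gamma>) (?a \<eta>))"
      using homotopy_class_eq_iff[OF a_in[OF m_in[OF \<gamma>\<eta>]] cube_concat_in[OF a_in[OF \<gamma>\<eta>(1)] a_in[OF \<gamma>\<eta>(2)]]] hom
      by simp
    then show ?thesis using homotopy_group_mult[OF a_in[OF \<gamma>\<eta>(1)] a_in[OF \<gamma>\<eta>(2)]] by simp
  qed
  show "?q \<gamma> = ?q \<eta> \<longleftrightarrow> ?\<Psi> \<gamma> = ?\<Psi> \<eta>" if \<gamma>\<eta>: "\<gamma> \<in> \<G>" "\<eta> \<in> \<G>" for \<gamma> \<eta>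
  proof -
    have "?q \<gamma> = ?q \<eta> \<longleftrightarrow> path_component_of_set T \<gamma> = path_component_of_set T \<eta>"
      using G.path_component_coset \<gamma>\<eta> by simp
    also have "\<dots> \<longleftrightarrow> path_component_of T \<gamma> \<eta>"
      using path_component_of_equiv[of T \<gamma> \<eta>] \<gamma>\<eta> by (simp add: topspace_T fun_eq_iff set_eq_iff)
    also have "\<dots> \<longleftrightarrow> cube_homotopic 0 T (\<lambda>x. \<one>) (\<lambda>_. \<gamma>) (\<lambda>_. \<eta>)" by (rule path_component_iff[OF \<gamma>\<eta>])
    also have "\<dots> \<longleftrightarrow> ?\<Psi> \<gamma> = ?\<Psi> \<eta>"
      using adjoint_class_eq_iff[OF const_in_cube_maps[OF \<gamma>\<eta>(1)] const_in_cube_maps[OF \<gamma>\<eta>(2)]] by simp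
    finally show ?thesis .
  qed
  have "homotopy_class CARD('d) M \<one> g \<in> ?\<Psi> ` \<G>" if g: "g \<in> cube_maps CARD('d) M \<one>" for g
  proof -
    obtain \<gamma> where \<gamma>: "\<gamma> \<in> \<G>" "cube_homotopic CARD('d) M \<one> (?a \<gamma>) g" using adjoint_surj_0[OF g] by blast
    then show ?thesis using homotopy_class_eq_iff[OF a_in[OF \<gamma>(1)] g] by blast
  qed
  then show "?\<Psi> ` \<G> = carrier (homotopy_group CARD('d) M \<one>)"
    unfolding homotopy_group_carrier using a_in by blast
qed

end

theorem theorem8p5:
  fixes n :: "real ^ 'd \<Rightarrow> real"
    and r :: enat
    and W :: "(real ^ 'd \<Rightarrow> real) set"
    and H :: "('h, 'z) monoid_scheme"
    and M :: "'h topology"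
    and E :: "'e::real_vector topology"
    and A :: "('h, 'e) chart set"
    and T :: "(real ^ 'd \<Rightarrow> 'h) topology"
    and B :: "(real ^ 'd \<Rightarrow> 'h, real ^ 'd \<Rightarrow> ('h, 'e) tangent) chart set"
  assumes norm: "is_norm n"
    and smooth_weights: "\<And>f. f \<in> W \<Longrightarrow> Cr_on \<infinity> euclidean euclideanreal UNIV f"
    and one_in_W: "(\<lambda>x. 1) \<in> W"
    and weights_nonneg: "\<And>f x. f \<in> W \<Longrightarrow> f x \<ge> 0"
    and weights_pos: "\<And>x. \<exists>f\<in>W. f x > 0"
    and weights_mult:
      "\<And>(N::nat) (fs :: nat \<Rightarrow> real ^ 'd \<Rightarrow> real) (ks :: nat \<Rightarrow> nat).
         N \<ge> 1 \<Longrightarrow> (\<forall>i\<in>{1..N}. fs i \<in> W \<and> enat (ks i) \<le> r) \<Longrightarrow>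
         \<exists>C>0. \<exists>f\<in>W. \<forall>x.
           (\<Prod>i=1..N. poly_norm n abs (gateaux euclideanreal (ks i) (fs i) x)) \<le> ennreal (C * f x)"
    and H_lie_group: "lie_group H M E A"
    and G_lie_group: "weighted_lie_group_structure n r W H M E A T B"
  shows "pi0_group (weighted_group n r W H M E A) T \<cong> homotopy_group CARD('d) M \<one>\<^bsub>H\<^esub> \<and>
    (\<forall>k\<ge>1. homotopy_group k T \<one>\<^bsub>weighted_group n r W H M E A\<^esub>
             \<cong> homotopy_group (k + CARD('d)) M \<one>\<^bsub>H\<^esub>)"
proof -
  from G_lie_group obtain P \<kappa> where "weighted_mapping_group n r W H M E A T B P \<kappa>"
    unfolding weighted_lie_group_structure_def Let_def
    using norm smooth_weights one_in_W weights_nonneg H_lie_group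
    by (elim conjE exE) (rule that, unfold_locales)
  then interpret weighted_mapping_group n r W H M E A T B P \<kappa> .
  show ?thesis unfolding weighted_group_eq using pi0_group_iso homotopy_group_iso by simp
qed

end
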